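(* Let $\Gamma$ be a countably infinite group, $\Sigma=\{\Gamma_n\}_{n=1}^\infty$ a sequence of finite-index normal subgroups of $\Gamma$ with $\bigcap_{n=1}^\infty\bigcup_{i\ge n}\Gamma_i=\{e\}$, and $f\in\mathbb{Z}\Gamma$ well-balanced. Then $$h_{\Sigma,\nu_{WSF}}(2^{E(\Gamma,f)},\Gamma)=h_\Sigma(\mathcal F_f,\Gamma)=\mathbf h(C(\Gamma,f))=\log\det_{\mathcal N\Gamma}f=\lim_{n\to\infty}[\Gamma:\Gamma_n]^{-1}\log\tau(C_n^f),$$ where $\tau(C_n^f)$ is the number of spanning trees of $C_n^f$.
   Context: Well-balanced, $\det_{\mathcal N\Gamma}$, convolution and sofic entropy $h_\Sigma,h_{\Sigma,\nu}$: as follows. $f\in\mathbb{R}\Gamma$ (finitely supported) is well-balanced if $\sum_sf_s=0$, $f_s\le0$ for $s\ne e$, $f_s=f_{s^{-1}}$ for all $s$, and the support of $f$ generates $\Gamma$. $\mathcal N\Gamma$ is the von Neumann algebra of bounded operators on $\ell^2(\Gamma,\mathbb{C})$ commuting with the left translation action, with trace $\mathrm{tr}(T)=\langle T\delta_e,\delta_e\rangle$; $f$ acts as the positive operator $x\mapsto xf$, $(xf)_w=\sum_s x_{ws^{-1}}f_s$; with spectral measure $\mu_f$ on $[0,\|f\|]$ (defined by $\int p\,d\mu_f=\mathrm{tr}(p(f))$ for polynomials $p$), $\det_{\mathcal N\Gamma}f=\exp\int_{(0,\|f\|]}\log t\,d\mu_f(t)$. Sofic entropy: for a $\Gamma$-action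 by homeomorphisms on compact metrizable $X$, a dynamically generating continuous pseudometric $\rho$, maps $\varphi:\Gamma/\Gamma_n\to X$, $\rho_\infty,\rho_2$ the max and normalized $\ell^2$ pseudometrics on such maps, $\mathrm{Map}(W,\delta,\Gamma_n)=\{\varphi:\rho_2(\varphi\circ s,s\circ\varphi)\le\delta\ \forall s\in W\}$ where $(\varphi\circ s)(g\Gamma_n)=\varphi(sg\Gamma_n)$, $(s\circ\varphi)(g\Gamma_n)=s\varphi(g\Gamma_n)$, and $\mathrm{Map}_\nu(W,L,\delta,\Gamma_n)$ the subset where additionally $|[\Gamma:\Gamma_n]^{-1}\sum_{g\Gamma_n}p(\varphi(g\Gamma_n))-\int p\,d\nu|\le\delta$ for $p\in L\subset C(X)$ finite: $h_\Sigma(X,\Gamma)=\sup_\varepsilon\inf_W\inf_\delta\limsup_n[\Gamma:\Gamma_n]^{-1}\log N_\varepsilon(\mathrm{Map}(W,\delta,\Gamma_n),\rho_\infty)$ and $h_{\Sigma,\nu}$ likewise with $\mathrm{Map}_\nu$ and an extra $\inf_L$; here $N_\varepsilon$ is the maximal size of an $\varepsilon$-separated set; these are independent of $\rho$. Cayley graphs: $C(\Gamma,f)$ is the multigraph with vertex set $\Gamma$ in which, for each $v\in\Gamma$ and $s\ne e$, there are exactly $|f_s|$ edges joining $v$ and $vs$ (consistent since $f_s=f_{s^{-1}}$); $E(\Gamma,f)$ is its edge set, and $\Gamma$ acts on it by left multiplication. $C_n^f$ is the quotient multigraph of $C(\Gamma,f)$ by the left action of $\Gamma_n$: vertex set $\Gamma/\Gamma_n$,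 and for each $g\Gamma_n$ and $s\ne e$ there are $|f_s|$ edges joining $g\Gamma_n$ and $gs\Gamma_n$ (loops and multiple edges allowed). Wired spanning forest: for a locally finite connected graph $G=(V,E)$ and finite subgraphs $G_n$ increasing to $G$, let $G_n^w$ be obtained from $G_n$ by adding a vertex $*$ and, for each edge of $G$ from a vertex $v$ of $G_n$ to a vertex outside $G_n$, an edge $\{v,*\}$. The uniform measure on spanning trees of $G_n^w$, projected to $2^{E_n}\subset 2^E$, converges weak* to a probability measure $\nu_{WSF}$ on $2^E$ (independent of choices); for $G=C(\Gamma,f)$ it is $\Gamma$-invariant. $2^{E}$ has the product topology. Tree entropy: with $\mu_s=|f_s|/f_e$ ($s\ne e$), $\mu_e=0$, $\mathbf h(C(\Gamma,f))=\log f_e-\sum_{k\ge1}k^{-1}(\mu^k)_e$. Topological model: $S=\{s\ne e: f_s\ne0\}$; $S_*$ is the set of edges of $C(\Gamma,f)$ having $e$ as an endpoint; $p:S_*\to S$ sends the edge with endpoints $\{e,g\}$ to $g$; for $s_*\in S_*$ with $p(s_* )=s$, $s_*^{-1}:=s^{-1}s_*\in S_*$. $\mathcal F_f\subset S_*^\Gamma$ is the set of $y$ such that (1) if $y_g=s_*$ with $p(s_* )=s$ then $y_{gs}\ne s_*^{-1}$, and (2) there are no $g_1,\dots,g_n\in\Gamma$, $s_1,\dots,s_n\in S$ with $g_is_i=g_{i+1}$, $g_1=g_n$ and $p(y_{g_i})=s_i$ for $1\le i\le n-1$. It is a closed subset of $S_*^\Gamma$ invariant under the shift $(sy)_t=y_{s^{-1}t}$.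 *)

theory Defs
  imports "HOL-Analysis.Analysis" "HOL-Algebra.Coset" "HOL-Algebra.Generated_Groups"
    "HOL-Computational_Algebra.Polynomial"
begin

section \<open>Group ring elements\<close>

definition fsupp :: "'g monoid \<Rightarrow> ('g \<Rightarrow> 'r::zero) \<Rightarrow> 'g set" where
  "fsupp G f = {s \<in> carrier G. f s \<noteq> 0}"

definition well_balanced :: "'g monoid \<Rightarrow> ('g \<Rightarrow> int) \<Rightarrow> bool" where
  "well_balanced G f \<longleftrightarrow>
     finite (fsupp G f) \<and>
     (\<Sum>s\<in>fsupp G f. f s) = 0 \<and>
     (\<forall>s\<in>carrier G. s \<noteq> \<one>\<^bsub>G\<^esub> \<longrightarrow> f s \<le> 0) \<and>
     (\<forall>s\<in>carrier G. f s = f (inv\<^bsub>G\<^esub> s)) \<and>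
     generate G (fsupp G f) = carrier G"

text \<open>Convolution in the group ring (finitely supported functions):
  (a * b)(w) = sum over s of a(s) b(s^-1 w).\<close>
definition conv :: "'g monoid \<Rightarrow> ('g \<Rightarrow> real) \<Rightarrow> ('g \<Rightarrow> real) \<Rightarrow> 'g \<Rightarrow> real" where
  "conv G a b w = (\<Sum>s\<in>fsupp G a. a s * b (inv\<^bsub>G\<^esub> s \<otimes>\<^bsub>G\<^esub> w))"

definition unit_elem :: "'g monoid \<Rightarrow> 'g \<Rightarrow> 'r::{zero,one}" where
  "unit_elem G w = (if w = \<one>\<^bsub>G\<^esub> then 1 else 0)"

primrec conv_pow :: "'g monoid \<Rightarrow> ('g \<Rightarrow> real) \<Rightarrow> nat \<Rightarrow> 'g \<Rightarrow> real" where
  "conv_pow G a 0 = unit_elem G"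
| "conv_pow G a (Suc k) = conv G (conv_pow G a k) a"

section \<open>Tree entropy\<close>

definition rw_mu :: "'g monoid \<Rightarrow> ('g \<Rightarrow> int) \<Rightarrow> 'g \<Rightarrow> real" where
  "rw_mu G f s = (if s \<in> carrier G \<and> s \<noteq> \<one>\<^bsub>G\<^esub> then \<bar>real_of_int (f s)\<bar> / real_of_int (f \<one>\<^bsub>G\<^esub>) else 0)"

definition tree_entropy :: "'g monoid \<Rightarrow> ('g \<Rightarrow> int) \<Rightarrow> real" where
  "tree_entropy G f = ln (real_of_int (f \<one>\<^bsub>G\<^esub>))
     - (\<Sum>k. conv_pow G (rw_mu G f) (Suc k) \<one>\<^bsub>G\<^esub> / real (Suc k))"

section \<open>Fuglede--Kadison determinant\<close>

text \<open>The operator x \<mapsto> x f on functions on the group: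
  (x f)(w) = sum over s of x(w s^-1) f(s).\<close>
definition conv_op :: "'g monoid \<Rightarrow> ('g \<Rightarrow> int) \<Rightarrow> ('g \<Rightarrow> complex) \<Rightarrow> 'g \<Rightarrow> complex" where
  "conv_op G f x w = (\<Sum>s\<in>fsupp G f. x (w \<otimes>\<^bsub>G\<^esub> inv\<^bsub>G\<^esub> s) * of_int (f s))"

definition in_l2 :: "'g monoid \<Rightarrow> ('g \<Rightarrow> complex) \<Rightarrow> bool" where
  "in_l2 G x \<longleftrightarrow> (\<lambda>w. (cmod (x w))\<^sup>2) summable_on carrier G"

definition l2_norm :: "'g monoid \<Rightarrow> ('g \<Rightarrow> complex) \<Rightarrow> real" where
  "l2_norm G x = sqrt (infsum (\<lambda>w. (cmod (x w))\<^sup>2) (carrier G))"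

text \<open>Operator norm of x \<mapsto> x f on l^2(G).\<close>
definition op_norm :: "'g monoid \<Rightarrow> ('g \<Rightarrow> int) \<Rightarrow> real" where
  "op_norm G f = Sup {l2_norm G (conv_op G f x) | x. in_l2 G x \<and> l2_norm G x \<le> 1}"

text \<open>tr(T) = <T delta_e, delta_e>, applied to T = (x \<mapsto> x f)^k.\<close>
definition tr_pow :: "'g monoid \<Rightarrow> ('g \<Rightarrow> int) \<Rightarrow> nat \<Rightarrow> complex" where
  "tr_pow G f k = ((conv_op G f) ^^ k) (unit_elem G) \<one>\<^bsub>G\<^esub>"

definition spectral_measure :: "'g monoid \<Rightarrow> ('g \<Rightarrow> int) \<Rightarrow> real measure" where
  "spectral_measure G f = (THE M.
     sets M = sets (restrict_space borel {0..op_norm G f}) \<and> finite_measure M \<and>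
     (\<forall>p :: real poly. integrable M (poly p) \<and>
        complex_of_real (integral\<^sup>L M (poly p)) =
          (\<Sum>k\<le>degree p. complex_of_real (coeff p k) * tr_pow G f k)))"

text \<open>log det = integral of log t over (0, norm f] w.r.t. the spectral measure,
  as an extended real (value -\<infinity> if the integral diverges, i.e. det = 0).\<close>
definition log_det_NG :: "'g monoid \<Rightarrow> ('g \<Rightarrow> int) \<Rightarrow> ereal" where
  "log_det_NG G f =
     enn2ereal (\<integral>\<^sup>+ t. ennreal (max (ln t) 0) * indicator {0<..op_norm G f} t \<partial>spectral_measure G f)
   - enn2ereal (\<integral>\<^sup>+ t. ennreal (max (- ln t) 0) * indicator {0<..op_norm G f} t \<partial>spectral_measure G f)"

section \<open>Cayley multigraphs\<close>

text \<open>Edges: for each vertex v and s \<noteq> e, |f s| edges joining v and v s; the edge labelled i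
  is the (unordered) pair {(v,s,i), (v s, s^-1, i)}, so it is the same edge as seen from v s.
  The endpoints of an edge are the first components.\<close>
definition cay_edges :: "'g monoid \<Rightarrow> ('g \<Rightarrow> int) \<Rightarrow> 'v set \<Rightarrow> ('v \<Rightarrow> 'g \<Rightarrow> 'v)
     \<Rightarrow> ('v \<times> 'g \<times> nat) set set" where
  "cay_edges G f V mul = {{(v, s, i), (mul v s, inv\<^bsub>G\<^esub> s, i)} | v s i.
      v \<in> V \<and> s \<in> carrier G \<and> s \<noteq> \<one>\<^bsub>G\<^esub> \<and> i < nat \<bar>f s\<bar>}"

definition ends :: "('v \<times> 'g \<times> nat) set \<Rightarrow> 'v set" where
  "ends \<epsilon> = fst ` \<epsilon>"

text \<open>E(Gamma, f)\<close>
definition E_cay :: "'g monoid \<Rightarrow> ('g \<Rightarrow> int) \<Rightarrow> ('g \<times> 'g \<times> nat) set set" where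
  "E_cay G f = cay_edges G f (carrier G) (mult G)"

definition left_cosets :: "'g monoid \<Rightarrow> 'g set \<Rightarrow> 'g set set" where
  "left_cosets G H = {l_coset G g H | g. g \<in> carrier G}"

text \<open>C_n^f: vertices g Gamma_n, and for each g Gamma_n and s \<noteq> e, |f s| edges joining
  g Gamma_n and g s Gamma_n (= (g Gamma_n) s); this is the quotient of C(Gamma,f) by Gamma_n.\<close>
definition quot_edges :: "'g monoid \<Rightarrow> ('g \<Rightarrow> int) \<Rightarrow> 'g set \<Rightarrow> ('g set \<times> 'g \<times> nat) set set" where
  "quot_edges G f H = cay_edges G f (left_cosets G H) (r_coset G)"

section \<open>Spanning trees of finite multigraphs\<close>

definition adj_rel :: "('e \<Rightarrow> 'v set) \<Rightarrow> 'e set \<Rightarrow> ('v \<times> 'v) set" where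
  "adj_rel en T = {(a, b). \<exists>\<epsilon>\<in>T. en \<epsilon> = {a, b}}"

text \<open>T is a spanning tree of the multigraph (V, Ed, en): T connects all vertices and
  is acyclic (no loops, and no edge of T has its endpoints joined by a path in T minus that edge).\<close>
definition spanning_tree :: "'v set \<Rightarrow> ('e \<Rightarrow> 'v set) \<Rightarrow> 'e set \<Rightarrow> 'e set \<Rightarrow> bool" where
  "spanning_tree V en Ed T \<longleftrightarrow> T \<subseteq> Ed \<and>
     (\<forall>u\<in>V. \<forall>w\<in>V. (u, w) \<in> (adj_rel en T)\<^sup>*) \<and>
     (\<forall>\<epsilon>\<in>T. \<forall>a b. en \<epsilon> = {a, b} \<longrightarrow> a \<noteq> b \<and> (a, b) \<notin> (adj_rel en (T - {\<epsilon>}))\<^sup>*)"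

definition num_spanning_trees :: "'v set \<Rightarrow> ('e \<Rightarrow> 'v set) \<Rightarrow> 'e set \<Rightarrow> nat" where
  "num_spanning_trees V en Ed = card {T. spanning_tree V en Ed T}"

text \<open>tau(C_n^f)\<close>
definition tau_quot :: "'g monoid \<Rightarrow> ('g \<Rightarrow> int) \<Rightarrow> 'g set \<Rightarrow> nat" where
  "tau_quot G f H = num_spanning_trees (left_cosets G H) ends (quot_edges G f H)"

section \<open>Wired spanning forest (as the integration functional of the weak* limit)\<close>

text \<open>Wired graph G_K^w for a finite vertex set K (None = the extra vertex *): the edges of C(Gamma,f)
  with at least one endpoint in K; endpoints outside K are identified with *.\<close>
definition wired_ends :: "'g set \<Rightarrow> ('g \<times> 'g \<times> nat) set \<Rightarrow> 'g option set" where
  "wired_ends K \<epsilon> = (\<lambda>v. if v \<in> K then Some v else None) ` ends \<epsilon>"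

definition wired_edges :: "'g monoid \<Rightarrow> ('g \<Rightarrow> int) \<Rightarrow> 'g set \<Rightarrow> ('g \<times> 'g \<times> nat) set set" where
  "wired_edges G f K = {\<epsilon> \<in> E_cay G f. ends \<epsilon> \<inter> K \<noteq> {}}"

definition wired_trees :: "'g monoid \<Rightarrow> ('g \<Rightarrow> int) \<Rightarrow> 'g set \<Rightarrow> ('g \<times> 'g \<times> nat) set set set" where
  "wired_trees G f K = {T. spanning_tree (Some ` K \<union> {None}) (wired_ends K) (wired_edges G f K) T}"

text \<open>Projection of a spanning tree of G_K^w to 2^{E_K} \<subseteq> 2^E (E_K = edges inside K).\<close>
definition wired_config :: "'g monoid \<Rightarrow> ('g \<Rightarrow> int) \<Rightarrow> 'g set \<Rightarrow> ('g \<times> 'g \<times> nat) set set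
     \<Rightarrow> ('g \<times> 'g \<times> nat) set \<Rightarrow> bool" where
  "wired_config G f K T = (\<lambda>\<epsilon>\<in>E_cay G f. \<epsilon> \<in> T \<and> ends \<epsilon> \<subseteq> K)"

text \<open>Integral of p against nu_WSF: the (choice-independent) limit of the integrals of p against
  the projected uniform spanning tree measures of G_{K_n}^w, K_n finite increasing to Gamma.\<close>
definition wsf_integral :: "'g monoid \<Rightarrow> ('g \<Rightarrow> int) \<Rightarrow> ((('g \<times> 'g \<times> nat) set \<Rightarrow> bool) \<Rightarrow> real) \<Rightarrow> real" where
  "wsf_integral G f p = (THE l. \<forall>K :: nat \<Rightarrow> 'g set.
      (\<forall>n. finite (K n) \<and> K n \<subseteq> K (Suc n)) \<and> (\<Union>n. K n) = carrier G \<longrightarrow>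
      (\<lambda>n. (\<Sum>T\<in>wired_trees G f (K n). p (wired_config G f (K n) T))
            / real (card (wired_trees G f (K n)))) \<longlonglongrightarrow> l)"

section \<open>Sofic entropy along Sigma = (Gamma_n)\<close>

definition eln :: "ereal \<Rightarrow> ereal" where
  "eln x = (if x = \<infinity> then \<infinity> else if x \<le> 0 then -\<infinity> else ereal (ln (real_of_ereal x)))"

definition rho_inf :: "'g set set \<Rightarrow> ('x \<Rightarrow> 'x \<Rightarrow> real) \<Rightarrow> ('g set \<Rightarrow> 'x) \<Rightarrow> ('g set \<Rightarrow> 'x) \<Rightarrow> real" where
  "rho_inf V \<rho> \<phi> \<psi> = Max ((\<lambda>A. \<rho> (\<phi> A) (\<psi> A)) ` V)"

definition rho_2 :: "'g set set \<Rightarrow> ('x \<Rightarrow> 'x \<Rightarrow> real) \<Rightarrow> ('g set \<Rightarrow> 'x) \<Rightarrow> ('g set \<Rightarrow> 'x) \<Rightarrow> real" where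
  "rho_2 V \<rho> \<phi> \<psi> = sqrt ((\<Sum>A\<in>V. (\<rho> (\<phi> A) (\<psi> A))\<^sup>2) / real (card V))"

text \<open>N_epsilon: maximal cardinality of an epsilon-separated subset.\<close>
definition sep_number :: "'a set \<Rightarrow> ('a \<Rightarrow> 'a \<Rightarrow> real) \<Rightarrow> real \<Rightarrow> ereal" where
  "sep_number M d \<epsilon> = (SUP F\<in>{F. finite F \<and> F \<subseteq> M \<and> (\<forall>x\<in>F. \<forall>y\<in>F. x \<noteq> y \<longrightarrow> d x y \<ge> \<epsilon>)}.
      ereal (real (card F)))"

definition sofic_Map :: "'g monoid \<Rightarrow> 'g set \<Rightarrow> 'x set \<Rightarrow> ('g \<Rightarrow> 'x \<Rightarrow> 'x) \<Rightarrow> ('x \<Rightarrow> 'x \<Rightarrow> real)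
     \<Rightarrow> 'g set \<Rightarrow> real \<Rightarrow> ('g set \<Rightarrow> 'x) set" where
  "sofic_Map G H X act \<rho> W \<delta> = {\<phi> \<in> left_cosets G H \<rightarrow>\<^sub>E X. \<forall>s\<in>W.
      rho_2 (left_cosets G H) \<rho> (\<lambda>A. \<phi> (l_coset G s A)) (\<lambda>A. act s (\<phi> A)) \<le> \<delta>}"

definition sofic_Map_nu :: "'g monoid \<Rightarrow> 'g set \<Rightarrow> 'x set \<Rightarrow> ('g \<Rightarrow> 'x \<Rightarrow> 'x) \<Rightarrow> ('x \<Rightarrow> 'x \<Rightarrow> real)
     \<Rightarrow> (('x \<Rightarrow> real) \<Rightarrow> real) \<Rightarrow> 'g set \<Rightarrow> ('x \<Rightarrow> real) set \<Rightarrow> real \<Rightarrow> ('g set \<Rightarrow> 'x) set" where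
  "sofic_Map_nu G H X act \<rho> \<nu> W L \<delta> = {\<phi> \<in> sofic_Map G H X act \<rho> W \<delta>. \<forall>p\<in>L.
      \<bar>(\<Sum>A\<in>left_cosets G H. p (\<phi> A)) / real (card (left_cosets G H)) - \<nu> p\<bar> \<le> \<delta>}"

definition sofic_entropy :: "'g monoid \<Rightarrow> (nat \<Rightarrow> 'g set) \<Rightarrow> 'x set \<Rightarrow> ('g \<Rightarrow> 'x \<Rightarrow> 'x)
     \<Rightarrow> ('x \<Rightarrow> 'x \<Rightarrow> real) \<Rightarrow> ereal" where
  "sofic_entropy G \<Sigma> X act \<rho> =
     (SUP \<epsilon>\<in>{0<..}. INF W\<in>{W. finite W \<and> W \<subseteq> carrier G}. INF \<delta>\<in>{0<..}.
        limsup (\<lambda>n. eln (sep_number (sofic_Map G (\<Sigma> n) X act \<rho> W \<delta>) (rho_inf (left_cosets G (\<Sigma> n)) \<rho>) \<epsilon>)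
                     / ereal (real (card (left_cosets G (\<Sigma> n))))))"

text \<open>Measure entropy; nu is given through its integration functional on C(X) (the set Cfun).\<close>
definition sofic_measure_entropy :: "'g monoid \<Rightarrow> (nat \<Rightarrow> 'g set) \<Rightarrow> 'x set \<Rightarrow> ('g \<Rightarrow> 'x \<Rightarrow> 'x)
     \<Rightarrow> ('x \<Rightarrow> 'x \<Rightarrow> real) \<Rightarrow> ('x \<Rightarrow> real) set \<Rightarrow> (('x \<Rightarrow> real) \<Rightarrow> real) \<Rightarrow> ereal" where
  "sofic_measure_entropy G \<Sigma> X act \<rho> Cfun \<nu> =
     (SUP \<epsilon>\<in>{0<..}. INF W\<in>{W. finite W \<and> W \<subseteq> carrier G}. INF L\<in>{L. finite L \<and> L \<subseteq> Cfun}.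
        INF \<delta>\<in>{0<..}.
        limsup (\<lambda>n. eln (sep_number (sofic_Map_nu G (\<Sigma> n) X act \<rho> \<nu> W L \<delta>)
                             (rho_inf (left_cosets G (\<Sigma> n)) \<rho>) \<epsilon>)
                     / ereal (real (card (left_cosets G (\<Sigma> n))))))"

section \<open>The two dynamical systems\<close>

text \<open>Left action of Gamma on edges.\<close>
definition edge_act :: "'g monoid \<Rightarrow> 'g \<Rightarrow> ('g \<times> 'g \<times> nat) set \<Rightarrow> ('g \<times> 'g \<times> nat) set" where
  "edge_act G g \<epsilon> = (\<lambda>(v, s, i). (g \<otimes>\<^bsub>G\<^esub> v, s, i)) ` \<epsilon>"

text \<open>2^{E(Gamma,f)} with the shift action and product topology.\<close>
definition config_space :: "'g monoid \<Rightarrow> ('g \<Rightarrow> int) \<Rightarrow> (('g \<times> 'g \<times> nat) set \<Rightarrow> bool) set" where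
  "config_space G f = E_cay G f \<rightarrow>\<^sub>E (UNIV :: bool set)"

definition config_act :: "'g monoid \<Rightarrow> ('g \<Rightarrow> int) \<Rightarrow> 'g \<Rightarrow> (('g \<times> 'g \<times> nat) set \<Rightarrow> bool)
     \<Rightarrow> ('g \<times> 'g \<times> nat) set \<Rightarrow> bool" where
  "config_act G f s x = (\<lambda>\<epsilon>\<in>E_cay G f. x (edge_act G (inv\<^bsub>G\<^esub> s) \<epsilon>))"

definition config_top :: "'g monoid \<Rightarrow> ('g \<Rightarrow> int) \<Rightarrow> (('g \<times> 'g \<times> nat) set \<Rightarrow> bool) topology" where
  "config_top G f = product_topology (\<lambda>_. discrete_topology (UNIV :: bool set)) (E_cay G f)"

definition config_C :: "'g monoid \<Rightarrow> ('g \<Rightarrow> int) \<Rightarrow> ((('g \<times> 'g \<times> nat) set \<Rightarrow> bool) \<Rightarrow> real) set" where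
  "config_C G f = {p. continuous_map (config_top G f) euclideanreal p}"

text \<open>S_*, the map p, and s_*^{-1}.\<close>
definition star_edges :: "'g monoid \<Rightarrow> ('g \<Rightarrow> int) \<Rightarrow> ('g \<times> 'g \<times> nat) set set" where
  "star_edges G f = {\<epsilon> \<in> E_cay G f. \<one>\<^bsub>G\<^esub> \<in> ends \<epsilon>}"

definition star_p :: "'g monoid \<Rightarrow> ('g \<times> 'g \<times> nat) set \<Rightarrow> 'g" where
  "star_p G \<epsilon> = (THE g. ends \<epsilon> = {\<one>\<^bsub>G\<^esub>, g})"

definition star_inv :: "'g monoid \<Rightarrow> ('g \<times> 'g \<times> nat) set \<Rightarrow> ('g \<times> 'g \<times> nat) set" where
  "star_inv G \<epsilon> = edge_act G (inv\<^bsub>G\<^esub> (star_p G \<epsilon>)) \<epsilon>"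

text \<open>S = supp f minus e.\<close>
definition S_set :: "'g monoid \<Rightarrow> ('g \<Rightarrow> int) \<Rightarrow> 'g set" where
  "S_set G f = {s \<in> carrier G. s \<noteq> \<one>\<^bsub>G\<^esub> \<and> f s \<noteq> 0}"

text \<open>The topological model F_f (cycles in condition (2) have n \<ge> 2, relations for 1 \<le> i \<le> n-1).\<close>
definition F_model :: "'g monoid \<Rightarrow> ('g \<Rightarrow> int) \<Rightarrow> ('g \<Rightarrow> ('g \<times> 'g \<times> nat) set) set" where
  "F_model G f = {y \<in> carrier G \<rightarrow>\<^sub>E star_edges G f.
     (\<forall>g\<in>carrier G. y (g \<otimes>\<^bsub>G\<^esub> star_p G (y g)) \<noteq> star_inv G (y g)) \<and>
     \<not> (\<exists>n::nat. \<exists>gs ss. n \<ge> 2 \<and> gs 1 = gs n \<and>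
          (\<forall>i\<in>{1..n}. gs i \<in> carrier G) \<and>
          (\<forall>i\<in>{1..n-1}. ss i \<in> S_set G f \<and> gs i \<otimes>\<^bsub>G\<^esub> ss i = gs (Suc i) \<and>
                         star_p G (y (gs i)) = ss i))}"

definition shift_act :: "'g monoid \<Rightarrow> 'g \<Rightarrow> ('g \<Rightarrow> 'a) \<Rightarrow> 'g \<Rightarrow> 'a" where
  "shift_act G s y = (\<lambda>t\<in>carrier G. y (inv\<^bsub>G\<^esub> s \<otimes>\<^bsub>G\<^esub> t))"

text \<open>Dynamically generating continuous pseudometrics.\<close>
definition rho_F :: "'g monoid \<Rightarrow> ('g \<Rightarrow> 'a) \<Rightarrow> ('g \<Rightarrow> 'a) \<Rightarrow> real" where
  "rho_F G x y = (if x \<one>\<^bsub>G\<^esub> = y \<one>\<^bsub>G\<^esub> then 0 else 1)"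

definition rho_config :: "'g monoid \<Rightarrow> ('g \<Rightarrow> int) \<Rightarrow> (('g \<times> 'g \<times> nat) set \<Rightarrow> bool)
     \<Rightarrow> (('g \<times> 'g \<times> nat) set \<Rightarrow> bool) \<Rightarrow> real" where
  "rho_config G f x y = (if \<forall>\<epsilon>\<in>star_edges G f. x \<epsilon> = y \<epsilon> then 0 else 1)"

end

theory Submission
 imports Defs "HOL-Probability.Probability" "HOL-Real_Asymp.Real_Asymp"
begin

text \<open>Rooted forests with massive roots turn the tree count of the quotients into resolvent moments of
 the Laplacian, so its exponential growth rate is the integral of the logarithm against the spectral
 measure, and forests with few roots grow at the same rate. Both entropies are then counting problems
 for such forests. For the wired forest, Kirchhoff's formula (edge probability = effective resistance)
 and Dirichlet's principle make cylinder probabilities monotone under vertex identification; as the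
 expected degree is 2 in the limit, trees of the quotients converge locally to the wired forest, and
 negative correlation gives concentration of the empirical measures.\<close>

text \<open>The logarithm is singular at 0, and comparing quotients with the group gives one moment
  at a time. A mass \<open>x > 0\<close> cures both: the moment series converges geometrically,
  uniformly in the quotient. Letting \<open>x\<close> tend to 0 rests on arithmetic: a tree count is
  an integer, at least 1, so the integrals of \<open>ln (t + x)\<close> are nonnegative for
  \<open>0 < x <= 1\<close>; this rules out an atom at 0 and makes \<open>ln\<close> integrable. It
  also makes the density of roots, the integral of \<open>x / (t + x)\<close>, vanish with
  \<open>x\<close>, and forests with few roots extend to trees at subexponential cost.

  The group need not be amenable, so boundaries cannot be neglected, and the expected degree 2 of
  the wired forest comes from Green's function instead. Monotonicity compares wired boxes with
  quotients in one direction only. For single edges, equal degree sums force equality; for larger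
  sets the event "\<open>e\<close> or all of \<open>B\<close>", also monotone, supplies the other
  direction by inclusion-exclusion.\<close>

type_synonym 'g ed = "('g \<times> 'g \<times> nat) set"
type_synonym 'g qd = "('g set \<times> 'g \<times> nat) set"

abbreviation rc :: "'a set => real" where "rc A == real (card A)"
abbreviation evs :: "(nat => bool) => bool" where "evs P == eventually P sequentially"

section \<open>Functional graphs\<close>

text \<open>\<open>lead nx V u r\<close>: the orbit of \<open>u\<close> under \<open>nx\<close>
  first leaves \<open>V\<close> at \<open>r\<close>. Being inductive, it fails for orbits that stay
  in \<open>V\<close> forever, so for finite \<open>V\<close> the predicate \<open>all_lead\<close>
  says that there is no cycle inside \<open>V\<close>.\<close>

inductive lead :: "('u => 'u) => 'u set => 'u => 'u => bool" for nx V where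
 stop: "r ~: V ==> lead nx V r r"
| step: "u : V ==> lead nx V (nx u) r ==> lead nx V u r"

definition all_lead :: "('u => 'u) => 'u set => bool" where
 "all_lead nx V \<longleftrightarrow> (ALL v:V. \<exists>r. lead nx V v r)"

lemma lead_end: "lead nx V w r ==> r ~: V"
 by (induction rule: lead.induct) auto

lemma lead_not_in: "lead nx V w r ==> w ~: V ==> r = w"
 by (erule lead.cases) auto

lemma lead_unique: "lead nx V w r ==> lead nx V w r' ==> r = r'"
proof (induction rule: lead.induct)
 case (stop r)
 thus ?case using lead_not_in by fastforce
next
 case (step u r)
 from step.prems have "lead nx V (nx u) r'" using step.hyps(1)
 by (cases rule: lead.cases) auto
 thus ?case using step.IH by blast
qed

lemma lead_step_iff: "u : V ==> lead nx V u r \<longleftrightarrow> lead nx V (nx u) r"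
 by (auto intro: lead.step elim: lead.cases)

lemma lead_cong_imp:
 assumes "lead nx V w r" "!!u. u : V ==> nx u = nx' u"
 shows "lead nx' V w r"
 using assms by (induction rule: lead.induct) (auto intro: lead.intros)

lemma lead_cong:
 assumes "!!u. u : V ==> nx u = nx' u"
 shows "lead nx V w r = lead nx' V w r"
 using lead_cong_imp[of nx V w r nx'] lead_cong_imp[of nx' V w r nx] assms by auto

lemma all_lead_cong:
 assumes "!!u. u : V ==> nx u = nx' u"
 shows "all_lead nx V = all_lead nx' V"
proof -
 have "lead nx V = lead nx' V" by (intro ext lead_cong assms)
 thus ?thesis unfolding all_lead_def by simp
qed

lemma lead_remove_mono:
 assumes "lead nx (V - {u}) w r" "r ~= u"
 shows "lead nx V w r"
 using assms
proof (induction rule: lead.induct)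
 case (stop r)
 thus ?case by (intro lead.stop) auto
next
 case (step w r)
 thus ?case using lead.step[of w V nx] by auto
qed

lemma lead_trans:
 assumes "lead nx (V - {u}) w z" "z = u" "lead nx V u r"
 shows "lead nx V w r"
 using assms
proof (induction rule: lead.induct)
 case (stop z)
 thus ?case by simp
next
 case (step w z)
 thus ?case using lead.step[of w V nx] by auto
qed

lemma lead_remove_imp:
 assumes "lead nx V w r" "u : V"
 shows "lead nx (V - {u}) w r | (lead nx (V - {u}) w u & lead nx (V - {u}) (nx u) r)"
 using assms
proof (induction rule: lead.induct)
 case (stop r)
 thus ?case by (intro disjI1 lead.stop) auto
next
 case (step w r)
 show ?case
 proof (cases "w = u")
 case True
 have "lead nx (V - {u}) u u" by (intro lead.stop) auto
 thus ?thesis using step True by blast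
 next
 case False
 thus ?thesis using step by (auto intro: lead.step)
 qed
qed

text \<open>Making \<open>u\<close> an exit splits the orbits by whether they pass through
  \<open>u\<close>; the value of \<open>nx\<close> at \<open>u\<close> then enters only as a new
  starting point. This lets the choice at one vertex vary while all others stay fixed.\<close>

lemma lead_remove:
 assumes "u : V" "r ~: V"
 shows "lead nx V w r \<longleftrightarrow>
 lead nx (V - {u}) w r | (lead nx (V - {u}) w u & lead nx (V - {u}) (nx u) r)"
proof
 assume "lead nx V w r"
 thus "lead nx (V - {u}) w r | (lead nx (V - {u}) w u & lead nx (V - {u}) (nx u) r)"
 by (rule lead_remove_imp[OF _ assms(1)])
next
 have ru: "r ~= u" using assms by auto
 assume "lead nx (V - {u}) w r | (lead nx (V - {u}) w u & lead nx (V - {u}) (nx u) r)"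
 thus "lead nx V w r"
 proof
 assume "lead nx (V - {u}) w r"
 thus ?thesis by (rule lead_remove_mono[OF _ ru])
 next
 assume a: "lead nx (V - {u}) w u & lead nx (V - {u}) (nx u) r"
 hence "lead nx V (nx u) r" using lead_remove_mono[OF _ ru] by blast
 hence "lead nx V u r" by (rule lead.step[OF assms(1)])
 thus ?thesis using lead_trans[OF conjunct1[OF a] refl] by blast
 qed
qed

lemma lead_no_return:
 assumes "u : V" "lead nx V u r"
 shows "lead nx (V - {u}) (nx u) r" "~ lead nx (V - {u}) (nx u) u"
proof -
 have r: "r ~: V" using lead_end[OF assms(2)] .
 have uu: "lead nx (V - {u}) u u" by (intro lead.stop) auto
 have "~ lead nx (V - {u}) u r"
 using lead_unique[OF uu, of r] r assms(1) by auto
 thus *: "lead nx (V - {u}) (nx u) r"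
 using lead_remove[OF assms(1) r, of nx u] assms(2) by blast
 show "~ lead nx (V - {u}) (nx u) u"
 using lead_unique[OF *, of u] r assms(1) by auto
qed

lemma all_lead_remove:
 assumes "u : V"
 shows "all_lead nx V \<longleftrightarrow>
 all_lead nx (V - {u}) & (\<exists>r. r ~: V & lead nx (V - {u}) (nx u) r)"
proof
 assume a: "all_lead nx V"
 have "\<exists>r. lead nx (V - {u}) v r" if v: "v : V - {u}" for v
 proof -
 obtain r where "lead nx V v r" using a v unfolding all_lead_def by auto
 from lead_remove_imp[OF this assms] show ?thesis by auto
 qed
 moreover obtain r where r: "lead nx V u r" using a assms unfolding all_lead_def by auto
 ultimately show "all_lead nx (V - {u}) & (\<exists>r. r ~: V & lead nx (V - {u}) (nx u) r)"
 using lead_no_return(1)[OF assms r] lead_end[OF r] unfolding all_lead_def by auto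
next
 assume a: "all_lead nx (V - {u}) & (\<exists>r. r ~: V & lead nx (V - {u}) (nx u) r)"
 then obtain r where r: "r ~: V" "lead nx (V - {u}) (nx u) r" by blast
 have uu: "lead nx (V - {u}) u u" by (intro lead.stop) auto
 have "\<exists>r'. lead nx V v r'" if v: "v : V" for v
 proof -
 have "\<exists>z. lead nx (V - {u}) v z"
 using a v uu unfolding all_lead_def by (cases "v = u") auto
 then obtain z where z: "lead nx (V - {u}) v z" ..
 show ?thesis
 proof (cases "z = u")
 case True
 thus ?thesis using lead_remove[OF assms r(1), of nx v] r z by auto
 next
 case False
 hence "z ~: V" using lead_end[OF z] by auto
 thus ?thesis using lead_remove[OF assms, of z nx v] z by auto
 qed
 qed
 thus "all_lead nx V" unfolding all_lead_def by auto
qed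

section \<open>Weighted sums over acyclic choice functions\<close>

lemma sum_PiE_remove:
 fixes h :: "('u => 'c) => real"
 assumes "finite V" "u : V"
 shows "(SUM y:PiE V C. h y) = (SUM y:PiE (V - {u}) C. SUM c:C u. h (y(u := c)))"
proof -
 have V: "V = insert u (V - {u})" using assms by auto
 have inj: "inj_on (%(y, g). g(u := y)) (C u \<times> PiE (V - {u}) C)"
 by (rule inj_combinator) auto
 have "(SUM y:PiE V C. h y) = (SUM y:(%(y, g). g(u := y)) ` (C u \<times> PiE (V - {u}) C). h y)"
 by (subst V, subst PiE_insert_eq) simp
 also have "... = (SUM (c, y):C u \<times> PiE (V - {u}) C. h (y(u := c)))"
 by (subst sum.reindex[OF inj]) (simp add: case_prod_unfold)
 also have "... = (SUM c:C u. SUM y:PiE (V - {u}) C. h (y(u := c)))"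
 by (simp add: sum.cartesian_product)
 also have "... = (SUM y:PiE (V - {u}) C. SUM c:C u. h (y(u := c)))"
 by (rule sum.swap)
 finally show ?thesis .
qed

text \<open>Choices are recorded rather than targets, so parallel edges stay distinct. An acyclic
  choice function is a forest oriented towards the exits of \<open>V\<close>.\<close>

definition forests :: "('u => 'c => 'u) => ('u => 'c set) => 'u set => ('u => 'c) set" where
 "forests tgt C V = {y : PiE V C. all_lead (%u. tgt u (y u)) V}"

definition forest_sum ::
 "('u => 'c => 'u) => ('u => 'c set) => ('u => 'c => real) => 'u set => 'u => 'u => real" where
 "forest_sum tgt C wt V w r =
 (SUM y:{y : forests tgt C V. lead (%u. tgt u (y u)) V w r}. \<Prod>v\<in>V. wt v (y v))"

lemma finite_forests: "finite V ==> (!!v. v : V ==> finite (C v)) ==> finite (forests tgt C V)"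
 unfolding forests_def by (simp add: finite_PiE)

lemma forest_sum_alt:
 assumes "finite V" "!!v. v : V ==> finite (C v)"
 shows "forest_sum tgt C wt V w r = (SUM y:PiE V C. (\<Prod>v\<in>V. wt v (y v)) *
 (of_bool (all_lead (%u. tgt u (y u)) V) * of_bool (lead (%u. tgt u (y u)) V w r)))"
proof -
 have "{y : forests tgt C V. lead (%u. tgt u (y u)) V w r} =
 {y : PiE V C. all_lead (%u. tgt u (y u)) V & lead (%u. tgt u (y u)) V w r}"
 by (auto simp: forests_def)
 moreover have "finite (PiE V C)" using assms by (simp add: finite_PiE)
 ultimately show ?thesis
 unfolding forest_sum_def by (simp only: sum.inter_filter) (intro sum.cong, auto)
qed

text \<open>The identity is the exchange of the choice \<open>c0\<close> made at \<open>u\<close> by the forest with the choice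
 \<open>c\<close> of the averaging operator: for a fixed forest off \<open>u\<close>, the summand is antisymmetric in
 \<open>c\<close> and \<open>c0\<close>.\<close>

theorem forest_sum_harmonic:
 assumes fin: "finite V" "!!v. v : V ==> finite (C v)" and u: "u : V" and r: "r ~: V"
 shows "(SUM c:C u. wt u c * (forest_sum tgt C wt V u r - forest_sum tgt C wt V (tgt u c) r)) = 0"
proof -
 let ?V = "V - {u}"
 define n where "n y = (%v. tgt v (y v))" for y
 \<comment> \<open>For a fixed forest \<open>y\<close> off \<open>u\<close>, \<open>g y c\<close>
   marks the choices at \<open>u\<close> that close no cycle, and \<open>q y c\<close> those after
   which the orbit ends at \<open>r\<close>.\<close>
 define Q where "Q y = (\<Prod>v\<in>?V. wt v (y v)) * of_bool (all_lead (n y) ?V)" for y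
 define g where "g y c = (of_bool (\<exists>r. r ~: V & lead (n y) ?V (tgt u c) r) :: real)" for y c
 define q where "q y c = (of_bool (lead (n y) ?V (tgt u c) r) :: real)" for y c
 have cong: "lead (n (y(u := c))) ?V w z = lead (n y) ?V w z" for y c w z
 by (rule lead_cong) (auto simp: n_def)
 have acong: "all_lead (n (y(u := c))) ?V = all_lead (n y) ?V" for y c
 by (rule all_lead_cong) (auto simp: n_def)
 have nu: "n (y(u := c)) u = tgt u c" for y c by (simp add: n_def)
 have ru: "r ~= u" using u r by auto
 have uu: "lead (n y) ?V u u" for y by (intro lead.stop) auto
 have not_ur: "~ lead (n y) ?V u r" for y using lead_unique[OF uu, of y r] ru by auto
 have qg: "q y c * g y c = q y c" for y c
 using r by (auto simp: q_def g_def)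
 have prodV: "(\<Prod>v\<in>V. wt v ((y(u := c)) v)) = wt u c * (\<Prod>v\<in>?V. wt v (y v))" for y c
 using fin u by (subst prod.remove[of V u]) auto
 have al: "all_lead (n (y(u := c))) V \<longleftrightarrow>
 all_lead (n y) ?V & (\<exists>r. r ~: V & lead (n y) ?V (tgt u c) r)" for y c
 unfolding all_lead_remove[OF u] acong cong nu ..
 have ld: "lead (n (y(u := c))) V w r \<longleftrightarrow>
 lead (n y) ?V w r | (lead (n y) ?V w u & lead (n y) ?V (tgt u c) r)" for y c w
 unfolding lead_remove[OF u r] cong nu ..
 have exh: "lead (n y) ?V (tgt u c) u \<longleftrightarrow> ~ (\<exists>r. r ~: V & lead (n y) ?V (tgt u c) r)"
 if a: "all_lead (n y) ?V" for y c
 proof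
 assume "lead (n y) ?V (tgt u c) u"
 thus "~ (\<exists>r. r ~: V & lead (n y) ?V (tgt u c) r)"
 using lead_unique[of "n y" ?V "tgt u c" u] u by blast
 next
 assume no: "~ (\<exists>r. r ~: V & lead (n y) ?V (tgt u c) r)"
 have "\<exists>z. lead (n y) ?V (tgt u c) z"
 using a lead.stop[of "tgt u c" ?V "n y"] unfolding all_lead_def by blast
 thus "lead (n y) ?V (tgt u c) u" using no lead_end[of "n y" ?V "tgt u c"] by blast
 qed
 have tm: "(\<Prod>v\<in>V. wt v ((y(u := c0)) v)) *
 (of_bool (all_lead (n (y(u := c0))) V) * of_bool (lead (n (y(u := c0))) V u r)) =
 Q y * (wt u c0 * (g y c0 * q y c0))" for y c0
 unfolding prodV al ld by (auto simp: Q_def g_def q_def uu not_ur)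
 \<comment> \<open>An orbit from \<open>tgt u c\<close> ends at \<open>r\<close> without meeting
   \<open>u\<close>, or it falls into \<open>u\<close> (factor \<open>1 - g y c\<close>) and then
   follows the choice \<open>c0\<close> actually made there.\<close>
 have term2: "(\<Prod>v\<in>V. wt v ((y(u := c0)) v)) *
 (of_bool (all_lead (n (y(u := c0))) V) * of_bool (lead (n (y(u := c0))) V (tgt u c) r)) =
 Q y * (wt u c0 * (g y c0 * (q y c + (1 - g y c) * q y c0)))" for y c0 c
 proof (cases "all_lead (n y) ?V")
 case False
 thus ?thesis unfolding al Q_def by simp
 next
 case True
 thus ?thesis unfolding prodV al ld using exh[OF True, of c] r
 by (auto simp: Q_def g_def q_def)
 qed
 have alt: "forest_sum tgt C wt V w r = (SUM y:PiE V C. (\<Prod>v\<in>V. wt v (y v)) *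
 (of_bool (all_lead (n y) V) * of_bool (lead (n y) V w r)))" for w
 unfolding n_def by (rule forest_sum_alt[OF fin])
 have S1: "forest_sum tgt C wt V u r =
 (SUM y:PiE ?V C. SUM c0:C u. Q y * (wt u c0 * (g y c0 * q y c0)))"
 unfolding alt sum_PiE_remove[OF fin(1) u] tm ..
 have S2: "forest_sum tgt C wt V (tgt u c) r =
 (SUM y:PiE ?V C. SUM c0:C u. Q y * (wt u c0 * (g y c0 * (q y c + (1 - g y c) * q y c0))))" for c
 unfolding alt sum_PiE_remove[OF fin(1) u] term2 ..
 have "(SUM c:C u. wt u c * (forest_sum tgt C wt V u r - forest_sum tgt C wt V (tgt u c) r)) =
 (SUM c:C u. SUM y:PiE ?V C. SUM c0:C u.
 Q y * (wt u c * wt u c0 * (q y c0 * g y c - q y c * g y c0)))"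
 unfolding S1 S2 sum_subtractf[symmetric] sum_distrib_left
 by (intro sum.cong refl) (use qg in \<open>auto simp: algebra_simps\<close>)
 also have "... = (SUM y:PiE ?V C. Q y *
 (SUM c:C u. SUM c0:C u. wt u c * wt u c0 * (q y c0 * g y c - q y c * g y c0)))"
 by (subst sum.swap) (simp add: sum_distrib_left)
 also have "... = 0"
 proof (intro sum.neutral ballI)
 fix y
 let ?f = "%c c0. wt u c * wt u c0 * (q y c0 * g y c - q y c * g y c0)"
 have "(SUM c:C u. SUM c0:C u. ?f c c0) = (SUM c:C u. SUM c0:C u. ?f c0 c)"
 by (rule sum.swap)
 also have "... = - (SUM c:C u. SUM c0:C u. ?f c c0)"
 unfolding sum_negf[symmetric] by (intro sum.cong refl) (simp add: algebra_simps)
 finally show "Q y * (SUM c:C u. SUM c0:C u. ?f c c0) = 0" by simp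
 qed
 finally show ?thesis .
qed

section \<open>Rooted forests and spanning trees of finite multigraphs\<close>

definition fgraph :: "'v set => ('e => 'v set) => 'e set => bool" where
 "fgraph V en Ed \<longleftrightarrow> finite V & finite Ed & (ALL epp:Ed. EX a:V. EX b:V. en epp = {a, b})"

text \<open>For a loop at \<open>v\<close> this is \<open>v\<close> itself.\<close>

definition other :: "'v set => 'v => 'v" where
 "other X v = (THE w. X = {v, w})"

definition inc :: "('e => 'v set) => 'e set => 'v => 'e set" where
 "inc en Ed v = {epp:Ed. v : en epp}"

text \<open>Spanning forests with root set \<open>Z\<close>: each vertex outside \<open>Z\<close>
  stores its first edge on the way to the roots. A loop can never be chosen, since it would be a
  cycle.\<close>

definition rf :: "'v set => ('e => 'v set) => 'e set => 'v set => ('v => 'e) set" where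
 "rf V en Ed Z = forests (%v epp. other (en epp) v) (inc en Ed) (V - Z)"

definition acyc :: "('e => 'v set) => 'e set => bool" where
 "acyc en T \<longleftrightarrow> (ALL epp:T. \<forall>a b. en epp = {a, b} --> (a, b) ~: (adj_rel en (T - {epp}))^*)"

definition gconn :: "'v set => ('e => 'v set) => 'e set => bool" where
 "gconn V en Ed \<longleftrightarrow> (ALL u:V. ALL w:V. (u, w) : (adj_rel en Ed)^*)"

lemma other_eq: "X = {v, w} ==> other X v = w"
 unfolding other_def by (rule the_equality) (auto simp: doubleton_eq_iff)

lemma fgraph_inc:
 assumes "fgraph V en Ed" "epp : inc en Ed v"
 shows "en epp = {v, other (en epp) v}" "v : V" "other (en epp) v : V" "epp : Ed"
proof -
 obtain a b where ab: "a : V" "b : V" "en epp = {a, b}" and v: "v = a | v = b" and E: "epp : Ed"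
 using assms unfolding fgraph_def inc_def by blast
 have "en epp = {v, other (en epp) v} & v : V & other (en epp) v : V"
 using v ab other_eq[of "en epp" a b] other_eq[of "en epp" b a] by (auto simp: insert_commute)
 thus "en epp = {v, other (en epp) v}" "v : V" "other (en epp) v : V" "epp : Ed"
 using E by auto
qed

lemma fgraph_ends_subset: "fgraph V en Ed ==> epp : Ed ==> en epp <= V"
 unfolding fgraph_def by (metis insert_subset empty_subsetI)

lemma fgraph_finite: "fgraph V en Ed ==> finite V" "fgraph V en Ed ==> finite Ed"
 unfolding fgraph_def by auto

lemma fgraph_mono: "fgraph V en Ed ==> E' <= Ed ==> fgraph V en E'"
 unfolding fgraph_def using finite_subset by blast

lemma finite_inc: "fgraph V en Ed ==> finite (inc en Ed v)"
 unfolding fgraph_def inc_def by auto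

lemma finite_rf: "fgraph V en Ed ==> finite (rf V en Ed Z)"
 unfolding rf_def by (intro finite_forests) (auto simp: finite_inc fgraph_finite)

lemma adj_rel_sym: "(a, b) : adj_rel en T ==> (b, a) : adj_rel en T"
 unfolding adj_rel_def by (auto simp: insert_commute)

lemma adj_rtrancl_sym: "(a, b) : (adj_rel en T)^* ==> (b, a) : (adj_rel en T)^*"
 by (meson adj_rel_sym symD symI sym_rtrancl)

lemma adj_rel_mono: "S <= T ==> adj_rel en S <= adj_rel en T"
 unfolding adj_rel_def by auto

lemma adj_rtrancl_mono: "S <= T ==> (a, b) : (adj_rel en S)^* ==> (a, b) : (adj_rel en T)^*"
 using rtrancl_mono[OF adj_rel_mono] by blast

lemma adj_edge: "epp : T ==> en epp = {a, b} ==> (a, b) : (adj_rel en T)^*"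
 unfolding adj_rel_def by auto

lemma adj_rtrancl_insert:
 assumes "(p, q) : (adj_rel en (insert epp X))^*" "en epp = {a, b}"
 shows "(p, q) : (adj_rel en X)^* |
 (p, a) : (adj_rel en X)^* & (b, q) : (adj_rel en X)^* |
 (p, b) : (adj_rel en X)^* & (a, q) : (adj_rel en X)^*"
 using assms(1)
proof (induction rule: rtrancl_induct)
 case base
 thus ?case by simp
next
 case (step q q')
 have "(q, q') : adj_rel en X | {q, q'} = {a, b}"
 using step.hyps(2) assms(2) unfolding adj_rel_def by auto
 then consider "(q, q') : adj_rel en X" | "q = a" "q' = b" | "q = b" "q' = a"
 by (auto simp: doubleton_eq_iff)
 thus ?case
 proof cases
 case 1
 thus ?thesis using step.IH by (meson rtrancl.rtrancl_into_rtrancl)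
 next
 case 2
 thus ?thesis using step.IH by auto
 next
 case 3
 thus ?thesis using step.IH by auto
 qed
qed

lemma spanning_tree_alt:
 assumes "fgraph V en Ed"
 shows "spanning_tree V en Ed T \<longleftrightarrow> T <= Ed & gconn V en T & acyc en T"
proof -
 have "a ~= b & (a, b) ~: R^* \<longleftrightarrow> (a, b) ~: R^*" for a b :: 'a and R by auto
 thus ?thesis unfolding spanning_tree_def gconn_def acyc_def by simp
qed

lemma finite_spanning_trees:
 assumes "finite Ed"
 shows "finite {T. spanning_tree V en Ed T}"
 by (rule finite_subset[of _ "Pow Ed"]) (use assms in \<open>auto simp: spanning_tree_def\<close>)

lemma all_lead_measure:
 fixes m :: "'u => nat"
 assumes "!!v. v : A ==> nx v : A ==> m (nx v) < m v"
 shows "all_lead nx A"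
proof -
 have "v : A --> (\<exists>r. lead nx A v r)" for v
 proof (induction "m v" arbitrary: v rule: less_induct)
 case less
 show ?case
 proof (intro impI)
 assume v: "v : A"
 show "\<exists>r. lead nx A v r"
 proof (cases "nx v : A")
 case True
 obtain r where "lead nx A (nx v) r" using less.hyps[OF assms[OF v True]] True by auto
 from lead.step[where nx = nx, OF v this] show ?thesis by auto
 next
 case False
 from lead.step[where nx = nx, OF v lead.stop[OF this]] show ?thesis by auto
 qed
 qed
 qed
 thus ?thesis unfolding all_lead_def by blast
qed

lemma rf_D:
 assumes "fgraph V en Ed" "y : rf V en Ed Z" "v : V - Z"
 shows "y v : inc en Ed v" "en (y v) = {v, other (en (y v)) v}" "other (en (y v)) v : V"
 "y v : Ed"
proof -
 show *: "y v : inc en Ed v" using assms unfolding rf_def forests_def by (auto simp: PiE_iff)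
 thus "en (y v) = {v, other (en (y v)) v}" "other (en (y v)) v : V" "y v : Ed"
 using fgraph_inc[OF assms(1)] by auto
qed

lemma rf_lead:
 assumes "y : rf V en Ed Z" "v : V - Z"
 obtains r where "lead (%v. other (en (y v)) v) (V - Z) v r"
 using assms unfolding rf_def forests_def all_lead_def by blast

lemma rf_lead_root:
 assumes "fgraph V en Ed" "y : rf V en Ed Z" "lead (%v. other (en (y v)) v) (V - Z) v r" "v : V"
 shows "r : Z & (v, r) : (adj_rel en (y ` (V - Z)))^*"
 using assms(3,4)
proof (induction rule: lead.induct)
 case (stop r)
 thus ?case by auto
next
 case (step u r)
 note d = rf_D[OF assms(1,2) step.hyps(1)]
 have "(u, other (en (y u)) u) : (adj_rel en (y ` (V - Z)))^*"
 by (rule adj_edge[where en = en and epp = "y u", OF _ d(2)]) (use step.hyps in auto)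
 thus ?case using step.IH d(3) by auto
qed

text \<open>Two vertices choosing the same edge are its two ends and point at each other, a cycle of
  length two.\<close>

lemma rf_inj:
 assumes "fgraph V en Ed" "y : rf V en Ed Z"
 shows "inj_on y (V - Z)"
proof (rule inj_onI, rule ccontr)
 let ?n = "%v. other (en (y v)) v"
 fix v w assume v: "v : V - Z" and w: "w : V - Z" and e: "y v = y w" and ne: "v ~= w"
 have "w : {v, ?n v}" using rf_D(2)[OF assms v] rf_D(2)[OF assms w] e by auto
 hence nv: "?n v = w" using ne by auto
 have "v : {w, ?n w}" using rf_D(2)[OF assms v] rf_D(2)[OF assms w] e by auto
 hence nw: "?n w = v" using ne by auto
 obtain r where "lead ?n (V - Z) v r" using rf_lead[OF assms(2) v] .
 from lead_no_return(2)[OF v this] nv have "~ lead ?n (V - Z - {v}) w v" by simp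
 moreover have "lead ?n (V - Z - {v}) w v"
 by (rule lead.step) (use w ne nw lead.stop[of v "V - Z - {v}" ?n] in simp_all)
 ultimately show False by simp
qed

text \<open>The set \<open>D\<close> of vertices whose orbit reaches \<open>v\<close> is closed
  under the edges that remain after removing \<open>y v\<close>. It contains \<open>v\<close> but
  not the successor of \<open>v\<close>, so the ends of \<open>y v\<close> are separated.\<close>

lemma rf_acyc:
 assumes "fgraph V en Ed" "y : rf V en Ed Z"
 shows "acyc en (y ` (V - Z))"
 unfolding acyc_def
proof (intro ballI allI impI)
 let ?n = "%v. other (en (y v)) v"
 fix epp a b assume epp: "epp : y ` (V - Z)" and ab: "en epp = {a, b}"
 obtain v where v: "v : V - Z" "epp = y v" using epp by auto
 define D where "D = {w. lead ?n (V - Z - {v}) w v}"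
 obtain r where r: "lead ?n (V - Z) v r" using rf_lead[OF assms(2) v(1)] .
 have nD: "?n v ~: D" using lead_no_return(2)[OF v(1) r] by (simp add: D_def)
 have vD: "v : D" unfolding D_def by (auto intro: lead.stop)
 have inv: "p : D \<longleftrightarrow> q : D" if pq: "(p, q) : adj_rel en (y ` (V - Z) - {epp})" for p q
 proof -
 obtain w where w: "w : V - Z" "w ~= v" "en (y w) = {p, q}"
 using pq v unfolding adj_rel_def by auto
 have "w : D \<longleftrightarrow> ?n w : D" unfolding D_def using w by (simp add: lead_step_iff)
 moreover have "{p, q} = {w, ?n w}" using w rf_D(2)[OF assms w(1)] by simp
 ultimately show ?thesis by (auto simp: doubleton_eq_iff)
 qed
 have inv': "p : D \<longleftrightarrow> q : D" if "(p, q) : (adj_rel en (y ` (V - Z) - {epp}))^*" for p q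
 using that by (induction rule: rtrancl_induct) (auto simp: inv)
 have "{a, b} = {v, ?n v}" using ab rf_D(2)[OF assms v(1)] v(2) by simp
 thus "(a, b) ~: (adj_rel en (y ` (V - Z) - {epp}))^*"
 using inv'[of a b] nD vD by (auto simp: doubleton_eq_iff)
qed

text \<open>Induction along the orbit towards the root. The edge \<open>y u\<close> is chosen in
  \<open>y'\<close> by one of its ends; if that were the successor of \<open>u\<close>, the
  induction hypothesis would make \<open>y\<close> choose this edge twice, against
  injectivity.\<close>

lemma rf_unique:
 assumes G: "fgraph V en Ed" and y: "y : rf V en Ed Z" "y' : rf V en Ed Z"
 and im: "y ` (V - Z) = y' ` (V - Z)"
 shows "y = y'"
proof -
 let ?n = "%v. other (en (y v)) v"
 have key: "w : V - Z --> y' w = y w" if "lead ?n (V - Z) w r" for w r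
 using that
 proof (induction rule: lead.induct)
 case (stop r)
 thus ?case by blast
 next
 case (step u r)
 have "y u : y' ` (V - Z)" unfolding im[symmetric] using step.hyps(1) by (rule imageI)
 then obtain u' where u': "u' : V - Z" "y u = y' u'" by auto
 have "u' : {u, ?n u}"
 using rf_D(2)[OF G y(1) step.hyps(1)] rf_D(2)[OF G y(2) u'(1)] u'(2) by auto
 then consider "u' = u" | "u' = ?n u" "u' ~= u" by auto
 thus ?case
 proof cases
 case 1
 thus ?thesis using u' by simp
 next
 case 2
 hence "y u' = y u" using step.IH u' by auto
 hence "u' = u" using inj_onD[OF rf_inj[OF G y(1)], of u' u] u' step.hyps(1) by simp
 thus ?thesis using u' by simp
 qed
 qed
 show ?thesis
 proof (rule PiE_ext[of y "V - Z" "inc en Ed"])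
 show "y : PiE (V - Z) (inc en Ed)" "y' : PiE (V - Z) (inc en Ed)"
 using y unfolding rf_def forests_def by auto
 fix x assume x: "x : V - Z"
 obtain r where "lead ?n (V - Z) x r" using rf_lead[OF y(1) x] .
 thus "y x = y' x" using key x by auto
 qed
qed

text \<open>Every vertex takes the first edge of a shortest path to \<open>Z\<close> inside
  \<open>omm\<close>; the distance to \<open>Z\<close> decreases along the orbit, which excludes
  cycles.\<close>

lemma bfs_forest:
 assumes G: "fgraph V en Ed" and om: "omm <= Ed" and Z: "Z <= V"
 and reach: "!!v. v : V ==> EX z:Z. (v, z) : (adj_rel en omm)^*"
 obtains y where "y : rf V en Ed Z" "y ` (V - Z) <= omm"
proof -
 define P where "P v k \<longleftrightarrow> (EX z:Z. (v, z) : adj_rel en omm ^^ k)" for v k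
 define m where "m v = (LEAST k. P v k)" for v
 have Pm: "P v (m v)" if v: "v : V" for v
 proof -
 obtain z where "z : Z" "(v, z) : (adj_rel en omm)^*" using reach[OF v] by blast
 hence "\<exists>k. P v k" unfolding P_def rtrancl_power by blast
 thus ?thesis unfolding m_def by (rule LeastI_ex)
 qed
 have ex: "\<exists>epp. epp : omm & v : en epp & m (other (en epp) v) < m v" if v: "v : V - Z" for v
 proof -
 have "P v (m v)" using Pm v by auto
 then obtain z where z: "z : Z" "(v, z) : adj_rel en omm ^^ m v" unfolding P_def by blast
 have "m v ~= 0" using z v by (metis DiffD2 relpow_0_E)
 then obtain k where k: "m v = Suc k" by (cases "m v") auto
 then obtain w where w: "(v, w) : adj_rel en omm" "(w, z) : adj_rel en omm ^^ k"
 using z(2) by (metis relpow_Suc_E2)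
 obtain epp where e: "epp : omm" "en epp = {v, w}" using w(1) unfolding adj_rel_def by auto
 have "m w <= k" unfolding m_def by (rule Least_le) (use w z in \<open>auto simp: P_def\<close>)
 thus ?thesis using e k other_eq[OF e(2)] by auto
 qed
 define y where "y = (\<lambda>v\<in>V - Z. SOME epp. epp : omm & v : en epp & m (other (en epp) v) < m v)"
 have y: "y v : omm & v : en (y v) & m (other (en (y v)) v) < m v" if v: "v : V - Z" for v
 using someI_ex[OF ex[OF v]] v unfolding y_def by simp
 have "y : PiE (V - Z) (inc en Ed)"
 using y om by (auto simp: inc_def y_def PiE_iff)
 moreover have "all_lead (%v. other (en (y v)) v) (V - Z)"
 by (rule all_lead_measure[of _ _ m]) (use y in auto)
 ultimately have "y : rf V en Ed Z" unfolding rf_def forests_def by simp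
 moreover have "y ` (V - Z) <= omm" using y by auto
 ultimately show ?thesis using that by blast
qed

lemma acyc_insert:
 assumes T: "acyc en T" and ab: "en epp = {a, b}" "(a, b) ~: (adj_rel en T)^*"
 shows "acyc en (insert epp T)"
 unfolding acyc_def
proof (intro ballI allI impI notI)
 fix epp' c d
 assume e: "epp' : insert epp T" and cd: "en epp' = {c, d}"
 and p: "(c, d) : (adj_rel en (insert epp T - {epp'}))^*"
 show False
 proof (cases "epp' = epp")
 case True
 have "(c, d) : (adj_rel en T)^*" by (rule adj_rtrancl_mono[OF _ p]) (use True in auto)
 thus False using ab cd True adj_rtrancl_sym[of c d en T] by (auto simp: doubleton_eq_iff)
 next
 case False
 let ?R = "(adj_rel en (T - {epp'}))^*"
 have eT: "epp' : T" using False e by auto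
 have "insert epp T - {epp'} = insert epp (T - {epp'})" using False by auto
 with p have "(c, d) : (adj_rel en (insert epp (T - {epp'})))^*" by simp
 from adj_rtrancl_insert[OF this ab(1)]
 consider "(c, d) : ?R" | "(c, a) : ?R" "(b, d) : ?R" | "(c, b) : ?R" "(a, d) : ?R" by blast
 thus False
 proof cases
 case 1
 thus False using T eT cd unfolding acyc_def by blast
 next
 case 2
 have "(c, a) : (adj_rel en T)^*" "(b, d) : (adj_rel en T)^*"
 using 2 adj_rtrancl_mono[of "T - {epp'}" T] by auto
 moreover have "(c, d) : (adj_rel en T)^*" using adj_edge[where en = en, OF eT cd] .
 ultimately have "(a, b) : (adj_rel en T)^*"
 by (blast intro: adj_rtrancl_sym rtrancl_trans)
 thus False using ab by simp
 next
 case 3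
 have "(c, b) : (adj_rel en T)^*" "(a, d) : (adj_rel en T)^*"
 using 3 adj_rtrancl_mono[of "T - {epp'}" T] by auto
 moreover have "(c, d) : (adj_rel en T)^*" using adj_edge[where en = en, OF eT cd] .
 ultimately have "(a, b) : (adj_rel en T)^*"
 by (blast intro: adj_rtrancl_sym rtrancl_trans)
 thus False using ab by simp
 qed
 qed
qed

text \<open>An inclusion-maximal acyclic superset already joins the ends of every edge of the
  graph.\<close>

lemma acyc_extend:
 assumes G: "fgraph V en Ed" and conn: "gconn V en Ed" and F: "F <= Ed" "acyc en F"
 obtains T where "F <= T" "spanning_tree V en Ed T"
proof -
 have fin: "finite {T. F <= T & T <= Ed & acyc en T}"
 by (rule finite_subset[of _ "Pow Ed"]) (use G in \<open>auto simp: fgraph_def\<close>)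
 have "F : {T. F <= T & T <= Ed & acyc en T}" using F by auto
 from finite_has_maximal2[OF fin this] obtain T where
 T: "F <= T" "T <= Ed" "acyc en T"
 and max: "!!T'. F <= T' ==> T' <= Ed ==> acyc en T' ==> T <= T' ==> T = T'"
 by auto
 have edge: "(p, q) : (adj_rel en T)^*" if pq: "(p, q) : adj_rel en Ed" for p q
 proof (rule ccontr)
 assume n: "(p, q) ~: (adj_rel en T)^*"
 obtain epp where e: "epp : Ed" "en epp = {p, q}" using pq unfolding adj_rel_def by auto
 have "epp ~: T" using adj_edge[where en = en and epp = epp, OF _ e(2), of T] n by auto
 moreover have "T = insert epp T"
 by (rule max) (use T e acyc_insert[OF T(3) e(2) n] in auto)
 ultimately show False by auto
 qed
 have "(p, q) : (adj_rel en T)^*" if "(p, q) : (adj_rel en Ed)^*" for p q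
 using that by (induction rule: rtrancl_induct) (auto intro: rtrancl_trans edge)
 hence "gconn V en T" using conn unfolding gconn_def by blast
 hence "spanning_tree V en Ed T" using T spanning_tree_alt[OF G] by blast
 thus ?thesis using that T by blast
qed

lemma rf_spanning_tree:
 assumes G: "fgraph V en Ed" and r: "r : V" and y: "y : rf V en Ed {r}"
 shows "spanning_tree V en Ed (y ` (V - {r}))"
proof -
 let ?T = "y ` (V - {r})"
 have toroot: "(v, r) : (adj_rel en ?T)^*" if v: "v : V" for v
 proof (cases "v = r")
 case False
 hence "v : V - {r}" using v by auto
 then obtain z where z: "lead (%v. other (en (y v)) v) (V - {r}) v z" using rf_lead[OF y] by blast
 show ?thesis using rf_lead_root[OF G y z v] by auto
 qed auto
 have "gconn V en ?T" unfolding gconn_def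
 by (intro ballI rtrancl_trans[OF toroot adj_rtrancl_sym[OF toroot]])
 thus ?thesis
 unfolding spanning_tree_alt[OF G] using rf_acyc[OF G y] rf_D(4)[OF G y] by auto
qed

text \<open>The breadth-first forest inside \<open>T\<close> with single root \<open>r\<close> spans
  the graph, and any further edge of \<open>T\<close> would close a cycle with it.\<close>

lemma spanning_tree_rf:
 assumes G: "fgraph V en Ed" and r: "r : V" and T: "spanning_tree V en Ed T"
 obtains y where "y : rf V en Ed {r}" "T = y ` (V - {r})"
proof -
 have T': "T <= Ed" "gconn V en T" "acyc en T" using T spanning_tree_alt[OF G] by blast+
 obtain y where y: "y : rf V en Ed {r}" "y ` (V - {r}) <= T"
 by (rule bfs_forest[OF G T'(1), of "{r}"]) (use r T' in \<open>auto simp: gconn_def\<close>)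
 have "epp : y ` (V - {r})" if e: "epp : T" for epp
 proof (rule ccontr)
 assume n: "epp ~: y ` (V - {r})"
 obtain a b where ab: "en epp = {a, b}" "a : V" "b : V" using G T' e unfolding fgraph_def by blast
 have "gconn V en (y ` (V - {r}))"
 using rf_spanning_tree[OF G r y(1)] spanning_tree_alt[OF G] by blast
 hence "(a, b) : (adj_rel en (y ` (V - {r})))^*" using ab unfolding gconn_def by blast
 hence "(a, b) : (adj_rel en (T - {epp}))^*"
 by (rule adj_rtrancl_mono[rotated]) (use n y in auto)
 thus False using T' e ab unfolding acyc_def by blast
 qed
 hence "T = y ` (V - {r})" using y by blast
 thus ?thesis using that y by blast
qed

lemma spanning_tree_bij:
 assumes G: "fgraph V en Ed" and r: "r : V"
 shows "bij_betw (%y. y ` (V - {r})) (rf V en Ed {r}) {T. spanning_tree V en Ed T}"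
proof (rule bij_betw_imageI)
 show "inj_on (%y. y ` (V - {r})) (rf V en Ed {r})"
 by (rule inj_onI) (rule rf_unique[OF G])
next
 show "(%y. y ` (V - {r})) ` rf V en Ed {r} = {T. spanning_tree V en Ed T}"
 proof (rule equalityI; rule subsetI)
 fix T assume "T : (%y. y ` (V - {r})) ` rf V en Ed {r}"
 thus "T : {T. spanning_tree V en Ed T}" using rf_spanning_tree[OF G r] by auto
 next
 fix T assume "T : {T. spanning_tree V en Ed T}"
 hence "spanning_tree V en Ed T" by simp
 from spanning_tree_rf[OF G r this] obtain y where "y : rf V en Ed {r}" "T = y ` (V - {r})" .
 thus "T : (%y. y ` (V - {r})) ` rf V en Ed {r}" by simp
 qed
qed

lemma num_spanning_trees_rf:
 assumes "fgraph V en Ed" "r : V"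
 shows "num_spanning_trees V en Ed = card (rf V en Ed {r})"
 unfolding num_spanning_trees_def using bij_betw_same_card[OF spanning_tree_bij[OF assms]] by simp

lemma card_spanning_tree:
 assumes G: "fgraph V en Ed" and T: "spanning_tree V en Ed T" and ne: "V ~= {}"
 shows "card T = card V - 1" "T <= Ed"
proof -
 obtain r where r: "r : V" using ne by auto
 obtain y where y: "y : rf V en Ed {r}" "T = y ` (V - {r})" using spanning_tree_rf[OF G r T] .
 show "card T = card V - 1" using card_image[OF rf_inj[OF G y(1)]] y(2) r fgraph_finite[OF G] by simp
 show "T <= Ed" using T unfolding spanning_tree_def by blast
qed

lemma num_spanning_trees_pos:
 assumes G: "fgraph V en Ed" and "gconn V en Ed"
 shows "num_spanning_trees V en Ed > 0"
proof -
 obtain T where "spanning_tree V en Ed T"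
 using acyc_extend[OF assms, of "{}"] unfolding acyc_def by blast
 thus ?thesis unfolding num_spanning_trees_def
 using finite_spanning_trees[OF fgraph_finite(2)[OF G], of V en] by (auto simp: card_gt_0_iff)
qed

section \<open>Counting forests with few roots\<close>

definition small_subsets :: "'a set => nat => 'a set set" where
 "small_subsets A k = {X. X <= A & card X <= k}"

lemma finite_small_subsets: "finite A ==> finite (small_subsets A k)"
 unfolding small_subsets_def by simp

text \<open>Chernoff's bound: each small subset has weight at least \<open>thh ^ k\<close>, and the
  weights \<open>thh ^ card X\<close> of all subsets add up to
  \<open>(1 + thh) ^ card A\<close>.\<close>

lemma card_small_subsets:
 fixes thh :: real
 assumes A: "finite A" and th: "0 < thh" "thh <= 1"
 shows "rc (small_subsets A k) <= (1 + thh) ^ card A / thh ^ k"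
proof -
 have "rc (small_subsets A k) * thh ^ k = (SUM X:small_subsets A k. thh ^ k)" by simp
 also have "... <= (SUM X:small_subsets A k. thh ^ card X)"
 using th by (intro sum_mono power_decreasing) (auto simp: small_subsets_def)
 also have "... <= (SUM X:Pow A. thh ^ card X)"
 using A th by (intro sum_mono2) (auto simp: small_subsets_def)
 also have "... = (\<Prod>x\<in>A. thh + 1)"
 using prod_add[OF A, of "%_. thh" "%_. 1"] by simp
 also have "... = (1 + thh) ^ card A" by (simp add: add.commute)
 finally show ?thesis using th by (simp add: field_simps)
qed

text \<open>Completing a forest to a spanning tree adds at most \<open>k\<close> edges, and the tree
  together with the added edges recovers the forest.\<close>

lemma card_rf_le:
 assumes G: "fgraph V en Ed" and conn: "gconn V en Ed" and Z: "Z <= V"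
 and ne: "V ~= {}" and k: "card Z <= k"
 shows "card (rf V en Ed Z) <= num_spanning_trees V en Ed * card (small_subsets Ed k)"
proof -
 have "\<exists>T. y ` (V - Z) <= T & spanning_tree V en Ed T" if y: "y : rf V en Ed Z" for y
 proof -
 have "y ` (V - Z) <= Ed" using rf_D(4)[OF G y] by auto
 from acyc_extend[OF G conn this rf_acyc[OF G y]] obtain T
 where "y ` (V - Z) <= T" "spanning_tree V en Ed T" .
 thus ?thesis by auto
 qed
 then obtain T where T: "!!y. y : rf V en Ed Z ==> y ` (V - Z) <= T y & spanning_tree V en Ed (T y)"
 by metis
 let ?h = "%y. (T y, T y - y ` (V - Z))"
 have inj: "inj_on ?h (rf V en Ed Z)"
 proof (rule inj_onI)
 fix y y' assume y: "y : rf V en Ed Z" "y' : rf V en Ed Z" and e: "?h y = ?h y'"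
 have "y ` (V - Z) = T y - (T y - y ` (V - Z))" "y' ` (V - Z) = T y' - (T y' - y' ` (V - Z))"
 using T[OF y(1)] T[OF y(2)] by blast+
 hence "y ` (V - Z) = y' ` (V - Z)" using e by (metis prod.inject)
 thus "y = y'" using rf_unique[OF G y] by simp
 qed
 have fin: "finite V" "finite Ed" using fgraph_finite[OF G] .
 have sub: "?h ` rf V en Ed Z <= {T. spanning_tree V en Ed T} \<times> small_subsets Ed k"
 proof
 fix p assume "p : ?h ` rf V en Ed Z"
 then obtain y where y: "y : rf V en Ed Z" "p = ?h y" by auto
 have TE: "T y <= Ed" "card (T y) = card V - 1" using card_spanning_tree[OF G _ ne] T[OF y(1)] by auto
 have "card (T y - y ` (V - Z)) = card (T y) - card (y ` (V - Z))"
 using T[OF y(1)] fin by (intro card_Diff_subset) auto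
 also have "card (y ` (V - Z)) = card V - card Z"
 using card_image[OF rf_inj[OF G y(1)]] fin Z by (simp add: card_Diff_subset finite_subset)
 finally have "card (T y - y ` (V - Z)) <= k" using TE(2) k by linarith
 thus "p : {T. spanning_tree V en Ed T} \<times> small_subsets Ed k"
 using y T[OF y(1)] TE unfolding small_subsets_def by auto
 qed
 have "card (rf V en Ed Z) = card (?h ` rf V en Ed Z)" using card_image[OF inj] by simp
 also have "... <= card ({T. spanning_tree V en Ed T} \<times> small_subsets Ed k)"
 by (rule card_mono[OF _ sub]) (simp add: finite_spanning_trees fin finite_small_subsets)
 finally show ?thesis by (simp add: card_cartesian_product num_spanning_trees_def)
qed

definition few_rooted :: "'v set => ('e => 'v set) => 'e set => nat => ('v set \<times> ('v => 'e)) set" where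
 "few_rooted V en Ed k = Sigma (small_subsets V k) (rf V en Ed)"

lemma card_few_rooted:
 assumes G: "fgraph V en Ed" and conn: "gconn V en Ed" and ne: "V ~= {}"
 shows "card (few_rooted V en Ed k) <=
 card (small_subsets V k) * (num_spanning_trees V en Ed * card (small_subsets Ed k))"
 "finite (few_rooted V en Ed k)"
proof -
 have fin: "finite (small_subsets V k)" using finite_small_subsets fgraph_finite[OF G] by blast
 show "finite (few_rooted V en Ed k)"
 unfolding few_rooted_def using fin finite_rf[OF G] by blast
 have "card (few_rooted V en Ed k) = (SUM Z:small_subsets V k. card (rf V en Ed Z))"
 unfolding few_rooted_def using fin finite_rf[OF G] by simp
 also have "... <= (SUM Z:small_subsets V k. num_spanning_trees V en Ed * card (small_subsets Ed k))"
 by (intro sum_mono card_rf_le[OF G conn _ ne]) (auto simp: small_subsets_def)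
 finally show "card (few_rooted V en Ed k) <=
 card (small_subsets V k) * (num_spanning_trees V en Ed * card (small_subsets Ed k))" by simp
qed

lemma small_subsets_subexponential:
 fixes c ett :: real
 assumes "c > 0" "ett > 0"
 obtains ka where "ka > 0"
 "!!N A k. finite A ==> rc A <= c * real N ==> real k <= ka * real N ==>
 rc (small_subsets A k) <= exp (ett * real N)"
proof -
 \<comment> \<open>By \<open>ln (1 + thh) <= thh\<close>, the factor
   \<open>(1 + thh) ^ card A\<close> uses at most half of \<open>ett\<close>; the factor
   \<open>1 / thh ^ k\<close> gets the other half.\<close>
 define thh where "thh = min 1 (ett / (2 * c))"
 have th: "0 < thh" "thh <= 1" "c * thh <= ett / 2"
 using assms by (auto simp: thh_def min_def field_simps)
 \<comment> \<open>\<open>1 - ln thh\<close> in place of \<open>- ln thh\<close> keeps the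
   denominator positive when \<open>thh = 1\<close>.\<close>
 define ka where "ka = ett / 2 / (1 - ln thh)"
 have ln: "ln thh <= 0" using th by simp
 have kp: "ka > 0" using assms ln by (simp add: ka_def)
 have kl: "ka * (- ln thh) <= ett / 2"
 proof -
 have "ka * (- ln thh) <= ka * (1 - ln thh)" by (rule mult_left_mono) (use kp in auto)
 also have "... = ett / 2" unfolding ka_def using ln by (intro nonzero_eq_divide_eq[THEN iffD1]) auto
 finally show ?thesis .
 qed
 show ?thesis
 proof (rule that[OF kp])
 fix N :: nat and A :: "'a set" and k :: nat
 assume A: "finite A" "rc A <= c * real N" and k: "real k <= ka * real N"
 have "rc (small_subsets A k) <= (1 + thh) ^ card A / thh ^ k"
 by (rule card_small_subsets[OF A(1) th(1,2)])
 also have "... = exp (card A * ln (1 + thh) + real k * (- ln thh))"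
 proof -
 have "exp (card A * ln (1 + thh)) = (1 + thh) ^ card A" "exp (real k * ln thh) = thh ^ k"
 using th by (simp_all add: exp_of_nat_mult)
 thus ?thesis by (simp add: exp_diff)
 qed
 also have "... <= exp (ett * real N)"
 proof (subst exp_le_cancel_iff)
 have "card A * ln (1 + thh) <= (c * real N) * thh"
 using th A ln_add_one_self_le_self[of thh] by (intro mult_mono) auto
 also have "... <= ett / 2 * real N" using mult_right_mono[OF th(3), of "real N"] by (simp add: algebra_simps)
 finally have 1: "card A * ln (1 + thh) <= ett / 2 * real N" .
 have "real k * (- ln thh) <= (ka * real N) * (- ln thh)" using k ln by (intro mult_right_mono) auto
 also have "... <= ett / 2 * real N" using mult_right_mono[OF kl, of "real N"] by (simp add: algebra_simps)
 finally show "card A * ln (1 + thh) + real k * (- ln thh) <= ett * real N" using 1 by simp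
 qed
 finally show "rc (small_subsets A k) <= exp (ett * real N)" .
 qed
qed

section \<open>Rooted forests weighted by the number of roots\<close>

text \<open>Each vertex \<open>Inl v\<close> has a private exit \<open>Inr v\<close>, entered by the
  choice \<open>None\<close> of weight \<open>x\<close>. Forests with arbitrary root sets thus
  become forests of a single graph with fixed exits, to which \<open>forest_sum_harmonic\<close>
  applies.\<close>

fun mtgt :: "('e => 'v set) => 'v + 'v => 'e option => 'v + 'v" where
 "mtgt en (Inl v) None = Inr v"
| "mtgt en (Inl v) (Some epp) = Inl (other (en epp) v)"
| "mtgt en (Inr v) _ = Inr v"

fun mC :: "('e => 'v set) => 'e set => 'v + 'v => 'e option set" where
 "mC en Ed (Inl v) = insert None (Some ` inc en Ed v)"
| "mC en Ed (Inr v) = {}"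

fun mwt :: "real => 'v + 'v => 'e option => real" where
 "mwt x w None = x"
| "mwt x w (Some epp) = 1"

definition mforests :: "'v set => ('e => 'v set) => 'e set => ('v + 'v => 'e option) set" where
 "mforests V en Ed = forests (mtgt en) (mC en Ed) (Inl ` V)"

definition mroots :: "'v set => ('v + 'v => 'e option) => 'v set" where
 "mroots V y = {v : V. y (Inl v) = None}"

text \<open>By the matrix-forest theorem this is \<open>det (L + x)\<close> for the Laplacian
  \<open>L\<close>; determinants themselves never occur.\<close>

definition mZ :: "'v set => ('e => 'v set) => 'e set => real => real" where
 "mZ V en Ed x = (SUM y:mforests V en Ed. x ^ card (mroots V y))"

abbreviation mlead :: "'v set => ('e => 'v set) => ('v + 'v => 'e option) => 'v + 'v => 'v + 'v => bool" where
 "mlead V en y == lead (%u. mtgt en u (y u)) (Inl ` V)"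

text \<open>Divided by \<open>mZ\<close>, this is the probability that \<open>w\<close> belongs to
  the tree rooted at \<open>v\<close>, an entry of the resolvent
  \<open>x (L + x)^-1\<close>.\<close>

definition mZr :: "'v set => ('e => 'v set) => 'e set => real => 'v + 'v => 'v => real" where
 "mZr V en Ed x w v = (SUM y:{y : mforests V en Ed. mlead V en y w (Inr v)}. x ^ card (mroots V y))"

definition adj_op :: "('e => 'v set) => 'e set => ('v => real) => 'v => real" where
 "adj_op en Ed fii u = (SUM epp:inc en Ed u. fii (other (en epp) u))"

definition closed_walks :: "'v set => ('e => 'v set) => 'e set => nat => real" where
 "closed_walks V en Ed k = (SUM v:V. (adj_op en Ed ^^ k) (%w. of_bool (w = v)) v)"

lemma finite_mforests:
 assumes "fgraph V en Ed"
 shows "finite (mforests V en Ed)"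
 unfolding mforests_def
 by (intro finite_forests) (use assms in \<open>auto simp: fgraph_finite finite_inc\<close>)

lemma mwt_prod:
 assumes "finite V"
 shows "(\<Prod>w\<in>Inl ` V. mwt x w (y w)) = x ^ card (mroots V y)"
proof -
 have "(\<Prod>w\<in>Inl ` V. mwt x w (y w)) = (\<Prod>v\<in>V. if y (Inl v) = None then x else 1)"
 by (subst prod.reindex) (auto simp: inj_on_def intro!: prod.cong split: option.split)
 also have "... = (\<Prod>v\<in>{v:V. y (Inl v) = None}. x)"
 by (rule prod.inter_filter[OF assms, symmetric])
 finally show ?thesis by (simp add: mroots_def)
qed

lemma mZr_forest_sum:
 assumes "finite V"
 shows "mZr V en Ed x w v = forest_sum (mtgt en) (mC en Ed) (mwt x) (Inl ` V) w (Inr v)"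
 unfolding mZr_def forest_sum_def mforests_def mwt_prod[OF assms] ..

lemma mZr_root:
 "mZr V en Ed x (Inr w) v = (if w = v then mZ V en Ed x else 0)"
proof -
 have "mlead V en y (Inr w) (Inr v) \<longleftrightarrow> w = v" for y
 using lead_not_in[of "%u. mtgt en u (y u)" "Inl ` V" "Inr w" "Inr v"]
 lead.stop[of "Inr w" "Inl ` V" "%u. mtgt en u (y u)"] by auto
 thus ?thesis unfolding mZr_def mZ_def by auto
qed

text \<open>The resolvent equation \<open>(L + x) h = x delta_v\<close>: it is harmonicity at
  \<open>u\<close>, with the private exit of \<open>u\<close> counted as a neighbour of weight
  \<open>x\<close>.\<close>

lemma mZr_rec:
 assumes G: "fgraph V en Ed" and reg: "card (inc en Ed u) = d" and u: "u : V"
 shows "(real d + x) * mZr V en Ed x (Inl u) v =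
 (SUM epp:inc en Ed u. mZr V en Ed x (Inl (other (en epp) u)) v)
 + x * (if u = v then mZ V en Ed x else 0)"
proof -
 have fV: "finite V" using fgraph_finite[OF G] by simp
 have fi: "finite (inc en Ed u)" using finite_inc[OF G] .
 have "(SUM c:mC en Ed (Inl u). mwt x (Inl u) c * (mZr V en Ed x (Inl u) v - mZr V en Ed x (mtgt en (Inl u) c) v)) = 0"
 unfolding mZr_forest_sum[OF fV]
 by (rule forest_sum_harmonic) (use fV u finite_inc[OF G] in auto)
 hence "x * (mZr V en Ed x (Inl u) v - mZr V en Ed x (Inr u) v) +
 (SUM epp:inc en Ed u. mZr V en Ed x (Inl u) v - mZr V en Ed x (Inl (other (en epp) u)) v) = 0"
 using fi by (simp add: sum.reindex)
 thus ?thesis by (simp add: sum_subtractf reg mZr_root algebra_simps)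
qed

text \<open>The exit \<open>Inr v\<close> can be entered only from \<open>Inl v\<close>, and the
  orbit of \<open>Inl v\<close> does not return to its start; so it must enter at once.\<close>

lemma mlead_self:
 assumes v: "v : V"
 shows "mlead V en y (Inl v) (Inr v) \<longleftrightarrow> y (Inl v) = None"
proof
 let ?n = "%u. mtgt en u (y u)"
 assume "y (Inl v) = None"
 hence "?n (Inl v) = Inr v" by simp
 moreover have "mlead V en y (Inr v) (Inr v)" by (rule lead.stop) auto
 ultimately have "mlead V en y (?n (Inl v)) (Inr v)" by simp
 thus "mlead V en y (Inl v) (Inr v)" by (rule lead.step[rotated]) (use v in auto)
next
 let ?n = "%u. mtgt en u (y u)"
 assume l: "mlead V en y (Inl v) (Inr v)"
 have A: "w = Inr v" if "lead ?n (Inl ` V - {Inl v}) w r" "r = Inr v" for w r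
 using that
 proof (induction rule: lead.induct)
 case (stop r)
 thus ?case by simp
 next
 case (step w r)
 then obtain z where z: "w = Inl z" "z ~= v" by auto
 have "?n w = Inr v" using step by simp
 thus ?case using z by (cases "y w") auto
 qed
 have "lead ?n (Inl ` V - {Inl v}) (?n (Inl v)) (Inr v)"
 using lead_no_return(1)[OF _ l] v by auto
 from A[OF this refl] have "?n (Inl v) = Inr v" .
 thus "y (Inl v) = None" by (cases "y (Inl v)") auto
qed

text \<open>A vertex hangs on itself exactly when it is a root, so the trace of the resolvent counts
  roots.\<close>

lemma sum_mZr_diag:
 assumes G: "fgraph V en Ed"
 shows "(SUM v:V. mZr V en Ed x (Inl v) v) =
 (SUM y:mforests V en Ed. rc (mroots V y) * x ^ card (mroots V y))"
proof -
 have fV: "finite V" using fgraph_finite[OF G] by simp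
 have "(SUM v:V. mZr V en Ed x (Inl v) v) =
 (SUM v:V. SUM y:mforests V en Ed. if v : mroots V y then x ^ card (mroots V y) else 0)"
 proof (intro sum.cong refl)
 fix v assume v: "v : V"
 have "{y : mforests V en Ed. mlead V en y (Inl v) (Inr v)} = {y : mforests V en Ed. v : mroots V y}"
 using mlead_self[OF v] v by (auto simp: mroots_def)
 thus "mZr V en Ed x (Inl v) v =
 (SUM y:mforests V en Ed. if v : mroots V y then x ^ card (mroots V y) else 0)"
 unfolding mZr_def using finite_mforests[OF G] by (simp add: sum.inter_filter)
 qed
 also have "... = (SUM y:mforests V en Ed. SUM v:V. if v : mroots V y then x ^ card (mroots V y) else 0)"
 by (rule sum.swap)
 also have "... = (SUM y:mforests V en Ed. SUM v:mroots V y. x ^ card (mroots V y))"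
 proof (rule sum.cong[OF refl])
 fix y
 have "{v : V. v : mroots V y} = mroots V y" by (auto simp: mroots_def)
 thus "(SUM v:V. if v : mroots V y then x ^ card (mroots V y) else 0) =
 (SUM v:mroots V y. x ^ card (mroots V y))"
 using sum.inter_filter[OF fV, of "%_. x ^ card (mroots V y)" "%v. v : mroots V y"] by simp
 qed
 finally show ?thesis by simp
qed

subsection \<open>Rooted forests with prescribed root set\<close>

definition rf_to_m :: "'v set => 'v set => ('v => 'e) => 'v + 'v => 'e option" where
 "rf_to_m V Z y = (\<lambda>w\<in>Inl ` V. case w of Inl v => if v : Z then None else Some (y v) | Inr v => None)"

lemma rf_to_m_roots: "Z <= V ==> mroots V (rf_to_m V Z y) = Z"
 by (auto simp: mroots_def rf_to_m_def)

lemma rf_to_m_all_lead: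
 assumes Z: "Z <= V" and cl: "!!v. v : V - Z ==> other (en (y v)) v : V"
 shows "all_lead (%u. mtgt en u (rf_to_m V Z y u)) (Inl ` V) \<longleftrightarrow>
 all_lead (%v. other (en (y v)) v) (V - Z)"
proof
 let ?m = "%u. mtgt en u (rf_to_m V Z y u)" and ?n = "%v. other (en (y v)) v"
 have m1: "?m (Inl v) = Inr v" if "v : Z" for v using that Z by (auto simp: rf_to_m_def)
 have m2: "?m (Inl v) = Inl (?n v)" if "v : V - Z" for v using that by (auto simp: rf_to_m_def)
 {
 assume a: "all_lead ?n (V - Z)"
 have A: "v : V --> lead ?m (Inl ` V) (Inl v) (Inr r)" if "lead ?n (V - Z) v r" for v r
 using that
 proof (induction rule: lead.induct)
 case (stop v)
 show ?case
 proof
 assume v: "v : V"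
 hence vZ: "v : Z" using stop by auto
 have "lead ?m (Inl ` V) (?m (Inl v)) (Inr v)" unfolding m1[OF vZ] by (rule lead.stop) auto
 thus "lead ?m (Inl ` V) (Inl v) (Inr v)" by (rule lead.step[rotated]) (use v in auto)
 qed
 next
 case (step v r)
 have "lead ?m (Inl ` V) (?m (Inl v)) (Inr r)" unfolding m2[OF step.hyps(1)]
 using step.IH cl[OF step.hyps(1)] by blast
 thus ?case using lead.step[of "Inl v" "Inl ` V" ?m] by auto
 qed
 show "all_lead ?m (Inl ` V)"
 unfolding all_lead_def
 proof
 fix w assume "w : (Inl ` V :: ('a + 'a) set)"
 then obtain v where v: "w = Inl v" "v : V" by auto
 have "\<exists>r. lead ?n (V - Z) v r"
 using a v lead.stop[of v "V - Z" ?n] unfolding all_lead_def by blast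
 thus "\<exists>r. lead ?m (Inl ` V) w r" using A v by blast
 qed
 }
 {
 assume a: "all_lead ?m (Inl ` V)"
 have A: "\<forall>v. w = Inl v --> (\<exists>z. lead ?n (V - Z) v z)" if "lead ?m (Inl ` V) w r" for w r
 using that
 proof (induction rule: lead.induct)
 case (stop w)
 show ?case
 proof (intro allI impI)
 fix v assume "w = Inl v"
 hence "v ~: V - Z" using stop by auto
 from lead.stop[OF this, of ?n] show "\<exists>z. lead ?n (V - Z) v z" by auto
 qed
 next
 case (step w r)
 show ?case
 proof (intro allI impI)
 fix v assume w: "w = Inl v"
 show "\<exists>z. lead ?n (V - Z) v z"
 proof (cases "v : V - Z")
 case True
 hence "\<exists>z. lead ?n (V - Z) (?n v) z" using step.IH w m2[OF True] by auto
 thus ?thesis using lead.step[of v "V - Z" ?n] True by auto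
 next
 case False
 from lead.stop[OF this, of ?n] show ?thesis by auto
 qed
 qed
 qed
 show "all_lead ?n (V - Z)"
 unfolding all_lead_def
 proof
 fix v assume v: "v : V - Z"
 then obtain r where "lead ?m (Inl ` V) (Inl v) r" using a unfolding all_lead_def by auto
 thus "\<exists>r. lead ?n (V - Z) v r" using A by auto
 qed
 }
qed

lemma rf_to_m_mforests:
 assumes G: "fgraph V en Ed" and Z: "Z <= V" and y: "y : rf V en Ed Z"
 shows "rf_to_m V Z y : mforests V en Ed"
proof -
 have "all_lead (%v. other (en (y v)) v) (V - Z)" using y by (simp add: rf_def forests_def)
 hence "all_lead (%u. mtgt en u (rf_to_m V Z y u)) (Inl ` V)"
 using rf_to_m_all_lead[OF Z, of en y] rf_D(3)[OF G y] by blast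
 moreover have "rf_to_m V Z y : PiE (Inl ` V) (mC en Ed)"
 using rf_D(1)[OF G y] by (auto simp: rf_to_m_def)
 ultimately show ?thesis unfolding mforests_def forests_def by simp
qed

lemma mforests_to_rf:
 assumes G: "fgraph V en Ed" and y: "y : mforests V en Ed"
 defines "Z == mroots V y" and "y' == \<lambda>v\<in>V - mroots V y. the (y (Inl v))"
 shows "y' : rf V en Ed Z" "y = rf_to_m V Z y'"
proof -
 have P: "y : PiE (Inl ` V) (mC en Ed)" using y by (simp add: mforests_def forests_def)
 have ZV: "Z <= V" by (auto simp: Z_def mroots_def)
 show eq: "y = rf_to_m V Z y'"
 proof
 fix w
 show "y w = rf_to_m V Z y' w"
 proof (cases "w : Inl ` V")
 case True
 then obtain v where "w = Inl v" "v : V" by auto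
 thus ?thesis by (auto simp: rf_to_m_def Z_def y'_def mroots_def)
 next
 case False
 thus ?thesis using P by (auto simp: rf_to_m_def PiE_iff extensional_def)
 qed
 qed
 have inc: "y' v : inc en Ed v" if v: "v : V - Z" for v
 proof -
 have "y (Inl v) : mC en Ed (Inl v)" by (rule PiE_mem[OF P]) (use v in auto)
 moreover have "y (Inl v) ~= None" using v by (auto simp: Z_def mroots_def)
 ultimately show ?thesis using v by (auto simp: y'_def Z_def)
 qed
 have "all_lead (%u. mtgt en u (y u)) (Inl ` V)" using y by (simp add: mforests_def forests_def)
 hence "all_lead (%u. mtgt en u (rf_to_m V Z y' u)) (Inl ` V)" using eq by simp
 hence "all_lead (%v. other (en (y' v)) v) (V - Z)"
 using rf_to_m_all_lead[OF ZV, of en y'] fgraph_inc(3)[OF G inc] by blast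
 moreover have "y' : PiE (V - Z) (inc en Ed)" using inc by (auto simp: y'_def Z_def)
 ultimately show "y' : rf V en Ed Z" by (simp add: rf_def forests_def)
qed

lemma mZ_ge_trees:
 assumes G: "fgraph V en Ed" and ne: "V ~= {}" and x: "x >= 0"
 shows "x * real (num_spanning_trees V en Ed) <= mZ V en Ed x"
proof -
 obtain r where r: "r : V" using ne by auto
 let ?h = "rf_to_m V {r}"
 have inj: "inj_on ?h (rf V en Ed {r})"
 proof (rule inj_onI)
 fix y y' assume y: "y : rf V en Ed {r}" "y' : rf V en Ed {r}" and e: "?h y = ?h y'"
 show "y = y'"
 proof (rule PiE_ext[of y "V - {r}" "inc en Ed"])
 show "y : PiE (V - {r}) (inc en Ed)" "y' : PiE (V - {r}) (inc en Ed)"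
 using y unfolding rf_def forests_def by auto
 fix v assume v: "v : V - {r}"
 have "?h y (Inl v) = ?h y' (Inl v)" using e by simp
 thus "y v = y' v" using v by (simp add: rf_to_m_def)
 qed
 qed
 have "x * real (num_spanning_trees V en Ed) = (SUM y:rf V en Ed {r}. x ^ card (mroots V (?h y)))"
 using r by (simp add: num_spanning_trees_rf[OF G r] rf_to_m_roots)
 also have "... = (SUM y:?h ` rf V en Ed {r}. x ^ card (mroots V y))"
 by (subst sum.reindex[OF inj]) simp
 also have "... <= mZ V en Ed x" unfolding mZ_def
 using finite_mforests[OF G] rf_to_m_mforests[OF G, of "{r}"] r x
 by (intro sum_mono2) auto
 finally show ?thesis .
qed

text \<open>Markov's inequality for the number of roots: forests with more than \<open>k\<close>
  roots carry at most half of the weight, and by \<open>x <= 1\<close> every other forest weighs at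
  most 1.\<close>

lemma mZ_le_few_rooted:
 assumes G: "fgraph V en Ed" and x: "0 < x" "x <= 1"
 and m: "(SUM y:mforests V en Ed. rc (mroots V y) * x ^ card (mroots V y)) <= m * mZ V en Ed x"
 and k: "2 * m <= real k" "k > 0"
 shows "mZ V en Ed x <= 2 * rc (few_rooted V en Ed k)"
proof -
 let ?M = "mforests V en Ed" and ?c = "%y. card (mroots V y)"
 have fM: "finite ?M" using finite_mforests[OF G] .
 have split: "mZ V en Ed x = (SUM y:{y:?M. ?c y <= k}. x ^ ?c y) + (SUM y:{y:?M. ~ ?c y <= k}. x ^ ?c y)"
 unfolding mZ_def by (subst sum.union_disjoint[symmetric]) (use fM in \<open>auto intro!: sum.cong\<close>)
 have Z0: "mZ V en Ed x >= 0" unfolding mZ_def using x by (intro sum_nonneg) auto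
 have "real k * (SUM y:{y:?M. ~ ?c y <= k}. x ^ ?c y) <= (SUM y:{y:?M. ~ ?c y <= k}. real (?c y) * x ^ ?c y)"
 unfolding sum_distrib_left using x by (intro sum_mono mult_right_mono) auto
 also have "... <= (SUM y:?M. real (?c y) * x ^ ?c y)" using fM x by (intro sum_mono2) auto
 also have "... <= m * mZ V en Ed x" by (rule m)
 also have "... <= (real k / 2) * mZ V en Ed x" using k Z0 by (intro mult_right_mono) auto
 finally have "real k * (SUM y:{y:?M. ~ ?c y <= k}. x ^ ?c y) <= real k * (mZ V en Ed x / 2)" by simp
 hence "(SUM y:{y:?M. ~ ?c y <= k}. x ^ ?c y) <= mZ V en Ed x / 2" using k by simp
 moreover have "(SUM y:{y:?M. ?c y <= k}. x ^ ?c y) <= rc (few_rooted V en Ed k)"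
 proof -
 have "(SUM y:{y:?M. ?c y <= k}. x ^ ?c y) <= (SUM y:{y:?M. ?c y <= k}. 1)"
 using x by (intro sum_mono power_le_one) auto
 also have "... = rc {y:?M. ?c y <= k}" by simp
 also have "card {y:?M. ?c y <= k} <= card ((%(Z, y). rf_to_m V Z y) ` few_rooted V en Ed k)"
 proof (rule card_mono)
 have "finite (small_subsets V k)" using finite_small_subsets fgraph_finite[OF G] by blast
 thus "finite ((%(Z, y). rf_to_m V Z y) ` few_rooted V en Ed k)"
 unfolding few_rooted_def using finite_rf[OF G] by blast
 show "{y:?M. ?c y <= k} <= (%(Z, y). rf_to_m V Z y) ` few_rooted V en Ed k"
 proof
 fix y assume y: "y : {y:?M. ?c y <= k}"
 let ?y = "\<lambda>v\<in>V - mroots V y. the (y (Inl v))"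
 have "(mroots V y, ?y) : few_rooted V en Ed k"
 using mforests_to_rf(1)[OF G, of y] y by (auto simp: few_rooted_def small_subsets_def mroots_def)
 moreover have "y = (%(Z, y). rf_to_m V Z y) (mroots V y, ?y)"
 using mforests_to_rf(2)[OF G, of y] y by auto
 ultimately show "y : (%(Z, y). rf_to_m V Z y) ` few_rooted V en Ed k" by blast
 qed
 qed
 also have "... <= card (few_rooted V en Ed k)"
 proof (rule card_image_le)
 have "finite (small_subsets V k)" using finite_small_subsets fgraph_finite[OF G] by blast
 thus "finite (few_rooted V en Ed k)" unfolding few_rooted_def using finite_rf[OF G] by blast
 qed
 finally show ?thesis by simp
 qed
 ultimately show ?thesis using split by linarith
qed

subsection \<open>The generating function of rooted forests of a regular graph\<close>

lemma adj_op_bound: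
 assumes G: "fgraph V en Ed" and reg: "!!u. u : V ==> card (inc en Ed u) = d"
 and h: "!!u. u : V ==> \<bar>h u\<bar> <= B" and u: "u : V"
 shows "\<bar>(adj_op en Ed ^^ k) h u\<bar> <= real d ^ k * B"
 using u
proof (induction k arbitrary: u)
 case 0
 thus ?case using h by simp
next
 case (Suc k)
 have "\<bar>(adj_op en Ed ^^ Suc k) h u\<bar> <= (SUM epp:inc en Ed u. \<bar>(adj_op en Ed ^^ k) h (other (en epp) u)\<bar>)"
 by (simp add: adj_op_def)
 also have "... <= (SUM epp:inc en Ed u. real d ^ k * B)"
 using Suc.IH fgraph_inc(3)[OF G] by (intro sum_mono) auto
 also have "... = real d ^ Suc k * B" using reg[OF Suc.prems] by simp
 finally show ?case .
qed

lemma adj_op_cong: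
 assumes G: "fgraph V en Ed" and "!!u. u : V ==> h u = h' u" "u : V"
 shows "(adj_op en Ed ^^ k) h u = (adj_op en Ed ^^ k) h' u"
 using assms(3)
proof (induction k arbitrary: u)
 case (Suc k)
 thus ?case using fgraph_inc(3)[OF G] by (auto simp: adj_op_def intro!: sum.cong)
qed (use assms in auto)

lemma adj_op_linear:
 "(adj_op en Ed ^^ k) (%w. a * h w + b * h' w) u =
 a * (adj_op en Ed ^^ k) h u + b * (adj_op en Ed ^^ k) h' u"
proof (induction k arbitrary: u)
 case (Suc k)
 have "(adj_op en Ed ^^ Suc k) (%w. a * h w + b * h' w) u =
 adj_op en Ed (%u. a * (adj_op en Ed ^^ k) h u + b * (adj_op en Ed ^^ k) h' u) u"
 proof -
 have "(adj_op en Ed ^^ k) (%w. a * h w + b * h' w) =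
 (%u. a * (adj_op en Ed ^^ k) h u + b * (adj_op en Ed ^^ k) h' u)" by (rule ext) (rule Suc)
 thus ?thesis by simp
 qed
 also have "... = a * (adj_op en Ed ^^ Suc k) h u + b * (adj_op en Ed ^^ Suc k) h' u"
 by (simp add: adj_op_def[of en Ed _ u] sum.distrib sum_distrib_left)
 finally show ?case .
qed simp

lemma mZ_pos:
 assumes G: "fgraph V en Ed" and x: "x > 0"
 shows "mZ V en Ed x > 0"
proof -
 have "rf_to_m V V (%v. undefined) : mforests V en Ed"
 by (rule rf_to_m_mforests[OF G]) (auto simp: rf_def forests_def all_lead_def)
 thus ?thesis unfolding mZ_def using finite_mforests[OF G] x by (intro sum_pos) auto
qed

text \<open>Neumann series: iterating the resolvent equation \<open>K\<close> times leaves a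
  remainder of size at most \<open>(d / (d + x)) ^ K\<close>, because the \<open>h u\<close> are
  probabilities.\<close>

lemma mZr_diag_sums:
 assumes G: "fgraph V en Ed" and reg: "!!u. u : V ==> card (inc en Ed u) = d"
 and x: "x > 0" and v: "v : V"
 shows "(%k. x * (adj_op en Ed ^^ k) (%w. of_bool (w = v)) v / (real d + x) ^ Suc k)
 sums (mZr V en Ed x (Inl v) v / mZ V en Ed x)"
proof -
 let ?A = "adj_op en Ed" and ?dl = "%w. of_bool (w = v) :: real"
 have Z: "mZ V en Ed x > 0" using mZ_pos[OF G x] .
 have dx: "real d + x > 0" using x by simp
 define h where "h u = mZr V en Ed x (Inl u) v / mZ V en Ed x" for u
 have h01: "\<bar>h u\<bar> <= 1" for u
 proof -
 have "mZr V en Ed x (Inl u) v >= 0" unfolding mZr_def using x by (intro sum_nonneg) auto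
 moreover have "mZr V en Ed x (Inl u) v <= mZ V en Ed x" unfolding mZr_def mZ_def
 using x finite_mforests[OF G] by (intro sum_mono2) auto
 ultimately show ?thesis using Z by (simp add: h_def)
 qed
 have rec: "h u = x / (real d + x) * ?dl u + 1 / (real d + x) * ?A h u" if u: "u : V" for u
 proof -
 have "(real d + x) * h u = (SUM epp:inc en Ed u. h (other (en epp) u)) + x * ?dl u"
 using mZr_rec[OF G reg[OF u] u, of x v] Z unfolding h_def
 by (simp add: sum_divide_distrib[symmetric] field_simps)
 hence "(real d + x) * h u = ?A h u + x * ?dl u" by (simp only: adj_op_def)
 hence "h u = (?A h u + x * ?dl u) / (real d + x)" using dx by (simp add: eq_divide_eq mult.commute)
 thus ?thesis by (simp add: add_divide_distrib)
 qed
 have iter: "h v = (\<Sum>k<K. x * (?A ^^ k) ?dl v / (real d + x) ^ Suc k) + (?A ^^ K) h v / (real d + x) ^ K" for K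
 proof (induction K)
 case (Suc K)
 have "(?A ^^ K) h v = (?A ^^ K) (%u. x / (real d + x) * ?dl u + 1 / (real d + x) * ?A h u) v"
 by (rule adj_op_cong[OF G rec v])
 also have "... = x / (real d + x) * (?A ^^ K) ?dl v + 1 / (real d + x) * (?A ^^ K) (?A h) v"
 by (rule adj_op_linear)
 also have "(?A ^^ K) (?A h) v = (?A ^^ Suc K) h v" by (simp only: funpow_Suc_right o_apply)
 finally have "(?A ^^ K) h v / (real d + x) ^ K =
 x * (?A ^^ K) ?dl v / (real d + x) ^ Suc K + (?A ^^ Suc K) h v / (real d + x) ^ Suc K"
 by (simp add: add_divide_distrib)
 thus ?case using Suc by simp
 qed simp
 have lim: "(%K. (?A ^^ K) h v / (real d + x) ^ K) \<longlonglongrightarrow> 0"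
 proof (rule Lim_null_comparison[OF always_eventually])
 show "\<forall>K. norm ((?A ^^ K) h v / (real d + x) ^ K) <= (real d / (real d + x)) ^ K"
 proof
 fix K
 have "\<bar>(?A ^^ K) h v\<bar> <= real d ^ K * 1" by (rule adj_op_bound[OF G reg h01 v])
 thus "norm ((?A ^^ K) h v / (real d + x) ^ K) <= (real d / (real d + x)) ^ K"
 using dx by (simp add: power_divide abs_divide power_abs divide_right_mono)
 qed
 show "(%K. (real d / (real d + x)) ^ K) \<longlonglongrightarrow> 0"
 by (rule LIMSEQ_realpow_zero) (use x in auto)
 qed
 have "(%K. h v - (?A ^^ K) h v / (real d + x) ^ K) \<longlonglongrightarrow> h v - 0"
 by (intro tendsto_diff tendsto_const lim)
 moreover have "(\<Sum>k<K. x * (?A ^^ k) ?dl v / (real d + x) ^ Suc k) =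
 h v - (?A ^^ K) h v / (real d + x) ^ K" for K
 using iter[of K] by linarith
 ultimately have "(%K. \<Sum>k<K. x * (?A ^^ k) ?dl v / (real d + x) ^ Suc k) \<longlonglongrightarrow> h v"
 by simp
 thus ?thesis unfolding sums_def h_def .
qed

lemma mZ_roots_sums:
 assumes G: "fgraph V en Ed" and reg: "!!u. u : V ==> card (inc en Ed u) = d" and x: "x > 0"
 shows "(%k. x * closed_walks V en Ed k / (real d + x) ^ Suc k)
 sums ((SUM y:mforests V en Ed. rc (mroots V y) * x ^ card (mroots V y)) / mZ V en Ed x)"
proof -
 have "(%k. SUM v:V. x * (adj_op en Ed ^^ k) (%w. of_bool (w = v)) v / (real d + x) ^ Suc k)
 sums (SUM v:V. mZr V en Ed x (Inl v) v / mZ V en Ed x)"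
 by (rule sums_sum) (rule mZr_diag_sums[OF G reg x])
 thus ?thesis
 by (simp add: closed_walks_def sum_mZr_diag[OF G, symmetric] sum_divide_distrib sum_distrib_left)
qed

text \<open>Below: the forest in which all vertices are roots. Above: the product obtained by
  summing over all choice functions, cyclic ones included. Both fix the growth of \<open>mZ\<close>
  as \<open>x\<close> tends to infinity.\<close>

lemma mZ_bounds:
 assumes G: "fgraph V en Ed" and reg: "!!u. u : V ==> card (inc en Ed u) = d" and x: "x > 0"
 shows "x ^ card V <= mZ V en Ed x" "mZ V en Ed x <= (real d + x) ^ card V"
proof -
 have fV: "finite V" using fgraph_finite[OF G] by simp
 have "rf_to_m V V (%v. undefined) : mforests V en Ed"
 by (rule rf_to_m_mforests[OF G]) (auto simp: rf_def forests_def all_lead_def)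
 hence "x ^ card (mroots V (rf_to_m V V (%v. undefined) :: _ => 'b option)) <= mZ V en Ed x"
 unfolding mZ_def using finite_mforests[OF G] x by (intro member_le_sum) auto
 thus "x ^ card V <= mZ V en Ed x" by (simp add: rf_to_m_roots)
 have fC: "finite (mC en Ed w)" if "w : Inl ` V" for w using finite_inc[OF G] that by auto
 have "mZ V en Ed x <= (SUM y:PiE (Inl ` V) (mC en Ed). x ^ card (mroots V y))"
 unfolding mZ_def using x fV fC
 by (intro sum_mono2) (auto simp: mforests_def forests_def intro!: finite_PiE)
 also have "... = (SUM y:PiE (Inl ` V) (mC en Ed). \<Prod>w\<in>Inl ` V. mwt x w (y w))"
 by (simp add: mwt_prod[OF fV])
 also have "... = (\<Prod>w\<in>Inl ` V. SUM c:mC en Ed w. mwt x w c)"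
 by (rule prod_sum_PiE[symmetric]) (use fV fC in auto)
 also have "... = (\<Prod>v\<in>V. SUM c:mC en Ed (Inl v). mwt x (Inl v) c)"
 by (subst prod.reindex) auto
 also have "... = (\<Prod>v\<in>V. real d + x)"
 using finite_inc[OF G] reg by (intro prod.cong) (auto simp: sum.reindex)
 finally show "mZ V en Ed x <= (real d + x) ^ card V" by simp
qed

text \<open>The expansion of \<open>ln det (L + x)\<close> in closed walks, obtained by integration
  in \<open>x\<close>: \<open>x * Z' / Z\<close> is the mean number of roots, whose series is known,
  so the two sides differ by a constant, and this constant is 0 by the behaviour at
  infinity.\<close>

theorem ln_mZ_sums:
 assumes G: "fgraph V en Ed" and reg: "!!u. u : V ==> card (inc en Ed u) = d"
 and d: "d > 0" and x: "x > 0"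
 shows "(%k. closed_walks V en Ed (Suc k) / (real (Suc k) * (real d + x) ^ Suc k))
 sums (rc V * ln (real d + x) - ln (mZ V en Ed x))"
proof -
 let ?t = "closed_walks V en Ed" and ?N = "rc V" and ?Z = "mZ V en Ed" and ?d = "real d"
 have fV: "finite V" using fgraph_finite[OF G] by simp
 have t_bound: "\<bar>?t k\<bar> <= ?N * ?d ^ k" for k
 proof -
 have "\<bar>?t k\<bar> <= (SUM v:V. \<bar>(adj_op en Ed ^^ k) (%w. of_bool (w = v)) v\<bar>)"
 unfolding closed_walks_def by simp
 also have "... <= (SUM v:V. ?d ^ k * 1)"
 by (intro sum_mono adj_op_bound[OF G reg]) auto
 finally show ?thesis by simp
 qed
 have t0: "?t 0 = ?N" by (simp add: closed_walks_def)
 define c where "c k = (if k = 0 then 0 else ?t k / real k)" for k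
 have c_bound: "\<bar>c k\<bar> <= ?N * ?d ^ k" for k
 proof (cases "k = 0")
 case False
 hence "\<bar>?t k\<bar> / real k <= \<bar>?t k\<bar> / 1" by (intro divide_left_mono) auto
 thus ?thesis using t_bound[of k] False by (simp add: c_def)
 qed (simp add: c_def)
 have c_summable: "summable (%k. c k * w ^ k)" if w: "\<bar>w\<bar> < 1 / ?d" for w
 proof (rule summable_comparison_test'[of "%k. ?N * (?d * \<bar>w\<bar>) ^ k" 0])
 show "summable (%k. ?N * (?d * \<bar>w\<bar>) ^ k)"
 using w d by (intro summable_mult summable_geometric) (simp add: field_simps abs_mult)
 fix k :: nat
 have "\<bar>c k\<bar> * \<bar>w\<bar> ^ k <= (?N * ?d ^ k) * \<bar>w\<bar> ^ k" using c_bound by (intro mult_right_mono) auto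
 thus "norm (c k * w ^ k) <= ?N * (?d * \<bar>w\<bar>) ^ k"
 by (simp add: abs_mult power_abs power_mult_distrib mult.assoc)
 qed
 define S where "S w = (\<Sum>k. c k * w ^ k)" for w
 have S_deriv: "(S has_field_derivative (\<Sum>k. diffs c k * w ^ k)) (at w)" if w: "\<bar>w\<bar> < 1 / ?d" for w
 proof -
 obtain K where K: "\<bar>w\<bar> < K" "K < 1 / ?d" using dense[OF w] by blast
 show ?thesis unfolding S_def
 by (rule termdiffs_strong[of c K]) (use K c_summable[of K] in auto)
 qed
 have dif: "diffs c k = ?t (Suc k)" for k by (simp add: diffs_def c_def)
 define F where "F y = ln (?Z y) - ?N * ln (?d + y) + S (1 / (?d + y))" for y
 have F_deriv: "(F has_field_derivative 0) (at y)" if y: "y > 0" for y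
 proof -
 let ?w = "1 / (?d + y)"
 have dy: "?d + y > 0" using y by simp
 have w: "\<bar>?w\<bar> < 1 / ?d" using y d by (simp add: field_simps)
 have Zp: "?Z y > 0" using mZ_pos[OF G y] .
 define R where "R = (SUM z:mforests V en Ed. rc (mroots V z) * y ^ card (mroots V z))"
 have Zd: "(?Z has_field_derivative R / y) (at y)"
 proof -
 have "((%y. SUM z:mforests V en Ed. y ^ card (mroots V z)) has_field_derivative
 (SUM z:mforests V en Ed. rc (mroots V z) * y ^ (card (mroots V z) - 1))) (at y)"
 by (rule DERIV_sum) (auto intro!: derivative_eq_intros)
 also have "(SUM z:mforests V en Ed. rc (mroots V z) * y ^ (card (mroots V z) - 1)) = R / y"
 unfolding R_def sum_divide_distrib
 proof (rule sum.cong[OF refl])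
 fix z
 show "rc (mroots V z) * y ^ (card (mroots V z) - 1) =
 rc (mroots V z) * y ^ card (mroots V z) / y"
 using y by (cases "card (mroots V z)") auto
 qed
 finally show ?thesis unfolding mZ_def .
 qed
 have s: "(%k. y * ?t k / (?d + y) ^ Suc k) sums (R / ?Z y)"
 unfolding R_def by (rule mZ_roots_sums[OF G reg y])
 have "(%k. (1 / y) * (y * ?t k / (?d + y) ^ Suc k)) sums ((1 / y) * (R / ?Z y))"
 by (rule sums_mult[OF s])
 hence s1: "(%k. ?t k / (?d + y) ^ Suc k) sums (R / y / ?Z y)"
 using y by (simp add: mult.commute)
 hence "(%k. ?t (Suc k) / (?d + y) ^ Suc (Suc k)) sums (R / y / ?Z y - ?N / (?d + y))"
 using sums_Suc_iff[of "%k. ?t k / (?d + y) ^ Suc k"] t0 by (simp add: sums_Suc_iff)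
 hence "(%k. (?d + y)^2 * (?t (Suc k) / (?d + y) ^ Suc (Suc k))) sums
 ((?d + y)^2 * (R / y / ?Z y - ?N / (?d + y)))"
 by (rule sums_mult)
 moreover have "(?d + y)^2 * (?t (Suc k) / (?d + y) ^ Suc (Suc k)) = diffs c k * ?w ^ k" for k
 proof -
 have "(?d + y)^2 * (T / (?d + y) ^ Suc (Suc k)) = T * ?w ^ k" for T
 using dy by (simp add: power2_eq_square power_divide)
 thus ?thesis by (simp add: dif)
 qed
 ultimately have sd: "(\<Sum>k. diffs c k * ?w ^ k) = (?d + y)^2 * (R / y / ?Z y - ?N / (?d + y))"
 by (simp add: sums_iff)
 have wd: "((%y. 1 / (?d + y)) has_field_derivative - 1 / (?d + y)^2) (at y)"
 using dy by (auto intro!: derivative_eq_intros simp: power2_eq_square)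
 have "((%y. S (1 / (?d + y))) has_field_derivative (\<Sum>k. diffs c k * ?w ^ k) * (- 1 / (?d + y)^2)) (at y)"
 by (rule DERIV_chain2[OF S_deriv[OF w] wd])
 moreover have "((%y. ln (?Z y)) has_field_derivative (1 / ?Z y) * (R / y)) (at y)"
 by (rule DERIV_chain2[OF DERIV_ln_divide[OF Zp] Zd])
 moreover have "((%y. ?N * ln (?d + y)) has_field_derivative ?N / (?d + y)) (at y)"
 using dy by (auto intro!: derivative_eq_intros)
 ultimately have "(F has_field_derivative (1 / ?Z y) * (R / y) - ?N / (?d + y)
 + (\<Sum>k. diffs c k * ?w ^ k) * (- 1 / (?d + y)^2)) (at y)"
 unfolding F_def by (intro DERIV_add DERIV_diff)
 moreover have "(1 / ?Z y) * (R / y) - ?N / (?d + y) + (\<Sum>k. diffs c k * ?w ^ k) * (- 1 / (?d + y)^2) = 0"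
 unfolding sd using dy by (simp add: mult.commute)
 ultimately show ?thesis by simp
 qed
 have F_const: "F y = F x" if y: "y > x" for y
 proof -
 have "\<exists>z. x < z & z < y & F y - F x = (y - x) * 0"
 by (rule MVT2[OF y]) (use F_deriv x in auto)
 thus ?thesis by auto
 qed
 have F_lim: "(F \<longlongrightarrow> 0) at_top"
 proof -
 have S0: "S 0 = 0" unfolding S_def by (simp add: c_def)
 have "isCont S 0" by (rule DERIV_isCont[OF S_deriv]) (use d in auto)
 moreover have inv: "((%y. 1 / (?d + y)) \<longlongrightarrow> 0) at_top" by real_asymp
 ultimately have 1: "((%y. S (1 / (?d + y))) \<longlongrightarrow> S 0) at_top"
 by (rule isCont_tendsto_compose)
 have 2: "((%y. ln (?Z y) - ?N * ln (?d + y)) \<longlongrightarrow> 0) at_top"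
 proof (rule tendsto_sandwich)
 show "eventually (%y. ?N * ln (y / (?d + y)) <= ln (?Z y) - ?N * ln (?d + y)) at_top"
 using eventually_gt_at_top[of 0]
 proof eventually_elim
 case (elim y)
 have "ln (y ^ card V) <= ln (?Z y)"
 using mZ_bounds(1)[OF G reg elim] elim by (intro ln_mono) (auto simp: mZ_pos[OF G])
 thus ?case using elim d by (simp add: ln_div ln_realpow algebra_simps)
 qed
 show "eventually (%y. ln (?Z y) - ?N * ln (?d + y) <= 0) at_top"
 using eventually_gt_at_top[of 0]
 proof eventually_elim
 case (elim y)
 have "ln (?Z y) <= ln ((?d + y) ^ card V)"
 using mZ_bounds(2)[OF G reg elim] mZ_pos[OF G elim] by (intro ln_mono) auto
 thus ?case using elim d by (simp add: ln_realpow)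
 qed
 have "((%y. ln (y / (?d + y))) \<longlongrightarrow> 0) at_top" by real_asymp
 hence "((%y. ?N * ln (y / (?d + y))) \<longlongrightarrow> ?N * 0) at_top" by (intro tendsto_intros)
 thus "((%y. ?N * ln (y / (?d + y))) \<longlongrightarrow> 0) at_top" by simp
 qed auto
 show ?thesis unfolding F_def using tendsto_add[OF 2 1] S0 by simp
 qed
 have "eventually (%y. F y = F x) at_top"
 using eventually_gt_at_top[of x] by eventually_elim (rule F_const)
 hence "(F \<longlongrightarrow> F x) at_top" by (simp add: tendsto_eventually)
 hence "F x = 0" using F_lim tendsto_unique by (metis trivial_limit_at_top_linorder)
 hence "S (1 / (?d + x)) = ?N * ln (?d + x) - ln (?Z x)" unfolding F_def by simp
 moreover have "summable (%k. c k * (1 / (?d + x)) ^ k)"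
 by (rule c_summable) (use x d in \<open>simp add: field_simps\<close>)
 ultimately have "(%k. c k * (1 / (?d + x)) ^ k) sums (?N * ln (?d + x) - ln (?Z x))"
 unfolding S_def by (simp add: sums_iff)
 hence "(%k. c (Suc k) * (1 / (?d + x)) ^ Suc k) sums (?N * ln (?d + x) - ln (?Z x))"
 by (subst sums_Suc_iff) (simp add: c_def)
 thus ?thesis by (simp add: c_def power_divide field_simps)
qed

section \<open>The Hausdorff moment problem\<close>

text \<open>For the moments of a measure on the unit interval this is the integral of
  \<open>t ^ i * (1 - t) ^ j\<close>.\<close>

fun hdiff :: "(nat => real) => nat => nat => real" where
 "hdiff c i 0 = c i"
| "hdiff c i (Suc j) = hdiff c i j - hdiff c (Suc i) j"

text \<open>The shadow on moments of the identity \<open>1 = (t + (1 - t)) ^ p\<close>.\<close>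

lemma hdiff_expand:
 "hdiff c a b = (\<Sum>i\<le>p. real (p choose i) * hdiff c (a + i) (b + (p - i)))"
proof (induction p arbitrary: a b)
 case (Suc p)
 have "hdiff c a b = hdiff c a (Suc b) + hdiff c (Suc a) b" by simp
 also have "... = (\<Sum>i\<le>p. real (p choose i) * hdiff c (a + i) (Suc b + (p - i)))
 + (\<Sum>i\<le>p. real (p choose i) * hdiff c (Suc a + i) (b + (p - i)))"
 using Suc[of a "Suc b"] Suc[of "Suc a" b] by (simp only:)
 also have "(\<Sum>i\<le>p. real (p choose i) * hdiff c (a + i) (Suc b + (p - i))) =
 (\<Sum>i\<le>p. real (p choose i) * hdiff c (a + i) (b + (Suc p - i)))"
 by (intro sum.cong refl) (auto simp: Suc_diff_le)
 also have "... = (\<Sum>i\<le>Suc p. real (p choose i) * hdiff c (a + i) (b + (Suc p - i)))"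
 by simp
 also have "... = hdiff c a (b + Suc p) + (\<Sum>i\<le>p. real (p choose Suc i) * hdiff c (a + Suc i) (b + (p - i)))"
 by (subst sum.atMost_Suc_shift) simp
 finally have "hdiff c a b = hdiff c a (b + Suc p) +
 (\<Sum>i\<le>p. real (Suc p choose Suc i) * hdiff c (a + Suc i) (b + (p - i)))"
 by (simp add: sum.distrib[symmetric] algebra_simps)
 also have "... = (\<Sum>i\<le>Suc p. real (Suc p choose i) * hdiff c (a + i) (b + (Suc p - i)))"
 by (subst sum.atMost_Suc_shift) simp
 finally show ?case .
qed simp

text \<open>The weights at \<open>k / n\<close> are the would-be integrals of Bernstein polynomials.
  They reproduce the factorial moments \<open>(k choose j) / (n choose j)\<close> exactly, ordinary
  moments only in the limit.\<close>

lemma hausdorff_weights: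
 assumes "j <= n"
 shows "(\<Sum>k\<le>n. real (n choose k) * hdiff c k (n - k) * (real (k choose j) / real (n choose j))) = c j"
proof -
 have "(\<Sum>k\<le>n. real (n choose k) * hdiff c k (n - k) * (real (k choose j) / real (n choose j))) =
 (SUM k:{j..n}. real (n choose k) * hdiff c k (n - k) * (real (k choose j) / real (n choose j)))"
 by (intro sum.mono_neutral_right) (auto simp: binomial_eq_0)
 also have "... = (SUM k:{j..n}. real ((n - j) choose (k - j)) * hdiff c k (n - k))"
 proof (intro sum.cong refl)
 fix k assume k: "k : {j..n}"
 have "(n choose k) * (k choose j) = (n choose j) * ((n - j) choose (k - j))"
 using k by (intro choose_mult) auto
 hence "real (n choose k) * real (k choose j) = real (n choose j) * real ((n - j) choose (k - j))"
 by (metis of_nat_mult)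
 moreover have "real (n choose j) > 0" using assms by simp
 ultimately have "real (n choose k) * (real (k choose j) / real (n choose j)) = real ((n - j) choose (k - j))"
 by (simp add: field_simps)
 thus "real (n choose k) * hdiff c k (n - k) * (real (k choose j) / real (n choose j)) =
 real ((n - j) choose (k - j)) * hdiff c k (n - k)"
 by (metis mult.assoc mult.commute)
 qed
 also have "... = (SUM i:{0..n - j}. real ((n - j) choose i) * hdiff c (j + i) (n - j - i))"
 by (rule sum.reindex_bij_witness[of _ "%i. i + j" "%k. k - j"]) (use assms in auto)
 also have "... = (\<Sum>i\<le>n - j. real ((n - j) choose i) * hdiff c (j + i) (0 + ((n - j) - i)))"
 by (simp add: atLeast0AtMost)
 also have "... = hdiff c j 0" by (rule hdiff_expand[symmetric])
 finally show ?thesis by simp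
qed

text \<open>Products are compared factor by factor; \<open>2 * j < n\<close> keeps every denominator
  \<open>n - i\<close> above \<open>n / 2\<close>.\<close>

lemma choose_ratio_approx:
 assumes "k <= n" "2 * j < n"
 shows "\<bar>real (k choose j) / real (n choose j) - (real k / real n) ^ j\<bar> <= real j * (2 * real j / real n)"
proof -
 have ffact: "real (m choose j) = (\<Prod>i<j. real m - real i) / fact j" for m
 by (simp add: binomial_gbinomial gbinomial_prod_rev atLeast0LessThan)
 have n: "n > 0" using assms by simp
 have "real (k choose j) / real (n choose j) = (\<Prod>i<j. (real k - real i) / (real n - real i))"
 unfolding ffact by (simp add: prod_dividef)
 moreover have "(real k / real n) ^ j = (\<Prod>i<j. real k / real n)" by simp
 ultimately have "\<bar>real (k choose j) / real (n choose j) - (real k / real n) ^ j\<bar> =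
 norm ((\<Prod>i<j. (real k - real i) / (real n - real i)) - (\<Prod>i<j. real k / real n))" by simp
 also have "... <= (\<Sum>i<j. norm ((real k - real i) / (real n - real i) - real k / real n))"
 proof (rule norm_prod_diff)
 fix i assume i: "i : {..<j}"
 hence "\<bar>real k - real i\<bar> <= real n - real i" using assms by auto
 thus "norm ((real k - real i) / (real n - real i)) <= 1" by (auto simp: abs_divide divide_le_eq)
 show "norm (real k / real n) <= 1" using assms by simp
 qed
 also have "... <= (\<Sum>i<j. 2 * real j / real n)"
 proof (intro sum_mono)
 fix i assume i: "i : {..<j}"
 have ni: "real n - real i >= real n / 2" "real n - real i > 0" using i assms by auto
 have "(real k - real i) / (real n - real i) - real k / real n =
 - (real i * (real n - real k) / (real n * (real n - real i)))"
 using ni n by (simp add: field_simps)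
 hence "norm ((real k - real i) / (real n - real i) - real k / real n) =
 real i * (real n - real k) / (real n * (real n - real i))"
 using ni n assms by simp
 also have "... <= real j * real n / (real n * (real n / 2))"
 using ni n assms i by (intro frac_le mult_mono) auto
 also have "... = 2 * real j / real n" using n by simp
 finally show "norm ((real k - real i) / (real n - real i) - real k / real n) <= 2 * real j / real n" .
 qed
 finally show ?thesis by simp
qed

text \<open>The Bernstein weights define probability measures on the unit interval. They are tight,
  and every weak subsequential limit has the moments \<open>c\<close>, because factorial and
  ordinary moments differ by \<open>O(1 / n)\<close>.\<close>

theorem hausdorff_moments:
 fixes c :: "nat => real"
 assumes c0: "c 0 = 1" and pos: "!!i j. hdiff c i j >= 0"
 obtains M where "real_distribution M" "AE t in M. t : {0..1}" "!!k. integral\<^sup>L M (%t. t ^ k) = c k"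
proof -
 define w where "w n k = (if k <= n then real (n choose k) * hdiff c k (n - k) else 0)" for n k
 have w0: "w n k >= 0" for n k using pos by (simp add: w_def)
 have wsum: "(\<Sum>k\<le>n. w n k * (real (k choose j) / real (n choose j))) = c j" if "j <= n" for n j
 using hausdorff_weights[OF that, of c] by (simp add: w_def)
 have w1: "(\<Sum>k\<le>n. w n k) = 1" for n using wsum[of 0 n] c0 by simp
 define P where "P n = embed_pmf (w n)" for n
 have nn: "(\<integral>\<^sup>+ k. ennreal (w n k) \<partial>count_space UNIV) = 1" for n
 proof -
 have "(\<integral>\<^sup>+ k. ennreal (w n k) \<partial>count_space UNIV) = (\<Sum>k\<le>n. ennreal (w n k))"
 by (rule nn_integral_count_space') (auto simp: w_def)
 also have "... = ennreal (\<Sum>k\<le>n. w n k)" using w0 by simp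
 finally show ?thesis using w1 by simp
 qed
 have pmfP: "pmf (P n) k = w n k" for n k
 unfolding P_def by (rule pmf_embed_pmf) (use w0 nn in auto)
 define nuu where "nuu n = distr (measure_pmf (P n)) borel (%k. real k / real n)" for n
 have rd: "real_distribution (nuu n)" for n
 unfolding nuu_def by (intro prob_space.real_distribution_distr[OF prob_space_measure_pmf]) auto
 have setP: "k <= n" if "k : set_pmf (P n)" for k n
 using that by (auto simp: set_pmf_iff pmfP w_def split: if_splits)
 have int: "integral\<^sup>L (nuu n) g = (\<Sum>k\<le>n. g (real k / real n) * w n k)"
 if "g : borel_measurable borel" for g :: "real => real" and n
 proof -
 have "integral\<^sup>L (nuu n) g = integral\<^sup>L (measure_pmf (P n)) (%k. g (real k / real n))"
 unfolding nuu_def by (rule integral_distr) (use that in auto)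
 also have "... = (SUM k:{..n}. g (real k / real n) * pmf (P n) k)"
 by (rule integral_measure_pmf_real) (use setP in auto)
 finally show ?thesis by (simp add: pmfP)
 qed
 \<comment> \<open>Tightness speaks of half-open intervals \<open>{a<..b}\<close>, and the point 0
   may carry mass; hence the left end \<open>-1\<close>.\<close>
 have supp: "measure (nuu n) {-1<..1} = 1" for n
 proof -
 interpret real_distribution "nuu n" by (rule rd)
 have "AE k in measure_pmf (P n). real k / real n : {-1<..1}"
 proof (rule AE_pmfI)
 fix k assume "k : set_pmf (P n)"
 hence "k <= n" using setP by simp
 hence "0 <= real k / real n" "real k / real n <= 1" by (auto simp: divide_le_eq)
 moreover from this(1) have "-1 < real k / real n" by linarith
 ultimately show "real k / real n : {-1<..1}" by (simp del: zero_le_divide_iff)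
 qed
 hence "AE t in nuu n. t : {-1<..1}" unfolding nuu_def by (subst AE_distr_iff) auto
 thus ?thesis by (intro prob_eq_1[THEN iffD2]) auto
 qed
 have "tight nuu" unfolding tight_def
 proof (intro conjI allI impI rd)
 fix epp :: real assume "epp > 0"
 thus "\<exists>a b. a < b & (\<forall>n. 1 - epp < measure (nuu n) {a<..b})"
 using supp by (intro exI[of _ "-1"] exI[of _ 1]) auto
 qed
 from tight_imp_convergent_subsubsequence[OF this strict_mono_id] obtain r M where
 r: "strict_mono (r :: nat => nat)" and M: "real_distribution M" and wc: "weak_conv_m (nuu \<circ> id \<circ> r) M"
 by blast
 interpret M: real_distribution M by (rule M)
 \<comment> \<open>Clamping to the unit interval turns the powers into bounded continuous functions,
   which weak convergence can test.\<close>
 define cl where "cl t = max 0 (min 1 t)" for t :: real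
 have cl01: "0 <= cl t" "cl t <= 1" for t by (auto simp: cl_def)
 have conv: "(%n. integral\<^sup>L (nuu (r n)) g) \<longlonglongrightarrow> integral\<^sup>L M g"
 if "!!x. isCont g x" "!!x. norm (g x) <= 1" for g :: "real => real"
 using weak_conv_imp_integral_bdd_continuous_conv[OF _ M wc that] rd by simp
 have clc: "isCont cl x" for x unfolding cl_def by (intro continuous_intros)
 have AE01: "AE t in M. t : {0..1}"
 proof -
 \<comment> \<open>The truncated distance to the unit interval: its integral is 0 for all
   approximants, hence for the limit.\<close>
 define g where "g t = min 1 \<bar>t - cl t\<bar>" for t
 have gc: "isCont g x" for x unfolding g_def by (intro continuous_intros clc)
 have gb: "norm (g x) <= 1" for x by (auto simp: g_def)
 have gm: "g : borel_measurable borel" using gc by (intro borel_measurable_continuous_onI continuous_at_imp_continuous_on) auto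
 have "integral\<^sup>L (nuu n) g = 0" for n unfolding int[OF gm]
 proof (intro sum.neutral ballI)
 fix k assume "k : {..n}"
 hence "0 <= real k / real n" "real k / real n <= 1" by (auto simp: divide_le_eq)
 thus "g (real k / real n) * w n k = 0" by (simp add: g_def cl_def)
 qed
 hence "integral\<^sup>L M g = 0" using conv[OF gc gb] by (simp add: LIMSEQ_const_iff)
 moreover have "integrable M g"
 by (rule M.integrable_const_bound[of _ 1]) (use gb gm in auto)
 ultimately have "AE t in M. g t = 0"
 by (subst (asm) integral_nonneg_eq_0_iff_AE) (auto simp: g_def)
 thus ?thesis by eventually_elim (auto simp: g_def cl_def min_def max_def split: if_splits)
 qed
 have mom: "integral\<^sup>L M (%t. t ^ j) = c j" for j
 proof -
 define g where "g t = cl t ^ j" for t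
 have gc: "isCont g x" for x unfolding g_def by (intro continuous_intros clc)
 have gb: "norm (g x) <= 1" for x using cl01[of x] by (auto simp: g_def power_le_one)
 have gm: "g : borel_measurable borel" using gc by (intro borel_measurable_continuous_onI continuous_at_imp_continuous_on) auto
 have close: "\<bar>integral\<^sup>L (nuu n) g - c j\<bar> <= real j * (2 * real j / real n)" if n: "2 * j < n" for n
 proof -
 have "integral\<^sup>L (nuu n) g - c j = (\<Sum>k\<le>n. (real k / real n) ^ j * w n k)
 - (\<Sum>k\<le>n. w n k * (real (k choose j) / real (n choose j)))"
 proof -
 have "cl (real k / real n) = real k / real n" if "k <= n" for k
 using that n by (auto simp: cl_def)
 hence "(\<Sum>k\<le>n. g (real k / real n) * w n k) = (\<Sum>k\<le>n. (real k / real n) ^ j * w n k)"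
 by (intro sum.cong) (auto simp: g_def)
 thus ?thesis using int[OF gm, of n] wsum[of j n] n by simp
 qed
 also have "... = (\<Sum>k\<le>n. ((real k / real n) ^ j - real (k choose j) / real (n choose j)) * w n k)"
 by (simp add: sum_subtractf algebra_simps)
 also have "\<bar>...\<bar> <= (\<Sum>k\<le>n. \<bar>((real k / real n) ^ j - real (k choose j) / real (n choose j)) * w n k\<bar>)"
 by (rule sum_abs)
 also have "... <= (\<Sum>k\<le>n. real j * (2 * real j / real n) * w n k)"
 proof (intro sum_mono)
 fix k assume "k : {..n}"
 hence "\<bar>real (k choose j) / real (n choose j) - (real k / real n) ^ j\<bar> <= real j * (2 * real j / real n)"
 using n by (intro choose_ratio_approx) auto
 thus "\<bar>((real k / real n) ^ j - real (k choose j) / real (n choose j)) * w n k\<bar>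
 <= real j * (2 * real j / real n) * w n k"
 unfolding abs_mult using w0[of n k] by (intro mult_mono) (auto simp: abs_minus_commute)
 qed
 also have "... = real j * (2 * real j / real n)" by (simp only: sum_distrib_left[symmetric] w1 mult_1_right)
 finally show ?thesis .
 qed
 have "(%n. integral\<^sup>L (nuu n) g - c j) \<longlonglongrightarrow> 0"
 proof (rule Lim_null_comparison)
 show "evs (%n. norm (integral\<^sup>L (nuu n) g - c j) <= real j * (2 * real j / real n))"
 using eventually_gt_at_top[of "2 * j"] by eventually_elim (use close in auto)
 show "(%n. real j * (2 * real j / real n)) \<longlonglongrightarrow> 0" by real_asymp
 qed
 hence "(%n. integral\<^sup>L (nuu n) g) \<longlonglongrightarrow> c j" by (simp add: LIM_zero_iff)
 from LIMSEQ_subseq_LIMSEQ[OF this r] have "(%n. integral\<^sup>L (nuu (r n)) g) \<longlonglongrightarrow> c j" by (simp add: o_def)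
 hence "integral\<^sup>L M g = c j" using conv[OF gc gb] LIMSEQ_unique by blast
 moreover have "integral\<^sup>L M g = integral\<^sup>L M (%t. t ^ j)"
 by (rule integral_cong_AE) (use AE01 gm in \<open>auto simp: g_def cl_def\<close>)
 ultimately show ?thesis by simp
 qed
 show ?thesis by (rule that[OF M AE01 mom])
qed

text \<open>Bounded support makes the Taylor remainder of each characteristic function at most
  \<open>2 * (|t| * B) ^ n / n!\<close>, so equal moments give equal characteristic
  functions.\<close>

theorem bounded_moments_unique:
 fixes B :: real
 assumes M: "real_distribution M" "real_distribution M'"
 and supp: "AE t in M. \<bar>t\<bar> <= B" "AE t in M'. \<bar>t\<bar> <= B"
 and mom: "!!k. integral\<^sup>L M (%t. t ^ k) = integral\<^sup>L M' (%t. t ^ k)"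
 shows "M = M'"
proof (rule Levy_uniqueness[OF M])
 have B: "B >= 0"
 proof -
 interpret real_distribution M by (rule M)
 have "\<exists>t. \<bar>t\<bar> <= B"
 proof (rule ccontr)
 assume "~ (\<exists>t. \<bar>t\<bar> <= B)"
 hence "AE t in M. False" using supp(1) by auto
 thus False by simp
 qed
 thus ?thesis by auto
 qed
 have bnd: "integrable N (%x. x ^ k) & integral\<^sup>L N (%x. \<bar>x\<bar> ^ k) <= B ^ k"
 if N: "real_distribution N" and s: "AE t in N. \<bar>t\<bar> <= B" for N k
 proof -
 interpret N: real_distribution N by (rule N)
 have ae: "AE t in N. \<bar>t\<bar> ^ k <= B ^ k" using s by eventually_elim (auto intro: power_mono)
 have i: "integrable N (%x. x ^ k)"
 by (rule N.integrable_const_bound[of _ "B ^ k"]) (use ae in \<open>auto simp: power_abs\<close>)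
 have i': "integrable N (%x. \<bar>x\<bar> ^ k)" using integrable_abs[OF i] by (simp add: power_abs)
 have "integral\<^sup>L N (%x. \<bar>x\<bar> ^ k) <= integral\<^sup>L N (%x. B ^ k)"
 by (rule integral_mono_AE[OF i' _ ae]) auto
 thus ?thesis using i N.prob_space by simp
 qed
 show "char M = char M'"
 proof
 fix t
 have le: "cmod (char M t - char M' t) <= 4 * (\<bar>t\<bar> * B) ^ n / fact n" for n
 proof -
 have app: "cmod (char N t - (\<Sum>k\<le>n. ((\<i> * t)^k / fact k) * integral\<^sup>L N (%x. x^k)))
 <= 2 * (\<bar>t\<bar> * B) ^ n / fact n" if N: "real_distribution N" and s: "AE t in N. \<bar>t\<bar> <= B" for N
 proof -
 have "cmod (char N t - (\<Sum>k\<le>n. ((\<i> * t)^k / fact k) * integral\<^sup>L N (%x. x^k)))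
 <= (2*\<bar>t\<bar>^n / fact n) * integral\<^sup>L N (%x. \<bar>x\<bar>^n)"
 by (rule real_distribution.char_approx1[OF N]) (use bnd[OF N s] in auto)
 also have "... <= (2*\<bar>t\<bar>^n / fact n) * B ^ n"
 using bnd[OF N s, of n] by (intro mult_left_mono) auto
 finally show ?thesis by (simp add: power_mult_distrib)
 qed
 let ?s = "\<Sum>k\<le>n. ((\<i> * t)^k / fact k) * integral\<^sup>L M' (%x. x^k)"
 have "cmod (char M t - char M' t) <= cmod (char M t - ?s) + cmod (char M' t - ?s)"
 using norm_triangle_ineq4[of "char M t - ?s" "char M' t - ?s"] by simp
 thus ?thesis
 using app[OF M(1) supp(1)] app[OF M(2) supp(2)] unfolding mom by simp
 qed
 have "(%n. inverse (fact n) * (\<bar>t\<bar> * B) ^ n) \<longlonglongrightarrow> 0"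
 by (rule summable_LIMSEQ_zero[OF summable_exp])
 hence "(%n. 4 * ((\<bar>t\<bar> * B) ^ n / fact n)) \<longlonglongrightarrow> 4 * 0"
 by (intro tendsto_mult tendsto_const) (simp add: divide_inverse mult.commute)
 hence "cmod (char M t - char M' t) <= 0"
 using le by (intro LIMSEQ_le_const) auto
 thus "char M t = char M' t" by simp
 qed
qed

section \<open>Logarithmic integrals\<close>

lemma alternating_sum_bounds:
 fixes b :: "nat => real"
 assumes "!!k. 0 <= b k" "!!k. b (Suc k) <= b k"
 shows "0 <= (\<Sum>k<K. (-1) ^ k * b k) & (\<Sum>k<K. (-1) ^ k * b k) <= b 0"
 using assms
proof (induction K arbitrary: b)
 case (Suc K)
 have "(\<Sum>k<Suc K. (-1) ^ k * b k) = b 0 - (\<Sum>k<K. (-1) ^ k * b (Suc k))"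
 by (subst sum.lessThan_Suc_shift) (simp add: sum_negf)
 moreover have "0 <= (\<Sum>k<K. (-1) ^ k * b (Suc k)) & (\<Sum>k<K. (-1) ^ k * b (Suc k)) <= b (Suc 0)"
 by (rule Suc.IH) (use Suc.prems in auto)
 ultimately show ?case using Suc.prems(2)[of 0] by linarith
qed simp

text \<open>The endpoint \<open>r = -1\<close> is included because the spectrum may reach
  \<open>t = 2 * d\<close>. The bound on partial sums, uniform in \<open>K\<close>, provides the
  dominating function for interchanging series and integral; for negative \<open>r\<close> the
  series alternates.\<close>

lemma log_series_bound:
 assumes r: "-1 <= r" "r < (1::real)"
 shows "(%k. r ^ Suc k / real (Suc k)) sums (- ln (1 - r))"
 "\<bar>\<Sum>k<K. r ^ Suc k / real (Suc k)\<bar> <= 1 + \<bar>ln (1 - r)\<bar>"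
proof -
 show S: "(%k. r ^ Suc k / real (Suc k)) sums (- ln (1 - r))"
 proof (cases "r = -1")
 case True
 have "(%k. - ((-1) ^ k / real (Suc k))) sums (- ln 2)"
 by (intro sums_minus alternating_harmonic_series_sums)
 thus ?thesis using True by simp
 next
 case False
 hence "\<bar>- r\<bar> < 1" using r by auto
 from ln_series'[OF this] have "(%n. - (r ^ n) / real n) sums ln (1 - r)" by simp
 from sums_minus[OF this] have "(%n. r ^ n / real n) sums (- ln (1 - r))" by simp
 thus ?thesis by (subst sums_Suc_iff) simp
 qed
 show "\<bar>\<Sum>k<K. r ^ Suc k / real (Suc k)\<bar> <= 1 + \<bar>ln (1 - r)\<bar>"
 proof (cases "r >= 0")
 case True
 have "(\<Sum>k<K. r ^ Suc k / real (Suc k)) <= - ln (1 - r)"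
 using sum_le_suminf[of "%k. r ^ Suc k / real (Suc k)" "{..<K}"] S True
 by (simp add: sums_iff)
 moreover have "0 <= (\<Sum>k<K. r ^ Suc k / real (Suc k))" using True by (intro sum_nonneg) auto
 ultimately show ?thesis by linarith
 next
 case False
 define b where "b k = (- r) ^ Suc k / real (Suc k)" for k
 have b0: "0 <= b k" for k
 unfolding b_def using False by (intro divide_nonneg_nonneg zero_le_power) auto
 have bS: "b (Suc k) <= b k" for k
 unfolding b_def using False r by (intro frac_le zero_le_power power_decreasing) auto
 have "r ^ Suc k / real (Suc k) = - ((-1) ^ k * b k)" for k
 by (simp add: b_def power_minus[of r])
 hence "(\<Sum>k<K. r ^ Suc k / real (Suc k)) = - (\<Sum>k<K. (-1) ^ k * b k)"
 by (simp add: sum_negf)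
 moreover have "b 0 <= 1" using r by (simp add: b_def)
 ultimately show ?thesis using alternating_sum_bounds[of b K] b0 bS by auto
 qed
qed

locale bounded_distribution = real_distribution M for M :: "real measure" +
 fixes d :: real
 assumes d: "d > 0" and supp: "AE t in M. 0 <= t & t <= 2 * d"
begin

lemma integrable_bounded:
 assumes "g : borel_measurable borel" "!!t. 0 <= t ==> t <= 2 * d ==> \<bar>g t\<bar> <= B"
 shows "integrable M (g :: real => real)"
proof (rule integrable_const_bound[of _ B])
 show "AE t in M. norm (g t) <= B" using supp by eventually_elim (use assms in auto)
qed (use assms in auto)

lemma ratio_bound:
 assumes "x > 0" "0 <= t" "t <= 2 * d"
 shows "\<bar>(d - t) / (d + x)\<bar> <= d / (d + x)" "d / (d + x) < 1"
 using assms d by (auto simp: abs_divide divide_right_mono)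

text \<open>Write \<open>t + x = (d + x) * (1 - r)\<close> with \<open>r = (d - t) / (d + x)\<close>
  and expand the logarithm in powers of \<open>r\<close>.\<close>

lemma log_shift_sums:
 assumes x: "x > 0"
 shows "(%k. integral\<^sup>L M (%t. (d - t) ^ Suc k) / (real (Suc k) * (d + x) ^ Suc k))
 sums (ln (d + x) - integral\<^sup>L M (%t. ln (t + x)))"
 "integrable M (%t. ln (t + x))"
proof -
 define q where "q = d / (d + x)"
 have q: "0 <= q" "q < 1" using x d by (auto simp: q_def)
 have rb: "\<bar>(d - t) / (d + x)\<bar> <= q" if "0 <= t" "t <= 2 * d" for t
 using ratio_bound(1)[OF x that] by (simp add: q_def)
 show int: "integrable M (%t. ln (t + x))"
 proof (rule integrable_bounded[of _ "\<bar>ln x\<bar> + \<bar>ln (2 * d + x)\<bar>"])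
 fix t assume t: "0 <= t" "t <= 2 * d"
 have "ln x <= ln (t + x)" "ln (t + x) <= ln (2 * d + x)" using t x by auto
 thus "\<bar>ln (t + x)\<bar> <= \<bar>ln x\<bar> + \<bar>ln (2 * d + x)\<bar>" by linarith
 qed auto
 let ?S = "%K t. \<Sum>k<K. ((d - t) / (d + x)) ^ Suc k / real (Suc k)"
 have intk: "integrable M (%t. ((d - t) / (d + x)) ^ Suc k / real (Suc k))" for k
 proof (rule integrable_bounded[of _ 1])
 fix t assume t: "0 <= t" "t <= 2 * d"
 have "\<bar>(d - t) / (d + x)\<bar> <= 1" using rb[OF t] q by linarith
 hence "\<bar>(d - t) / (d + x)\<bar> ^ Suc k <= 1" by (intro power_le_one) auto
 hence "\<bar>(d - t) / (d + x)\<bar> ^ Suc k / real (Suc k) <= 1"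
 by (subst divide_le_eq_1) auto
 thus "\<bar>((d - t) / (d + x)) ^ Suc k / real (Suc k)\<bar> <= 1"
 by (simp only: abs_divide power_abs abs_of_nat)
 qed measurable
 have "(%K. integral\<^sup>L M (?S K)) \<longlonglongrightarrow> integral\<^sup>L M (%t. ln (d + x) - ln (t + x))"
 proof (rule integral_dominated_convergence[where w = "%t. 1 + \<bar>ln (d + x)\<bar> + \<bar>ln (t + x)\<bar>"])
 show "AE t in M. (%K. ?S K t) \<longlonglongrightarrow> ln (d + x) - ln (t + x)"
 using supp
 proof eventually_elim
 case (elim t)
 have r: "-1 <= (d - t) / (d + x)" "(d - t) / (d + x) < 1" using rb[OF conjunct1[OF elim] conjunct2[OF elim]] q by linarith+
 have "1 - (d - t) / (d + x) = (t + x) / (d + x)" using d x by (simp add: field_simps)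
 hence "ln (1 - (d - t) / (d + x)) = ln (t + x) - ln (d + x)" using elim d x by (simp add: ln_div)
 thus ?case using log_series_bound(1)[OF r] by (simp add: sums_def)
 qed
 show "AE t in M. norm (?S K t) <= 1 + \<bar>ln (d + x)\<bar> + \<bar>ln (t + x)\<bar>" for K
 using supp
 proof eventually_elim
 case (elim t)
 have r: "-1 <= (d - t) / (d + x)" "(d - t) / (d + x) < 1" using rb[OF conjunct1[OF elim] conjunct2[OF elim]] q by linarith+
 have "1 - (d - t) / (d + x) = (t + x) / (d + x)" using d x by (simp add: field_simps)
 hence "ln (1 - (d - t) / (d + x)) = ln (t + x) - ln (d + x)" using elim d x by (simp add: ln_div)
 thus ?case using log_series_bound(2)[OF r, of K] unfolding real_norm_def by linarith
 qed
 show "integrable M (%t. 1 + \<bar>ln (d + x)\<bar> + \<bar>ln (t + x)\<bar>)" using int by auto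
 qed auto
 moreover have "integral\<^sup>L M (?S K) = (\<Sum>k<K. integral\<^sup>L M (%t. (d - t) ^ Suc k) / (real (Suc k) * (d + x) ^ Suc k))" for K
 by (subst Bochner_Integration.integral_sum[OF intk])
 (simp add: power_divide mult.commute del: power_Suc of_nat_Suc)
 ultimately show "(%k. integral\<^sup>L M (%t. (d - t) ^ Suc k) / (real (Suc k) * (d + x) ^ Suc k))
 sums (ln (d + x) - integral\<^sup>L M (%t. ln (t + x)))"
 using int prob_space by (simp add: sums_def)
qed

lemma resolvent_sums:
 assumes x: "x > 0"
 shows "(%k. x * integral\<^sup>L M (%t. (d - t) ^ k) / (d + x) ^ Suc k)
 sums integral\<^sup>L M (%t. x / (t + x))"
proof -
 define q where "q = d / (d + x)"
 have q: "0 <= q" "q < 1" using x d by (auto simp: q_def)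
 have rb: "\<bar>(d - t) / (d + x)\<bar> <= q" if "0 <= t" "t <= 2 * d" for t
 using ratio_bound(1)[OF x that] by (simp add: q_def)
 let ?S = "%K t. \<Sum>k<K. x / (d + x) * ((d - t) / (d + x)) ^ k"
 have intk: "integrable M (%t. x / (d + x) * ((d - t) / (d + x)) ^ k)" for k
 proof (rule integrable_mult_right, rule integrable_bounded[of _ 1])
 fix t assume t: "0 <= t" "t <= 2 * d"
 have "\<bar>(d - t) / (d + x)\<bar> <= 1" using rb[OF t] q by linarith
 thus "\<bar>((d - t) / (d + x)) ^ k\<bar> <= 1" unfolding power_abs by (intro power_le_one) auto
 qed measurable
 have "(%K. integral\<^sup>L M (?S K)) \<longlonglongrightarrow> integral\<^sup>L M (%t. x / (t + x))"
 proof (rule integral_dominated_convergence[where w = "%t. x / (d + x) * (1 / (1 - q))"])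
 show "AE t in M. (%K. ?S K t) \<longlonglongrightarrow> x / (t + x)"
 using supp
 proof eventually_elim
 case (elim t)
 have "norm ((d - t) / (d + x)) < 1" using rb[of t] elim q by auto
 from sums_mult[OF geometric_sums[OF this], of "x / (d + x)"]
 have lim: "(%K. ?S K t) \<longlonglongrightarrow> x / (d + x) * (1 / (1 - (d - t) / (d + x)))" unfolding sums_def .
 have "1 - (d - t) / (d + x) = (t + x) / (d + x)" using d x by (simp add: field_simps)
 hence "x / (d + x) * (1 / (1 - (d - t) / (d + x))) = x / (t + x)" using d x by simp
 with lim show ?case by (simp only:)
 qed
 show "AE t in M. norm (?S K t) <= x / (d + x) * (1 / (1 - q))" for K
 using supp
 proof eventually_elim
 case (elim t)
 have "norm (?S K t) <= (\<Sum>k<K. norm (x / (d + x) * ((d - t) / (d + x)) ^ k))" by (rule norm_sum)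
 also have "... <= (\<Sum>k<K. x / (d + x) * q ^ k)"
 proof (intro sum_mono)
 fix k
 have "\<bar>(d - t) / (d + x)\<bar> ^ k <= q ^ k" by (intro power_mono) (use rb[of t] elim in auto)
 thus "norm (x / (d + x) * ((d - t) / (d + x)) ^ k) <= x / (d + x) * q ^ k"
 unfolding real_norm_def abs_mult power_abs using x d by (intro mult_mono) auto
 qed
 also have "... = x / (d + x) * (\<Sum>k<K. q ^ k)" by (simp add: sum_distrib_left)
 also have "... <= x / (d + x) * (1 / (1 - q))"
 proof (rule mult_left_mono)
 have "norm q < 1" using q by simp
 from geometric_sums[OF this] have "summable (%k. q ^ k)" "suminf (%k. q ^ k) = 1 / (1 - q)"
 by (auto simp: sums_iff)
 thus "(\<Sum>k<K. q ^ k) <= 1 / (1 - q)" using sum_le_suminf[of "%k. q ^ k" "{..<K}"] q by simp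
 qed (use x d in auto)
 finally show ?case .
 qed
 qed auto
 moreover have "integral\<^sup>L M (?S K) = (\<Sum>k<K. x * integral\<^sup>L M (%t. (d - t) ^ k) / (d + x) ^ Suc k)" for K
 by (subst Bochner_Integration.integral_sum[OF intk]) (simp add: power_divide)
 ultimately show ?thesis by (simp add: sums_def)
qed

definition "xs n = 1 / real (Suc n)" for n

lemma xs: "0 < xs n" "xs n <= 1" by (auto simp: xs_def)

context
 assumes Lam: "!!x. 0 < x ==> x <= 1 ==> integral\<^sup>L M (%t. ln (t + x)) >= 0"
begin

text \<open>Mass \<open>p > 0\<close> at 0 would bound the integral of \<open>ln (t + x)\<close> by
  \<open>p * ln x\<close> plus a constant, which is negative for small \<open>x\<close>. The
  assumption \<open>Lam\<close> will come from the existence of spanning trees in the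
  quotients.\<close>

lemma AE_pos: "AE t in M. 0 < t"
proof -
 define p where "p = measure M {..0}"
 have "p = 0"
 proof (rule ccontr)
 assume "p ~= 0"
 hence p: "p > 0" by (simp add: p_def zero_less_measure_iff less_le)
 have le: "0 <= p * ln (xs n) + \<bar>ln (2 * d + 1)\<bar>" for n
 proof -
 have "0 <= integral\<^sup>L M (%t. ln (t + xs n))" using Lam xs by blast
 also have "... <= integral\<^sup>L M (%t. indicator {..0} t * ln (xs n) + \<bar>ln (2 * d + 1)\<bar>)"
 proof (rule integral_mono_AE[OF log_shift_sums(2)[OF xs(1)]])
 show "AE t in M. ln (t + xs n) <= indicator {..0} t * ln (xs n) + \<bar>ln (2 * d + 1)\<bar>"
 using supp
 proof eventually_elim
 case (elim t)
 show ?case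
 proof (cases "t <= 0")
 case True
 thus ?thesis using elim by simp
 next
 case False
 have "ln (t + xs n) <= ln (2 * d + 1)" using False elim xs[of n] by (intro ln_mono) auto
 thus ?thesis using False by simp
 qed
 qed
 show "integrable M (%t. indicator {..0} t * ln (xs n) + \<bar>ln (2 * d + 1)\<bar>)"
 proof (rule integrable_bounded[of _ "\<bar>ln (xs n)\<bar> + \<bar>ln (2 * d + 1)\<bar>"])
 fix t :: real
 have *: "\<bar>indicator {..0} t * a + \<bar>b\<bar>\<bar> <= \<bar>a\<bar> + \<bar>b\<bar>" for a b :: real
 by (auto simp: indicator_def)
 show "\<bar>indicator {..0} t * ln (xs n) + \<bar>ln (2 * d + 1)\<bar>\<bar> <= \<bar>ln (xs n)\<bar> + \<bar>ln (2 * d + 1)\<bar>"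
 by (rule *)
 qed auto
 qed
 also have "... = p * ln (xs n) + \<bar>ln (2 * d + 1)\<bar>"
 proof -
 have i1: "integrable M (%t. indicator {..0} t * ln (xs n))"
 by (rule integrable_bounded[of _ "\<bar>ln (xs n)\<bar>"]) (auto simp: indicator_def)
 have "integral\<^sup>L M (%t. indicator {..0} t * ln (xs n) + \<bar>ln (2 * d + 1)\<bar>) =
 integral\<^sup>L M (%t. indicator {..0} t * ln (xs n)) + integral\<^sup>L M (%t. \<bar>ln (2 * d + 1)\<bar>)"
 by (rule Bochner_Integration.integral_add[OF i1]) auto
 thus ?thesis using prob_space by (simp add: p_def)
 qed
 finally show ?thesis .
 qed
 have "filterlim (%n. p * ln (xs n) + \<bar>ln (2 * d + 1)\<bar>) at_bot sequentially"
 unfolding xs_def using p by real_asymp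
 hence "evs (%n. p * ln (xs n) + \<bar>ln (2 * d + 1)\<bar> < 0)"
 by (auto simp: filterlim_at_bot_dense)
 thus False using le by (auto simp: eventually_sequentially not_less[symmetric])
 qed
 hence "AE t in M. t ~: {..0}" unfolding p_def by (intro AE_I'[of "{..0}"]) (auto simp: null_sets_def emeasure_eq_measure)
 thus ?thesis by eventually_elim auto
qed

text \<open>Monotone convergence of \<open>- ln (t + xs n)\<close>: by \<open>Lam\<close> the
  integrals increase but stay at most 0.\<close>

lemma ln_integral:
 shows "integrable M (%t. ln t)"
 and "(%n. integral\<^sup>L M (%t. ln (t + xs n))) \<longlonglongrightarrow> integral\<^sup>L M (%t. ln t)"
 and "integral\<^sup>L M (%t. ln t) >= 0"
 and "integral\<^sup>L M (%t. ln t) <= integral\<^sup>L M (%t. ln (t + xs n))"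
proof -
 let ?g = "%n t. - ln (t + xs n)"
 have decx: "xs (Suc n) <= xs n" for n by (simp add: xs_def frac_le)
 have intg: "integrable M (?g n)" for n using log_shift_sums(2)[OF xs(1)] by auto
 have mono: "AE t in M. mono (%n. ?g n t)"
 using supp
 proof eventually_elim
 case (elim t)
 show ?case
 proof (rule incseq_SucI)
 fix n
 have "ln (t + xs (Suc n)) <= ln (t + xs n)"
 using elim xs(1)[of "Suc n"] decx[of n] by (intro ln_mono) auto
 thus "?g n t <= ?g (Suc n) t" by simp
 qed
 qed
 have lim: "AE t in M. (%n. ?g n t) \<longlonglongrightarrow> - ln t"
 using AE_pos
 proof eventually_elim
 case (elim t)
 have "(%n. ln (t + xs n)) \<longlonglongrightarrow> ln t" unfolding xs_def using elim by real_asymp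
 thus ?case by (rule tendsto_minus)
 qed
 have inc: "incseq (%n. integral\<^sup>L M (?g n))"
 proof (rule incseq_SucI, rule integral_mono_AE[OF intg intg])
 fix n show "AE t in M. ?g n t <= ?g (Suc n) t"
 using mono by eventually_elim (simp add: mono_def)
 qed
 have bdd: "integral\<^sup>L M (?g n) <= 0" for n using Lam[OF xs] by simp
 from incseq_convergent[OF inc, of 0] bdd obtain L where L: "(%n. integral\<^sup>L M (?g n)) \<longlonglongrightarrow> L"
 "!!n. integral\<^sup>L M (?g n) <= L" by auto
 have meas: "(%t. - ln t) : borel_measurable M" by measurable
 have i: "integrable M (%t. - ln t)"
 by (rule integrable_monotone_convergence[OF intg mono lim L(1) meas])
 thus "integrable M (%t. ln t)" by simp
 have "integral\<^sup>L M (%t. - ln t) = L"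
 by (rule integral_monotone_convergence[OF intg mono lim L(1) meas])
 hence L': "L = - integral\<^sup>L M (%t. ln t)" by simp
 thus "(%n. integral\<^sup>L M (%t. ln (t + xs n))) \<longlonglongrightarrow> integral\<^sup>L M (%t. ln t)"
 using tendsto_minus[OF L(1)] by simp
 show "integral\<^sup>L M (%t. ln t) >= 0" using LIMSEQ_le_const2[OF L(1), of 0] bdd L' by auto
 show "integral\<^sup>L M (%t. ln t) <= integral\<^sup>L M (%t. ln (t + xs n))" using L(2)[of n] L' by simp
qed

text \<open>Without mass at 0 the integrand tends to 0 almost everywhere, and it is bounded by
  1.\<close>

lemma resolvent_vanish: "(%n. integral\<^sup>L M (%t. xs n / (t + xs n))) \<longlonglongrightarrow> 0"
proof -
 have "(%n. integral\<^sup>L M (%t. xs n / (t + xs n))) \<longlonglongrightarrow> integral\<^sup>L M (%t. 0)"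
 proof (rule integral_dominated_convergence[where w = "%t. 1"])
 show "AE t in M. (%n. xs n / (t + xs n)) \<longlonglongrightarrow> 0"
 using AE_pos
 proof eventually_elim
 case (elim t)
 thus ?case unfolding xs_def by real_asymp
 qed
 show "AE t in M. norm (xs n / (t + xs n)) <= 1" for n
 using supp
 proof eventually_elim
 case (elim t)
 thus ?case using xs[of n] by (simp add: divide_le_eq)
 qed
 qed auto
 thus ?thesis by simp
qed

text \<open>The massless expansion about \<open>t = d\<close>. No geometric decay is left; the
  interchange of series and integral rests on the integrability of \<open>ln\<close>.\<close>

lemma ln_series_sums:
 "(%k. integral\<^sup>L M (%t. (d - t) ^ Suc k) / d ^ Suc k / real (Suc k))
 sums (ln d - integral\<^sup>L M (%t. ln t))"
proof -
 let ?S = "%K t. \<Sum>k<K. ((d - t) / d) ^ Suc k / real (Suc k)"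
 have r: "-1 <= (d - t) / d" "(d - t) / d < 1" "ln (1 - (d - t) / d) = ln t - ln d"
 if "0 < t" "t <= 2 * d" for t
 proof -
 show "-1 <= (d - t) / d" "(d - t) / d < 1" using that d by (auto simp: field_simps)
 have "1 - (d - t) / d = t / d" using d by (simp add: field_simps)
 thus "ln (1 - (d - t) / d) = ln t - ln d" using that d by (simp add: ln_div)
 qed
 have intk: "integrable M (%t. ((d - t) / d) ^ Suc k / real (Suc k))" for k
 proof (rule integrable_bounded[of _ 1])
 fix t assume t: "0 <= t" "t <= 2 * d"
 have "\<bar>(d - t) / d\<bar> <= 1" using t d by (auto simp: abs_divide)
 hence "\<bar>(d - t) / d\<bar> ^ Suc k <= 1" by (intro power_le_one) auto
 hence "\<bar>(d - t) / d\<bar> ^ Suc k / real (Suc k) <= 1"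
 by (subst divide_le_eq_1) auto
 thus "\<bar>((d - t) / d) ^ Suc k / real (Suc k)\<bar> <= 1"
 by (simp only: abs_divide power_abs abs_of_nat)
 qed measurable
 have ae: "AE t in M. 0 < t & t <= 2 * d" using AE_pos supp by eventually_elim auto
 have "(%K. integral\<^sup>L M (?S K)) \<longlonglongrightarrow> integral\<^sup>L M (%t. ln d - ln t)"
 proof (rule integral_dominated_convergence[where w = "%t. 1 + \<bar>ln d\<bar> + \<bar>ln t\<bar>"])
 show "AE t in M. (%K. ?S K t) \<longlonglongrightarrow> ln d - ln t"
 using ae
 proof eventually_elim
 case (elim t)
 thus ?case using log_series_bound(1)[OF r(1,2)[of t]] r(3)[of t] by (simp add: sums_def)
 qed
 show "AE t in M. norm (?S K t) <= 1 + \<bar>ln d\<bar> + \<bar>ln t\<bar>" for K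
 using ae
 proof eventually_elim
 case (elim t)
 thus ?case using log_series_bound(2)[OF r(1,2)[of t], of K] r(3)[of t] unfolding real_norm_def by linarith
 qed
 show "integrable M (%t. 1 + \<bar>ln d\<bar> + \<bar>ln t\<bar>)" using ln_integral(1) by auto
 qed (use borel_measurable_integrable[OF intk] in auto)
 moreover have "integral\<^sup>L M (?S K) = (\<Sum>k<K. integral\<^sup>L M (%t. (d - t) ^ Suc k) / d ^ Suc k / real (Suc k))" for K
 by (subst Bochner_Integration.integral_sum[OF intk])
 (simp add: power_divide del: power_Suc of_nat_Suc)
 ultimately show ?thesis using ln_integral(1) prob_space by (simp add: sums_def)
qed

end

end

section \<open>The spectral measure of a well-balanced element\<close>

lemma infsum_sum_finite:
 fixes g :: "'a => 'b => real"
 assumes "finite A" "!!a. a : A ==> g a summable_on S"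
 shows "infsum (%w. SUM a:A. g a w) S = (SUM a:A. infsum (g a) S)"
 and "(%w. SUM a:A. g a w) summable_on S"
proof -
 have "infsum (%w. SUM a:A. g a w) S = (SUM a:A. infsum (g a) S) & (%w. SUM a:A. g a w) summable_on S"
 using assms by (induction A rule: finite_induct) (auto simp: infsum_add summable_on_add)
 thus "infsum (%w. SUM a:A. g a w) S = (SUM a:A. infsum (g a) S)"
 "(%w. SUM a:A. g a w) summable_on S" by auto
qed

locale wb_group = group G for G :: "'g monoid" (structure) +
 fixes f :: "'g => int"
 assumes wb: "well_balanced G f" and inf: "infinite (carrier G)"
begin

abbreviation gmul (infixl "@@" 70) where "a @@ b == a \<otimes> b"
abbreviation "cG == carrier G"
abbreviation "cX == config_space G f"
abbreviation "Ec == E_cay G f"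
abbreviation "SE == star_edges G f"
abbreviation "wI == wsf_integral G f"
abbreviation "hT == tree_entropy G f"
abbreviation "CX == config_C G f"

text \<open>Labels of the edges at a vertex. \<open>linv\<close> gives the label of the same edge
  seen from its other end, and \<open>nbr\<close> is the adjacency operator.\<close>

definition Lab :: "('g \<times> nat) set" where
 "Lab = {(s, i). s : cG & s ~= \<one> & i < nat \<bar>f s\<bar>}"

definition deg :: nat where "deg = card Lab"

definition linv :: "'g \<times> nat => 'g \<times> nat" where "linv l = (inv (fst l), snd l)"

definition nbr :: "('g => 'a::comm_monoid_add) => 'g => 'a" where
 "nbr x w = (SUM l:Lab. x (w @@ fst l))"

lemma f_inv: "s : cG ==> f (inv s) = f s"
 using wb unfolding well_balanced_def by metis

lemma f_nonpos: "s : cG ==> s ~= \<one> ==> f s <= 0"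
 using wb unfolding well_balanced_def by metis

lemma finite_supp: "finite (fsupp G f)"
 using wb unfolding well_balanced_def by metis

lemma Lab_Sigma: "Lab = Sigma (fsupp G f - {\<one>}) (%s. {..<nat \<bar>f s\<bar>})"
 unfolding Lab_def fsupp_def by auto

lemma finite_Lab: "finite Lab"
 unfolding Lab_Sigma using finite_supp by auto

lemma Lab_carrier: "l : Lab ==> fst l : cG" "l : Lab ==> fst l ~= \<one>"
 unfolding Lab_def by auto

lemma linv_Lab: "l : Lab ==> linv l : Lab"
 unfolding Lab_def linv_def by (auto simp: f_inv)

lemma linv_linv: "l : Lab ==> linv (linv l) = l"
 unfolding Lab_def linv_def by auto

lemma bij_linv: "bij_betw linv Lab Lab"
 by (rule bij_betw_byWitness[of _ linv]) (auto simp: linv_linv linv_Lab)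

lemma fst_linv: "fst (linv l) = inv (fst l)" "snd (linv l) = snd l"
 unfolding linv_def by auto

lemma sum_Lab_linv: "(SUM l:Lab. g (linv l)) = (SUM l:Lab. g l)"
 by (rule sum.reindex_bij_betw[OF bij_linv])

lemma nbr_inv: "nbr x w = (SUM l:Lab. x (w @@ inv (fst l)))"
 unfolding nbr_def using sum_Lab_linv[of "%l. x (w @@ fst l)"] by (simp add: fst_linv)

lemma f_one: "f \<one> = int deg"
proof -
 have fin: "finite (fsupp G f - {\<one>})" using finite_supp by simp
 have "(SUM s:fsupp G f. f s) = 0" using wb unfolding well_balanced_def by metis
 moreover have "(SUM s:fsupp G f. f s) = f \<one> + (SUM s:fsupp G f - {\<one>}. f s)"
 proof (cases "\<one> : fsupp G f")
 case True
 thus ?thesis using finite_supp by (simp add: sum.remove)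
 next
 case False
 thus ?thesis by (auto simp: fsupp_def)
 qed
 moreover have "int deg = (SUM s:fsupp G f - {\<one>}. - f s)"
 proof -
 have "int deg = (SUM s:fsupp G f - {\<one>}. int (card {..<nat \<bar>f s\<bar>}))"
 unfolding deg_def Lab_Sigma using fin by simp
 also have "... = (SUM s:fsupp G f - {\<one>}. - f s)"
 by (intro sum.cong refl) (use f_nonpos in \<open>auto simp: fsupp_def\<close>)
 finally show ?thesis .
 qed
 ultimately show ?thesis by (simp add: sum_negf)
qed

text \<open>Connectedness of the Cayley graph: the support is symmetric, so inverses of generators
  are again right steps along labels, and a factor \<open>\<one>\<close> changes nothing.\<close>

lemma word_induct:
 assumes g: "g : cG" and one: "P \<one>"
 and step: "!!g l. g : cG ==> l : Lab ==> P g ==> P (g @@ fst l)"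
 shows "P g"
proof -
 have supp: "s = \<one> | (s, 0) : Lab" if "s : fsupp G f" for s
 using that unfolding fsupp_def Lab_def by auto
 have gen: "g : generate G (fsupp G f)" using wb g unfolding well_balanced_def by auto
 have car: "h : cG" if "h : generate G (fsupp G f)" for h
 using wb that unfolding well_balanced_def by auto
 have "ALL p:cG. P p --> P (p @@ h)" if "h : generate G (fsupp G f)" for h
 using that
 proof (induction rule: generate.induct)
 case one
 thus ?case by simp
 next
 case (incl h)
 thus ?case using supp[of h] step[of _ "(h, 0)"] by auto
 next
 case (inv h)
 hence "inv h = \<one> | (inv h, 0) : Lab" using supp[of h] linv_Lab[of "(h, 0)"] by (auto simp: linv_def)
 thus ?case using step[of _ "(inv h, 0)"] by auto
 next
 case (eng h1 h2)
 thus ?case using car by (auto simp: m_assoc[symmetric])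
 qed
 thus ?thesis using gen one g by (metis l_one one_closed)
qed

lemma deg_pos: "deg > 0"
proof (rule ccontr)
 assume "~ deg > 0"
 hence "Lab = {}" unfolding deg_def using finite_Lab by simp
 hence "g = \<one>" if "g : cG" for g using word_induct[OF that, of "%g. g = \<one>"] by auto
 hence "cG <= {\<one>}" by auto
 thus False using inf finite_subset by auto
qed

subsection \<open>Finitely supported functions\<close>

text \<open>The moments of the Laplacian at \<open>\<one>\<close> involve only finitely supported
  functions, so the positivity arguments can be carried out here, by algebra, without the Hilbert
  space.\<close>

definition FS :: "('g => real) set" where "FS = {x. finite {w : cG. x w ~= 0}}"

definition ip :: "('g => real) => ('g => real) => real" where
 "ip x y = infsum (%w. x w * y w) (cG)"

lemma FS_summable: "y : FS ==> (%w. x w * y w) summable_on cG"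
 unfolding FS_def by (rule finite_nonzero_values_imp_summable_on) (auto elim: rev_finite_subset)

lemma FS_summable': "x : FS ==> (%w. x w * y w) summable_on cG"
 unfolding FS_def by (rule finite_nonzero_values_imp_summable_on) (auto elim: rev_finite_subset)

lemma bij_right_mult: "s : cG ==> bij_betw (%w. w @@ s) (cG) (cG)"
 by (rule bij_betw_byWitness[of _ "%w. w @@ inv s"]) (auto simp: m_assoc)

lemma bij_left_mult: "s : cG ==> bij_betw (%w. s @@ w) (cG) (cG)"
 by (rule bij_betw_byWitness[of _ "%w. inv s @@ w"]) (auto simp: m_assoc[symmetric])

lemma FS_translate:
 assumes "x : FS" "s : cG"
 shows "(%w. x (w @@ s)) : FS"
proof -
 have "{w : cG. x (w @@ s) ~= 0} <= (%w. w @@ inv s) ` {w : cG. x w ~= 0}"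
 proof
 fix w assume w: "w : {w : cG. x (w @@ s) ~= 0}"
 hence "w = (w @@ s) @@ inv s" using assms by (auto simp: m_assoc)
 thus "w : (%w. w @@ inv s) ` {w : cG. x w ~= 0}" using w assms by blast
 qed
 thus ?thesis using assms(1) unfolding FS_def by (auto elim: finite_subset)
qed

lemma FS_add: "x : FS ==> y : FS ==> (%w. a * x w + b * y w) : FS"
 unfolding FS_def
 by (auto intro: finite_subset[of _ "{w : cG. x w ~= 0} Un {w : cG. y w ~= 0}"])

lemma FS_nbr: assumes "x : FS" shows "nbr x : FS"
proof -
 have "{w : cG. nbr x w ~= 0} <= (UN l:Lab. {w : cG. x (w @@ fst l) ~= 0})"
 unfolding nbr_def by (auto intro: ccontr dest: sum.neutral)
 moreover have "finite (UN l:Lab. {w : cG. x (w @@ fst l) ~= 0})"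
 using finite_Lab FS_translate[OF assms] Lab_carrier unfolding FS_def by auto
 ultimately show ?thesis unfolding FS_def by (auto elim: finite_subset)
qed

text \<open>Every operator used for the moments is affine in the adjacency operator; in particular
  they all commute.\<close>

definition opr :: "real => real => ('g => real) => 'g => real" where
 "opr a b x = (%w. a * x w + b * nbr x w)"

lemma FS_opr: "x : FS ==> opr a b x : FS"
 unfolding opr_def by (intro FS_add FS_nbr)

lemma FS_opr_pow: "x : FS ==> (opr a b ^^ k) x : FS"
 by (induction k) (auto simp: FS_opr)

lemma nbr_linear: "nbr (%w. a * x w + b * y w) w = a * nbr x w + b * (nbr y w :: real)"
 unfolding nbr_def by (simp add: sum.distrib sum_distrib_left)

lemma opr_linear: "opr a b (%w. p * x w + q * y w) w = p * opr a b x w + q * opr a b y w"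
 unfolding opr_def nbr_linear by (simp add: algebra_simps)

lemma opr_pow_linear:
 "(opr a b ^^ k) (%w. p * x w + q * y w) = (%w. p * (opr a b ^^ k) x w + q * (opr a b ^^ k) y w)"
 by (induction k) (auto simp: opr_linear)

lemma opr_commute: "opr a b (opr a' b' x) = opr a' b' (opr a b x)"
 unfolding opr_def by (auto simp: nbr_linear algebra_simps)

lemma opr_pow_commute: "(opr a b ^^ k) (opr a' b' x) = opr a' b' ((opr a b ^^ k) x)"
 by (induction k) (auto simp: opr_commute)

lemma ip_sym: "ip x y = ip y x" unfolding ip_def by (simp add: mult.commute)

lemma ip_linear:
 assumes "y : FS"
 shows "ip (%w. a * x w + b * x' w) y = a * ip x y + b * ip x' y"
proof -
 have "ip (%w. a * x w + b * x' w) y = infsum (%w. a * (x w * y w) + b * (x' w * y w)) (cG)"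
 unfolding ip_def by (simp add: algebra_simps)
 also have "... = infsum (%w. a * (x w * y w)) (cG) + infsum (%w. b * (x' w * y w)) (cG)"
 by (intro infsum_add summable_on_cmult_right FS_summable assms)
 finally show ?thesis unfolding ip_def by (simp add: infsum_cmult_right')
qed

lemma ip_translate:
 assumes "s : cG"
 shows "infsum (%w. x (w @@ s) * y w) (cG) = infsum (%w. x w * y (w @@ inv s)) (cG)"
proof -
 have "infsum (%w. x w * y (w @@ inv s)) (cG) =
 infsum (%w. x (w @@ s) * y ((w @@ s) @@ inv s)) (cG)"
 by (rule infsum_reindex_bij_betw[OF bij_right_mult[OF assms], symmetric])
 also have "... = infsum (%w. x (w @@ s) * y w) (cG)"
 by (intro infsum_cong) (use assms in \<open>auto simp: m_assoc\<close>)
 finally show ?thesis ..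
qed

lemma ip_nbr: assumes "x : FS" "y : FS" shows "ip (nbr x) y = ip x (nbr y)"
proof -
 have "ip (nbr x) y = infsum (%w. SUM l:Lab. x (w @@ fst l) * y w) (cG)"
 unfolding ip_def nbr_def by (simp add: sum_distrib_right)
 also have "... = (SUM l:Lab. infsum (%w. x (w @@ fst l) * y w) (cG))"
 by (intro infsum_sum_finite(1) finite_Lab FS_summable assms)
 also have "... = (SUM l:Lab. infsum (%w. x w * y (w @@ inv (fst l))) (cG))"
 by (intro sum.cong refl ip_translate Lab_carrier)
 also have "... = infsum (%w. SUM l:Lab. x w * y (w @@ inv (fst l))) (cG)"
 by (intro infsum_sum_finite(1)[symmetric] finite_Lab FS_summable' assms)
 also have "... = ip x (nbr y)"
 unfolding ip_def nbr_inv by (simp add: sum_distrib_left)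
 finally show ?thesis .
qed

lemma ip_opr: "x : FS ==> y : FS ==> ip (opr a b x) y = ip x (opr a b y)"
 using ip_linear[of y a x b "nbr x"] ip_linear[of x a y b "nbr y"] ip_nbr[of x y]
 unfolding opr_def by (simp add: ip_sym[of x])

lemma ip_self: "ip x x >= 0" unfolding ip_def by (intro infsum_nonneg) auto

text \<open>Each translate of \<open>x\<close> has the norm of \<open>x\<close>; the squares of the
  norms of sum and difference, \<open>c = 1\<close> and \<open>c = -1\<close>, bound the inner
  product of \<open>x\<close> with a translate.\<close>

lemma ip_nbr_self: assumes "x : FS" shows "\<bar>ip (nbr x) x\<bar> <= real deg * ip x x"
proof -
 have e1: "ip (nbr x) x = (SUM l:Lab. infsum (%w. x (w @@ fst l) * x w) (cG))"
 unfolding ip_def nbr_def sum_distrib_right by (intro infsum_sum_finite(1) finite_Lab FS_summable assms)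
 have e2: "\<bar>infsum (%w. x (w @@ fst l) * x w) (cG)\<bar> <= ip x x" if l: "l : Lab" for l
 proof -
 let ?y = "%w. x (w @@ fst l)"
 have s: "fst l : cG" using Lab_carrier l by auto
 have y: "?y : FS" by (rule FS_translate[OF assms s])
 have yy: "ip ?y ?y = ip x x"
 unfolding ip_def by (rule infsum_reindex_bij_betw[OF bij_right_mult[OF s], of "%w. x w * x w"])
 have *: "0 <= ip x x + c * (2 * ip ?y x) + c^2 * ip ?y ?y" for c
 proof -
 have z: "(%w. 1 * x w + c * ?y w) : FS" by (intro FS_add assms y)
 have "0 <= ip (%w. 1 * x w + c * ?y w) (%w. 1 * x w + c * ?y w)" by (rule ip_self)
 also have "... = 1 * ip x (%w. 1 * x w + c * ?y w) + c * ip ?y (%w. 1 * x w + c * ?y w)"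
 by (rule ip_linear[OF z])
 also have "ip x (%w. 1 * x w + c * ?y w) = 1 * ip x x + c * ip ?y x"
 unfolding ip_sym[of x "%w. 1 * x w + c * ?y w"] by (rule ip_linear[OF assms])
 also have "ip ?y (%w. 1 * x w + c * ?y w) = 1 * ip x ?y + c * ip ?y ?y"
 unfolding ip_sym[of ?y "%w. 1 * x w + c * ?y w"] by (rule ip_linear[OF y])
 finally show ?thesis using ip_sym[of x ?y] by (simp add: algebra_simps power2_eq_square)
 qed
 show ?thesis using *[of 1] *[of "-1"] yy unfolding ip_def by (simp add: abs_le_iff)
 qed
 have "\<bar>ip (nbr x) x\<bar> <= (SUM l:Lab. \<bar>infsum (%w. x (w @@ fst l) * x w) (cG)\<bar>)"
 unfolding e1 by (rule sum_abs)
 also have "... <= (SUM l:Lab. ip x x)" by (intro sum_mono e2)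
 finally show ?thesis by (simp add: deg_def)
qed

text \<open>The Laplacian divided by \<open>2 * deg\<close> and its complement to the identity: the
  operators playing the roles of \<open>t\<close> and \<open>1 - t\<close> in the moment
  problem.\<close>

definition M1 :: "('g => real) => 'g => real" where "M1 = opr (1/2) (- 1 / (2 * real deg))"
definition M2 :: "('g => real) => 'g => real" where "M2 = opr (1/2) (1 / (2 * real deg))"

lemma M12: "M2 x = (%w. 1 * x w + (- 1) * M1 x w)"
 unfolding M1_def M2_def opr_def by (auto simp: field_simps)

lemma ip_M_nonneg:
 assumes "x : FS"
 shows "ip (M1 x) x >= 0" "ip (M2 x) x >= 0"
proof -
 have "ip (M1 x) x = 1/2 * ip x x + (- 1 / (2 * real deg)) * ip (nbr x) x"
 "ip (M2 x) x = 1/2 * ip x x + (1 / (2 * real deg)) * ip (nbr x) x"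
 unfolding M1_def M2_def opr_def by (rule ip_linear[OF assms])+
 hence e: "ip (M1 x) x = (ip x x - ip (nbr x) x / real deg) / 2"
 "ip (M2 x) x = (ip x x + ip (nbr x) x / real deg) / 2" by (simp_all add: field_simps)
 have "\<bar>ip (nbr x) x / real deg\<bar> <= ip x x"
 using ip_nbr_self[OF assms] deg_pos by (simp add: abs_divide divide_le_eq mult.commute)
 hence "ip (nbr x) x / real deg <= ip x x" "- (ip (nbr x) x / real deg) <= ip x x"
 unfolding abs_le_iff by auto
 thus "ip (M1 x) x >= 0" "ip (M2 x) x >= 0" unfolding e by auto
qed

text \<open>Squares are split between the two arguments of the form. The product of one factor of
  each kind is handled without square roots: as \<open>M1 + M2 = 1\<close>, it equals
  \<open>M1 M2 M1 + M2 M1 M2\<close>, a sum of conjugates of positive operators.\<close>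

lemma ip_M_pow_nonneg: "x : FS ==> ip ((M1 ^^ i) ((M2 ^^ j) x)) x >= 0"
proof (induction "i + j" arbitrary: i j x rule: less_induct)
 case less
 have M1F: "M1 y : FS" "(M1 ^^ k) y : FS" if "y : FS" for y k
 unfolding M1_def using that FS_opr FS_opr_pow by auto
 have M2F: "M2 y : FS" "(M2 ^^ k) y : FS" if "y : FS" for y k
 unfolding M2_def using that FS_opr FS_opr_pow by auto
 have c12: "(M1 ^^ k) (M2 y) = M2 ((M1 ^^ k) y)" "(M2 ^^ k) (M1 y) = M1 ((M2 ^^ k) y)"
 "(M1 ^^ k) (M1 y) = M1 ((M1 ^^ k) y)" "(M2 ^^ k) (M2 y) = M2 ((M2 ^^ k) y)" for k y
 unfolding M1_def M2_def by (rule opr_pow_commute)+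
 have sa: "ip (M1 y) z = ip y (M1 z)" "ip (M2 y) z = ip y (M2 z)" if "y : FS" "z : FS" for y z
 unfolding M1_def M2_def using that by (auto intro: ip_opr)
 show ?case
 proof (cases "i >= 2")
 case True
 then obtain k where k: "i = Suc (Suc k)" by (metis One_nat_def Suc_1 Suc_le_D Suc_le_mono)
 have "(M1 ^^ i) ((M2 ^^ j) x) = M1 ((M1 ^^ k) ((M2 ^^ j) (M1 x)))"
 unfolding k by (simp add: c12)
 moreover have "ip (M1 ((M1 ^^ k) ((M2 ^^ j) (M1 x)))) x = ip ((M1 ^^ k) ((M2 ^^ j) (M1 x))) (M1 x)"
 by (intro sa M1F M2F less.prems)
 ultimately show ?thesis using less.hyps[of k j "M1 x"] M1F less.prems k by simp
 next
 case i: False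
 show ?thesis
 proof (cases "j >= 2")
 case True
 then obtain k where k: "j = Suc (Suc k)" by (metis One_nat_def Suc_1 Suc_le_D Suc_le_mono)
 have "(M1 ^^ i) ((M2 ^^ j) x) = M2 ((M1 ^^ i) ((M2 ^^ k) (M2 x)))"
 unfolding k by (simp add: c12)
 moreover have "ip (M2 ((M1 ^^ i) ((M2 ^^ k) (M2 x)))) x = ip ((M1 ^^ i) ((M2 ^^ k) (M2 x))) (M2 x)"
 by (intro sa M1F M2F less.prems)
 ultimately show ?thesis using less.hyps[of i k "M2 x"] M2F less.prems k by simp
 next
 case False
 with i consider "i = 0" "j = 0" | "i = 1" "j = 0" | "i = 0" "j = 1" | "i = 1" "j = 1" by linarith
 thus ?thesis
 proof cases
 case 4
 have "M1 (M2 x) = (%w. 1 * M2 (M1 (M1 x)) w + 1 * M1 (M2 (M2 x)) w)"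
 proof -
 have a: "x = (%w. 1 * M1 x w + 1 * M2 x w)" using M12 by auto
 have "M1 (M2 x) = M1 (M2 (%w. 1 * M1 x w + 1 * M2 x w))" using a by simp
 also have "... = (%w. 1 * M1 (M2 (M1 x)) w + 1 * M1 (M2 (M2 x)) w)"
 unfolding M1_def M2_def opr_linear by (rule ext) (simp only: opr_linear)
 finally show ?thesis using c12(1)[of 1] by simp
 qed
 hence "ip (M1 (M2 x)) x = 1 * ip (M2 (M1 (M1 x))) x + 1 * ip (M1 (M2 (M2 x))) x"
 using ip_linear[OF less.prems] by metis
 also have "M2 (M1 (M1 x)) = M1 (M2 (M1 x))" using c12(1)[of 1] by simp
 also have "M1 (M2 (M2 x)) = M2 (M1 (M2 x))" using c12(1)[of 1] by simp
 also have "ip (M1 (M2 (M1 x))) x = ip (M2 (M1 x)) (M1 x)" by (intro sa M1F M2F less.prems)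
 also have "ip (M2 (M1 (M2 x))) x = ip (M1 (M2 x)) (M2 x)" by (intro sa M1F M2F less.prems)
 finally show ?thesis using 4 ip_M_nonneg M1F M2F less.prems by simp
 qed (use ip_self ip_M_nonneg less.prems in auto)
 qed
 qed
qed

definition dl1 :: "'g => real" where "dl1 = unit_elem G"

lemma dl1_FS: "dl1 : FS" unfolding FS_def dl1_def unit_elem_def
 by (auto intro: finite_subset[of _ "{\<one>}"])

lemma ip_dl1: "ip x dl1 = x \<one>"
proof -
 have "ip x dl1 = infsum (%w. x w * dl1 w) {\<one>}"
 unfolding ip_def by (rule infsum_cong_neutral) (auto simp: dl1_def unit_elem_def)
 thus ?thesis by (simp add: dl1_def unit_elem_def)
qed

lemma hdiff_M: "hdiff (%k. (M1 ^^ k) dl1 \<one>) i j = (M1 ^^ i) ((M2 ^^ j) dl1) \<one>"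
proof (induction j arbitrary: i)
 case (Suc j)
 have "(M1 ^^ i) ((M2 ^^ Suc j) dl1) = (M1 ^^ i) (M2 ((M2 ^^ j) dl1))" by simp
 also have "... = (%w. 1 * (M1 ^^ i) ((M2 ^^ j) dl1) w + (-1) * (M1 ^^ i) (M1 ((M2 ^^ j) dl1)) w)"
 unfolding M12 unfolding M1_def by (rule opr_pow_linear)
 also have "(M1 ^^ i) (M1 ((M2 ^^ j) dl1)) = (M1 ^^ Suc i) ((M2 ^^ j) dl1)"
 by (simp add: funpow_swap1)
 finally show ?case using Suc[of i] Suc[of "Suc i"] by simp
qed simp

definition lap :: "('g => real) => 'g => real" where "lap = opr (real deg) (-1)"

lemma lap_pow_M1: "(lap ^^ k) x = (%w. (2 * real deg) ^ k * (M1 ^^ k) x w)"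
proof (induction k)
 case (Suc k)
 have l: "lap y = (%w. 2 * real deg * M1 y w)" for y
 unfolding lap_def M1_def opr_def using deg_pos by (auto simp: field_simps)
 have "(lap ^^ Suc k) x = lap (%w. (2 * real deg) ^ k * (M1 ^^ k) x w + 0 * x w)" using Suc by simp
 also have "... = (%w. (2 * real deg) ^ k * lap ((M1 ^^ k) x) w + 0 * lap x w)"
 unfolding lap_def by (rule ext) (rule opr_linear)
 also have "... = (%w. (2 * real deg) ^ Suc k * (M1 ^^ Suc k) x w)" unfolding l by auto
 finally show ?case .
qed simp

definition is_spectral :: "real measure => bool" where
 "is_spectral M \<longleftrightarrow> bounded_distribution M (real deg) &
 (\<forall>k. integral\<^sup>L M (%t. t ^ k) = (lap ^^ k) dl1 \<one>)"

lemma spectral_exists: obtains M where "is_spectral M"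
proof -
 obtain M0 where M0: "real_distribution M0" "AE t in M0. t : {0..1}"
 "!!k. integral\<^sup>L M0 (%t. t ^ k) = (M1 ^^ k) dl1 \<one>"
 proof (rule hausdorff_moments[of "%k. (M1 ^^ k) dl1 \<one>"])
 show "(M1 ^^ 0) dl1 \<one> = 1" by (simp add: dl1_def unit_elem_def)
 show "hdiff (%k. (M1 ^^ k) dl1 \<one>) i j >= 0" for i j
 unfolding hdiff_M using ip_M_pow_nonneg[OF dl1_FS, of i j] by (simp add: ip_dl1)
 qed blast
 interpret M0: real_distribution M0 by (rule M0)
 define M where "M = distr M0 borel (%u. 2 * real deg * u)"
 interpret M: real_distribution M unfolding M_def by (rule M0.real_distribution_distr) auto
 have "bounded_distribution M (real deg)"
 proof
 show "real deg > 0" using deg_pos by simp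
 have "AE u in M0. 0 <= 2 * real deg * u & 2 * real deg * u <= 2 * real deg"
 using M0(2) by eventually_elim (auto intro: mult_left_le)
 thus "AE t in M. 0 <= t & t <= 2 * real deg"
 unfolding M_def by (subst AE_distr_iff) auto
 qed
 moreover have "integral\<^sup>L M (%t. t ^ k) = (lap ^^ k) dl1 \<one>" for k
 unfolding M_def by (subst integral_distr) (auto simp: power_mult_distrib M0(3) lap_pow_M1)
 ultimately show ?thesis using that unfolding is_spectral_def by blast
qed

text \<open>The additional power of \<open>t\<close> makes the induction close: replacing one
  \<open>nbr\<close> by \<open>deg - lap\<close> lowers \<open>k\<close> and raises
  \<open>j\<close>.\<close>

lemma spectral_walks:
 assumes M: "is_spectral M"
 shows "integral\<^sup>L M (%t. (real deg - t) ^ k * t ^ j) = (nbr ^^ k) ((lap ^^ j) dl1) \<one>"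
proof (induction k arbitrary: j)
 case 0
 thus ?case using M unfolding is_spectral_def by simp
next
 case (Suc k)
 interpret bounded_distribution M "real deg" using M unfolding is_spectral_def by blast
 have int: "integrable M (%t. (real deg - t) ^ k * t ^ j)" for j
 proof (rule integrable_bounded[of _ "real deg ^ k * (2 * real deg) ^ j"])
 fix t assume "0 <= t" "t <= 2 * real deg"
 hence "\<bar>real deg - t\<bar> <= real deg" "\<bar>t\<bar> <= 2 * real deg" by auto
 thus "\<bar>(real deg - t) ^ k * t ^ j\<bar> <= real deg ^ k * (2 * real deg) ^ j"
 unfolding abs_mult power_abs by (intro mult_mono power_mono) auto
 qed measurable
 have nbr_opr: "nbr = opr 0 1" unfolding opr_def by auto
 let ?y = "(lap ^^ j) dl1"
 have "nbr ?y = (%w. real deg * ?y w + (-1) * (lap ^^ Suc j) dl1 w)"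
 by (auto simp: lap_def opr_def)
 hence "(nbr ^^ Suc k) ?y = (nbr ^^ k) (%w. real deg * ?y w + (-1) * (lap ^^ Suc j) dl1 w)"
 by (simp add: funpow_swap1)
 also have "... = (%w. real deg * (nbr ^^ k) ?y w + (-1) * (nbr ^^ k) ((lap ^^ Suc j) dl1) w)"
 unfolding nbr_opr by (rule opr_pow_linear)
 finally have "(nbr ^^ Suc k) ?y \<one> = real deg * (nbr ^^ k) ?y \<one> - (nbr ^^ k) ((lap ^^ Suc j) dl1) \<one>"
 by simp
 also have "... = real deg * integral\<^sup>L M (%t. (real deg - t) ^ k * t ^ j)
 - integral\<^sup>L M (%t. (real deg - t) ^ k * t ^ Suc j)"
 using Suc[of j] Suc[of "Suc j"] by simp
 also have "... = integral\<^sup>L M (%t. real deg * ((real deg - t) ^ k * t ^ j) - (real deg - t) ^ k * t ^ Suc j)"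
 using int[of j] int[of "Suc j"] by (simp del: power_Suc)
 also have "... = integral\<^sup>L M (%t. (real deg - t) ^ Suc k * t ^ j)"
 by (rule Bochner_Integration.integral_cong) (auto simp: algebra_simps)
 finally show ?case by simp
qed

end

section \<open>The Fuglede--Kadison determinant and the tree entropy\<close>

context wb_group
begin

lemma sum_Lab_supp:
 fixes h :: "'g => 'a::comm_ring_1"
 shows "(SUM l:Lab. h (fst l)) = (SUM s:fsupp G f - {\<one>}. - of_int (f s) * h s)"
proof -
 have "(SUM l:Lab. h (fst l)) = (SUM s:fsupp G f - {\<one>}. \<Sum>i<nat \<bar>f s\<bar>. h s)"
 unfolding Lab_Sigma using finite_supp by (subst sum.Sigma) (auto intro!: sum.cong)
 also have "... = (SUM s:fsupp G f - {\<one>}. - of_int (f s) * h s)"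
 proof (intro sum.cong refl)
 fix s assume "s : fsupp G f - {\<one>}"
 hence "f s <= 0" using f_nonpos by (auto simp: fsupp_def)
 hence "int (nat \<bar>f s\<bar>) = - f s" by simp
 hence "of_nat (nat \<bar>f s\<bar>) = (- of_int (f s) :: 'a)"
 by (metis of_int_minus of_int_of_nat_eq)
 thus "(\<Sum>i<nat \<bar>f s\<bar>. h s) = - of_int (f s) * h s" by simp
 qed
 finally show ?thesis .
qed

lemma conv_op_nbr:
 assumes "w : cG"
 shows "conv_op G f x w = of_nat deg * x w - nbr x w"
proof -
 have "conv_op G f x w = x (w @@ inv \<one>) * of_int (f \<one>) + (SUM s:fsupp G f - {\<one>}. x (w @@ inv s) * of_int (f s))"
 proof (cases "\<one> : fsupp G f")
 case True
 thus ?thesis unfolding conv_op_def using finite_supp by (subst sum.remove) auto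
 next
 case False
 hence "f \<one> = 0" by (auto simp: fsupp_def)
 thus ?thesis unfolding conv_op_def using False by simp
 qed
 moreover have "nbr x w = - (SUM s:fsupp G f - {\<one>}. x (w @@ inv s) * of_int (f s))"
 unfolding nbr_inv sum_Lab_supp[of "%s. x (w @@ inv s)"] by (simp add: sum_negf mult.commute)
 ultimately show ?thesis using assms by (simp add: f_one)
qed

lemma conv_op_pow:
 "w : cG ==> (conv_op G f ^^ k) (unit_elem G) w = complex_of_real ((lap ^^ k) dl1 w)"
proof (induction k arbitrary: w)
 case 0
 thus ?case by (simp add: dl1_def unit_elem_def)
next
 case (Suc k)
 have "(conv_op G f ^^ Suc k) (unit_elem G) w =
 of_nat deg * (conv_op G f ^^ k) (unit_elem G) w - nbr ((conv_op G f ^^ k) (unit_elem G)) w"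
 using conv_op_nbr[OF Suc.prems] by simp
 moreover have "nbr ((conv_op G f ^^ k) (unit_elem G)) w = complex_of_real (nbr ((lap ^^ k) dl1) w)"
 unfolding nbr_def of_real_sum by (intro sum.cong refl Suc.IH) (use Suc.prems Lab_carrier in auto)
 moreover have "lap y w = real deg * y w - nbr y w" for y by (simp add: lap_def opr_def)
 ultimately show ?case using Suc.IH[OF Suc.prems] by simp
qed

lemma tr_pow_lap: "tr_pow G f k = complex_of_real ((lap ^^ k) dl1 \<one>)"
 unfolding tr_pow_def by (rule conv_op_pow) simp

subsection \<open>The operator norm\<close>

lemma in_l2_translate:
 assumes "in_l2 G x" "s : cG"
 shows "(%w. (cmod (x (w @@ s)))^2) summable_on cG"
 "infsum (%w. (cmod (x (w @@ s)))^2) (cG) = infsum (%w. (cmod (x w))^2) (cG)"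
proof -
 show "(%w. (cmod (x (w @@ s)))^2) summable_on cG"
 using assms summable_on_reindex_bij_betw[OF bij_right_mult[OF assms(2)], of "%w. (cmod (x w))^2"]
 unfolding in_l2_def by simp
 show "infsum (%w. (cmod (x (w @@ s)))^2) (cG) = infsum (%w. (cmod (x w))^2) (cG)"
 by (rule infsum_reindex_bij_betw[OF bij_right_mult[OF assms(2)]])
qed

text \<open>This bounds the set whose supremum is \<open>op_norm\<close>. It follows from writing
  \<open>x f\<close> as the sum of the increments \<open>x w - x (w s)\<close> over labels, with
  Cauchy-Schwarz.\<close>

lemma conv_op_l2:
 assumes x: "in_l2 G x"
 shows "in_l2 G (conv_op G f x)" "l2_norm G (conv_op G f x) <= 2 * real deg * l2_norm G x"
proof -
 let ?b = "%w. SUM l:Lab. 2 * real deg * ((cmod (x w))^2 + (cmod (x (w @@ fst l)))^2)"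
 have bnd: "(cmod (conv_op G f x w))^2 <= ?b w" if w: "w : cG" for w
 proof -
 have "conv_op G f x w = (SUM l:Lab. x w - x (w @@ fst l))"
 unfolding conv_op_nbr[OF w] nbr_def by (simp add: sum_subtractf deg_def)
 hence "cmod (conv_op G f x w) <= (SUM l:Lab. cmod (x w) + cmod (x (w @@ fst l)))"
 by (simp only:) (intro sum_norm_le norm_triangle_ineq4)
 hence "(cmod (conv_op G f x w))^2 <= (SUM l:Lab. cmod (x w) + cmod (x (w @@ fst l)))^2"
 by (intro power_mono) auto
 also have "... <= (SUM l:Lab. (cmod (x w) + cmod (x (w @@ fst l)))^2) * real deg"
 unfolding deg_def by (rule sum_squared_le_sum_of_squares)
 also have "... <= (SUM l:Lab. 2 * ((cmod (x w))^2 + (cmod (x (w @@ fst l)))^2)) * real deg"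
 proof (intro mult_right_mono sum_mono)
 fix l
 have "0 <= (cmod (x w) - cmod (x (w @@ fst l)))^2" by simp
 thus "(cmod (x w) + cmod (x (w @@ fst l)))^2 <= 2 * ((cmod (x w))^2 + (cmod (x (w @@ fst l)))^2)"
 by (simp add: power2_eq_square algebra_simps)
 qed auto
 finally show ?thesis by (simp add: sum_distrib_right sum_distrib_left algebra_simps)
 qed
 have xs: "(%w. (cmod (x w))^2) summable_on cG" using x unfolding in_l2_def .
 have sl: "(%w. 2 * real deg * ((cmod (x w))^2 + (cmod (x (w @@ fst l)))^2)) summable_on cG"
 if "l : Lab" for l
 by (intro summable_on_cmult_right summable_on_add xs in_l2_translate(1)[OF x] Lab_carrier that)
 have bs: "?b summable_on cG" by (rule infsum_sum_finite(2)[OF finite_Lab sl])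
 show in2: "in_l2 G (conv_op G f x)"
 unfolding in_l2_def by (rule summable_on_comparison_test[OF bs]) (use bnd in auto)
 have "infsum (%w. (cmod (conv_op G f x w))^2) (cG) <= infsum ?b (cG)"
 by (rule infsum_mono) (use in2 bs bnd in \<open>auto simp: in_l2_def\<close>)
 also have "... = (SUM l:Lab. infsum (%w. 2 * real deg * ((cmod (x w))^2 + (cmod (x (w @@ fst l)))^2)) (cG))"
 by (rule infsum_sum_finite(1)[OF finite_Lab sl])
 also have "... = (SUM l:Lab. 2 * real deg * (2 * infsum (%w. (cmod (x w))^2) (cG)))"
 proof (intro sum.cong refl)
 fix l assume l: "l : Lab"
 note t = in_l2_translate[OF x Lab_carrier(1)[OF l]]
 show "infsum (%w. 2 * real deg * ((cmod (x w))^2 + (cmod (x (w @@ fst l)))^2)) (cG) =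
 2 * real deg * (2 * infsum (%w. (cmod (x w))^2) (cG))"
 unfolding infsum_cmult_right' infsum_add[OF xs t(1)] t(2) by simp
 qed
 also have "... = (2 * real deg)^2 * infsum (%w. (cmod (x w))^2) (cG)"
 by (simp add: deg_def[symmetric] power2_eq_square)
 finally have "sqrt (infsum (%w. (cmod (conv_op G f x w))^2) (cG)) <=
 sqrt ((2 * real deg)^2 * infsum (%w. (cmod (x w))^2) (cG))" by (rule real_sqrt_le_mono)
 thus "l2_norm G (conv_op G f x) <= 2 * real deg * l2_norm G x"
 unfolding l2_norm_def real_sqrt_mult real_sqrt_abs by simp
qed

lemma op_norm_upper:
 assumes x: "in_l2 G x" "l2_norm G x <= 1"
 shows "l2_norm G (conv_op G f x) <= op_norm G f"
 unfolding op_norm_def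
proof (rule cSup_upper)
 show "l2_norm G (conv_op G f x) : {l2_norm G (conv_op G f x) | x. in_l2 G x & l2_norm G x <= 1}"
 using x by blast
 show "bdd_above {l2_norm G (conv_op G f x) | x. in_l2 G x & l2_norm G x <= 1}"
 proof (rule bdd_aboveI[of _ "2 * real deg"])
 fix r assume "r : {l2_norm G (conv_op G f x) | x. in_l2 G x & l2_norm G x <= 1}"
 then obtain z where z: "r = l2_norm G (conv_op G f z)" "in_l2 G z" "l2_norm G z <= 1" by blast
 have "r <= 2 * real deg * l2_norm G z" using conv_op_l2(2)[OF z(2)] z(1) by simp
 also have "... <= 2 * real deg * 1" using z by (intro mult_left_mono) auto
 finally show "r <= 2 * real deg" by simp
 qed
qed

lemma l2_norm_nonneg: "l2_norm G x >= 0"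
 unfolding l2_norm_def by (simp add: infsum_nonneg)

lemma op_norm_nonneg: "op_norm G f >= 0"
proof -
 have "in_l2 G (%_. 0)" "l2_norm G (%_. 0) <= 1" by (auto simp: in_l2_def l2_norm_def)
 from op_norm_upper[OF this] show ?thesis using l2_norm_nonneg order_trans by blast
qed

lemma l2_norm_scale:
 "l2_norm G (%w. complex_of_real c * x w) = \<bar>c\<bar> * l2_norm G x"
 unfolding l2_norm_def
 by (simp add: norm_mult power_mult_distrib infsum_cmult_right' real_sqrt_mult)

lemma op_norm_bound:
 assumes x: "in_l2 G x"
 shows "l2_norm G (conv_op G f x) <= op_norm G f * l2_norm G x"
proof (cases "l2_norm G x = 0")
 case True
 thus ?thesis using conv_op_l2(2)[OF x] by simp
next
 case False
 define c where "c = 1 / l2_norm G x"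
 have nx: "l2_norm G x > 0" using False l2_norm_nonneg[of x] by simp
 have c: "c > 0" "c * l2_norm G x = 1" using nx by (auto simp: c_def)
 let ?y = "%w. complex_of_real c * x w"
 have "in_l2 G ?y" using x unfolding in_l2_def
 by (simp add: norm_mult power_mult_distrib summable_on_cmult_right)
 moreover have "l2_norm G ?y <= 1" using l2_norm_scale[of c x] c by simp
 ultimately have "l2_norm G (conv_op G f ?y) <= op_norm G f" by (rule op_norm_upper)
 moreover have "conv_op G f ?y = (%w. complex_of_real c * conv_op G f x w)"
 unfolding conv_op_def by (auto simp: sum_distrib_left mult.assoc)
 ultimately have "c * l2_norm G (conv_op G f x) <= op_norm G f" using l2_norm_scale c by simp
 thus ?thesis using nx by (simp add: c_def divide_le_eq)
qed

lemma lap_moment_bound: "(lap ^^ k) dl1 \<one> <= op_norm G f ^ k"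
proof -
 let ?X = "%k. (conv_op G f ^^ k) (unit_elem G)"
 have "in_l2 G (?X k) & l2_norm G (?X k) <= op_norm G f ^ k"
 proof (induction k)
 case 0
 let ?u = "%w. (cmod (unit_elem G w))^2"
 have z: "infsum ?u (cG) = infsum ?u {\<one>}"
 by (rule infsum_cong_neutral) (auto simp: unit_elem_def)
 have "?u summable_on cG"
 by (rule finite_nonzero_values_imp_summable_on)
 (auto simp: unit_elem_def intro: finite_subset[of _ "{\<one>}"])
 thus ?case unfolding in_l2_def l2_norm_def by (simp add: z) (simp add: unit_elem_def)
 next
 case (Suc k)
 have "l2_norm G (?X (Suc k)) <= op_norm G f * l2_norm G (?X k)" using op_norm_bound[of "?X k"] Suc by simp
 also have "... <= op_norm G f * op_norm G f ^ k" using Suc op_norm_nonneg by (intro mult_left_mono) auto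
 finally show ?case using conv_op_l2(1)[of "?X k"] Suc by simp
 qed
 hence X: "in_l2 G (?X k)" "l2_norm G (?X k) <= op_norm G f ^ k" by auto
 have "(cmod (?X k \<one>))^2 = infsum (%w. (cmod (?X k w))^2) {\<one>}" by simp
 also have "... <= infsum (%w. (cmod (?X k w))^2) (cG)"
 by (rule infsum_mono_neutral) (use X in \<open>auto simp: in_l2_def\<close>)
 finally have "cmod (?X k \<one>) <= l2_norm G (?X k)" unfolding l2_norm_def by (simp add: real_le_rsqrt)
 hence "cmod (complex_of_real ((lap ^^ k) dl1 \<one>)) <= op_norm G f ^ k"
 using X conv_op_pow[of \<one> k] by simp
 thus ?thesis by simp
qed

text \<open>Mass at or beyond \<open>a > op_norm G f\<close> contributes at least
  \<open>a ^ k\<close> times itself to the \<open>k\<close>-th moment, which is at most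
  \<open>op_norm G f ^ k\<close>.\<close>

lemma spectral_le_op_norm:
 assumes M: "is_spectral M"
 shows "AE t in M. 0 <= t & t <= op_norm G f"
proof -
 interpret bounded_distribution M "real deg" using M unfolding is_spectral_def by blast
 let ?c = "op_norm G f"
 have zero: "measure M {a..} = 0" if a: "a > ?c" for a
 proof -
 have a0: "a > 0" using a op_norm_nonneg by linarith
 have le: "measure M {a..} <= (?c / a) ^ k" for k
 proof -
 have ik: "integrable M (%t. t ^ k)"
 proof (rule integrable_bounded[of _ "(2 * real deg) ^ k"])
 fix t assume "0 <= t" "t <= 2 * real deg"
 thus "\<bar>t ^ k\<bar> <= (2 * real deg) ^ k" unfolding power_abs by (intro power_mono) auto
 qed measurable
 have "a ^ k * measure M {a..} = integral\<^sup>L M (%t. a ^ k * indicator {a..} t)" by simp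
 also have "... <= integral\<^sup>L M (%t. t ^ k)"
 proof (rule integral_mono_AE[OF _ ik])
 show "integrable M (%t. a ^ k * indicator {a..} t)"
 by (rule integrable_bounded[of _ "a ^ k"]) (use a0 in \<open>auto simp: indicator_def\<close>)
 show "AE t in M. a ^ k * indicator {a..} t <= t ^ k"
 using supp by eventually_elim (use a0 in \<open>auto simp: indicator_def intro: power_mono\<close>)
 qed
 also have "... <= ?c ^ k" using M lap_moment_bound unfolding is_spectral_def by simp
 finally show ?thesis using a0 by (simp add: power_divide pos_le_divide_eq mult.commute)
 qed
 have "(%k. (?c / a) ^ k) \<longlonglongrightarrow> 0"
 by (rule LIMSEQ_realpow_zero) (use a a0 op_norm_nonneg in auto)
 hence "measure M {a..} <= 0" using le by (intro LIMSEQ_le_const) auto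
 thus ?thesis using measure_nonneg[of M "{a..}"] by linarith
 qed
 have "AE t in M. t < ?c + 1 / real (Suc n)" for n
 proof -
 have "AE t in M. t ~: {?c + 1 / real (Suc n)..}"
 by (intro AE_I'[of "{?c + 1 / real (Suc n)..}"]) (auto simp: null_sets_def emeasure_eq_measure zero)
 thus ?thesis by eventually_elim auto
 qed
 hence "AE t in M. \<forall>n. t < ?c + 1 / real (Suc n)" by (simp add: AE_all_countable)
 hence "AE t in M. t <= ?c"
 proof eventually_elim
 case (elim t)
 show ?case
 proof (rule field_le_epsilon)
 fix e :: real assume "e > 0"
 then obtain n where "1 / real (Suc n) < e" using nat_approx_posE by blast
 thus "t <= ?c + e" using elim[rule_format, of n] by linarith
 qed
 qed
 thus ?thesis using supp by eventually_elim auto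
qed

text \<open>The definite description needs uniqueness: a competing measure on the interval is pushed
  forward to the line, where bounded support and equal moments identify it with
  \<open>M\<close>.\<close>

lemma spectral_measure_eq:
 assumes M: "is_spectral M"
 shows "spectral_measure G f = restrict_space M {0..op_norm G f}"
 unfolding spectral_measure_def
proof (rule the_equality)
 let ?c = "op_norm G f" and ?R = "restrict_space M {0..op_norm G f}"
 interpret bounded_distribution M "real deg" using M unfolding is_spectral_def by blast
 have supp': "AE t in M. t : {0..?c}" using spectral_le_op_norm[OF M] by auto
 have mom: "integral\<^sup>L M (%t. t ^ k) = (lap ^^ k) dl1 \<one>" for k using M unfolding is_spectral_def by blast
 have ik: "integrable M (%t. t ^ k)" for k
 proof (rule integrable_bounded[of _ "(2 * real deg) ^ k"])
 fix t assume "0 <= t" "t <= 2 * real deg"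
 thus "\<bar>t ^ k\<bar> <= (2 * real deg) ^ k" unfolding power_abs by (intro power_mono) auto
 qed measurable
 have restr_int: "integrable ?R g" "integral\<^sup>L ?R g = integral\<^sup>L M g"
 if g: "integrable M g" for g :: "real => real"
 proof -
 have m[measurable]: "g : borel_measurable M" using g by auto
 have "integrable M (%t. indicator {0..?c} t *\<^sub>R g t)"
 by (rule integrable_mult_indicator[OF _ g]) auto
 thus "integrable ?R g" by (subst integrable_restrict_space) auto
 have "integral\<^sup>L ?R g = integral\<^sup>L M (%t. indicator {0..?c} t *\<^sub>R g t)"
 by (subst integral_restrict_space) auto
 also have "... = integral\<^sup>L M g"
 by (rule integral_cong_AE) (use supp' in \<open>auto simp: indicator_def\<close>)
 finally show "integral\<^sup>L ?R g = integral\<^sup>L M g" .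
 qed
 show "sets ?R = sets (restrict_space borel {0..?c}) & finite_measure ?R &
 (\<forall>p :: real poly. integrable ?R (poly p) &
 complex_of_real (integral\<^sup>L ?R (poly p)) =
 (\<Sum>k\<le>degree p. complex_of_real (coeff p k) * tr_pow G f k))"
 proof (intro conjI allI)
 show "sets ?R = sets (restrict_space borel {0..?c})" by (rule sets_restrict_space_cong) simp
 show "finite_measure ?R" by (rule finite_measure_restrict_space) (auto intro: finite_measure_axioms)
 fix p :: "real poly"
 have pint: "integrable M (poly p)" unfolding poly_altdef using ik by auto
 show "integrable ?R (poly p)" by (rule restr_int(1)[OF pint])
 have "integral\<^sup>L ?R (poly p) = integral\<^sup>L M (poly p)" by (rule restr_int(2)[OF pint])
 also have "... = (\<Sum>k\<le>degree p. coeff p k * (lap ^^ k) dl1 \<one>)"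
 unfolding poly_altdef using ik by (simp add: mom)
 finally show "complex_of_real (integral\<^sup>L ?R (poly p)) =
 (\<Sum>k\<le>degree p. complex_of_real (coeff p k) * tr_pow G f k)"
 by (simp add: tr_pow_lap)
 qed
 fix N
 assume N: "sets N = sets (restrict_space borel {0..?c}) & finite_measure N &
 (\<forall>p :: real poly. integrable N (poly p) &
 complex_of_real (integral\<^sup>L N (poly p)) =
 (\<Sum>k\<le>degree p. complex_of_real (coeff p k) * tr_pow G f k))"
 have Ns: "sets N = sets (restrict_space borel {0..?c})" using N by blast
 have spN: "space N = {0..?c}" using sets_eq_imp_space_eq[OF Ns] by (simp add: space_restrict_space)
 interpret N: finite_measure N using N by blast
 have idm[measurable]: "(%t. t) : measurable N borel"
 using measurable_restrict_space1[of "%t. t" borel borel "{0..?c}"] measurable_cong_sets[OF Ns refl] by auto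
 define N' where "N' = distr N borel (%t. t)"
 have momN: "integral\<^sup>L N (%t. t ^ k) = (lap ^^ k) dl1 \<one>" for k
 proof -
 have "complex_of_real (integral\<^sup>L N (poly (monom 1 k))) =
 (\<Sum>j\<le>degree (monom (1::real) k). complex_of_real (coeff (monom 1 k) j) * tr_pow G f j)"
 using N by blast
 also have "... = (\<Sum>j\<le>k. if j = k then tr_pow G f j else 0)"
 unfolding degree_monom_eq[OF one_neq_zero] by (intro sum.cong) auto
 also have "... = tr_pow G f k" by simp
 finally have "integral\<^sup>L N (poly (monom 1 k)) = (lap ^^ k) dl1 \<one>"
 unfolding tr_pow_lap by (simp only: of_real_eq_iff)
 moreover have "poly (monom 1 k) = (%t. t ^ k :: real)" by (auto simp: poly_monom)
 ultimately show ?thesis by simp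
 qed
 have "prob_space N"
 proof
 have "measure N (space N) = 1" using momN[of 0] by (simp add: dl1_def unit_elem_def)
 thus "emeasure N (space N) = 1" by (simp add: N.emeasure_eq_measure)
 qed
 hence rN: "real_distribution N'" unfolding N'_def by (intro prob_space.real_distribution_distr) auto
 have "N' = M"
 proof (rule bounded_moments_unique[of _ _ "?c + 2 * real deg"])
 show "real_distribution N'" by (rule rN)
 show "real_distribution M" by (rule real_distribution_axioms)
 have "AE t in N. \<bar>t\<bar> <= ?c + 2 * real deg" by (rule AE_I2) (use spN in auto)
 thus "AE t in N'. \<bar>t\<bar> <= ?c + 2 * real deg" unfolding N'_def by (subst AE_distr_iff) auto
 show "AE t in M. \<bar>t\<bar> <= ?c + 2 * real deg" using supp by eventually_elim (use op_norm_nonneg in auto)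
 show "integral\<^sup>L N' (%t. t ^ k) = integral\<^sup>L M (%t. t ^ k)" for k
 unfolding N'_def by (subst integral_distr) (auto simp: mom momN)
 qed
 show "N = ?R"
 proof (rule measure_eqI)
 show "sets N = sets ?R" unfolding Ns by (rule sets_restrict_space_cong) simp
 fix A assume A: "A : sets N"
 hence A': "A : sets borel" "A <= {0..?c}" unfolding Ns by (auto simp: sets_restrict_space)
 have "emeasure N A = emeasure N' A"
 unfolding N'_def using A' spN by (subst emeasure_distr) (auto simp: Int_absorb2)
 thus "emeasure N A = emeasure ?R A"
 using A' \<open>N' = M\<close> by (subst emeasure_restrict_space) auto
 qed
qed

text \<open>The substitution \<open>u = inv s w\<close> turns convolution into a sum over the last
  step of a walk, so convolution powers of the step distribution are normalized walk counts.\<close>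

lemma conv_pow_nbr:
 "w : cG ==> conv_pow G (rw_mu G f) k w = (nbr ^^ k) dl1 w / real deg ^ k"
proof (induction k arbitrary: w)
 case 0
 thus ?case by (simp add: dl1_def)
next
 case (Suc k)
 let ?p = "conv_pow G (rw_mu G f) k" and ?muu = "rw_mu G f"
 have FSk: "(nbr ^^ k) dl1 : FS" by (induction k) (auto simp: dl1_FS FS_nbr)
 have fp: "finite (fsupp G ?p)"
 proof -
 have "fsupp G ?p <= {w : cG. (nbr ^^ k) dl1 w ~= 0}" unfolding fsupp_def using Suc.IH by auto
 thus ?thesis using FSk unfolding FS_def by (auto elim: finite_subset)
 qed
 have mu: "?muu u = - of_int (f u) / real deg" if "u : cG" "u ~= \<one>" for u
 using that f_nonpos[OF that] by (simp add: rw_mu_def f_one)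
 have muz: "?muu u ~= 0 ==> u : fsupp G f - {\<one>}" for u
 by (auto simp: rw_mu_def fsupp_def split: if_splits)
 have "conv_pow G ?muu (Suc k) w = (SUM s:fsupp G ?p. ?p s * ?muu (inv s @@ w))" by (simp add: conv_def)
 also have "... = (SUM u:fsupp G f - {\<one>}. ?p (w @@ inv u) * ?muu u)"
 proof (rule sum.reindex_bij_witness_not_neutral[of "{s : fsupp G ?p. ?muu (inv s @@ w) = 0}"
 "{u : fsupp G f - {\<one>}. ?p (w @@ inv u) = 0}" _ "%u. w @@ inv u" "%s. inv s @@ w"])
 fix s assume "s : fsupp G ?p - {s : fsupp G ?p. ?muu (inv s @@ w) = 0}"
 hence s: "s : cG" "?p s ~= 0" "?muu (inv s @@ w) ~= 0" by (auto simp: fsupp_def)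
 show e: "w @@ inv (inv s @@ w) = s" using s Suc.prems by (simp add: inv_mult_group m_assoc[symmetric])
 show "inv s @@ w : fsupp G f - {\<one>} - {u : fsupp G f - {\<one>}. ?p (w @@ inv u) = 0}"
 using muz[OF s(3)] s e by auto
 next
 fix s assume "s : fsupp G ?p"
 hence "w @@ inv (inv s @@ w) = s" using Suc.prems by (simp add: fsupp_def inv_mult_group m_assoc[symmetric])
 thus "?p (w @@ inv (inv s @@ w)) * ?muu (inv s @@ w) = ?p s * ?muu (inv s @@ w)" by simp
 next
 fix u assume "u : fsupp G f - {\<one>} - {u : fsupp G f - {\<one>}. ?p (w @@ inv u) = 0}"
 hence u: "u : cG" "u ~= \<one>" "f u ~= 0" "?p (w @@ inv u) ~= 0" by (auto simp: fsupp_def)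
 show e: "inv (w @@ inv u) @@ w = u" using u Suc.prems by (simp add: inv_mult_group m_assoc)
 have "?muu u ~= 0" using mu[OF u(1,2)] u deg_pos by simp
 thus "w @@ inv u : fsupp G ?p - {s : fsupp G ?p. ?muu (inv s @@ w) = 0}"
 using u Suc.prems e by (auto simp: fsupp_def)
 qed (use fp finite_supp in auto)
 also have "... = (SUM u:fsupp G f - {\<one>}. - of_int (f u) * (?p (w @@ inv u) / real deg))"
 by (intro sum.cong refl) (auto simp: mu fsupp_def)
 also have "... = (SUM l:Lab. ?p (w @@ inv (fst l)) / real deg)"
 by (rule sum_Lab_supp[symmetric])
 also have "... = (SUM l:Lab. (nbr ^^ k) dl1 (w @@ inv (fst l)) / real deg ^ Suc k)"
 by (intro sum.cong refl) (use Suc Lab_carrier in auto)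
 also have "... = nbr ((nbr ^^ k) dl1) w / real deg ^ Suc k"
 unfolding nbr_inv[of _ w] by (simp add: sum_divide_distrib)
 finally show ?case by simp
qed

lemma spectral_nbr: "is_spectral M ==> integral\<^sup>L M (%t. (real deg - t) ^ k) = (nbr ^^ k) dl1 \<one>"
 using spectral_walks[of M k 0] by simp

context
 fixes M
 assumes M: "is_spectral M"
 and Lam: "!!x. 0 < x ==> x <= 1 ==> integral\<^sup>L M (%t. ln (t + x)) >= 0"
begin

lemma bounded_M: "bounded_distribution M (real deg)"
 using M unfolding is_spectral_def by blast

lemma tree_entropy_eq: "hT = integral\<^sup>L M (%t. ln t)"
proof -
 interpret bounded_distribution M "real deg" by (rule bounded_M)
 have "(%k. conv_pow G (rw_mu G f) (Suc k) \<one> / real (Suc k)) sums (ln (real deg) - integral\<^sup>L M (%t. ln t))"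
 using ln_series_sums[OF Lam] unfolding spectral_nbr[OF M] conv_pow_nbr[OF one_closed] by simp
 thus ?thesis unfolding tree_entropy_def sums_iff by (simp add: f_one)
qed

text \<open>Positive and negative part of \<open>ln\<close> are both integrable, so the extended
  difference is the integral itself; \<open>part\<close> is used with \<open>c = 1\<close> and
  \<open>c = -1\<close>.\<close>

lemma log_det_eq: "log_det_NG G f = ereal (hT)"
proof -
 interpret bounded_distribution M "real deg" by (rule bounded_M)
 let ?c = "op_norm G f"
 have li: "integrable M (%t. ln t)" by (rule ln_integral(1)[OF Lam])
 have pos: "AE t in M. 0 < t" by (rule AE_pos) (rule Lam)
 have ae: "AE t in M. 0 < t & t <= ?c" using pos spectral_le_op_norm[OF M] by eventually_elim auto
 have part: "enn2ereal (\<integral>\<^sup>+ t. ennreal (max (c * ln t) 0) * indicator {0<..?c} t \<partial>spectral_measure G f)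
 = ereal (integral\<^sup>L M (%t. max (c * ln t) 0))" for c
 proof -
 have i: "integrable M (%t. max (c * ln t) 0)" using li by auto
 have "(\<integral>\<^sup>+ t. ennreal (max (c * ln t) 0) * indicator {0<..?c} t \<partial>spectral_measure G f) =
 (\<integral>\<^sup>+ t. ennreal (max (c * ln t) 0) * indicator {0<..?c} t * indicator {0..?c} t \<partial>M)"
 unfolding spectral_measure_eq[OF M] by (subst nn_integral_restrict_space) auto
 also have "... = (\<integral>\<^sup>+ t. ennreal (max (c * ln t) 0) \<partial>M)"
 by (rule nn_integral_cong_AE) (use ae in \<open>eventually_elim, auto simp: indicator_def\<close>)
 also have "... = ennreal (integral\<^sup>L M (%t. max (c * ln t) 0))"
 by (rule nn_integral_eq_integral[OF i]) auto
 finally show ?thesis by (simp add: enn2ereal_ennreal integral_nonneg_AE)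
 qed
 have "log_det_NG G f = ereal (integral\<^sup>L M (%t. max (ln t) 0)) - ereal (integral\<^sup>L M (%t. max (- ln t) 0))"
 unfolding log_det_NG_def using part[of 1] part[of "-1"] by simp
 also have "... = ereal (integral\<^sup>L M (%t. max (ln t) 0 - max (- ln t) 0))"
 using li by (subst Bochner_Integration.integral_diff) auto
 also have "(%t. max (ln t) 0 - max (- ln t) 0) = (%t::real. ln t)" by auto
 finally show ?thesis using tree_entropy_eq by simp
qed

end

end

section \<open>Finite quotients of the Cayley graph\<close>

context wb_group
begin

lemma Lab_pair: "(s, i) : Lab ==> s : cG"
 unfolding Lab_def by auto

lemma cancel_left:
 "a : cG ==> x : cG ==> a @@ (inv a @@ x) = x"
 "a : cG ==> x : cG ==> inv a @@ (a @@ x) = x"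
 by (simp_all add: m_assoc[symmetric])

lemma nbr_Suc: "(nbr ^^ Suc k) x g = (SUM l:Lab. (nbr ^^ k) x (g @@ fst l))"
 by (simp add: nbr_def[of "(nbr ^^ k) x" g])

primrec wball :: "nat => 'g set" where
 "wball 0 = {\<one>}"
| "wball (Suc k) = wball k Un (%(b, l). b @@ fst l) ` (wball k \<times> Lab)"

lemma wball_carrier: "wball k <= cG"
 by (induction k) (auto simp: Lab_pair)

lemma finite_wball: "finite (wball k)"
 by (induction k) (auto simp: finite_Lab)

lemma one_wball: "\<one> : wball k"
 by (induction k) auto

lemma wball_mono: "j <= k ==> wball j <= wball k"
 by (rule lift_Suc_mono_le[of wball]) auto

lemma wball_step: "b : wball k ==> l : Lab ==> b @@ fst l : wball (Suc k)"
 by force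

lemma wball_step_left: "b : wball k ==> l : Lab ==> fst l @@ b : wball (Suc k)"
proof (induction k arbitrary: b)
 case 0
 thus ?case using wball_step[of \<one> 0 l] Lab_carrier by auto
next
 case (Suc k)
 consider "b : wball k" | b' l' where "b = b' @@ fst l'" "b' : wball k" "l' : Lab"
 using Suc.prems by auto
 thus ?case
 proof cases
 case 1
 thus ?thesis using Suc.IH[of b] Suc.prems by auto
 next
 case 2
 hence "fst l @@ b = (fst l @@ b') @@ fst l'"
 using subsetD[OF wball_carrier] Lab_carrier(1) Suc.prems(2) by (simp add: m_assoc)
 thus ?thesis using wball_step[OF Suc.IH[of b'], of l'] 2 Suc.prems by simp
 qed
qed

lemma nbr_pow_local:
 fixes x x' :: "'g => real"
 assumes "g : cG" "!!b. b : wball k ==> x (g @@ b) = x' (g @@ b)"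
 shows "(nbr ^^ k) x g = (nbr ^^ k) x' g"
 using assms
proof (induction k arbitrary: g)
 case 0
 thus ?case by simp
next
 case (Suc k)
 have "(nbr ^^ k) x (g @@ fst l) = (nbr ^^ k) x' (g @@ fst l)" if l: "l : Lab" for l
 proof (rule Suc.IH)
 fix b assume b: "b : wball k"
 thus "x (g @@ fst l @@ b) = x' (g @@ fst l @@ b)"
 using Suc.prems(2)[OF wball_step_left[OF b l]] Suc.prems(1) subsetD[OF wball_carrier b]
 Lab_carrier(1)[OF l] by (simp add: m_assoc)
 qed (use Suc.prems l Lab_carrier in auto)
 thus ?case unfolding nbr_Suc by simp
qed

lemma nbr_pow_translate:
 fixes x :: "'g => real"
 assumes "h : cG" "g : cG"
 shows "(nbr ^^ k) (%w. x (h @@ w)) g = (nbr ^^ k) x (h @@ g)"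
 using assms(2)
proof (induction k arbitrary: g)
 case (Suc k)
 have "(nbr ^^ Suc k) (%w. x (h @@ w)) g = (SUM l:Lab. (nbr ^^ k) (%w. x (h @@ w)) (g @@ fst l))"
 by (rule nbr_Suc)
 also have "... = (SUM l:Lab. (nbr ^^ k) x (h @@ g @@ fst l))"
 by (intro sum.cong refl) (use Suc assms Lab_carrier in \<open>auto simp: m_assoc\<close>)
 finally show ?case unfolding nbr_Suc .
qed simp

end

locale wb_quot = wb_group G f for G :: "'g monoid" (structure) and f +
 fixes H :: "'g set"
 assumes H: "H \<lhd> G" and finV: "finite (left_cosets G H)"
begin

abbreviation V where "V == left_cosets G H"
abbreviation E where "E == quot_edges G f H"

definition qe :: "'g => 'g \<times> nat => 'g qd" where
 "qe g l = {(g <# H, fst l, snd l), ((g @@ fst l) <# H, inv (fst l), snd l)}"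

lemma H_sub: "subgroup H G" using H normal_imp_subgroup by blast

lemma H_carrier: "H <= cG" using H_sub subgroup.subset by blast

lemma H_mem: "h : H ==> h : cG" using H_carrier by auto

lemma coset_mem: "g : cG ==> x : g <# H \<longleftrightarrow> x : cG & inv g @@ x : H"
proof
 assume g: "g : cG" and "x : g <# H"
 then obtain h where h: "h : H" "x = g @@ h" unfolding l_coset_def by auto
 thus "x : cG & inv g @@ x : H" using g H_carrier by (auto simp: m_assoc[symmetric])
next
 assume g: "g : cG" and x: "x : cG & inv g @@ x : H"
 hence "x = g @@ (inv g @@ x)" by (auto simp: m_assoc[symmetric])
 thus "x : g <# H" unfolding l_coset_def using x by blast
qed

lemma coset_eq:
 assumes "g : cG" "g' : cG"
 shows "g <# H = g' <# H \<longleftrightarrow> inv g @@ g' : H"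
proof
 assume "g <# H = g' <# H"
 moreover have "g' : g' <# H" using coset_mem[OF assms(2)] assms H_sub subgroup.one_closed by fastforce
 ultimately show "inv g @@ g' : H" using coset_mem assms by auto
next
 assume a: "inv g @@ g' : H"
 have "x : g <# H \<longleftrightarrow> x : g' <# H" for x
 proof -
 have "inv g' @@ x = inv (inv g @@ g') @@ (inv g @@ x)" "inv g @@ x = (inv g @@ g') @@ (inv g' @@ x)" if "x : cG"
 using assms that by (simp_all add: inv_mult_group m_assoc cancel_left)
 hence "inv g @@ x : H \<longleftrightarrow> inv g' @@ x : H" if "x : cG"
 using subgroup.m_closed[OF H_sub a] subgroup.m_closed[OF H_sub subgroup.m_inv_closed[OF H_sub a]] that
 by metis
 thus ?thesis using coset_mem[OF assms(1), of x] coset_mem[OF assms(2), of x] by blast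
 qed
 thus "g <# H = g' <# H" by blast
qed

lemma coset_rmult:
 assumes "g : cG" "s : cG"
 shows "(g <# H) #> s = (g @@ s) <# H"
proof -
 have "(g <# H) #> s = g <# (H #> s)"
 using assms unfolding l_coset_def r_coset_def by (auto simp: m_assoc H_mem)
 also have "H #> s = s <# H" using H assms normal.coset_eq by blast
 also have "g <# (s <# H) = (g @@ s) <# H" using lcos_m_assoc[OF H_carrier] assms by auto
 finally show ?thesis .
qed

lemma coset_lmult:
 assumes "g : cG" "s : cG"
 shows "s <# (g <# H) = (s @@ g) <# H"
 using lcos_m_assoc[OF H_carrier] assms by auto

lemma V_iff: "A : V \<longleftrightarrow> (EX g:cG. A = g <# H)"
 unfolding left_cosets_def by auto

lemma coset_V: "g : cG ==> g <# H : V" using V_iff by auto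

lemma V_ne: "V ~= {}" using coset_V[OF one_closed] by auto

lemma E_iff: "epp : E \<longleftrightarrow> (EX g:cG. EX l:Lab. epp = qe g l)"
proof
 assume "epp : E"
 then obtain A s i where A: "A : V" "s : cG" "s ~= \<one>" "i < nat \<bar>f s\<bar>"
 "epp = {(A, s, i), (A #> s, inv s, i)}" unfolding quot_edges_def cay_edges_def by blast
 then obtain g where g: "g : cG" "A = g <# H" using V_iff by auto
 have "epp = qe g (s, i)" unfolding qe_def using A g coset_rmult by simp
 moreover have "(s, i) : Lab" using A unfolding Lab_def by simp
 ultimately show "EX g:cG. EX l:Lab. epp = qe g l" using g by blast
next
 assume "EX g:cG. EX l:Lab. epp = qe g l"
 then obtain g l where g: "g : cG" "l : Lab" "epp = qe g l" by blast
 have "epp = {(g <# H, fst l, snd l), ((g <# H) #> fst l, inv (fst l), snd l)}"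
 using g coset_rmult Lab_carrier unfolding qe_def by simp
 thus "epp : E" unfolding quot_edges_def cay_edges_def
 using g(2) coset_V[OF g(1)] unfolding Lab_def by fastforce
qed

lemma ends_qe: "ends (qe g l) = {g <# H, (g @@ fst l) <# H}"
 unfolding ends_def qe_def by auto

lemma qe_cong: "g <# H = g' <# H ==> g : cG ==> g' : cG ==> l : Lab ==> qe g l = qe g' l"
 unfolding qe_def using coset_rmult Lab_carrier by metis

lemma qe_flip: "g : cG ==> l : Lab ==> qe (g @@ fst l) (linv l) = qe g l"
 unfolding qe_def linv_def using Lab_carrier by (auto simp: m_assoc)

lemma E_subset: "E <= (%(A, l). qe (SOME g. g : cG & A = g <# H) l) ` (V \<times> Lab)"
proof
 fix epp assume "epp : E"
 then obtain g l where g: "g : cG" "l : Lab" "epp = qe g l" using E_iff by blast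
 let ?g = "SOME g'. g' : cG & g <# H = g' <# H"
 have "?g : cG & g <# H = ?g <# H" by (rule someI_ex) (use g in blast)
 hence "qe ?g l = epp" using qe_cong[of ?g g l] g by auto
 thus "epp : (%(A, l). qe (SOME g. g : cG & A = g <# H) l) ` (V \<times> Lab)"
 using g coset_V by (auto intro!: image_eqI[of _ _ "(g <# H, l)"])
qed

lemma finE: "finite E"
 by (rule finite_subset[OF E_subset]) (simp add: finV finite_Lab)

lemma cardE: "card E <= deg * card V"
 using surj_card_le[OF finite_cartesian_product[OF finV finite_Lab] E_subset]
 by (simp add: card_cartesian_product deg_def mult.commute)

lemma graph: "fgraph V ends E"
 unfolding fgraph_def
proof (intro conjI ballI finV finE)
 fix epp assume "epp : E"
 then obtain g l where g: "g : cG" "l : Lab" "epp = qe g l" using E_iff by blast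
 have "g <# H : V" "(g @@ fst l) <# H : V" using g Lab_carrier(1)[OF g(2)] by (auto intro: coset_V)
 moreover have "ends epp = {g <# H, (g @@ fst l) <# H}" unfolding g(3) by (rule ends_qe)
 ultimately show "EX a:V. EX b:V. ends epp = {a, b}" by auto
qed

lemma conn: "gconn V ends E"
proof -
 have "(\<one> <# H, g <# H) : (adj_rel ends E)^*" if "g : cG" for g
 proof (rule word_induct[OF that])
 show "(\<one> <# H, \<one> <# H) : (adj_rel ends E)^*" by simp
 fix g l assume g: "g : cG" "l : Lab" "(\<one> <# H, g <# H) : (adj_rel ends E)^*"
 have "qe g l : E" using E_iff g by blast
 hence "(g <# H, (g @@ fst l) <# H) : (adj_rel ends E)^*" using ends_qe by (rule adj_edge)
 thus "(\<one> <# H, (g @@ fst l) <# H) : (adj_rel ends E)^*" using g by auto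
 qed
 hence *: "(\<one> <# H, A) : (adj_rel ends E)^*" if "A : V" for A using that unfolding V_iff by auto
 show ?thesis unfolding gconn_def by (intro ballI rtrancl_trans[OF adj_rtrancl_sym[OF *] *])
qed

lemma tau_pos: "tau_quot G f H > 0"
 unfolding tau_quot_def by (rule num_spanning_trees_pos[OF graph conn])

end

text \<open>A generator lying in \<open>H\<close> would give loops, and its labels \<open>l\<close>
  and \<open>linv l\<close> would name the same edge at the same vertex, spoiling regularity. Along
  the sequence this happens only finitely often.\<close>

locale wb_quot_loopfree = wb_quot +
 assumes no_loop: "!!l. l : Lab ==> fst l ~: H"
begin

lemma step_neq: "g : cG ==> l : Lab ==> (g @@ fst l) <# H ~= g <# H"
 using coset_eq[of g "g @@ fst l"] no_loop[of l] Lab_carrier[of l] by (auto simp: m_assoc[symmetric])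

lemma inc_qe:
 assumes g: "g : cG"
 shows "bij_betw (qe g) Lab (inc ends E (g <# H))"
proof (rule bij_betw_imageI)
 show "inj_on (qe g) Lab"
 proof (rule inj_onI)
 fix l l' assume l: "l : Lab" "l' : Lab" and e: "qe g l = qe g l'"
 have "(g <# H, fst l, snd l) : qe g l'" using e unfolding qe_def by auto
 thus "l = l'" using step_neq[OF g l(2)] unfolding qe_def by (auto simp: prod_eq_iff)
 qed
 show "qe g ` Lab = inc ends E (g <# H)"
 proof (rule equalityI; rule subsetI)
 fix epp assume "epp : qe g ` Lab"
 thus "epp : inc ends E (g <# H)" unfolding inc_def using E_iff g ends_qe by auto
 next
 fix epp assume "epp : inc ends E (g <# H)"
 then obtain g' l where g': "g' : cG" "l : Lab" "epp = qe g' l" and m: "g <# H : ends epp"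
 unfolding inc_def E_iff by blast
 from m g' consider "g' <# H = g <# H" | "(g' @@ fst l) <# H = g <# H" by (auto simp: ends_qe)
 thus "epp : qe g ` Lab"
 proof cases
 case 1
 thus ?thesis using qe_cong[OF 1 g'(1) g g'(2)] g' by auto
 next
 case 2
 have "epp = qe (g' @@ fst l) (linv l)" using qe_flip g' by simp
 also have "... = qe g (linv l)" using 2 g' g Lab_carrier linv_Lab by (intro qe_cong) auto
 finally show ?thesis using linv_Lab g' by blast
 qed
 qed
qed

lemma regular: "A : V ==> card (inc ends E A) = deg"
 using inc_qe bij_betw_same_card unfolding V_iff deg_def by metis

lemma other_qe: "other (ends (qe g l)) (g <# H) = (g @@ fst l) <# H"
 by (rule other_eq) (rule ends_qe)

lemma adj_op_nbr:
 "g : cG ==> (adj_op ends E ^^ k) fii (g <# H) = (nbr ^^ k) (%w. fii (w <# H)) g"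
proof (induction k arbitrary: g)
 case (Suc k)
 have "(adj_op ends E ^^ Suc k) fii (g <# H) =
 (SUM epp:inc ends E (g <# H). (adj_op ends E ^^ k) fii (other (ends epp) (g <# H)))"
 by (simp add: adj_op_def)
 also have "... = (SUM l:Lab. (adj_op ends E ^^ k) fii (other (ends (qe g l)) (g <# H)))"
 by (rule sum.reindex_bij_betw[OF inc_qe[OF Suc.prems], symmetric])
 also have "... = (SUM l:Lab. (nbr ^^ k) (%w. fii (w <# H)) (g @@ fst l))"
 by (intro sum.cong refl) (use Suc Lab_carrier other_qe in auto)
 finally show ?case unfolding nbr_Suc .
qed simp

text \<open>A walk of length \<open>k\<close> stays in a translate of the ball of radius
  \<open>k\<close>; if \<open>H\<close> meets that ball only in \<open>\<one>\<close>, it closes up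
  in the quotient exactly when it does in the group.\<close>

lemma closed_walks_eq:
 assumes "!!b. b : wball k ==> b : H ==> b = \<one>"
 shows "closed_walks V ends E k = rc V * (nbr ^^ k) dl1 \<one>"
proof -
 have "(adj_op ends E ^^ k) (%w. of_bool (w = A)) A = (nbr ^^ k) dl1 \<one>" if "A : V" for A
 proof -
 obtain g where g: "g : cG" "A = g <# H" using \<open>A : V\<close> V_iff by auto
 have "(adj_op ends E ^^ k) (%w. of_bool (w = A)) A = (nbr ^^ k) (%w. of_bool (w <# H = A)) g"
 using adj_op_nbr[OF g(1)] g by simp
 also have "... = (nbr ^^ k) (%w. of_bool (w <# H = A)) (g @@ \<one>)" using g by simp
 also have "... = (nbr ^^ k) (%w. of_bool ((g @@ w) <# H = A)) \<one>"
 by (rule nbr_pow_translate[symmetric]) (use g in auto)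
 also have "... = (nbr ^^ k) dl1 \<one>"
 proof (rule nbr_pow_local)
 fix b assume b: "b : wball k"
 hence bc: "b : cG" using wball_carrier by auto
 have "(g @@ b) <# H = A \<longleftrightarrow> b : H"
 using coset_eq[of g "g @@ b"] g bc by (auto simp: m_assoc[symmetric])
 also have "... \<longleftrightarrow> b = \<one>" using assms[OF b] subgroup.one_closed[OF H_sub] by auto
 finally show "of_bool ((g @@ (\<one> @@ b)) <# H = A) = dl1 (\<one> @@ b)"
 using bc by (auto simp: dl1_def unit_elem_def)
 qed auto
 finally show ?thesis .
 qed
 thus ?thesis unfolding closed_walks_def by simp
qed

lemma closed_walks_bound: "\<bar>closed_walks V ends E k\<bar> <= rc V * real deg ^ k"
proof -
 have "\<bar>closed_walks V ends E k\<bar> <= (SUM v:V. \<bar>(adj_op ends E ^^ k) (%w. of_bool (w = v)) v\<bar>)"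
 unfolding closed_walks_def by simp
 also have "... <= (SUM v:V. real deg ^ k * 1)"
 by (intro sum_mono adj_op_bound[OF graph regular]) auto
 finally show ?thesis by simp
qed

end

section \<open>The exponential growth rate of the number of spanning trees\<close>

locale sofic = wb_group G f for G :: "'g monoid" (structure) and f +
 fixes Sg :: "nat => 'g set"
 assumes nor: "!!n. Sg n \<lhd> G" and fin: "!!n. finite (left_cosets G (Sg n))"
 and inter: "(\<Inter>n. UN i:{n..}. Sg i) = {\<one>}"
begin

sublocale q: wb_quot G f "Sg n" for n
 by (intro wb_quot.intro wb_quot_axioms.intro wb_group_axioms nor fin)

text \<open>The intersection condition says that a nontrivial element lies in only finitely many
  \<open>Sg n\<close>. All local comparisons of quotient and group start here.\<close>

lemma eventually_not_in:
 assumes "finite F" "F <= cG"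
 shows "evs (%n. ALL b:F. b : Sg n --> b = \<one>)"
 using assms(1)
proof (rule eventually_ball_finite, intro ballI)
 fix b assume "b : F"
 show "evs (%n. b : Sg n --> b = \<one>)"
 proof (cases "b = \<one>")
 case False
 hence "b ~: (\<Inter>n. UN i:{n..}. Sg i)" using inter by auto
 then obtain n where "\<forall>i\<ge>n. b ~: Sg i" by auto
 thus ?thesis unfolding eventually_sequentially by blast
 qed simp
qed

lemma eventually_inj:
 assumes "finite F" "F <= cG"
 shows "evs (%n. ALL a:F. ALL b:F. a <# Sg n = b <# Sg n --> a = b)"
proof -
 let ?D = "(%(a, b). inv a @@ b) ` (F \<times> F)"
 have "evs (%n. ALL b:?D. b : Sg n --> b = \<one>)"
 by (rule eventually_not_in) (use assms in auto)
 thus ?thesis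
 proof eventually_elim
 case (elim n)
 show ?case
 proof (intro ballI impI)
 fix a b assume ab: "a : F" "b : F" "a <# Sg n = b <# Sg n"
 hence "inv a @@ b : Sg n" using q.coset_eq[of a b n] assms by auto
 hence e: "inv a @@ b = \<one>" using elim ab by auto
 have c: "a : cG" "b : cG" using ab assms by auto
 have "b = a @@ (inv a @@ b)" using c by (simp add: m_assoc[symmetric])
 thus "a = b" using e c by simp
 qed
 qed
qed

lemma eventually_loopfree: "evs (%n. wb_quot_loopfree G f (Sg n))"
proof -
 have "evs (%n. ALL b:fst ` Lab. b : Sg n --> b = \<one>)"
 by (rule eventually_not_in) (use finite_Lab Lab_carrier in auto)
 thus ?thesis
 proof eventually_elim
 case (elim n)
 show ?case
 by (intro wb_quot_loopfree.intro wb_quot_loopfree_axioms.intro q.wb_quot_axioms)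
 (use elim Lab_carrier in auto)
 qed
qed

abbreviation N where "N n == card (q.V n)"

lemma N_pos: "N n > 0" using fin q.V_ne by (simp add: card_gt_0_iff)

lemma N_at_top: "filterlim (%n. real (N n)) at_top sequentially"
 unfolding filterlim_at_top
proof
 fix Z :: real
 obtain F where F: "finite F" "card F = nat \<lceil>Z\<rceil>" "F <= cG"
 using infinite_arbitrarily_large[OF inf] by blast
 have "evs (%n. ALL a:F. ALL b:F. a <# Sg n = b <# Sg n --> a = b)"
 by (rule eventually_inj[OF F(1,3)])
 thus "evs (%n. Z <= real (N n))"
 proof eventually_elim
 case (elim n)
 have "card F = card ((%a. a <# Sg n) ` F)"
 by (rule card_image[symmetric]) (use elim in \<open>auto simp: inj_on_def\<close>)
 also have "... <= N n" by (rule card_mono[OF fin]) (use q.coset_V F in auto)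
 finally show ?case using F(2) by linarith
 qed
qed

lemma N_inv_tendsto: "(%n. c / real (N n)) \<longlonglongrightarrow> 0"
 by (rule tendsto_divide_0[OF tendsto_const filterlim_at_top_imp_at_infinity[OF N_at_top]])

abbreviation "ZZ n == mZ (q.V n) ends (q.E n)"
abbreviation "cw n == closed_walks (q.V n) ends (q.E n)"

lemma cw_eventually: "evs (%n. cw n k / real (N n) = (nbr ^^ k) dl1 \<one>)"
 using eventually_loopfree eventually_not_in[OF finite_wball[of k] wball_carrier]
proof eventually_elim
 case (elim n)
 interpret L: wb_quot_loopfree G f "Sg n" by (rule elim)
 show ?case using L.closed_walks_eq[of k] elim N_pos[of n] by simp
qed

text \<open>Tannery's theorem: each coefficient is eventually constant, and a geometric series
  dominates uniformly in the quotient. The weights \<open>w\<close> cover the logarithm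
  (\<open>1 / k\<close>) as well as the resolvent (\<open>1\<close>).\<close>

lemma series_limit:
 assumes x: "x > 0" and w: "!!k. 0 <= w k" "!!k. w k <= 1"
 shows "(%n. \<Sum>k. cw n k / real (N n) * (w k / (real deg + x) ^ k))
 \<longlonglongrightarrow> (\<Sum>k. (nbr ^^ k) dl1 \<one> * (w k / (real deg + x) ^ k))"
proof -
 have dx: "real deg + x > 0" using x by simp
 define a where "a k n = cw n k / real (N n) * (w k / (real deg + x) ^ k)" for k n
 define b where "b k = (nbr ^^ k) dl1 \<one> * (w k / (real deg + x) ^ k)" for k
 have bound: "eventually (%(k, n). norm (a k n) <= (real deg / (real deg + x)) ^ k) (at_top \<times>\<^sub>F sequentially)"
 unfolding eventually_prod_filter
 proof (intro exI conjI allI impI)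
 show "eventually (%k::nat. True) at_top" by simp
 show "evs (%n. wb_quot_loopfree G f (Sg n))" by (rule eventually_loopfree)
 fix k n assume "wb_quot_loopfree G f (Sg n)"
 then interpret L: wb_quot_loopfree G f "Sg n" .
 have "\<bar>cw n k\<bar> / real (N n) <= real deg ^ k"
 using L.closed_walks_bound[of k] N_pos[of n] by (simp add: divide_le_eq mult.commute)
 hence "\<bar>cw n k\<bar> / real (N n) * (w k / (real deg + x) ^ k) <= real deg ^ k * (1 / (real deg + x) ^ k)"
 using w dx by (intro mult_mono divide_right_mono) auto
 thus "case (k, n) of (k, n) => norm (a k n) <= (real deg / (real deg + x)) ^ k"
 using w dx by (simp add: a_def abs_mult power_divide)
 qed
 have lim: "(%n. a k n) \<longlonglongrightarrow> b k" for k
 unfolding a_def b_def by (intro tendsto_mult tendsto_const tendsto_eventually cw_eventually)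
 have summ: "summable (%k. (real deg / (real deg + x)) ^ k)"
 by (rule summable_geometric) (use x in auto)
 have "(%n. suminf (%k. a k n)) \<longlonglongrightarrow> suminf b"
 using tannerys_theorem[OF lim bound summ] by simp
 thus ?thesis unfolding a_def b_def .
qed

definition roots_mean :: "nat => real => real" where
 "roots_mean n x = (SUM y:mforests (q.V n) ends (q.E n).
 rc (mroots (q.V n) y) * x ^ card (mroots (q.V n) y)) / ZZ n x"

context
 fixes M
 assumes M: "is_spectral M"
begin

lemma bd: "bounded_distribution M (real deg)"
 using M unfolding is_spectral_def by blast

lemma ln_Z_limit:
 assumes x: "x > 0"
 shows "(%n. ln (ZZ n x) / real (N n)) \<longlonglongrightarrow> integral\<^sup>L M (%t. ln (t + x))"
proof -
 interpret bounded_distribution M "real deg" by (rule bd)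
 \<comment> \<open>The value 0 at \<open>k = 0\<close> absorbs the index shift of the logarithmic
   series.\<close>
 define w where "w k = (if k = 0 then 0 else 1 / real k)" for k
 have w: "0 <= w k" "w k <= 1" for k by (auto simp: w_def)
 have conv: "(%k. u (Suc k) / (real (Suc k) * (real deg + x) ^ Suc k)) sums S \<longleftrightarrow>
 (%k. u k * (w k / (real deg + x) ^ k)) sums S" for u :: "nat => real" and S
 using sums_Suc_iff[of "%k. u k * (w k / (real deg + x) ^ k)" S] by (simp add: w_def)
 have L: "(%k. (nbr ^^ k) dl1 \<one> * (w k / (real deg + x) ^ k)) sums
 (ln (real deg + x) - integral\<^sup>L M (%t. ln (t + x)))"
 using log_shift_sums(1)[OF x] unfolding spectral_nbr[OF M]
 by (rule conv[of "%k. (nbr ^^ k) dl1 \<one>", THEN iffD1])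
 have "(%n. ln (real deg + x) - (\<Sum>k. cw n k / real (N n) * (w k / (real deg + x) ^ k)))
 \<longlonglongrightarrow> ln (real deg + x) - (ln (real deg + x) - integral\<^sup>L M (%t. ln (t + x)))"
 using series_limit[of x w, OF x w(1) w(2)] L by (intro tendsto_diff tendsto_const) (simp add: sums_iff)
 moreover have "evs (%n. ln (real deg + x) - (\<Sum>k. cw n k / real (N n) * (w k / (real deg + x) ^ k))
 = ln (ZZ n x) / real (N n))"
 using eventually_loopfree
 proof eventually_elim
 case (elim n)
 interpret L: wb_quot_loopfree G f "Sg n" by (rule elim)
 have "(%k. cw n k * (w k / (real deg + x) ^ k)) sums (real (N n) * ln (real deg + x) - ln (ZZ n x))"
 using ln_mZ_sums[OF q.graph L.regular deg_pos x] by (rule conv[THEN iffD1])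
 from sums_divide[OF this, of "real (N n)"]
 have "(%k. cw n k / real (N n) * (w k / (real deg + x) ^ k)) sums
 (ln (real deg + x) - ln (ZZ n x) / real (N n))"
 using N_pos[of n] by (simp add: diff_divide_distrib mult_ac)
 thus ?case by (simp add: sums_iff)
 qed
 ultimately show ?thesis by (auto elim: Lim_transform_eventually)
qed

lemma roots_limit:
 assumes x: "x > 0"
 shows "(%n. roots_mean n x / real (N n)) \<longlonglongrightarrow> integral\<^sup>L M (%t. x / (t + x))"
proof -
 interpret bounded_distribution M "real deg" by (rule bd)
 let ?c = "x / (real deg + x)"
 have dx: "real deg + x > 0" using x by simp
 have conv: "(%k. x * u k / (real deg + x) ^ Suc k) sums S \<longleftrightarrow> (%k. ?c * (u k * (1 / (real deg + x) ^ k))) sums S"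
 for u :: "nat => real" and S by simp
 have c0: "?c ~= 0" using x dx by simp
 have "(%k. ?c * ((nbr ^^ k) dl1 \<one> * (1 / (real deg + x) ^ k))) sums integral\<^sup>L M (%t. x / (t + x))"
 using resolvent_sums[OF x] unfolding spectral_nbr[OF M]
 by (rule conv[of "%k. (nbr ^^ k) dl1 \<one>", THEN iffD1])
 hence L: "?c * (\<Sum>k. (nbr ^^ k) dl1 \<one> * (1 / (real deg + x) ^ k)) = integral\<^sup>L M (%t. x / (t + x))"
 using suminf_mult[of "%k. (nbr ^^ k) dl1 \<one> * (1 / (real deg + x) ^ k)" ?c] c0
 by (simp only: sums_iff summable_cmult_iff) auto
 have "(%n. ?c * (\<Sum>k. cw n k / real (N n) * (1 / (real deg + x) ^ k)))
 \<longlonglongrightarrow> ?c * (\<Sum>k. (nbr ^^ k) dl1 \<one> * (1 / (real deg + x) ^ k))"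
 by (intro tendsto_mult tendsto_const series_limit[OF x]) auto
 moreover have "evs (%n. ?c * (\<Sum>k. cw n k / real (N n) * (1 / (real deg + x) ^ k))
 = roots_mean n x / real (N n))"
 using eventually_loopfree
 proof eventually_elim
 case (elim n)
 interpret L: wb_quot_loopfree G f "Sg n" by (rule elim)
 have "(%k. ?c * (cw n k * (1 / (real deg + x) ^ k))) sums roots_mean n x"
 using mZ_roots_sums[OF q.graph L.regular x] unfolding roots_mean_def by (rule conv[THEN iffD1])
 from sums_divide[OF this, of "real (N n)"]
 have s: "(%k. ?c * (cw n k / real (N n) * (1 / (real deg + x) ^ k))) sums (roots_mean n x / real (N n))"
 by (simp add: mult_ac)
 hence "summable (%k. ?c * (cw n k / real (N n) * (1 / (real deg + x) ^ k)))" by (rule sums_summable)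
 hence "summable (%k. cw n k / real (N n) * (1 / (real deg + x) ^ k))"
 unfolding summable_cmult_iff using c0 by simp
 from suminf_mult[OF this, of ?c] s show ?case by (simp only: sums_iff)
 qed
 ultimately show ?thesis using L by (auto elim: Lim_transform_eventually)
qed

text \<open>A connected quotient has a spanning tree, which with one root contributes
  \<open>x\<close> to \<open>ZZ n x\<close>; after division by \<open>N n\<close>, the lower bound
  \<open>ln x\<close> disappears.\<close>

lemma Lam_nonneg:
 assumes x: "0 < x" "x <= 1"
 shows "integral\<^sup>L M (%t. ln (t + x)) >= 0"
proof (rule LIMSEQ_le[OF N_inv_tendsto[of "ln x"] ln_Z_limit[OF x(1)]])
 have "ln x / real (N n) <= ln (ZZ n x) / real (N n)" for n
 proof (intro divide_right_mono ln_mono)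
 have "x * 1 <= x * real (num_spanning_trees (q.V n) ends (q.E n))"
 using q.tau_pos[of n] x unfolding tau_quot_def by (intro mult_left_mono) auto
 also have "... <= ZZ n x" by (rule mZ_ge_trees[OF q.graph q.V_ne]) (use x in auto)
 finally show "x <= ZZ n x" by simp
 qed (use x mZ_pos[OF q.graph] in auto)
 thus "\<exists>K. \<forall>n\<ge>K. ln x / real (N n) <= ln (ZZ n x) / real (N n)" by blast
qed

text \<open>Above: \<open>x * tau\<close> is at most \<open>ZZ n x\<close>. Below: for small
  \<open>x\<close> half of \<open>ZZ n x\<close> comes from forests with at most
  \<open>ka * N n\<close> roots, and completing these to trees loses only subexponential factors.
  The limit in \<open>n\<close> is taken first, at fixed \<open>x\<close>.\<close>

lemma tau_limit_aux:
 "(%n. ln (real (tau_quot G f (Sg n))) / real (N n)) \<longlonglongrightarrow> integral\<^sup>L M (%t. ln t)"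
proof -
 interpret bounded_distribution M "real deg" by (rule bd)
 let ?h = "integral\<^sup>L M (%t. ln t)" and ?L = "%n. ln (real (tau_quot G f (Sg n))) / real (N n)"
 have lnlim: "(%n. integral\<^sup>L M (%t. ln (t + xs n))) \<longlonglongrightarrow> ?h"
 by (rule ln_integral(2)) (rule Lam_nonneg)
 have lnle: "?h <= integral\<^sup>L M (%t. ln (t + xs n))" for n
 by (rule ln_integral(4)) (rule Lam_nonneg)
 have van: "(%n. integral\<^sup>L M (%t. xs n / (t + xs n))) \<longlonglongrightarrow> 0"
 by (rule resolvent_vanish) (rule Lam_nonneg)
 have up: "evs (%n. ?L n < ?h + e)" if e: "e > 0" for e
 proof -
 obtain j where j: "integral\<^sup>L M (%t. ln (t + xs j)) < ?h + e"
 using order_tendstoD(2)[OF lnlim, of "?h + e"] e by (auto simp: eventually_sequentially)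
 have "(%n. ln (ZZ n (xs j)) / real (N n) - ln (xs j) / real (N n)) \<longlonglongrightarrow>
 integral\<^sup>L M (%t. ln (t + xs j)) - 0"
 by (intro tendsto_diff ln_Z_limit xs N_inv_tendsto)
 from order_tendstoD(2)[OF this, of "?h + e"] j
 have "evs (%n. ln (ZZ n (xs j)) / real (N n) - ln (xs j) / real (N n) < ?h + e)" by simp
 thus ?thesis
 proof eventually_elim
 case (elim n)
 have "xs j * real (tau_quot G f (Sg n)) <= ZZ n (xs j)"
 unfolding tau_quot_def by (rule mZ_ge_trees[OF q.graph q.V_ne]) (use xs[of j] in auto)
 hence "ln (xs j * real (tau_quot G f (Sg n))) <= ln (ZZ n (xs j))"
 using xs[of j] q.tau_pos[of n] mZ_pos[OF q.graph xs(1)] by (intro ln_mono) auto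
 hence "ln (real (tau_quot G f (Sg n))) <= ln (ZZ n (xs j)) - ln (xs j)"
 using xs[of j] q.tau_pos[of n] by (simp add: ln_mult)
 hence "?L n <= (ln (ZZ n (xs j)) - ln (xs j)) / real (N n)"
 by (intro divide_right_mono) auto
 thus ?case using elim by (simp add: diff_divide_distrib)
 qed
 qed
 have low: "evs (%n. ?h - e < ?L n)" if e: "e > 0" for e
 proof -
 \<comment> \<open>The choice of roots and the choice of added edges cost \<open>ett\<close> each;
   another quarter of \<open>e\<close> covers the passage from the integral to
   \<open>ZZ n\<close>.\<close>
 define ett where "ett = e / 4"
 have eta: "ett > 0" using e by (simp add: ett_def)
 obtain ka1 where k1: "ka1 > 0" "!!N (A :: 'g set set) k. finite A ==> rc A <= 1 * real N ==> real k <= ka1 * real N ==>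
 rc (small_subsets A k) <= exp (ett * real N)"
 by (rule small_subsets_subexponential[of 1 ett]) (use eta in auto)
 obtain ka2 where k2: "ka2 > 0" "!!N (A :: 'g qd set) k. finite A ==> rc A <= real deg * real N ==> real k <= ka2 * real N ==>
 rc (small_subsets A k) <= exp (ett * real N)"
 by (rule small_subsets_subexponential[of "real deg" ett]) (use eta deg_pos in auto)
 define ka where "ka = min ka1 ka2"
 have kp: "ka > 0" using k1 k2 by (simp add: ka_def)
 \<comment> \<open>The factor 1/4 leaves room for the factor 2 in Markov's inequality and for
   rounding \<open>ka * N n\<close> down to \<open>k\<close>.\<close>
 obtain j where j: "integral\<^sup>L M (%t. xs j / (t + xs j)) < ka / 4"
 using order_tendstoD(2)[OF van, of "ka / 4"] kp by (auto simp: eventually_sequentially)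
 have e1: "evs (%n. roots_mean n (xs j) / real (N n) < ka / 4)"
 by (rule order_tendstoD(2)[OF roots_limit[OF xs(1)] j])
 have e2: "evs (%n. real (N n) >= 2 / ka)"
 using N_at_top by (auto simp: filterlim_at_top)
 have "(%n. ln (ZZ n (xs j)) / real (N n) - ln 2 / real (N n)) \<longlonglongrightarrow>
 integral\<^sup>L M (%t. ln (t + xs j)) - 0"
 by (intro tendsto_diff ln_Z_limit xs N_inv_tendsto)
 from order_tendstoD(1)[OF this, of "?h - e / 4"] lnle[of j] e
 have e3: "evs (%n. ?h - e / 4 < ln (ZZ n (xs j)) / real (N n) - ln 2 / real (N n))"
 by simp
 from e1 e2 e3 show ?thesis
 proof eventually_elim
 case (elim n)
 let ?V = "q.V n" and ?E = "q.E n" and ?\<tau> = "real (tau_quot G f (Sg n))"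
 have Np: "real (N n) > 0" using N_pos[of n] by simp
 have Zp: "ZZ n (xs j) > 0" using mZ_pos[OF q.graph xs(1)] .
 define k where "k = nat \<lfloor>ka * real (N n)\<rfloor>"
 have kN: "ka * real (N n) >= 2" using elim(2) kp by (simp add: field_simps)
 have k: "real k <= ka * real (N n)" "real k >= ka * real (N n) - 1" "k > 0"
 using kN by (auto simp: k_def)
 have "ZZ n (xs j) <= 2 * rc (few_rooted ?V ends ?E k)"
 proof (rule mZ_le_few_rooted[OF q.graph xs])
 show "(SUM y:mforests ?V ends ?E. rc (mroots ?V y) * xs j ^ card (mroots ?V y))
 <= roots_mean n (xs j) * ZZ n (xs j)" unfolding roots_mean_def using Zp by simp
 have "roots_mean n (xs j) < ka / 4 * real (N n)" using elim(1) Np by (simp add: divide_less_eq)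
 thus "2 * roots_mean n (xs j) <= real k" using k(2) kN by linarith
 show "k > 0" by (rule k(3))
 qed
 also have "rc (few_rooted ?V ends ?E k) <=
 rc (small_subsets ?V k) * (?\<tau> * rc (small_subsets ?E k))"
 using card_few_rooted(1)[OF q.graph q.conn q.V_ne, of n k] unfolding tau_quot_def
 by (metis of_nat_le_iff of_nat_mult)
 also have "... <= exp (ett * real (N n)) * (?\<tau> * exp (ett * real (N n)))"
 proof (intro mult_mono)
 show "rc (small_subsets ?V k) <= exp (ett * real (N n))"
 by (rule k1(2)) (use fin k(1) Np in \<open>auto simp: ka_def intro: order_trans mult_right_mono\<close>)
 have "rc ?E <= real deg * real (N n)"
 using q.cardE[of n] by (metis of_nat_le_iff of_nat_mult)
 thus "rc (small_subsets ?E k) <= exp (ett * real (N n))"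
 by (intro k2(2)) (use q.finE k(1) Np in \<open>auto simp: ka_def intro: order_trans mult_right_mono\<close>)
 qed auto
 finally have "ZZ n (xs j) <= 2 * (exp (ett * real (N n)) * (?\<tau> * exp (ett * real (N n))))" by simp
 hence "ln (ZZ n (xs j)) <= ln (2 * (exp (ett * real (N n)) * (?\<tau> * exp (ett * real (N n)))))"
 using Zp by (intro ln_mono) auto
 also have "... = ln 2 + (ett * real (N n) + (ln ?\<tau> + ett * real (N n)))"
 using q.tau_pos[of n] by (simp add: ln_mult)
 finally have "ln (ZZ n (xs j)) / real (N n) <= (ln 2 + (ett * real (N n) + (ln ?\<tau> + ett * real (N n)))) / real (N n)"
 using Np by (intro divide_right_mono) auto
 also have "... = ln 2 / real (N n) + 2 * ett + ?L n" using Np by (simp add: add_divide_distrib)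
 finally show ?case using elim(3) e unfolding ett_def by linarith
 qed
 qed
 show ?thesis
 proof (rule order_tendstoI)
 fix a assume "a < ?h"
 thus "evs (%n. a < ?L n)" using low[of "?h - a"] by simp
 next
 fix a assume "?h < a"
 thus "evs (%n. ?L n < a)" using up[of "a - ?h"] by simp
 qed
qed

end

theorem tau_limit:
 "(%n. ln (real (tau_quot G f (Sg n))) / real (N n)) \<longlonglongrightarrow> hT"
proof -
 obtain M where M: "is_spectral M" by (rule spectral_exists)
 have "hT = integral\<^sup>L M (%t. ln t)"
 by (rule tree_entropy_eq[OF M]) (rule Lam_nonneg[OF M])
 thus ?thesis using tau_limit_aux[OF M] by simp
qed

theorem log_det_tree_entropy: "log_det_NG G f = ereal (hT)"
proof -
 obtain M where M: "is_spectral M" by (rule spectral_exists)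
 show ?thesis by (rule log_det_eq[OF M]) (rule Lam_nonneg[OF M])
qed

theorem resolvent_limit:
 obtains M where "is_spectral M" "(%j. integral\<^sup>L M (%t. (1 / real (Suc j)) / (t + 1 / real (Suc j)))) \<longlonglongrightarrow> 0"
proof -
 obtain M where M: "is_spectral M" by (rule spectral_exists)
 interpret bounded_distribution M "real deg" using M unfolding is_spectral_def by blast
 have "(%n. integral\<^sup>L M (%t. xs n / (t + xs n))) \<longlonglongrightarrow> 0"
 by (rule resolvent_vanish) (rule Lam_nonneg[OF M])
 thus ?thesis using that[OF M] by (simp add: xs_def)
qed

end

section \<open>Separated sets and sofic entropy\<close>

lemma eln_upper: "x <= ereal c ==> c > 0 ==> eln x <= ereal (ln c)"
 unfolding eln_def by (cases x) auto

lemma eln_lower: "ereal c <= x ==> c > 0 ==> ereal (ln c) <= eln x"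
 unfolding eln_def by (cases x) auto

lemma sep_number_upper:
 assumes "finite K" "key ` M <= K" and "!!fii ps. fii : M ==> ps : M ==> key fii = key ps ==> d fii ps < epp"
 shows "sep_number M d epp <= ereal (rc K)"
 unfolding sep_number_def
proof (rule SUP_least)
 fix F assume F: "F : {F. finite F & F <= M & (ALL x:F. ALL y:F. x ~= y --> d x y >= epp)}"
 have "inj_on key F"
 proof (rule inj_onI, rule ccontr)
 fix x y assume xy: "x : F" "y : F" "key x = key y" "x ~= y"
 hence "d x y >= epp" "x : M" "y : M" using F by auto
 thus False using assms(3)[of x y] xy by linarith
 qed
 hence "card F = card (key ` F)" by (simp add: card_image)
 also have "... <= card K" by (rule card_mono[OF assms(1)]) (use assms(2) F in auto)
 finally show "ereal (rc F) <= ereal (rc K)" by simp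
qed

lemma sep_number_lower:
 assumes "finite F" "F <= M" "!!x y. x : F ==> y : F ==> x ~= y ==> d x y >= epp"
 shows "ereal (rc F) <= sep_number M d epp"
 unfolding sep_number_def by (rule SUP_upper) (use assms in auto)

text \<open>For a pseudometric with values 0 and 1, the normalized l2 distance only counts the
  cosets where the maps disagree.\<close>

lemma rho_2_count:
 assumes V: "finite V" "V ~= {}" and "!!A. A : V ==> rh (fii A) (ps A) = of_bool (P A)"
 shows "rho_2 V rh fii ps <= dl \<longleftrightarrow> 0 <= dl & rc {A : V. P A} <= dl^2 * rc V"
proof -
 have "(SUM A:V. (rh (fii A) (ps A))^2) = (SUM A:V. if P A then 1 else 0)"
 by (intro sum.cong) (auto simp: assms)
 also have "... = rc {A : V. P A}" using V by (simp add: sum.inter_filter[symmetric])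
 finally have e: "rho_2 V rh fii ps = sqrt (rc {A : V. P A} / rc V)"
 unfolding rho_2_def by simp
 have c: "rc V > 0" using V by (simp add: card_gt_0_iff)
 have "sqrt (rc {A : V. P A} / rc V) <= dl \<longleftrightarrow>
 0 <= dl & rc {A : V. P A} / rc V <= dl^2"
 using sqrt_le_D[of "rc {A : V. P A} / rc V" dl]
 real_le_lsqrt[of dl "rc {A : V. P A} / rc V"]
 order_trans[OF real_sqrt_ge_zero[of "rc {A : V. P A} / rc V"], of dl] by auto
 thus ?thesis unfolding e using c by (simp add: divide_le_eq)
qed

lemma rho_inf_pos:
 assumes "finite V" "A : V" "rh (fii A) (ps A) >= epp"
 shows "rho_inf V rh fii ps >= epp"
proof -
 have "rh (fii A) (ps A) <= rho_inf V rh fii ps" unfolding rho_inf_def using assms by (intro Max_ge) auto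
 thus ?thesis using assms by linarith
qed

lemma rho_inf_zero:
 assumes "finite V" "V ~= {}" "!!A. A : V ==> rh (fii A) (ps A) = 0" "epp > 0"
 shows "rho_inf V rh fii ps < epp"
proof -
 have "(%A. rh (fii A) (ps A)) ` V = {0}" using assms by auto
 thus ?thesis unfolding rho_inf_def using assms(4) by simp
qed

section \<open>Functional graphs with few cycles\<close>

text \<open>Converse of \<open>all_lead_measure\<close>: the number of steps to the exit is a
  strictly decreasing rank.\<close>

lemma all_lead_rank:
 assumes "all_lead nx A"
 obtains m :: "'u => nat" where "!!v. v : A ==> nx v : A ==> m (nx v) < m v"
proof -
 have ex: "\<exists>k. (nx ^^ k) v ~: A" if "lead nx A v r" for v r
 using that
 proof (induction rule: lead.induct)
 case (stop r)
 thus ?case by (intro exI[of _ 0]) simp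
 next
 case (step u r)
 then obtain k where "(nx ^^ k) (nx u) ~: A" by blast
 thus ?case by (intro exI[of _ "Suc k"]) (simp add: funpow_swap1)
 qed
 define m where "m v = (LEAST k. (nx ^^ k) v ~: A)" for v
 show ?thesis
 proof (rule that[of m])
 fix v assume v: "v : A"
 obtain r where r: "lead nx A v r" using assms v unfolding all_lead_def by auto
 have P: "(nx ^^ m v) v ~: A" unfolding m_def using ex[OF r] by (rule LeastI_ex)
 have "m v ~= 0"
 proof
 assume "m v = 0"
 thus False using P v by simp
 qed
 then obtain k where k: "m v = Suc k" by (cases "m v") auto
 hence "(nx ^^ k) (nx v) ~: A" using P by (simp add: funpow_swap1)
 hence "m (nx v) <= k" unfolding m_def by (rule Least_le)
 thus "m (nx v) < m v" using k by simp
 qed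
qed

text \<open>\<open>Z\<close> takes from each cycle the vertex that comes first in an enumeration. A
  cycle whose representative is not in \<open>Bad\<close> has at least \<open>L\<close> vertices,
  and distinct cycles are disjoint, so there are at most \<open>card V / L\<close> of these.\<close>

lemma few_cycles:
 fixes nx :: "'v => 'v" and L :: nat
 assumes V: "finite V" and cl: "!!v. v : V ==> nx v : V" and L: "L > 0"
 and good: "!!v. v : V - Bad ==> inj_on (%i. (nx ^^ i) v) {..<L}" and Bad: "finite Bad"
 obtains Z where "Z <= V" "all_lead nx (V - Z)" "rc Z <= rc Bad + rc V / real L"
proof -
 obtain \<iota> :: "'v => nat" where io: "inj_on \<iota> V" using finite_imp_inj_to_nat_seg[OF V] by blast
 have fp: "(nx ^^ a) ((nx ^^ b) v) = (nx ^^ (a + b)) v" for a b v by (simp add: funpow_add)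
 have clk: "(nx ^^ k) v : V" if "v : V" for v k using that by (induction k) (auto simp: cl)
 define per where "per v \<longleftrightarrow> (\<exists>k>0. (nx ^^ k) v = v)" for v
 define Z where "Z = {v : V. per v & (\<forall>j. \<iota> v <= \<iota> ((nx ^^ j) v))}"
 have bk: "\<exists>t. (nx ^^ t) ((nx ^^ i) v) = v" if p: "per v" for v i
 proof -
 obtain k where k: "k > 0" "(nx ^^ k) v = v" using p unfolding per_def by blast
 have kk: "(nx ^^ (k * q)) v = v" for q
 by (induction q) (auto simp: funpow_add k)
 have "i <= k * i" using k by simp
 hence "(nx ^^ (k * i - i)) ((nx ^^ i) v) = (nx ^^ (k * i)) v"
 unfolding fp by simp
 thus ?thesis using kk by auto
 qed
 have reach: "\<exists>k. (nx ^^ k) v : Z" if v: "v : V" for v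
 proof -
 have "~ inj_on (%k. (nx ^^ k) v) (UNIV :: nat set)"
 proof
 assume i: "inj_on (%k. (nx ^^ k) v) (UNIV :: nat set)"
 have "finite (range (%k. (nx ^^ k) v))" by (rule finite_subset[OF _ V]) (use clk[OF v] in auto)
 from finite_imageD[OF this i] show False by simp
 qed
 then obtain a b where ab: "(nx ^^ a) v = (nx ^^ b) v" "a ~= b" unfolding inj_on_def by auto
 obtain i j where ij: "i < j" "(nx ^^ i) v = (nx ^^ j) v"
 proof (cases "a < b")
 case True
 thus ?thesis using that ab by blast
 next
 case False
 hence "b < a" using ab by simp
 thus ?thesis using that ab(1)[symmetric] by blast
 qed
 define p where "p = (nx ^^ i) v"
 have pp: "(nx ^^ (j - i)) p = p" unfolding p_def fp using ij by simp
 obtain t where t: "!!s. \<iota> ((nx ^^ t) p) <= \<iota> ((nx ^^ s) p)"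
 using ex_has_least_nat[of "%_. True" 0 "%s. \<iota> ((nx ^^ s) p)"] by auto
 let ?z = "(nx ^^ t) p"
 have com: "(nx ^^ a) ((nx ^^ b) p) = (nx ^^ b) ((nx ^^ a) p)" for a b
 unfolding fp by (simp add: add.commute)
 have "per ?z" unfolding per_def using ij(1) com[of "j - i" t] pp by (intro exI[of _ "j - i"]) simp
 moreover have "\<iota> ?z <= \<iota> ((nx ^^ s) ?z)" for s using t[of "s + t"] unfolding fp by simp
 moreover have "?z : V" using clk v p_def by auto
 ultimately have "?z : Z" unfolding Z_def by blast
 thus ?thesis unfolding p_def fp by blast
 qed
 define m where "m v = (LEAST k. (nx ^^ k) v : Z)" for v
 have al: "all_lead nx (V - Z)"
 proof (rule all_lead_measure[of _ _ m])
 fix v assume v: "v : V - Z"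
 have P: "(nx ^^ m v) v : Z"
 unfolding m_def using LeastI_ex[of "%k. (nx ^^ k) v : Z"] reach[of v] v by simp
 have "m v ~= 0"
 proof
 assume "m v = 0"
 thus False using P v by simp
 qed
 then obtain k where k: "m v = Suc k" by (cases "m v") auto
 hence "(nx ^^ k) (nx v) : Z" using P by (simp add: funpow_swap1)
 hence "m (nx v) <= k" unfolding m_def by (rule Least_le)
 thus "m (nx v) < m v" using k by simp
 qed
 have ZV: "Z <= V" unfolding Z_def by auto
 have eqz: "z = z'" if z: "z : Z" "z' : Z" and e: "(nx ^^ i) z = (nx ^^ j) z'" for z z' i j
 proof -
 have le: "\<iota> a <= \<iota> b" if a: "a : Z" and b: "b : Z" and ab: "(nx ^^ i) a = (nx ^^ j) b" for a b i j
 proof -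
 obtain t where "(nx ^^ t) ((nx ^^ j) b) = b" using bk[of b j] b unfolding Z_def by auto
 hence "b = (nx ^^ (t + i)) a" using ab by (simp add: funpow_add)
 thus ?thesis using a unfolding Z_def by auto
 qed
 have "\<iota> z = \<iota> z'" using le[OF z e] le[OF z(2,1) e[symmetric]] by simp
 thus ?thesis using io z ZV by (auto dest: inj_onD)
 qed
 have "inj_on (%(z, i). (nx ^^ i) z) ((Z - Bad) \<times> {..<L})"
 proof (rule inj_onI, clarify)
 fix z i z' i' assume z: "z : Z" "z ~: Bad" "z' : Z" and i: "i < L" "i' < L"
 and e: "(nx ^^ i) z = (nx ^^ i') z'"
 have zz: "z = z'" using eqz[OF z(1,3) e] .
 have "inj_on (%i. (nx ^^ i) z) {..<L}" using good z ZV by auto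
 hence "i = i'" using e zz i by (auto dest: inj_onD)
 thus "z = z' & i = i'" using zz by simp
 qed
 hence "card ((Z - Bad) \<times> {..<L}) <= card V"
 by (rule card_inj_on_le) (use V ZV clk in auto)
 hence "rc (Z - Bad) * real L <= rc V"
 by (metis card_cartesian_product card_lessThan of_nat_le_iff of_nat_mult)
 hence 1: "rc (Z - Bad) <= rc V / real L" using L by (simp add: le_divide_eq)
 have "card Z <= card (Z - Bad) + card Bad"
 proof -
 have "card Z <= card ((Z - Bad) Un Bad)" by (rule card_mono) (use V ZV Bad finite_subset in auto)
 also have "... <= card (Z - Bad) + card Bad" by (rule card_Un_le)
 finally show ?thesis .
 qed
 hence "rc Z <= rc Bad + rc V / real L" using 1 by linarith
 thus ?thesis using that ZV al by blast
qed

text \<open>Off \<open>Z\<close> the choices form a forest rooted at \<open>Z\<close>; on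
  \<open>Z\<close> at most \<open>d ^ k\<close> choices remain.\<close>

lemma card_few_cycles:
 assumes G: "fgraph V en Ed" and reg: "!!v. v : V ==> card (inc en Ed v) = d" and d: "d > 0"
 and Y: "!!y. y : Y ==> y : PiE V (inc en Ed) &
 (\<exists>Z\<subseteq>V. card Z <= k & all_lead (%v. other (en (y v)) v) (V - Z))"
 and fin: "finite (few_rooted V en Ed k)"
 shows "card Y <= card (few_rooted V en Ed k) * d ^ k" "finite Y"
proof -
 have "ALL y:Y. \<exists>Z. Z <= V & card Z <= k & all_lead (%v. other (en (y v)) v) (V - Z)"
 using Y by blast
 from bchoice[OF this] obtain Z where
 Z: "!!y. y : Y ==> Z y <= V & card (Z y) <= k & all_lead (%v. other (en (y v)) v) (V - Z y)"
 by auto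
 have fV: "finite V" using fgraph_finite[OF G] by simp
 let ?S = "Sigma (few_rooted V en Ed k) (%p. PiE (fst p) (inc en Ed))"
 let ?h = "%y. ((Z y, restrict y (V - Z y)), restrict y (Z y))"
 have inj: "inj_on ?h Y"
 proof (rule inj_onI)
 fix y y' assume y: "y : Y" "y' : Y" and e: "?h y = ?h y'"
 show "y = y'"
 proof (rule PiE_ext[of y V "inc en Ed"])
 show "y : PiE V (inc en Ed)" "y' : PiE V (inc en Ed)" using Y y by auto
 fix v assume v: "v : V"
 have z: "Z y' = Z y" "restrict y' (V - Z y) = restrict y (V - Z y)" "restrict y' (Z y) = restrict y (Z y)"
 using e by auto
 have "restrict y (V - Z y) v = restrict y' (V - Z y) v" "restrict y (Z y) v = restrict y' (Z y) v"
 using z by auto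
 thus "y v = y' v" using v by (cases "v : Z y") auto
 qed
 qed
 have sub: "?h ` Y <= ?S"
 proof
 fix p assume "p : ?h ` Y"
 then obtain y where y: "y : Y" "p = ?h y" by auto
 have PE: "y : PiE V (inc en Ed)" using Y y by auto
 have "all_lead (%v. other (en (restrict y (V - Z y) v)) v) (V - Z y) = all_lead (%v. other (en (y v)) v) (V - Z y)"
 by (rule all_lead_cong) simp
 hence "restrict y (V - Z y) : rf V en Ed (Z y)"
 unfolding rf_def forests_def using Z[OF y(1)] PE by auto
 thus "p : ?S" using Z[OF y(1)] PE y(2) by (auto simp: few_rooted_def small_subsets_def)
 qed
 have zf: "finite (fst p)" "card (fst p) <= k" "fst p <= V" if "p : few_rooted V en Ed k" for p
 using that fV finite_subset by (auto simp: few_rooted_def small_subsets_def)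
 have finS: "finite ?S"
 using fin zf finite_inc[OF G] by (intro finite_SigmaI finite_PiE) auto
 have cardP: "card (PiE (fst p) (inc en Ed)) <= d ^ k" if p: "p : few_rooted V en Ed k" for p
 proof -
 have "card (PiE (fst p) (inc en Ed)) = (\<Prod>v\<in>fst p. card (inc en Ed v))" by (rule card_PiE[OF zf(1)[OF p]])
 also have "... = d ^ card (fst p)" using reg zf[OF p] by (subst prod.cong[OF refl, of _ _ "%_. d"]) auto
 also have "... <= d ^ k" using d zf[OF p] by (intro power_increasing) auto
 finally show ?thesis .
 qed
 show "finite Y" by (rule finite_imageD[OF finite_subset[OF sub finS] inj])
 have "card Y = card (?h ` Y)" using card_image[OF inj] by simp
 also have "... <= card ?S" by (rule card_mono[OF finS sub])
 also have "... = (SUM p:few_rooted V en Ed k. card (PiE (fst p) (inc en Ed)))"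
 using fin zf finite_inc[OF G] by (intro card_SigmaI) (auto intro!: finite_PiE)
 also have "... <= (SUM p:few_rooted V en Ed k. d ^ k)" by (intro sum_mono cardP)
 finally show "card Y <= card (few_rooted V en Ed k) * d ^ k" by simp
qed

section \<open>Edges of the Cayley graph\<close>

context wb_group
begin

definition ge :: "'g => 'g \<times> nat => 'g ed" where
 "ge g l = {(g, fst l, snd l), (g @@ fst l, inv (fst l), snd l)}"

abbreviation se :: "'g \<times> nat => 'g ed" where "se == ge \<one>"

definition lb :: "'g ed => 'g \<times> nat" where "lb = the_inv_into Lab se"

lemma E_cay_iff: "epp : Ec \<longleftrightarrow> (EX g:cG. EX l:Lab. epp = ge g l)"
 unfolding E_cay_def cay_edges_def Lab_def ge_def by fastforce

lemma ends_ge: "ends (ge g l) = {g, g @@ fst l}"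
 unfolding ends_def ge_def by auto

lemma ge_flip: "g : cG ==> l : Lab ==> ge (g @@ fst l) (linv l) = ge g l"
 unfolding ge_def linv_def using Lab_carrier by (auto simp: m_assoc)

lemma step_neq: "g : cG ==> l : Lab ==> g @@ fst l ~= g"
 using Lab_carrier by (metis l_cancel_one')

lemma ge_inj: "g : cG ==> l : Lab ==> l' : Lab ==> ge g l = ge g l' ==> l = l'"
 using step_neq[of g l'] unfolding ge_def by (auto simp: prod_eq_iff doubleton_eq_iff)

lemma edge_act_ge: "h : cG ==> g : cG ==> l : Lab ==> edge_act G h (ge g l) = ge (h @@ g) l"
 unfolding edge_act_def ge_def using Lab_carrier[of l] by (auto simp: m_assoc)

lemma star_edges_eq: "SE = se ` Lab"
proof (rule equalityI; rule subsetI)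
 fix epp assume "epp : SE"
 then obtain g l where g: "g : cG" "l : Lab" "epp = ge g l" "\<one> : ends epp"
 unfolding star_edges_def E_cay_iff by blast
 then consider "g = \<one>" | "g @@ fst l = \<one>" by (auto simp: ends_ge)
 thus "epp : se ` Lab"
 proof cases
 case 2
 thus ?thesis using ge_flip[OF g(1,2)] g(3) linv_Lab[OF g(2)] by auto
 qed (use g in auto)
next
 fix epp assume "epp : se ` Lab"
 thus "epp : SE" unfolding star_edges_def E_cay_iff using ends_ge by auto
qed

lemma finite_star: "finite (SE)" unfolding star_edges_eq using finite_Lab by simp

lemma inj_se: "inj_on se Lab" by (rule inj_onI) (rule ge_inj[OF one_closed])

lemma lb_se: "l : Lab ==> lb (se l) = l"
 unfolding lb_def by (rule the_inv_into_f_f[OF inj_se])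

lemma lb_Lab: "epp : SE ==> lb epp : Lab" "epp : SE ==> se (lb epp) = epp"
 unfolding star_edges_eq using lb_se by auto

lemma star_p_lb: "epp : SE ==> star_p G epp = fst (lb epp)"
proof -
 assume e: "epp : SE"
 have "ends epp = {\<one>, fst (lb epp)}"
 using ends_ge[of \<one> "lb epp"] lb_Lab[OF e] Lab_carrier by simp
 thus ?thesis unfolding star_p_def by (intro the_equality) (auto simp: doubleton_eq_iff)
qed

lemma star_inv_lb: "epp : SE ==> star_inv G epp = se (linv (lb epp))"
proof -
 assume e: "epp : SE"
 let ?l = "lb epp"
 have l: "?l : Lab" "fst ?l : cG" using lb_Lab[OF e] Lab_carrier by auto
 have "star_inv G epp = edge_act G (inv (fst ?l)) (se ?l)"
 unfolding star_inv_def star_p_lb[OF e] using lb_Lab[OF e] by simp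
 also have "... = ge (inv (fst ?l)) ?l" using edge_act_ge l by simp
 also have "... = se (linv ?l)" using ge_flip[of "inv (fst ?l)" ?l] l by simp
 finally show ?thesis .
qed

lemma carrier_wball: assumes "g : cG" shows "\<exists>k. g : wball k"
proof (rule word_induct[OF assms])
 show "\<exists>k. \<one> : wball k" using one_wball by blast
 fix g l assume "g : cG" "l : Lab" "\<exists>k. g : wball k"
 thus "\<exists>k. g @@ fst l : wball k" using wball_step by blast
qed

lemma finite_in_wball:
 assumes "finite F" "F <= cG"
 obtains k where "F <= wball k"
proof -
 have "\<exists>k. F <= wball k" using assms
 proof (induction F rule: finite_induct)
 case (insert g F)
 then obtain k k' where "F <= wball k" "g : wball k'" using carrier_wball by blast
 hence "insert g F <= wball (max k k')" using wball_mono[of k "max k k'"] wball_mono[of k' "max k k'"] by auto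
 thus ?case by blast
 qed simp
 thus ?thesis using that by blast
qed

definition znx :: "('g => 'g ed) => 'g => 'g" where
 "znx z g = g @@ fst (lb (z g))"

text \<open>A violation of either condition of the model is a finite cycle, of length two in the
  first case, and lies in some ball, where a rank forbids it. One rank on the whole group cannot
  exist, as orbits never stop; hence one for each radius.\<close>

lemma F_modelI:
 assumes z: "z : cG \<rightarrow>\<^sub>E SE"
 and rk: "!!R. \<exists>m::'g => nat. ALL g:wball R. znx z g : wball R --> m (znx z g) < m g"
 shows "z : F_model G f"
proof -
 have st: "z g : SE" if "g : cG" for g using z that by auto
 have c1: "z (g @@ star_p G (z g)) ~= star_inv G (z g)" if g: "g : cG" for g
 proof
 let ?l = "lb (z g)"
 assume a: "z (g @@ star_p G (z g)) = star_inv G (z g)"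
 have l: "?l : Lab" "fst ?l : cG" using lb_Lab[OF st[OF g]] Lab_carrier by auto
 have n1: "znx z g = g @@ fst ?l" by (simp add: znx_def)
 have "z (znx z g) = se (linv ?l)" using a star_p_lb[OF st[OF g]] star_inv_lb[OF st[OF g]] n1 by simp
 hence n2: "znx z (znx z g) = g"
 unfolding znx_def[of z "znx z g"] using n1 lb_se[OF linv_Lab[OF l(1)]] g l by (simp add: fst_linv m_assoc)
 obtain k where k: "{g, znx z g} <= wball k"
 by (rule finite_in_wball[of "{g, znx z g}"]) (use g l n1 in auto)
 obtain m :: "'g => nat" where "ALL g:wball k. znx z g : wball k --> m (znx z g) < m g" using rk by blast
 hence "m (znx z g) < m g" "m (znx z (znx z g)) < m (znx z g)" using k n2 by auto
 thus False using n2 by simp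
 qed
 have c2: False if n: "n >= 2" "gs 1 = gs n" "ALL i:{1..n}. gs i : cG"
 "ALL i:{1..n-1}. ss i : S_set G f & gs i @@ ss i = gs (Suc i) & star_p G (z (gs i)) = ss i"
 for n :: nat and gs ss
 proof -
 obtain k where k: "gs ` {1..n} <= wball k" by (rule finite_in_wball[of "gs ` {1..n}"]) (use n(3) in auto)
 obtain m :: "'g => nat" where m: "ALL g:wball k. znx z g : wball k --> m (znx z g) < m g" using rk by blast
 have step: "m (gs (Suc i)) < m (gs i)" if i: "1 <= i" "i < n" for i
 proof -
 have "i : {1..n-1}" using i by auto
 hence "gs i @@ ss i = gs (Suc i)" "star_p G (z (gs i)) = ss i" using n(4) by blast+
 moreover have "gs i : cG" using n(3) i by auto
 ultimately have "gs (Suc i) = znx z (gs i)" using star_p_lb[OF st, of "gs i"] by (simp add: znx_def)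
 moreover have "gs i : wball k" "gs (Suc i) : wball k" using k i by (auto simp: image_subset_iff)
 ultimately show ?thesis using m by auto
 qed
 have "m (gs (Suc j)) < m (gs 1)" if "1 <= j" "j < n" for j
 using that
 proof (induction j)
 case (Suc j)
 thus ?case using step[of "Suc j"] step[of 1] n by (cases "j = 0") (auto simp: numeral_2_eq_2)
 qed simp
 moreover have "Suc (n - 1) = n" "1 <= n - 1" "n - 1 < n" using n(1) by linarith+
 ultimately have "m (gs n) < m (gs 1)" by metis
 thus False using n(2) by simp
 qed
 show ?thesis unfolding F_model_def using z c1 c2 by blast
qed

primrec traj :: "('g => 'g ed) => nat => 'g" where
 "traj z 0 = \<one>"
| "traj z (Suc i) = znx z (traj z i)"

lemma F_model_star: "z : F_model G f ==> g : cG ==> z g : SE"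
 unfolding F_model_def by auto

lemma traj_wball:
 assumes "z : F_model G f"
 shows "traj z i : wball i" "traj z i : cG"
proof -
 have "traj z i : wball i & traj z i : cG"
 proof (induction i)
 case (Suc i)
 have "lb (z (traj z i)) : Lab" using lb_Lab F_model_star[OF assms] Suc by blast
 thus ?case using Suc wball_step Lab_carrier by (simp add: znx_def del: wball.simps)
 qed simp
 thus "traj z i : wball i" "traj z i : cG" by auto
qed

lemma traj_inj:
 assumes z: "z : F_model G f" and ij: "i < j"
 shows "traj z i ~= traj z j"
proof
 assume e: "traj z i = traj z j"
 define n where "n = j - i + 1"
 define gs where "gs t = traj z (i + t - 1)" for t
 define ss where "ss t = star_p G (z (gs t))" for t
 have c: "gs t : cG" for t using traj_wball[OF z] gs_def by auto
 have st: "z (gs t) : SE" for t using F_model_star[OF z c] .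
 have 1: "n >= 2" "gs 1 = gs n" using ij e by (auto simp: n_def gs_def)
 have 2: "ALL t:{1..n-1}. ss t : S_set G f & gs t @@ ss t = gs (Suc t) & star_p G (z (gs t)) = ss t"
 proof
 fix t assume t: "t : {1..n-1}"
 have "lb (z (gs t)) : Lab" by (rule lb_Lab(1)[OF st])
 hence "ss t : S_set G f" unfolding ss_def star_p_lb[OF st] S_set_def Lab_def by (auto simp: case_prod_beta)
 moreover have "gs (Suc t) = znx z (gs t)"
 proof -
 have "i + Suc t - 1 = Suc (i + t - 1)" using t by auto
 thus ?thesis unfolding gs_def by (simp only: traj.simps)
 qed
 ultimately show "ss t : S_set G f & gs t @@ ss t = gs (Suc t) & star_p G (z (gs t)) = ss t"
 by (simp add: znx_def ss_def star_p_lb[OF st])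
 qed
 have "~ (\<exists>n::nat. \<exists>gs ss. n >= 2 & gs 1 = gs n & (ALL i:{1..n}. gs i : cG) &
 (ALL i:{1..n-1}. ss i : S_set G f & gs i @@ ss i = gs (Suc i) & star_p G (z (gs i)) = ss i))"
 using z unfolding F_model_def by blast
 thus False using 1 2 c by blast
qed

end

context wb_quot
begin

definition qa :: "'g set => 'g \<times> nat => 'g qd" where
 "qa B l = {(B, fst l, snd l), (B #> fst l, inv (fst l), snd l)}"

lemma qa_qe: "g : cG ==> l : Lab ==> qa (g <# H) l = qe g l"
 unfolding qa_def qe_def using coset_rmult Lab_carrier by simp

text \<open>Microstates are moved by left multiplication of cosets, whereas edges of the Cayley
  graph are right steps. Inversion exchanges the two; so coordinate \<open>A\<close> of a microstate
  describes the graph at the vertex \<open>invc A\<close>.\<close>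

definition invc :: "'g set => 'g set" where "invc A = (%a. inv a) ` A"

lemma invc_coset: assumes "g : cG" shows "invc (g <# H) = inv g <# H"
proof -
 have 1: "inv x : inv g <# H" if x: "x : g <# H" and g: "g : cG" for x g
 proof -
 have x': "x : cG" "inv g @@ x : H" using coset_mem[OF g] x by auto
 have "inv (inv g @@ x) : H" using subgroup.m_inv_closed[OF H_sub x'(2)] .
 hence "inv x @@ g : H" using x' g by (simp add: inv_mult_group)
 hence "g @@ (inv x @@ g) @@ inv g : H" using normal.inv_op_closed2[OF H g] by blast
 hence "g @@ inv x : H" using x' g by (simp add: m_assoc)
 thus ?thesis using coset_mem[of "inv g" "inv x"] x' g by simp
 qed
 have "x : invc (g <# H)" if x: "x : inv g <# H" for x
 proof -
 have "inv x : inv (inv g) <# H" using 1[OF x] assms by simp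
 moreover have "x : cG" using coset_mem[of "inv g" x] x assms by auto
 ultimately show ?thesis using assms unfolding invc_def by (auto intro!: image_eqI[of _ _ "inv x"])
 qed
 moreover have "invc (g <# H) <= inv g <# H" unfolding invc_def using 1 assms by auto
 ultimately show ?thesis by blast
qed

lemma invc_invc: "A : V ==> invc (invc A) = A"
 unfolding V_iff using invc_coset by auto

lemma invc_V: "A : V ==> invc A : V"
 unfolding V_iff using invc_coset by auto

lemma bij_invc: "bij_betw invc V V"
 by (rule bij_betw_byWitness[of _ invc]) (auto simp: invc_invc invc_V)

end

section \<open>Topological entropy: upper bound\<close>

lemma rho_F_bool: "rho_F G x y = of_bool (x \<one>\<^bsub>G\<^esub> ~= y \<one>\<^bsub>G\<^esub>)"
 unfolding rho_F_def by simp

context sofic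
begin

abbreviation "fr n == few_rooted (q.V n) ends (q.E n)"

lemma finite_fr: "finite (fr n k)"
 by (rule card_few_rooted(2)[OF q.graph q.conn q.V_ne])

lemma few_rooted_growth:
 assumes e: "e > 0"
 obtains ka where "ka > 0" "evs (%n. \<forall>k. real k <= ka * real (N n) -->
 rc (fr n k) <= exp ((hT + e) * real (N n)))"
proof -
 define ett where "ett = e / 3"
 have eta: "ett > 0" using e by (simp add: ett_def)
 obtain ka1 where k1: "ka1 > 0" "!!N (A :: 'g set set) k. finite A ==> rc A <= 1 * real N ==> real k <= ka1 * real N ==>
 rc (small_subsets A k) <= exp (ett * real N)"
 by (rule small_subsets_subexponential[of 1 ett]) (use eta in auto)
 obtain ka2 where k2: "ka2 > 0" "!!N (A :: 'g qd set) k. finite A ==> rc A <= real deg * real N ==> real k <= ka2 * real N ==>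
 rc (small_subsets A k) <= exp (ett * real N)"
 by (rule small_subsets_subexponential[of "real deg" ett]) (use eta deg_pos in auto)
 have "evs (%n. ln (real (tau_quot G f (Sg n))) / real (N n) < hT + ett)"
 by (rule order_tendstoD(2)[OF tau_limit]) (use eta in simp)
 hence "evs (%n. \<forall>k. real k <= min ka1 ka2 * real (N n) -->
 rc (fr n k) <= exp ((hT + e) * real (N n)))"
 proof eventually_elim
 case (elim n)
 let ?V = "q.V n" and ?E = "q.E n" and ?\<tau> = "real (tau_quot G f (Sg n))"
 have tau: "?\<tau> <= exp ((hT + ett) * real (N n))"
 proof -
 have "ln ?\<tau> <= (hT + ett) * real (N n)" using elim N_pos[of n] by (simp add: divide_less_eq)
 hence "exp (ln ?\<tau>) <= exp ((hT + ett) * real (N n))" by simp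
 thus ?thesis using q.tau_pos[of n] by simp
 qed
 show ?case
 proof (intro allI impI)
 fix k assume k: "real k <= min ka1 ka2 * real (N n)"
 have kk: "real k <= ka1 * real (N n)" "real k <= ka2 * real (N n)"
 by (auto intro!: order_trans[OF k] mult_right_mono)
 have "rc (fr n k) <= rc (small_subsets ?V k) * (?\<tau> * rc (small_subsets ?E k))"
 using card_few_rooted(1)[OF q.graph q.conn q.V_ne, of n k] unfolding tau_quot_def
 by (metis of_nat_le_iff of_nat_mult)
 also have "... <= exp (ett * real (N n)) * (exp ((hT + ett) * real (N n)) * exp (ett * real (N n)))"
 proof (intro mult_mono tau)
 show "rc (small_subsets ?V k) <= exp (ett * real (N n))"
 by (rule k1(2)) (use fin kk in auto)
 have "rc ?E <= real deg * real (N n)"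
 using q.cardE[of n] by (metis of_nat_le_iff of_nat_mult)
 thus "rc (small_subsets ?E k) <= exp (ett * real (N n))"
 by (intro k2(2)) (use q.finE kk in auto)
 qed auto
 also have "... = exp ((hT + e) * real (N n))"
 unfolding exp_add[symmetric] by (simp add: ett_def algebra_simps)
 finally show "rc (fr n k) <= exp ((hT + e) * real (N n))" .
 qed
 qed
 thus ?thesis using that[of "min ka1 ka2"] k1(1) k2(1) by auto
qed

lemma limsup_le_entropy:
 assumes "evs (%n. S n <= ereal (exp (c * real (N n))))"
 shows "limsup (%n. eln (S n) / ereal (real (N n))) <= ereal c"
proof (rule Limsup_bounded)
 show "evs (%n. eln (S n) / ereal (real (N n)) <= ereal c)"
 using assms
 proof eventually_elim
 case (elim n)
 have "eln (S n) <= ereal (ln (exp (c * real (N n))))" by (rule eln_upper[OF elim]) simp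
 hence "eln (S n) / ereal (real (N n)) <= ereal (c * real (N n)) / ereal (real (N n))"
 using N_pos[of n] by (intro ereal_divide_right_mono) auto
 thus ?case using N_pos[of n] by simp
 qed
qed

text \<open>The key of a microstate is the functional graph on the quotient in which every vertex
  follows its chosen edge. At a good vertex it copies a point of the model for \<open>L\<close>
  steps, so the orbit does not return; there are few cycles, and cutting them leaves a forest with
  few roots. As \<open>rho_F\<close> sees only the coordinate at \<open>\<one>\<close>, equal keys
  mean distance 0.\<close>

lemma top_upper:
 assumes epp: "epp > 0" and e: "e > 0"
 shows "(INF W\<in>{W. finite W & W <= cG}. INF dl\<in>{0<..}.
 limsup (%n. eln (sep_number (sofic_Map G (Sg n) (F_model G f) (shift_act G) (rho_F G) W dl)
 (rho_inf (q.V n) (rho_F G)) epp) / ereal (real (N n))))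
 <= ereal (hT + e)"
proof -
 obtain ka0 where k0: "ka0 > 0" "evs (%n. \<forall>k. real k <= ka0 * real (N n) -->
 rc (fr n k) <= exp ((hT + e / 2) * real (N n)))"
 by (rule few_rooted_growth[of "e / 2"]) (use e in auto)
 define ld where "ld = ln (real deg)"
 have ld: "ld >= 0" using deg_pos by (simp add: ld_def)
 \<comment> \<open>The second entry pays, within \<open>e / 2\<close>, for the
   \<open>deg ^ k\<close> choices on the cut vertices.\<close>
 define ka where "ka = min ka0 (e / 2 / (ld + 1))"
 have kp: "ka > 0" using k0 e ld by (simp add: ka_def)
 have kld: "ka * ld <= e / 2"
 proof -
 have "ka * ld <= e / 2 / (ld + 1) * (ld + 1)" using ld e kp by (intro mult_mono) (auto simp: ka_def)
 also have "... = e / 2" using ld by (intro nonzero_eq_divide_eq[THEN iffD1]) auto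
 finally show ?thesis .
 qed
 \<comment> \<open>Cycles of length at least \<open>L\<close> then number at most
   \<open>ka / 4 * N n\<close>.\<close>
 define L where "L = nat \<lceil>4 / ka\<rceil> + 1"
 have L: "L > 0" "1 / real L <= ka / 4"
 proof -
 have "4 / ka <= real L" "real L > 0" unfolding L_def by linarith+
 thus "1 / real L <= ka / 4" using kp by (simp add: field_simps)
 qed (simp add: L_def)
 define W where "W = (%g. inv g) ` wball L"
 have W: "finite W" "W <= cG" "W ~= {}"
 using finite_wball[of L] wball_carrier[of L] one_wball[of L] by (auto simp: W_def)
 define w where "w = rc W"
 have w: "w > 0" using W by (simp add: w_def card_gt_0_iff)
 \<comment> \<open>\<open>rho_2 <= dl\<close> allows a fraction \<open>dl^2\<close> of failures for
   each of the \<open>w\<close> elements of \<open>W\<close>; in total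
   \<open>ka / 4\<close>.\<close>
 define dl where "dl = sqrt (ka / (4 * w))"
 have d: "dl > 0" "w * dl^2 = ka / 4" using kp w by (auto simp: dl_def)
 have "evs (%n. real (N n) >= 2 / ka)"
 using N_at_top by (auto simp: filterlim_at_top)
 hence "evs (%n. sep_number (sofic_Map G (Sg n) (F_model G f) (shift_act G) (rho_F G) W dl)
 (rho_inf (q.V n) (rho_F G)) epp <= ereal (exp ((hT + e) * real (N n))))"
 using k0(2) eventually_loopfree eventually_inj[OF finite_wball[of L] wball_carrier]
 proof eventually_elim
 case (elim n)
 interpret L: wb_quot_loopfree G f "Sg n" by (rule elim)
 let ?V = "q.V n" and ?E = "q.E n" and ?H = "Sg n"
 let ?M = "sofic_Map G ?H (F_model G f) (shift_act G) (rho_F G) W dl"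
 define k where "k = nat \<lfloor>ka * real (N n)\<rfloor>"
 have Np: "real (N n) > 0" using N_pos[of n] by simp
 have k: "real k <= ka * real (N n)" using kp Np by (simp add: k_def)
 have kN: "ka * real (N n) >= 2" using elim(1) kp by (simp add: field_simps)
 define key where "key fii = (\<lambda>B\<in>?V. q.qa B (lb (fii (q.invc B) \<one>)))" for fii
 have st: "fii A : F_model G f" "fii A \<one> : SE" if "fii : ?M" "A : ?V" for fii A
 using that F_model_star unfolding sofic_Map_def by auto
 have keyb: "key fii (b <# ?H) = q.qe n b (lb (fii (inv b <# ?H) \<one>))" "lb (fii (inv b <# ?H) \<one>) : Lab"
 if "fii : ?M" "b : cG" for fii b
 proof -
 have "inv b <# ?H : ?V" using that q.coset_V by auto
 thus l: "lb (fii (inv b <# ?H) \<one>) : Lab" using st(2)[OF that(1)] lb_Lab by auto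
 show "key fii (b <# ?H) = q.qe n b (lb (fii (inv b <# ?H) \<one>))"
 unfolding key_def using that q.coset_V q.invc_coset q.qa_qe[OF that(2) l] by simp
 qed
 have Pkey: "key fii : PiE ?V (inc ends ?E)" if ph: "fii : ?M" for fii
 proof (rule PiE_I)
 fix B assume "B : ?V"
 then obtain b where b: "b : cG" "B = b <# ?H" using q.V_iff by auto
 show "key fii B : inc ends ?E B"
 using keyb[OF ph b(1)] L.inc_qe[OF b(1)] b(2) by (auto simp: bij_betw_def)
 qed (simp add: key_def)
 have Zex: "\<exists>Z\<subseteq>?V. card Z <= k & all_lead (%v. other (ends (key fii v)) v) (?V - Z)" if ph: "fii : ?M" for fii
 proof -
 let ?nx = "%v. other (ends (key fii v)) v"
 define P where "P s A \<longleftrightarrow> fii (s <# A) \<one> ~= shift_act G s (fii A) \<one>" for s A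
 define Bad where "Bad = q.invc ` (UN s:W. {A : ?V. P s A})"
 have Ps: "rc {A : ?V. P s A} <= dl^2 * real (N n)" if "s : W" for s
 proof -
 have "rho_2 ?V (rho_F G) (%A. fii (s <# A)) (%A. shift_act G s (fii A)) <= dl"
 using ph that unfolding sofic_Map_def by auto
 thus ?thesis
 by (subst (asm) rho_2_count[of _ _ _ _ "P s"]) (auto simp: fin q.V_ne P_def rho_F_bool)
 qed
 have finU: "finite (UN s:W. {A : ?V. P s A})" using W fin by auto
 hence finB: "finite Bad" unfolding Bad_def by simp
 have cB: "rc Bad <= ka / 4 * real (N n)"
 proof -
 have "card Bad <= card (UN s:W. {A : ?V. P s A})" unfolding Bad_def by (rule card_image_le[OF finU])
 also have "... <= (SUM s:W. card {A : ?V. P s A})" by (rule card_UN_le[OF W(1)])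
 finally have "rc Bad <= (SUM s:W. rc {A : ?V. P s A})"
 by (metis of_nat_le_iff of_nat_sum)
 also have "... <= (SUM s:W. dl^2 * real (N n))" by (intro sum_mono Ps)
 also have "... = (w * dl^2) * real (N n)" by (simp add: w_def)
 finally show ?thesis using d(2) by simp
 qed
 have nxb: "?nx (b <# ?H) = (b @@ fst (lb (fii (inv b <# ?H) \<one>))) <# ?H" if "b : cG" for b
 using keyb(1)[OF ph that] L.other_qe by simp
 have good: "inj_on (%i. (?nx ^^ i) B) {..<L}" if B: "B : ?V - Bad" for B
 proof -
 obtain b where b: "b : cG" "B = b <# ?H" using B q.V_iff by auto
 let ?A = "inv b <# ?H"
 have AV: "?A : ?V" using b q.coset_V by auto
 have nP: "~ P s ?A" if "s : W" for s
 proof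
 assume "P s ?A"
 hence "q.invc ?A : Bad" unfolding Bad_def using that AV by blast
 thus False using B b q.invc_coset[of "inv b" n] by simp
 qed
 define z where "z = fii ?A"
 have zF: "z : F_model G f" using st(1)[OF ph AV] by (simp add: z_def)
 \<comment> \<open>At a good coset all elements of \<open>W\<close> act equivariantly, so around
   \<open>b\<close> the functional graph repeats the single point \<open>z\<close> on the ball of
   radius \<open>L\<close>.\<close>
 have loc: "fii (inv (b @@ g) <# ?H) \<one> = z g" if g: "g : wball L" for g
 proof -
 have gc: "g : cG" using g wball_carrier by auto
 have "inv g : W" using g by (simp add: W_def)
 hence "fii (inv g <# ?A) \<one> = shift_act G (inv g) z \<one>" using nP unfolding P_def z_def by blast
 also have "... = z g" unfolding shift_act_def using gc by simp
 finally show ?thesis using q.coset_lmult[of "inv b" "inv g" n] gc b by (simp add: inv_mult_group)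
 qed
 have tr: "(?nx ^^ i) B = (b @@ traj z i) <# ?H" if "i <= L" for i
 using that
 proof (induction i)
 case 0
 thus ?case using b by simp
 next
 case (Suc i)
 let ?g = "traj z i"
 have g: "?g : cG" "?g : wball L"
 using traj_wball[OF zF, of i] wball_mono[of i L] Suc.prems by auto
 have "(?nx ^^ Suc i) B = ?nx ((b @@ ?g) <# ?H)" using Suc by simp
 also have "... = (b @@ ?g @@ fst (lb (z ?g))) <# ?H" using nxb[of "b @@ ?g"] loc[OF g(2)] b g by simp
 also have "b @@ ?g @@ fst (lb (z ?g)) = b @@ traj z (Suc i)"
 using b g lb_Lab(1)[OF F_model_star[OF zF g(1)]] Lab_carrier by (simp add: znx_def m_assoc)
 finally show ?case .
 qed
 show ?thesis
 proof (rule inj_onI, rule ccontr)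
 fix i j assume ij: "i : {..<L}" "j : {..<L}" "(?nx ^^ i) B = (?nx ^^ j) B" "i ~= j"
 let ?gi = "traj z i" and ?gj = "traj z j"
 have g: "?gi : cG" "?gi : wball L" "?gj : cG" "?gj : wball L"
 using traj_wball[OF zF, of i] traj_wball[OF zF, of j] wball_mono[of i L] wball_mono[of j L] ij by auto
 have "(b @@ ?gi) <# ?H = (b @@ ?gj) <# ?H" using ij tr by auto
 hence "inv (b @@ ?gi) @@ (b @@ ?gj) : ?H" using q.coset_eq b g by auto
 hence "inv ?gi @@ ?gj : ?H" using b g by (simp add: inv_mult_group m_assoc cancel_left)
 hence "?gi <# ?H = ?gj <# ?H" using q.coset_eq g by auto
 hence "?gi = ?gj" using elim(4) g by auto
 thus False using traj_inj[OF zF] ij(4) by (metis linorder_neqE_nat)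
 qed
 qed
 obtain Z where Z: "Z <= ?V" "all_lead ?nx (?V - Z)" "rc Z <= rc Bad + rc ?V / real L"
 proof (rule few_cycles[OF fin _ L(1) good finB])
 fix v assume "v : ?V"
 thus "?nx v : ?V" using Pkey[OF ph] fgraph_inc(3)[OF q.graph] by (auto simp: PiE_iff)
 qed blast
 have "rc ?V / real L <= ka / 4 * real (N n)" using mult_right_mono[OF L(2), of "real (N n)"] by simp
 hence "rc Z <= ka / 2 * real (N n)" using Z(3) cB by linarith
 hence "card Z <= k" unfolding k_def using kN by linarith
 thus ?thesis using Z by blast
 qed
 have keyeq: "rho_inf ?V (rho_F G) fii ps < epp" if ph: "fii : ?M" "ps : ?M" and e: "key fii = key ps" for fii ps
 proof (rule rho_inf_zero[OF fin q.V_ne _ epp])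
 fix A assume A: "A : ?V"
 then obtain a where a: "a : cG" "A = a <# ?H" using q.V_iff by auto
 have "key fii (inv a <# ?H) = key ps (inv a <# ?H)" using e by simp
 hence "q.qe n (inv a) (lb (fii A \<one>)) = q.qe n (inv a) (lb (ps A \<one>))"
 using keyb(1)[OF ph(1), of "inv a"] keyb(1)[OF ph(2), of "inv a"] a by simp
 hence "lb (fii A \<one>) = lb (ps A \<one>)"
 using L.inc_qe[of "inv a"] keyb(2)[OF ph(1), of "inv a"] keyb(2)[OF ph(2), of "inv a"] a
 by (auto simp: bij_betw_def dest: inj_onD)
 hence "se (lb (fii A \<one>)) = se (lb (ps A \<one>))" by (rule arg_cong)
 hence "fii A \<one> = ps A \<one>"
 unfolding lb_Lab(2)[OF st(2)[OF ph(1) A]] lb_Lab(2)[OF st(2)[OF ph(2) A]] .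
 thus "rho_F G (fii A) (ps A) = 0" by (simp add: rho_F_def)
 qed
 have cY: "card (key ` ?M) <= card (fr n k) * deg ^ k" "finite (key ` ?M)"
 proof -
 have Y: "y : PiE ?V (inc ends ?E) &
 (\<exists>Z\<subseteq>?V. card Z <= k & all_lead (%v. other (ends (y v)) v) (?V - Z))" if yk: "y : key ` ?M" for y
 proof -
 obtain fii where ph: "fii : ?M" "y = key fii" using yk by fast
 show ?thesis unfolding ph(2) by (rule conjI[OF Pkey[OF ph(1)] Zex[OF ph(1)]])
 qed
 show "card (key ` ?M) <= card (fr n k) * deg ^ k"
 by (rule card_few_cycles(1)[OF q.graph L.regular deg_pos Y finite_fr])
 show "finite (key ` ?M)"
 by (rule card_few_cycles(2)[OF q.graph L.regular deg_pos Y finite_fr])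
 qed
 have "sep_number ?M (rho_inf ?V (rho_F G)) epp <= ereal (rc (key ` ?M))"
 by (rule sep_number_upper[where key = key, OF cY(2) subset_refl keyeq])
 also have "rc (key ` ?M) <= rc (fr n k) * real deg ^ k"
 using cY(1) by (metis of_nat_le_iff of_nat_mult of_nat_power)
 also have "... <= exp ((hT + e / 2) * real (N n)) * exp (e / 2 * real (N n))"
 proof (intro mult_mono)
 have "ka * real (N n) <= ka0 * real (N n)" by (intro mult_right_mono) (auto simp: ka_def)
 thus "rc (fr n k) <= exp ((hT + e / 2) * real (N n))"
 using elim(2) k by auto
 have "real deg ^ k = exp (real k * ld)" using deg_pos by (simp add: ld_def exp_of_nat_mult)
 also have "... <= exp (ka * real (N n) * ld)" using k ld by (simp add: mult_right_mono)
 also have "... <= exp (e / 2 * real (N n))" using mult_right_mono[OF kld, of "real (N n)"] by (simp add: mult_ac)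
 finally show "real deg ^ k <= exp (e / 2 * real (N n))" .
 qed auto
 also have "... = exp ((hT + e) * real (N n))"
 unfolding exp_add[symmetric] by (simp add: algebra_simps)
 finally show ?case by simp
 qed
 from limsup_le_entropy[OF this]
 have "(INF dl\<in>{0<..}. limsup (%n. eln (sep_number (sofic_Map G (Sg n) (F_model G f) (shift_act G) (rho_F G) W dl)
 (rho_inf (q.V n) (rho_F G)) epp) / ereal (real (N n)))) <= ereal (hT + e)"
 by (rule INF_lower2[rotated]) (use d in auto)
 thus ?thesis by (rule INF_lower2[rotated]) (use W in auto)
qed

end

section \<open>Topological entropy: lower bound\<close>

lemma closedin_finite_coords:
 assumes F: "finite F" "F <= I" and C: "C <= PiE I S"
 and dep: "!!z z'. z : C ==> z' : PiE I S ==> (!!i. i : F ==> z i = z' i) ==> z' : C"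
 shows "closedin (product_topology (%i. discrete_topology (S i)) I) C"
proof -
 let ?X = "product_topology (%i. discrete_topology (S i)) I"
 have "openin ?X (PiE I S - C)"
 proof (subst openin_subopen, intro ballI)
 fix z assume z: "z : PiE I S - C"
 let ?B = "PiE I (%i. if i : F then {z i} else S i)"
 have "openin ?X ?B"
 proof (subst openin_PiE_gen, intro disjI2 conjI ballI)
 show "finite {i : I. (if i : F then {z i} else S i) ~= topspace (discrete_topology (S i))}"
 by (rule finite_subset[OF _ F(1)]) auto
 show "openin (discrete_topology (S i)) (if i : F then {z i} else S i)" if "i : I" for i
 using z that by auto
 qed
 moreover have "z : ?B" using z by auto
 moreover have "?B <= PiE I S - C"
 proof
 fix z' assume z': "z' : ?B"
 have 1: "z' i : (if i : F then {z i} else S i)" if "i : I" for i using PiE_mem[OF z' that] .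
 have "z' i : S i" if "i : I" for i using 1[OF that] z that by (auto split: if_splits)
 hence "z' : PiE I S" using z' by (auto simp: PiE_iff)
 moreover have "z' ~: C"
 proof
 assume "z' : C"
 moreover have "z' i = z i" if "i : F" for i using 1[of i] that F(2) by auto
 ultimately have "z : C" using dep[of z' z] z by auto
 thus False using z by simp
 qed
 ultimately show "z' : PiE I S - C" by simp
 qed
 ultimately show "\<exists>T. openin ?X T & z : T & T <= PiE I S - C" by blast
 qed
 thus ?thesis unfolding closedin_def using C by simp
qed

section \<open>Extending finite patterns to points of the model\<close>

context wb_group
begin

definition avoid :: "'g set => ('g \<times> 'g) set" where
 "avoid S = {(g, g @@ fst l) | g l. g : cG - S & l : Lab & g @@ fst l ~: S}"

lemma avoidI: "g : cG ==> g ~: S ==> l : Lab ==> g @@ fst l ~: S ==> (g, g @@ fst l) : avoid S"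
 unfolding avoid_def by (intro CollectI exI[of _ g] exI[of _ l]) auto

lemma avoidE:
 assumes "(g, h) : avoid S"
 obtains l where "g : cG" "g ~: S" "l : Lab" "h = g @@ fst l" "h ~: S"
 using assms unfolding avoid_def by (elim CollectE exE) (simp only: prod.inject Diff_iff, blast)

lemma avoid_sym: "(g, h) : avoid S ==> (h, g) : avoid S"
proof -
 assume "(g, h) : avoid S"
 then obtain l where l: "g : cG" "g ~: S" "l : Lab" "h = g @@ fst l" "h ~: S" by (rule avoidE)
 have e: "g = h @@ fst (linv l)" using l Lab_carrier by (simp add: fst_linv m_assoc)
 have hc: "h : cG" using l Lab_carrier(1)[OF l(3)] by simp
 have "(h, h @@ fst (linv l)) : avoid S"
 by (rule avoidI[OF hc l(5) linv_Lab[OF l(3)]]) (simp only: e[symmetric] l(2) not_False_eq_True)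
 thus ?thesis using e by simp
qed

lemma avoid_rtrancl_sym: "(g, h) : (avoid S)^* ==> (h, g) : (avoid S)^*"
 by (meson avoid_sym symD symI sym_rtrancl)

text \<open>The finite components of the complement of \<open>W0\<close> are added to it. Each
  contains a neighbour of \<open>W0\<close>, so there are finitely many, and from every vertex left
  outside one can escape to infinity without entering \<open>W'\<close>.\<close>

lemma fill:
 assumes W0: "finite W0" "W0 <= cG" "\<one> : W0"
 obtains W' where "W0 <= W'" "finite W'" "W' <= cG"
 "!!g F. g : cG - W' ==> finite F ==> \<exists>g'. g' ~: F & (g, g') : (avoid W')^*"
proof -
 let ?R = "avoid W0"
 define cmp where "cmp g = (?R^*) `` {g}" for g
 define W' where "W' = W0 Un {g : cG - W0. finite (cmp g)}"
 have same: "cmp h = cmp g" if "(g, h) : ?R^*" for g h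
 proof -
 have "(h, g) : ?R^*" by (rule avoid_rtrancl_sym[OF that])
 thus ?thesis unfolding cmp_def using that by (auto intro: rtrancl_trans)
 qed
 define Nb where "Nb = (%(w, l). w @@ fst l) ` (W0 \<times> Lab)"
 have hit: "g : W0 | (EX h:Nb. (h, g) : ?R^*)" if "g : cG" for g
 proof (rule word_induct[OF that])
 show "\<one> : W0 | (EX h:Nb. (h, \<one>) : ?R^*)" using W0 by simp
 fix g l assume g: "g : cG" "l : Lab" and IH: "g : W0 | (EX h:Nb. (h, g) : ?R^*)"
 show "g @@ fst l : W0 | (EX h:Nb. (h, g @@ fst l) : ?R^*)"
 proof (cases "g @@ fst l : W0 | g : W0")
 case True
 thus ?thesis using g by (auto simp: Nb_def)
 next
 case False
 hence "(g, g @@ fst l) : ?R" using g by (intro avoidI) auto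
 moreover obtain h where "h : Nb" "(h, g) : ?R^*" using IH False by blast
 ultimately show ?thesis by (meson rtrancl.rtrancl_into_rtrancl)
 qed
 qed
 have "W' <= W0 Un (UN h:{h : Nb. finite (cmp h)}. cmp h)"
 proof
 fix g assume g: "g : W'"
 show "g : W0 Un (UN h:{h : Nb. finite (cmp h)}. cmp h)"
 proof (cases "g : W0")
 case False
 hence gc: "g : cG" "finite (cmp g)" using g by (auto simp: W'_def)
 obtain h where h: "h : Nb" "(h, g) : ?R^*" using hit[OF gc(1)] False by blast
 have "cmp h = cmp g" using same[OF h(2)] by simp
 moreover have "g : cmp g" by (simp add: cmp_def)
 ultimately show ?thesis using h gc by auto
 qed simp
 qed
 moreover have "finite Nb" unfolding Nb_def using W0 finite_Lab by auto
 ultimately have fW: "finite W'" using W0 by (auto elim!: finite_subset)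
 have cW: "W' <= cG" using W0 by (auto simp: W'_def)
 show ?thesis
 proof (rule that[OF _ fW cW])
 show "W0 <= W'" by (auto simp: W'_def)
 fix g F assume g: "g : cG - W'" and F: "finite (F :: 'g set)"
 have inf: "infinite (cmp g)" using g by (auto simp: W'_def)
 then obtain g' where g': "g' : cmp g" "g' ~: F" using F by (meson finite_subset subsetI)
 have "(g, x) : (avoid W')^*" if "(g, x) : ?R^*" for x
 using that
 proof (induction rule: rtrancl_induct)
 case (step y x)
 have out: "u ~: W'" if "(g, u) : ?R^*" "u ~: W0" for u
 using same[OF that(1)] inf that(2) by (auto simp: W'_def)
 obtain l where l: "y : cG" "y ~: W0" "l : Lab" "x = y @@ fst l" "x ~: W0"
 using step.hyps(2) by (rule avoidE)
 have "y ~: W'" "x ~: W'" using out step.hyps l by (auto intro: rtrancl.rtrancl_into_rtrancl)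
 hence "(y, x) : avoid W'" unfolding l(4) using l by (intro avoidI) auto
 thus ?case using step.IH by simp
 qed simp
 thus "\<exists>g'. g' ~: F & (g, g') : (avoid W')^*" using g' by (auto simp: cmp_def)
 qed
qed

text \<open>Compactness: \<open>C R\<close> consists of the extensions of \<open>p\<close> having a
  rank on the ball of radius \<open>R\<close>. It contains the configuration that outside
  \<open>W'\<close> heads for the complement of the ball along shortest paths avoiding
  \<open>W'\<close>. These closed sets are nested in a compact product of finite sets.\<close>

lemma F_model_extend:
 fixes mW :: "'g => nat"
 assumes W': "finite W'" "W' <= cG"
 and esc: "!!g F. g : cG - W' ==> finite F ==> \<exists>g'. g' ~: F & (g, g') : (avoid W')^*"
 and p: "!!g. g : W' ==> p g : Lab"
 and rk: "!!g. g : W' ==> g @@ fst (p g) : W' ==> mW (g @@ fst (p g)) < mW g"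
 obtains z where "z : F_model G f" "!!g. g : W' ==> z g = se (p g)"
proof -
 let ?S = "SE"
 let ?X = "product_topology (%_. discrete_topology ?S) (cG)"
 define C where "C R = {z : cG \<rightarrow>\<^sub>E ?S. (ALL g:W'. z g = se (p g)) &
 (\<exists>m::'g => nat. ALL g:wball R. znx z g : wball R --> m (znx z g) < m g)}" for R
 obtain l0 where l0: "l0 : Lab" using deg_pos unfolding deg_def by (metis card_gt_0_iff equals0I)
 have ne: "C R ~= {}" for R
 proof -
 let ?F = "wball R Un W'"
 have finF: "finite ?F" using finite_wball W' by auto
 define P where "P g k \<longleftrightarrow> (\<exists>g'. g' ~: ?F & (g, g') : avoid W' ^^ k)" for g k
 define m where "m g = (LEAST k. P g k)" for g
 have Pm: "P g (m g)" if g: "g : cG - W'" for g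
 proof -
 obtain g' where "g' ~: ?F" "(g, g') : (avoid W')^*" using esc[OF g finF] by blast
 hence "\<exists>k. P g k" unfolding P_def rtrancl_power by blast
 thus ?thesis unfolding m_def by (rule LeastI_ex)
 qed
 have ex: "\<exists>l. l : Lab & g @@ fst l ~: W' & m (g @@ fst l) < m g" if g: "g : wball R - W'" for g
 proof -
 have gc: "g : cG - W'" using g wball_carrier by auto
 obtain g' where g': "g' ~: ?F" "(g, g') : avoid W' ^^ m g" using Pm[OF gc] unfolding P_def by blast
 have "m g ~= 0"
 proof
 assume "m g = 0"
 thus False using g' g by simp
 qed
 then obtain k where k: "m g = Suc k" by (cases "m g") auto
 have "(g, g') : avoid W' ^^ Suc k" using g'(2) k by simp
 from relpow_Suc_D2[OF this] obtain h where h: "(g, h) : avoid W'" "(h, g') : avoid W' ^^ k" by blast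
 obtain l where l: "l : Lab" "h = g @@ fst l" "h ~: W'" using h(1) by (rule avoidE)
 have "m h <= k" unfolding m_def by (rule Least_le) (use h g' in \<open>auto simp: P_def\<close>)
 thus ?thesis using l k by (intro exI[of _ l]) auto
 qed
 define q where "q g = (if g : W' then p g else if g : wball R
 then SOME l. l : Lab & g @@ fst l ~: W' & m (g @@ fst l) < m g else l0)" for g
 have q1: "q g : Lab & g @@ fst (q g) ~: W' & m (g @@ fst (q g)) < m g" if g: "g : wball R - W'" for g
 using someI_ex[OF ex[OF g]] g unfolding q_def by simp
 have qL: "q g : Lab" for g
 proof (cases "g : wball R - W'")
 case True
 thus ?thesis using q1 by blast
 next
 case False
 thus ?thesis using p l0 by (auto simp: q_def)
 qed
 define z where "z = (\<lambda>g\<in>cG. se (q g))"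
 have zn: "znx z g = g @@ fst (q g)" if "g : cG" for g
 using that lb_se[OF qL] by (simp add: znx_def z_def)
 define B where "B = Suc (Max (m ` ?F))"
 have mB: "m g < B" if "g : ?F" for g
 using Max_ge[of "m ` ?F" "m g"] finF that unfolding B_def by (simp add: less_Suc_eq_le)
 \<comment> \<open>Orbits may leave \<open>W'\<close> but the constructed \<open>z\<close> never
   lets them re-enter from inside the ball, so the rank on \<open>W'\<close> is lifted above all
   values outside.\<close>
 define m' where "m' g = (if g : W' then B + mW g else m g)" for g
 have "m' (znx z g) < m' g" if g: "g : wball R" "znx z g : wball R" for g
 proof -
 have gc: "g : cG" using g wball_carrier by auto
 show ?thesis
 proof (cases "g : W'")
 case True
 hence e: "znx z g = g @@ fst (p g)" using zn[OF gc] by (simp add: q_def)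
 show ?thesis
 proof (cases "znx z g : W'")
 case T2: True
 thus ?thesis using rk[OF True] e True by (simp add: m'_def)
 next
 case False
 thus ?thesis using mB[of "znx z g"] g True by (simp add: m'_def)
 qed
 next
 case False
 hence "znx z g ~: W' & m (znx z g) < m g" using q1[of g] zn[OF gc] g by simp
 thus ?thesis using False by (simp add: m'_def)
 qed
 qed
 moreover have "z : cG \<rightarrow>\<^sub>E ?S" using qL by (auto simp: z_def star_edges_eq)
 moreover have "z g = se (p g)" if "g : W'" for g using that W' by (auto simp: z_def q_def)
 ultimately have "z : C R" unfolding C_def by blast
 thus ?thesis by blast
 qed
 have cl: "closedin ?X (C R)" for R
 proof (rule closedin_finite_coords[of "wball R Un W'"])
 show "finite (wball R Un W')" "wball R Un W' <= cG" using finite_wball wball_carrier W' by auto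
 show "C R <= cG \<rightarrow>\<^sub>E ?S" by (auto simp: C_def)
 fix z z' assume z: "z : C R" "z' : cG \<rightarrow>\<^sub>E ?S" and e: "!!g. g : wball R Un W' ==> z g = z' g"
 have "znx z' g = znx z g" if "g : wball R" for g using e[of g] that by (simp add: znx_def)
 thus "z' : C R" using z e unfolding C_def by auto
 qed
 have dec: "decseq C"
 proof (rule decseq_SucI, rule subsetI)
 fix R z assume z: "z : C (Suc R)"
 have "wball R <= wball (Suc R)" by (rule wball_mono) simp
 thus "z : C R" using z unfolding C_def by blast
 qed
 have "compact_space ?X" by (rule compact_space_product_topology[THEN iffD2]) (auto simp: compact_space_discrete_topology finite_star)
 hence "(\<Inter>n. C n) ~= {}" by (rule compact_space_imp_nest[OF _ cl ne dec])
 then obtain z where z: "!!R. z : C R" by blast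
 have "z : F_model G f"
 by (rule F_modelI) (use z in \<open>auto simp: C_def\<close>)
 moreover have "z g = se (p g)" if "g : W'" for g using z[of 0] that by (auto simp: C_def)
 ultimately show ?thesis using that by blast
qed

end

section \<open>Microstates from rooted spanning trees\<close>

context sofic
begin

lemma limsup_ge_entropy:
 assumes "evs (%n. ereal (c * real (tau_quot G f (Sg n))) <= S n)" "c > 0"
 shows "ereal (hT) <= limsup (%n. eln (S n) / ereal (real (N n)))"
proof -
 let ?Y = "%n. ln c / real (N n) + ln (real (tau_quot G f (Sg n))) / real (N n)"
 have "?Y \<longlonglongrightarrow> 0 + hT" by (intro tendsto_add N_inv_tendsto tau_limit)
 hence "limsup (%n. ereal (?Y n)) = ereal (hT)" by (intro lim_imp_Limsup) auto
 moreover have "limsup (%n. ereal (?Y n)) <= limsup (%n. eln (S n) / ereal (real (N n)))"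
 proof (rule Limsup_mono)
 show "evs (%n. ereal (?Y n) <= eln (S n) / ereal (real (N n)))"
 using assms(1)
 proof eventually_elim
 case (elim n)
 have t: "real (tau_quot G f (Sg n)) > 0" using q.tau_pos[of n] by simp
 have "ereal (ln (c * real (tau_quot G f (Sg n)))) <= eln (S n)"
 by (rule eln_lower[OF elim]) (use t assms in simp)
 hence "ereal (ln (c * real (tau_quot G f (Sg n)))) / ereal (real (N n)) <= eln (S n) / ereal (real (N n))"
 using N_pos[of n] by (intro ereal_divide_right_mono) auto
 thus ?case using t assms(2) N_pos[of n] by (simp add: ln_mult add_divide_distrib)
 qed
 qed
 ultimately show ?thesis by simp
qed

text \<open>An oriented spanning tree looks like a point of the model except near its root. Away
  from the root its pattern on \<open>W'\<close> extends to such a point; the boundedly many other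
  cosets get a default value. Only boundedly many trees, independently of \<open>n\<close>, can
  share their data off these cosets.\<close>

lemma top_lower:
 assumes W: "finite W" "W <= cG" and dl: "dl > 0"
 shows "ereal (hT) <=
 limsup (%n. eln (sep_number (sofic_Map G (Sg n) (F_model G f) (shift_act G) (rho_F G) W dl)
 (rho_inf (q.V n) (rho_F G)) 1) / ereal (real (N n)))"
proof -
 \<comment> \<open>\<open>\<one>\<close> is the coordinate seen by \<open>rho_F\<close>; the
   inverses are the coordinates that the elements of \<open>W\<close> shift to
   \<open>\<one>\<close>.\<close>
 define W0 where "W0 = insert \<one> ((%g. inv g) ` W)"
 obtain W' where W': "W0 <= W'" "finite W'" "W' <= cG"
 and esc: "!!g F. g : cG - W' ==> finite F ==> \<exists>g'. g' ~: F & (g, g') : (avoid W')^*"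
 by (rule fill[of W0]) (use W in \<open>auto simp: W0_def\<close>)
 have one: "\<one> : W'" using W' by (auto simp: W0_def)
 \<comment> \<open>Extending the empty pattern yields a default point; this already requires that
   the group be infinite and connected by generators.\<close>
 obtain z0 where z0: "z0 : F_model G f"
 proof -
 have esc0: "\<exists>g'. g' ~: F & (g, g') : (avoid {})^*" if gF: "g : cG - {}" "finite F" for g F
 proof -
 have r: "(\<one>, x) : (avoid {})^*" if "x : cG" for x
 proof (rule word_induct[OF that])
 fix g l assume g: "g : cG" "l : Lab" "(\<one>, g) : (avoid {})^*"
 have "(g, g @@ fst l) : avoid {}" using g by (intro avoidI) auto
 thus "(\<one>, g @@ fst l) : (avoid {})^*" using g(3) by simp
 qed simp
 obtain x where x: "x : cG" "x ~: F" using inf gF(2) by (meson finite_subset subsetI)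
 have "(g, x) : (avoid {})^*" using rtrancl_trans[OF avoid_rtrancl_sym[OF r] r[OF x(1)]] gF by blast
 thus ?thesis using x by blast
 qed
 show ?thesis by (rule F_model_extend[of "{}", OF _ _ esc0]) (use that in auto)
 qed
 define cW where "cW = card W'"
 \<comment> \<open>Equivariance under \<open>s\<close> can fail at \<open>A\<close> if
   \<open>A\<close> or \<open>s <# A\<close> is affected by the root, so at most
   \<open>2 * cW\<close> times.\<close>
 have "evs (%n. real (N n) >= 2 * real cW / dl^2)"
 using N_at_top by (auto simp: filterlim_at_top)
 hence "evs (%n. ereal (1 / real deg ^ cW * real (tau_quot G f (Sg n))) <=
 sep_number (sofic_Map G (Sg n) (F_model G f) (shift_act G) (rho_F G) W dl)
 (rho_inf (q.V n) (rho_F G)) 1)"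
 using eventually_loopfree
 proof eventually_elim
 case (elim n)
 interpret L: wb_quot_loopfree G f "Sg n" by (rule elim)
 let ?V = "q.V n" and ?E = "q.E n" and ?H = "Sg n"
 let ?M = "sofic_Map G ?H (F_model G f) (shift_act G) (rho_F G) W dl"
 define r where "r = \<one> <# ?H"
 have rV: "r : ?V" unfolding r_def by (rule q.coset_V) simp
 define Y where "Y = rf ?V ends ?E {r}"
 have cY: "card Y = tau_quot G f ?H" unfolding Y_def tau_quot_def by (rule num_spanning_trees_rf[OF q.graph rV, symmetric])
 have finY: "finite Y" unfolding Y_def by (rule finite_rf[OF q.graph])
 define yl where "yl y b = inv_into Lab (q.qe n b) (y (b <# ?H))" for y b
 have yl: "yl y b : Lab" "q.qe n b (yl y b) = y (b <# ?H)" if "y : Y" "b : cG" "b <# ?H ~= r" for y b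
 proof -
 have yP: "y : PiE (?V - {r}) (inc ends ?E)" using that(1) unfolding Y_def rf_def forests_def by simp
 have bV: "b <# ?H : ?V - {r}" using that q.coset_V by simp
 have "y (b <# ?H) : inc ends ?E (b <# ?H)" using PiE_mem[OF yP bV] .
 hence *: "y (b <# ?H) : q.qe n b ` Lab" using L.inc_qe[OF that(2)] by (simp add: bij_betw_def)
 show "yl y b : Lab" unfolding yl_def by (rule inv_into_into[OF *])
 show "q.qe n b (yl y b) = y (b <# ?H)" unfolding yl_def by (rule f_inv_into_f[OF *])
 qed
 \<comment> \<open>The cosets \<open>b <# ?H\<close> for which the translate of \<open>W'\<close> by
   \<open>b\<close> meets the root.\<close>
 define bad where "bad = (%g. inv g <# ?H) ` W'"
 have badV: "bad <= ?V" using W' q.coset_V by (auto simp: bad_def)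
 have cbad: "card bad <= cW" unfolding bad_def cW_def by (rule card_image_le[OF W'(2)])
 have finbad: "finite bad" unfolding bad_def using W' by simp
 have goodb: "(b @@ g) <# ?H ~= r" if "b : cG" "b <# ?H ~: bad" "g : W'" for b g
 proof
 assume a: "(b @@ g) <# ?H = r"
 have g: "g : cG" using that W' by auto
 have "inv \<one> @@ (b @@ g) : ?H" using a q.coset_eq[of \<one> "b @@ g" n] that g unfolding r_def by auto
 hence "b @@ g : ?H" using that g by simp
 hence "g @@ (b @@ g) @@ inv g : ?H" using normal.inv_op_closed2[OF nor g] by blast
 hence "inv (inv g) @@ b : ?H" using that g by (simp add: m_assoc)
 hence "b <# ?H = inv g <# ?H" using q.coset_eq[of "inv g" b n] that g by simp
 thus False using that by (auto simp: bad_def)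
 qed
 have zex: "\<exists>z. z : F_model G f & (ALL g:W'. z g = se (yl y (b @@ g)))"
 if y: "y : Y" and b: "b : cG" "b <# ?H ~: bad" for y b
 proof -
 have "all_lead (%v. other (ends (y v)) v) (?V - {r})" using y by (simp add: Y_def rf_def forests_def)
 then obtain m :: "'g set => nat" where
 m: "!!v. v : ?V - {r} ==> other (ends (y v)) v : ?V - {r} ==> m (other (ends (y v)) v) < m v"
 using all_lead_rank by blast
 have oth: "other (ends (y ((b @@ g) <# ?H))) ((b @@ g) <# ?H) = (b @@ (g @@ fst (yl y (b @@ g)))) <# ?H"
 if g: "g : W'" for g
 proof -
 have gc: "b @@ g : cG" "g : cG" using g W' b by auto
 note l = yl[OF y gc(1) goodb[OF b g]]
 have "other (ends (q.qe n (b @@ g) (yl y (b @@ g)))) ((b @@ g) <# ?H) = (b @@ g @@ fst (yl y (b @@ g))) <# ?H"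
 by (rule L.other_qe)
 thus ?thesis using l gc b Lab_carrier(1)[OF l(1)] by (simp add: m_assoc)
 qed
 show ?thesis
 proof (rule F_model_extend[of W' "%g. yl y (b @@ g)" "%g. m ((b @@ g) <# ?H)"])
 fix g assume g: "g : W'"
 have gc: "b @@ g : cG" using g W' b by auto
 show "yl y (b @@ g) : Lab" using yl[OF y gc goodb[OF b g]] by simp
 assume g': "g @@ fst (yl y (b @@ g)) : W'"
 have "(b @@ g) <# ?H : ?V - {r}" "(b @@ (g @@ fst (yl y (b @@ g)))) <# ?H : ?V - {r}"
 using goodb[OF b g] goodb[OF b g'] gc g' W' b q.coset_V by auto
 thus "m ((b @@ (g @@ fst (yl y (b @@ g)))) <# ?H) < m ((b @@ g) <# ?H)"
 using m[of "(b @@ g) <# ?H"] oth[OF g] by simp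
 qed (use W' esc in auto)
 qed
 define rep where "rep B = (SOME b. b : cG & B = b <# ?H)" for B
 have rep: "rep B : cG & B = rep B <# ?H" if "B : ?V" for B
 unfolding rep_def by (rule someI_ex) (use that q.V_iff in auto)
 define ph where "ph y = (\<lambda>A\<in>?V. if q.invc A : bad then z0
 else SOME z. z : F_model G f & (ALL g:W'. z g = se (yl y (rep (q.invc A) @@ g))))" for y
 \<comment> \<open>Labels belong to cosets although \<open>inv_into\<close> is formed with
   representatives: for representatives of one coset the functions \<open>q.qe n b\<close> agree on
   \<open>Lab\<close>.\<close>
 have ylc: "yl y b = yl y b'" if "b : cG" "b' : cG" "b <# ?H = b' <# ?H" for y b b'
 proof -
 have "q.qe n b l = q.qe n b' l" if "l : Lab" for l using q.qe_cong[of b n b' l] that \<open>b <# ?H = b' <# ?H\<close>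
 \<open>b : cG\<close> \<open>b' : cG\<close> by auto
 hence "inv_into Lab (q.qe n b) x = inv_into Lab (q.qe n b') x" for x
 unfolding inv_into_def by (metis (no_types, lifting))
 thus ?thesis using that by (simp add: yl_def)
 qed
 have ph1: "ph y A : F_model G f" if "y : Y" "A : ?V" for y A
 proof (cases "q.invc A : bad")
 case False
 have B: "q.invc A : ?V" by (rule q.invc_V[OF that(2)])
 have "\<exists>z. z : F_model G f & (ALL g:W'. z g = se (yl y (rep (q.invc A) @@ g)))"
 by (rule zex[OF that(1)]) (use rep[OF B] False in auto)
 from someI_ex[OF this] show ?thesis using False that by (simp add: ph_def)
 qed (use z0 that in \<open>simp add: ph_def\<close>)
 have ph2: "ph y (inv b <# ?H) g = se (yl y (b @@ g))"
 if "y : Y" "b : cG" "b <# ?H ~: bad" "g : W'" for y b g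
 proof -
 let ?A = "inv b <# ?H"
 have A: "?A : ?V" "q.invc ?A = b <# ?H" using that q.coset_V q.invc_coset[of "inv b" n] by auto
 have B: "b <# ?H : ?V" using that q.coset_V by auto
 let ?c = "rep (b <# ?H)"
 have c: "?c : cG" "b <# ?H = ?c <# ?H" using rep[OF B] by auto
 have "\<exists>z. z : F_model G f & (ALL g:W'. z g = se (yl y (?c @@ g)))"
 by (rule zex[OF that(1) c(1)]) (use c that in auto)
 from someI_ex[OF this] have "ph y ?A g = se (yl y (?c @@ g))" using that A by (simp add: ph_def)
 moreover have "yl y (?c @@ g) = yl y (b @@ g)"
 proof (rule ylc)
 have g: "g : cG" using that W' by auto
 thus "?c @@ g : cG" "b @@ g : cG" using c that by auto
 show "(?c @@ g) <# ?H = (b @@ g) <# ?H" using q.coset_rmult[OF c(1) g] q.coset_rmult[OF that(2) g] c by metis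
 qed
 ultimately show ?thesis by simp
 qed
 have phM: "ph y : ?M" if y: "y : Y" for y
 unfolding sofic_Map_def
 proof (intro CollectI conjI ballI)
 show "ph y : ?V \<rightarrow>\<^sub>E F_model G f" using ph1[OF y] by (auto simp: ph_def)
 fix s assume s: "s : W"
 have sc: "s : cG" using s W by auto
 define P where "P A \<longleftrightarrow> ph y (s <# A) \<one> ~= shift_act G s (ph y A) \<one>" for A
 have "{A : ?V. P A} <= q.invc ` bad Un (%B. inv s <# q.invc B) ` bad"
 proof
 fix A assume A: "A : {A : ?V. P A}"
 then obtain b where b: "b : cG" "q.invc A = b <# ?H" using q.invc_V q.V_iff by blast
 have Ab: "A = inv b <# ?H" using q.invc_invc[of A n] A b q.invc_coset[of b n] by simp
 show "A : q.invc ` bad Un (%B. inv s <# q.invc B) ` bad"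
 proof (cases "b <# ?H : bad")
 case True
 thus ?thesis using Ab q.invc_coset[OF b(1), of n] by (auto intro!: imageI)
 next
 case 1: False
 let ?b = "b @@ inv s"
 have bc: "?b : cG" using b sc by auto
 have sA: "s <# A = inv ?b <# ?H" using Ab q.coset_lmult[of "inv b" s n] b sc by (simp add: inv_mult_group)
 show ?thesis
 proof (cases "?b <# ?H : bad")
 case True
 have "inv s <# q.invc (?b <# ?H) = A"
 using q.invc_coset[OF bc, of n] q.coset_lmult[of "inv ?b" "inv s" n] bc b sc Ab
 by (simp add: inv_mult_group cancel_left)
 thus ?thesis using True by blast
 next
 case False
 have isW: "inv s : W'" using s W' by (auto simp: W0_def)
 have "ph y (s <# A) \<one> = se (yl y ?b)" using ph2[OF y bc False one] sA bc by simp
 moreover have "shift_act G s (ph y A) \<one> = se (yl y ?b)"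
 using ph2[OF y b(1) 1 isW] Ab sc by (simp add: shift_act_def)
 ultimately show ?thesis using A unfolding P_def by simp
 qed
 qed
 qed
 hence "card {A : ?V. P A} <= card (q.invc ` bad Un (%B. inv s <# q.invc B) ` bad)"
 using finbad by (intro card_mono) auto
 also have "... <= card bad + card bad"
 by (rule order_trans[OF card_Un_le]) (intro add_mono card_image_le finbad)
 finally have "rc {A : ?V. P A} <= 2 * real cW" using cbad by linarith
 also have "... <= dl^2 * real (N n)" using elim(1) dl by (simp add: divide_le_eq mult.commute)
 finally show "rho_2 ?V (rho_F G) (%A. ph y (s <# A)) (%A. shift_act G s (ph y A)) <= dl"
 by (subst rho_2_count[of _ _ _ _ P]) (use dl in \<open>auto simp: fin q.V_ne P_def rho_F_bool\<close>)
 qed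
 define key where "key y = restrict y (?V - bad - {r})" for y :: "'g set => 'g qd"
 define sel where "sel k = (SOME y. y : Y & key y = k)" for k
 have sel: "sel (key y) : Y & key (sel (key y)) = key y" if "y : Y" for y
 unfolding sel_def by (rule someI_ex[of "%y'. y' : Y & key y' = key y"]) (use that in blast)
 define F where "F = (%k. ph (sel k)) ` (key ` Y)"
 have rbad: "r : bad" unfolding bad_def r_def using one by (auto intro!: image_eqI[of _ _ \<one>])
 have diff: "rho_inf ?V (rho_F G) (ph y) (ph y') >= 1" if y: "y : Y" "y' : Y" "key y ~= key y'" for y y'
 proof -
 have "\<exists>B. key y B ~= key y' B" using y(3) by blast
 then obtain B where B: "B : ?V - bad" "B ~= r" "y B ~= y' B" by (auto simp: key_def restrict_def split: if_splits)
 obtain b where b: "b : cG" "B = b <# ?H" using B q.V_iff by auto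
 have nr: "b <# ?H ~= r" using B b by simp
 have "yl y b ~= yl y' b" using yl(2)[OF y(1) b(1) nr] yl(2)[OF y(2) b(1) nr] B b by auto
 hence "se (yl y b) ~= se (yl y' b)"
 using yl(1)[OF y(1) b(1) nr] yl(1)[OF y(2) b(1) nr] inj_onD[OF inj_se] by blast
 hence "ph y (inv b <# ?H) \<one> ~= ph y' (inv b <# ?H) \<one>"
 using ph2[OF y(1) b(1) _ one] ph2[OF y(2) b(1) _ one] B b by auto
 thus ?thesis
 by (intro rho_inf_pos[OF fin, of "inv b <# ?H"]) (use b q.coset_V in \<open>auto simp: rho_F_bool\<close>)
 qed
 have diffk: "rho_inf ?V (rho_F G) (ph (sel k)) (ph (sel k')) >= 1"
 if "k : key ` Y" "k' : key ` Y" "k ~= k'" for k k'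
 proof -
 have "sel k : Y" "sel k' : Y" "key (sel k) = k" "key (sel k') = k'" using sel that by auto
 thus ?thesis using diff[of "sel k" "sel k'"] that by simp
 qed
 have injF: "inj_on (%k. ph (sel k)) (key ` Y)"
 proof (rule inj_onI, rule ccontr)
 fix k k' assume k: "k : key ` Y" "k' : key ` Y" "ph (sel k) = ph (sel k')" "k ~= k'"
 have "rho_inf ?V (rho_F G) (ph (sel k)) (ph (sel k')) < 1"
 by (rule rho_inf_zero[OF fin q.V_ne]) (use k(3) in \<open>auto simp: rho_F_def\<close>)
 thus False using diffk[OF k(1,2,4)] by simp
 qed
 have finF: "finite F" unfolding F_def using finY by simp
 have "ereal (rc F) <= sep_number ?M (rho_inf ?V (rho_F G)) 1"
 proof (rule sep_number_lower[OF finF])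
 show "F <= ?M" unfolding F_def using phM sel by auto
 fix x y assume xy: "x : F" "y : F" "x ~= y"
 obtain k k' where k: "k : key ` Y" "k' : key ` Y" "x = ph (sel k)" "y = ph (sel k')"
 using xy unfolding F_def by blast
 hence "k ~= k'" using xy(3) by auto
 from diffk[OF k(1,2) this] show "rho_inf ?V (rho_F G) x y >= 1" using k by simp
 qed
 \<comment> \<open>Trees with the same key differ only on \<open>bad\<close>, where there are at
   most \<open>deg ^ cW\<close> possibilities.\<close>
 moreover have "real (tau_quot G f ?H) <= rc F * real deg ^ cW"
 proof -
 let ?h = "%y. (key y, restrict y (bad - {r}))"
 have "inj_on ?h Y"
 proof (rule inj_onI)
 fix y y' assume y: "y : Y" "y' : Y" and e: "?h y = ?h y'"
 show "y = y'"
 proof (rule PiE_ext[of y "?V - {r}" "inc ends ?E"])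
 show "y : PiE (?V - {r}) (inc ends ?E)" "y' : PiE (?V - {r}) (inc ends ?E)"
 using y unfolding Y_def rf_def forests_def by auto
 fix B assume B: "B : ?V - {r}"
 have "key y B = key y' B" "restrict y (bad - {r}) B = restrict y' (bad - {r}) B" using e by auto
 thus "y B = y' B" using B by (cases "B : bad") (auto simp: key_def)
 qed
 qed
 hence "card Y = card (?h ` Y)" by (simp add: card_image)
 also have "... <= card ((key ` Y) \<times> PiE (bad - {r}) (inc ends ?E))"
 proof (rule card_mono)
 show "finite ((key ` Y) \<times> PiE (bad - {r}) (inc ends ?E))"
 using finY finbad finite_inc[OF q.graph] by (auto intro!: finite_PiE)
 show "?h ` Y <= (key ` Y) \<times> PiE (bad - {r}) (inc ends ?E)"
 proof
 fix x assume "x : ?h ` Y"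
 then obtain y where y: "y : Y" "x = ?h y" by auto
 have yP: "y : PiE (?V - {r}) (inc ends ?E)" using y(1) unfolding Y_def rf_def forests_def by simp
 have "y B : inc ends ?E B" if "B : bad - {r}" for B using PiE_mem[OF yP, of B] that badV by auto
 thus "x : (key ` Y) \<times> PiE (bad - {r}) (inc ends ?E)" using y by auto
 qed
 qed
 also have "... = card F * card (PiE (bad - {r}) (inc ends ?E))"
 using card_image[OF injF] by (simp add: card_cartesian_product F_def)
 also have "card (PiE (bad - {r}) (inc ends ?E)) = deg ^ card (bad - {r})"
 using finbad badV L.regular by (subst card_PiE) (auto simp: subset_iff intro!: prod.cong)
 also have "card F * deg ^ card (bad - {r}) <= card F * deg ^ cW"
 using deg_pos cbad card_mono[OF finbad, of "bad - {r}"] by (intro mult_left_mono power_increasing) auto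
 finally have "card Y <= card F * deg ^ cW" .
 thus ?thesis unfolding cY by (metis of_nat_le_iff of_nat_mult of_nat_power)
 qed
 hence "1 / real deg ^ cW * real (tau_quot G f ?H) <= rc F"
 using deg_pos by (simp add: divide_le_eq)
 ultimately show ?case by (meson ereal_less_eq(3) order_trans)
 qed
 thus ?thesis by (rule limsup_ge_entropy) (use deg_pos in simp)
qed

theorem sofic_entropy_eq:
 "sofic_entropy G Sg (F_model G f) (shift_act G) (rho_F G) = ereal (hT)"
 unfolding sofic_entropy_def
proof (rule antisym)
 show "(SUP epp\<in>{0<..}. INF W\<in>{W. finite W & W <= cG}. INF dl\<in>{0<..}.
 limsup (%n. eln (sep_number (sofic_Map G (Sg n) (F_model G f) (shift_act G) (rho_F G) W dl)
 (rho_inf (q.V n) (rho_F G)) epp) / ereal (real (N n)))) <= ereal (hT)"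
 proof (rule SUP_least)
 fix epp :: real assume epp: "epp : {0<..}"
 show "(INF W\<in>{W. finite W & W <= cG}. INF dl\<in>{0<..}.
 limsup (%n. eln (sep_number (sofic_Map G (Sg n) (F_model G f) (shift_act G) (rho_F G) W dl)
 (rho_inf (q.V n) (rho_F G)) epp) / ereal (real (N n)))) <= ereal (hT)"
 by (rule ereal_le_epsilon2) (use top_upper epp in auto)
 qed
 show "ereal (hT) <= (SUP epp\<in>{0<..}. INF W\<in>{W. finite W & W <= cG}. INF dl\<in>{0<..}.
 limsup (%n. eln (sep_number (sofic_Map G (Sg n) (F_model G f) (shift_act G) (rho_F G) W dl)
 (rho_inf (q.V n) (rho_F G)) epp) / ereal (real (N n))))"
 by (rule SUP_upper2[of 1]) (auto intro!: INF_greatest top_lower)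
qed

end

section \<open>Negative association of spanning ntrees\<close>

text \<open>The squared increment of \<open>u\<close> along an edge, written without choosing an
  orientation; a loop contributes 0.\<close>

definition spread :: "('v => real) => 'v set => real" where
 "spread u X = (Max (u ` X) - Min (u ` X))^2"

definition energy :: "('e => 'v set) => 'e set => ('v => real) => real" where
 "energy en Ed u = (SUM epp:Ed. spread u (en epp))"

definition ntrees :: "'v set => ('e => 'v set) => 'e set => 'e set => real" where
 "ntrees V en Ed B = rc {T. spanning_tree V en Ed T & B <= T}"

lemma spread_pair: "spread u {a, b} = (u a - u b)^2"
 by (auto simp: spread_def max_def min_def power2_commute)

lemma spread_single [simp]: "spread u {a} = 0"
 by (simp add: spread_def)

lemma spread_comp: "spread (u \<circ> q) X = spread u (q ` X)"
 by (simp add: spread_def image_comp)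

lemma energy_nonneg [simp]: "energy en Ed u >= 0"
 by (simp add: energy_def spread_def sum_nonneg)

lemma trees_nonneg [simp]: "ntrees V en Ed B >= 0"
 by (simp add: ntrees_def)

lemma trees_pos_iff [simp]: "0 < ntrees V en Ed B \<longleftrightarrow> ntrees V en Ed B ~= 0"
 by (simp add: ntrees_def)

lemma trees_mono: "finite Ed ==> B <= B' ==> ntrees V en Ed B' <= ntrees V en Ed B"
 unfolding ntrees_def using finite_spanning_trees[of Ed V en] by (auto intro!: card_mono)

section \<open>Dirichlet forms and voltages\<close>

lemma sum_inc_swap:
 fixes k :: "'v => 'v => real"
 assumes G: "fgraph V en Ed"
 shows "(SUM v:V. SUM epp:inc en Ed v. k v (other (en epp) v)) = (SUM v:V. SUM epp:inc en Ed v. k (other (en epp) v) v)"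
proof -
 have fin: "finite V" "ALL v:V. finite (inc en Ed v)" using fgraph_finite[OF G] finite_inc[OF G] by auto
 let ?s = "%(v, epp). (other (en epp) v, epp)"
 have s: "?s (v, epp) : Sigma V (inc en Ed)" "?s (?s (v, epp)) = (v, epp)" if "epp : inc en Ed v" for v epp
 proof -
 note e = fgraph_inc[OF G that]
 have "en epp = {other (en epp) v, v}" using e(1) by (metis insert_commute)
 hence "other (en epp) (other (en epp) v) = v" by (rule other_eq)
 thus "?s (v, epp) : Sigma V (inc en Ed)" "?s (?s (v, epp)) = (v, epp)" using e by (auto simp: inc_def)
 qed
 have "(SUM (v, epp):Sigma V (inc en Ed). k v (other (en epp) v)) = (SUM (v, epp):Sigma V (inc en Ed). k (other (en epp) v) v)"
 proof (rule sum.reindex_bij_witness[of _ ?s ?s])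
 fix x assume x: "x : Sigma V (inc en Ed)"
 then obtain v epp where v: "x = (v, epp)" "epp : inc en Ed v" by auto
 show "?s (?s x) = x" "?s x : Sigma V (inc en Ed)" "?s (?s x) = x" "?s x : Sigma V (inc en Ed)"
 using s[OF v(2)] v by auto
 show "(case ?s x of (v, epp) => k (other (en epp) v) v) = (case x of (v, epp) => k v (other (en epp) v))"
 using s(2)[OF v(2)] v(1) by simp
 qed
 thus ?thesis using fin by (simp add: sum.Sigma)
qed

text \<open>Summation by parts: reversing all oriented edges symmetrizes the sum.\<close>

lemma dirichlet_form:
 fixes u w :: "'v => real"
 assumes G: "fgraph V en Ed"
 shows "2 * (SUM v:V. w v * (SUM epp:inc en Ed v. u v - u (other (en epp) v))) =
 (SUM v:V. SUM epp:inc en Ed v. (u v - u (other (en epp) v)) * (w v - w (other (en epp) v)))"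
proof -
 have "(SUM v:V. SUM epp:inc en Ed v. w v * (u v - u (other (en epp) v))) =
 (SUM v:V. SUM epp:inc en Ed v. w (other (en epp) v) * (u (other (en epp) v) - u v))"
 by (rule sum_inc_swap[OF G, of "%a b. w a * (u a - u b)"])
 hence "2 * (SUM v:V. SUM epp:inc en Ed v. w v * (u v - u (other (en epp) v))) =
 (SUM v:V. SUM epp:inc en Ed v. w v * (u v - u (other (en epp) v)) +
 w (other (en epp) v) * (u (other (en epp) v) - u v))"
 by (simp add: sum.distrib)
 thus ?thesis by (simp add: sum_distrib_left algebra_simps)
qed

lemma energy_vertex_sum:
 assumes G: "fgraph V en Ed"
 shows "(SUM v:V. SUM epp:inc en Ed v. (u v - u (other (en epp) v))^2) = 2 * energy en Ed u"
proof -
 have "(SUM v:V. SUM epp:inc en Ed v. (u v - u (other (en epp) v))^2) =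
 (SUM epp:Ed. SUM v:{v : V. v : en epp}. (u v - u (other (en epp) v))^2)"
 unfolding inc_def using fgraph_finite[OF G] by (intro sum.swap_restrict)
 also have "... = (SUM epp:Ed. 2 * spread u (en epp))"
 proof (rule sum.cong[OF refl])
 fix epp assume "epp : Ed"
 then obtain a b where ab: "a : V" "b : V" "en epp = {a, b}" using G unfolding fgraph_def by blast
 have o: "other {a, b} a = b" "other {a, b} b = a" by (rule other_eq, simp, rule other_eq, blast)
 have "{v : V. v : en epp} = {a, b}" using ab by auto
 thus "(SUM v:{v : V. v : en epp}. (u v - u (other (en epp) v))^2) = 2 * spread u (en epp)"
 using o ab(3) by (cases "a = b") (auto simp: spread_pair power2_commute)
 qed
 finally show ?thesis by (simp add: energy_def sum_distrib_left)
qed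

text \<open>The forests with roots \<open>c\<close> and \<open>d\<close> in which \<open>w\<close>
  hangs on \<open>c\<close>: an unnormalized voltage with source \<open>c\<close> and sink
  \<open>d\<close>.\<close>

definition lead_count :: "'v set => ('e => 'v set) => 'e set => 'v => 'v => 'v => real" where
 "lead_count V en Ed c d w =
 forest_sum (%v epp. other (en epp) v) (inc en Ed) (%_ _. 1) (V - {c, d}) w c"

text \<open>A tree oriented towards \<open>d\<close> is a forest with roots \<open>c\<close> and
  \<open>d\<close> plus an edge at \<open>c\<close> whose other end does not hang on
  \<open>c\<close>.\<close>

lemma sum_rf_at:
 fixes h :: "'e => real"
 assumes G: "fgraph V en Ed" and cd: "c : V" "d : V" "c ~= d"
 shows "(SUM y:rf V en Ed {d}. h (y c)) = (SUM epp:inc en Ed c. h epp *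
 (rc (rf V en Ed {c, d}) - lead_count V en Ed c d (other (en epp) c)))"
proof -
 let ?I = "inc en Ed" and ?U = "V - {c, d}"
 define n where "n y = (%v. other (en (y v)) v)" for y
 have U: "V - {d} - {c} = ?U" by blast
 have fin: "finite (V - {d})" "finite ?U" "!!v. finite (?I v)" using fgraph_finite[OF G] finite_inc[OF G] by auto
 have key: "of_bool (all_lead (n (y(c := epp))) (V - {d})) =
 of_bool (all_lead (n y) ?U) * (1 - of_bool (lead (n y) ?U (other (en epp) c) c) :: real)"
 if y: "y : PiE ?U ?I" and e: "epp : ?I c" for y epp
 proof -
 let ?o = "other (en epp) c"
 have same: "n (y(c := epp)) u = n y u" if "u : ?U" for u using that by (auto simp: n_def)
 have nc: "n (y(c := epp)) c = ?o" by (simp add: n_def)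
 have al: "all_lead (n (y(c := epp))) (V - {d}) \<longleftrightarrow>
 all_lead (n y) ?U & (\<exists>r. r ~: V - {d} & lead (n y) ?U ?o r)"
 proof -
 have "c : V - {d}" using cd by simp
 note * = all_lead_remove[OF this, of "n (y(c := epp))", unfolded U nc]
 have c1: "all_lead (n (y(c := epp))) ?U = all_lead (n y) ?U" by (rule all_lead_cong) (rule same)
 have c2: "lead (n (y(c := epp))) ?U ?o r = lead (n y) ?U ?o r" for r by (rule lead_cong) (rule same)
 show ?thesis using * unfolding c1 c2 .
 qed
 show ?thesis
 proof (cases "all_lead (n y) ?U")
 case True
 have yr: "y : rf V en Ed {c, d}" using y True by (simp add: rf_def forests_def n_def)
 have oV: "?o : V" using fgraph_inc[OF G e] by simp
 have root: "r = c | r = d" if "lead (n y) ?U ?o r" for r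
 using rf_lead_root[OF G yr _ oV] that unfolding n_def by blast
 have "\<exists>r. lead (n y) ?U ?o r"
 proof (cases "?o : ?U")
 case True
 show ?thesis by (rule bspec[OF \<open>all_lead (n y) ?U\<close>[unfolded all_lead_def] True])
 next
 case False
 show ?thesis by (rule exI, rule lead.stop[OF False])
 qed
 then obtain r0 where r0: "lead (n y) ?U ?o r0" by blast
 have uq: "r = r0" if "lead (n y) ?U ?o r" for r using lead_unique[OF that r0] .
 have "(\<exists>r. r ~: V - {d} & lead (n y) ?U ?o r) \<longleftrightarrow> ~ lead (n y) ?U ?o c"
 proof
 assume "\<exists>r. r ~: V - {d} & lead (n y) ?U ?o r"
 then obtain r where r: "r ~: V - {d}" "lead (n y) ?U ?o r" by (elim exE conjE)
 show "~ lead (n y) ?U ?o c"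
 proof
 assume "lead (n y) ?U ?o c"
 from uq[OF this] uq[OF r(2)] have "c = r" by simp
 thus False using r(1) cd by simp
 qed
 next
 assume nc: "~ lead (n y) ?U ?o c"
 have "r0 ~= c" using r0 nc by (cases "r0 = c") simp_all
 hence "r0 = d" using root[OF r0] by simp
 thus "\<exists>r. r ~: V - {d} & lead (n y) ?U ?o r" using r0 by (intro exI[of _ d]) simp
 qed
 thus ?thesis using al True by simp
 qed (simp add: al)
 qed
 have "(SUM y:rf V en Ed {d}. h (y c)) = (SUM y:PiE (V - {d}) ?I. of_bool (all_lead (n y) (V - {d})) * h (y c))"
 proof (rule sum.mono_neutral_cong_left)
 show "finite (PiE (V - {d}) ?I)" using fin by (intro finite_PiE) auto
 qed (auto simp: rf_def forests_def n_def)
 also have "... = (SUM y:PiE ?U ?I. SUM epp:?I c. of_bool (all_lead (n (y(c := epp))) (V - {d})) * h epp)"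
 using sum_PiE_remove[of "V - {d}" c "%y. of_bool (all_lead (n y) (V - {d})) * h (y c)" ?I] fin cd
 unfolding U by simp
 also have "... = (SUM y:PiE ?U ?I. SUM epp:?I c. h epp * (of_bool (all_lead (n y) ?U) -
 of_bool (all_lead (n y) ?U) * of_bool (lead (n y) ?U (other (en epp) c) c)))"
 by (intro sum.cong refl) (simp only: key, simp add: algebra_simps)
 also have "... = (SUM epp:?I c. h epp * ((SUM y:PiE ?U ?I. of_bool (all_lead (n y) ?U)) -
 (SUM y:PiE ?U ?I. of_bool (all_lead (n y) ?U) * of_bool (lead (n y) ?U (other (en epp) c) c))))"
 unfolding sum_subtractf[symmetric] sum_distrib_left by (rule sum.swap)
 also have "(SUM y:PiE ?U ?I. of_bool (all_lead (n y) ?U)) = rc (rf V en Ed {c, d})"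
 proof -
 have "rf V en Ed {c, d} = {y : PiE ?U ?I. all_lead (n y) ?U}" by (auto simp: rf_def forests_def n_def)
 thus ?thesis using fin by (simp add: finite_PiE Int_def)
 qed
 also have "(%w. SUM y:PiE ?U ?I. of_bool (all_lead (n y) ?U) * of_bool (lead (n y) ?U w c)) = lead_count V en Ed c d"
 unfolding lead_count_def using fin by (intro ext) (subst forest_sum_alt, auto simp: n_def)
 finally show ?thesis .
qed

lemma trees_rf: "fgraph V en Ed ==> r : V ==> ntrees V en Ed {} = rc (rf V en Ed {r})"
 using num_spanning_trees_rf by (simp add: ntrees_def num_spanning_trees_def)

text \<open>Deleting \<open>e\<close> from a tree oriented towards \<open>d\<close> turns
  \<open>c\<close> into a second root.\<close>

lemma trees_edge:
 assumes G: "fgraph V en Ed" and e: "e : Ed" "en e = {c, d}" "c ~= d"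
 shows "ntrees V en Ed {e} = rc (rf V en Ed {c, d})"
proof -
 have cd: "c : V" "d : V" using fgraph_ends_subset[OF G e(1)] e(2) by auto
 have mem: "e : y ` (V - {d}) \<longleftrightarrow> y c = e" if y: "y : rf V en Ed {d}" for y
 proof
 assume "e : y ` (V - {d})"
 then obtain v where v: "v : V - {d}" "e = y v" by blast
 have "v : {c, d}" using rf_D(2)[OF G y v(1)] e(2) v(2) by auto
 thus "y c = e" using v by auto
 qed (use cd e in auto)
 have "bij_betw (%y. y ` (V - {d})) {y : rf V en Ed {d}. y c = e} {T. spanning_tree V en Ed T & {e} <= T}"
 proof (rule bij_betw_subset[OF spanning_tree_bij[OF G cd(2)]])
 have im: "(%y. y ` (V - {d})) ` rf V en Ed {d} = {T. spanning_tree V en Ed T}"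
 using spanning_tree_bij[OF G cd(2)] by (simp add: bij_betw_def)
 show "(%y. y ` (V - {d})) ` {y : rf V en Ed {d}. y c = e} = {T. spanning_tree V en Ed T & {e} <= T}"
 proof (intro equalityI subsetI)
 fix T assume "T : (%y. y ` (V - {d})) ` {y : rf V en Ed {d}. y c = e}"
 then obtain y where y: "y : rf V en Ed {d}" "y c = e" "T = y ` (V - {d})" by blast
 thus "T : {T. spanning_tree V en Ed T & {e} <= T}" using im mem[OF y(1)] by blast
 next
 fix T assume T: "T : {T. spanning_tree V en Ed T & {e} <= T}"
 then obtain y where y: "y : rf V en Ed {d}" "T = y ` (V - {d})" using im by blast
 thus "T : (%y. y ` (V - {d})) ` {y : rf V en Ed {d}. y c = e}" using mem[OF y(1)] T by blast
 qed
 qed simp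
 hence "ntrees V en Ed {e} = rc {y : rf V en Ed {d}. y c = e}"
 unfolding ntrees_def by (simp add: bij_betw_same_card)
 also have "... = (SUM y:rf V en Ed {d}. of_bool (y c = e))" using finite_rf[OF G] by (simp add: Int_def)
 also have "... = (SUM epp:inc en Ed c. of_bool (epp = e) *
 (rc (rf V en Ed {c, d}) - lead_count V en Ed c d (other (en epp) c)))"
 by (rule sum_rf_at[OF G cd e(3)])
 also have "... = (SUM epp:{e}. of_bool (epp = e) *
 (rc (rf V en Ed {c, d}) - lead_count V en Ed c d (other (en epp) c)))"
 using e finite_inc[OF G] by (intro sum.mono_neutral_right) (auto simp: inc_def)
 also have "... = rc (rf V en Ed {c, d}) - lead_count V en Ed c d d" using other_eq[OF e(2)] by simp
 also have "lead_count V en Ed c d d = 0"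
 proof -
 have "~ lead nx (V - {c, d}) d c" for nx using lead_not_in[of nx "V - {c, d}" d c] e(3) by auto
 thus ?thesis unfolding lead_count_def forest_sum_def by simp
 qed
 finally show ?thesis by simp
qed

text \<open>The voltage carries the current \<open>ntrees V en Ed {}\<close> from \<open>c\<close>
  to \<open>d\<close>: it is harmonic elsewhere by \<open>forest_sum_harmonic\<close>, the outflow
  at \<open>c\<close> counts trees by \<open>sum_rf_at\<close>, and that at \<open>d\<close> follows
  since the total vanishes.\<close>

lemma laplace_lead_count:
 assumes G: "fgraph V en Ed" and e: "e : Ed" "en e = {c, d}" "c ~= d"
 shows "(SUM v:V. w v * (SUM epp:inc en Ed v. lead_count V en Ed c d v - lead_count V en Ed c d (other (en epp) v)))
 = ntrees V en Ed {} * (w c - w d)"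
 "lead_count V en Ed c d c = ntrees V en Ed {e}" "lead_count V en Ed c d d = 0"
proof -
 have cd: "c : V" "d : V" using fgraph_ends_subset[OF G e(1)] e(2) by auto
 have fin: "finite V" "finite (V - {c, d})" "!!v. finite (inc en Ed v)" using fgraph_finite[OF G] finite_inc[OF G] by auto
 let ?F = "lead_count V en Ed c d"
 define L where "L v = (SUM epp:inc en Ed v. ?F v - ?F (other (en epp) v))" for v
 have "lead nx (V - {c, d}) c c" for nx by (rule lead.stop) simp
 hence "?F c = rc (rf V en Ed {c, d})" unfolding lead_count_def forest_sum_def rf_def by simp
 thus Fc: "?F c = ntrees V en Ed {e}" using trees_edge[OF G e] by simp
 have "~ lead nx (V - {c, d}) d c" for nx using lead_not_in[of nx "V - {c, d}" d c] e(3) by auto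
 thus "?F d = 0" unfolding lead_count_def forest_sum_def by simp
 have L0: "L v = 0" if "v : V - {c, d}" for v
 using forest_sum_harmonic[OF fin(2,3) that, of c "%_ _. 1" "%v epp. other (en epp) v"]
 unfolding L_def lead_count_def by simp
 have Lc: "L c = ntrees V en Ed {}"
 using sum_rf_at[OF G cd e(3), of "%_. 1"] trees_rf[OF G cd(2)] Fc trees_edge[OF G e] by (simp add: L_def)
 have all: "(SUM v:V. h v * L v) = h c * L c + h d * L d" for h
 proof -
 have "(SUM v:V. h v * L v) = (SUM v:{c, d}. h v * L v)"
 using L0 cd fin by (intro sum.mono_neutral_right) auto
 thus ?thesis using e(3) by simp
 qed
 have "2 * (SUM v:V. 1 * L v) = 0" unfolding L_def dirichlet_form[OF G, of "%_. 1"] by simp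
 hence "L d = - L c" using all[of "%_. 1"] by simp
 thus "(SUM v:V. w v * (SUM epp:inc en Ed v. ?F v - ?F (other (en epp) v))) = ntrees V en Ed {} * (w c - w d)"
 using all[of w] Lc unfolding L_def[symmetric] by (simp add: algebra_simps)
qed

lemma energy_lead_count:
 assumes G: "fgraph V en Ed" and e: "e : Ed" "en e = {c, d}" "c ~= d"
 shows "energy en Ed (lead_count V en Ed c d) = ntrees V en Ed {} * ntrees V en Ed {e}"
proof -
 let ?F = "lead_count V en Ed c d"
 have "2 * energy en Ed ?F = 2 * (SUM v:V. ?F v * (SUM epp:inc en Ed v. ?F v - ?F (other (en epp) v)))"
 unfolding dirichlet_form[OF G] energy_vertex_sum[OF G, symmetric] by (simp add: power2_eq_square)
 thus ?thesis using laplace_lead_count[OF G e] by simp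
qed

text \<open>Kirchhoff's formula: the probability that an edge belongs to the uniform spanning tree is
 the effective resistance between its endpoints, here in the form of Dirichlet's principle.\<close>

lemma dirichlet_principle:
 assumes G: "fgraph V en Ed" and e: "e : Ed" "en e = {c, d}" "c ~= d"
 shows "(u c - u d)^2 * ntrees V en Ed {} <= ntrees V en Ed {e} * energy en Ed u"
proof (cases "ntrees V en Ed {} = 0")
 case True
 thus ?thesis by (simp add: mult_nonneg_nonneg)
next
 case False
 let ?F = "lead_count V en Ed c d" and ?t = "ntrees V en Ed {}"
 let ?S = "Sigma V (inc en Ed)"
 have pos: "?t > 0" using False trees_nonneg[of V en Ed "{}"] by simp
 have fin: "finite V" "ALL v:V. finite (inc en Ed v)" using fgraph_finite[OF G] finite_inc[OF G] by auto
 let ?a = "%(v, epp). ?F v - ?F (other (en epp) v)" and ?b = "%(v, epp). u v - u (other (en epp) v)"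
 have "2 * (?t * (u c - u d)) = (SUM v:V. SUM epp:inc en Ed v. (?F v - ?F (other (en epp) v)) * (u v - u (other (en epp) v)))"
 using dirichlet_form[OF G, of u ?F] laplace_lead_count(1)[OF G e, of u] by simp
 also have "... = (SUM x:?S. ?a x * ?b x)" using fin by (simp add: sum.Sigma split_def)
 finally have "(2 * (?t * (u c - u d)))^2 = (SUM x:?S. ?a x * ?b x)^2" by simp
 also have "... <= (SUM x:?S. (?a x)^2) * (SUM x:?S. (?b x)^2)" by (rule Cauchy_Schwarz_ineq_sum)
 also have "(SUM x:?S. (?a x)^2) = 2 * (?t * ntrees V en Ed {e})"
 using energy_vertex_sum[OF G, of ?F] energy_lead_count[OF G e] fin by (simp add: sum.Sigma split_def)
 also have "(SUM x:?S. (?b x)^2) = 2 * energy en Ed u"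
 using energy_vertex_sum[OF G, of u] fin by (simp add: sum.Sigma split_def)
 finally have "?t * ((u c - u d)^2 * ?t) <= ?t * (ntrees V en Ed {e} * energy en Ed u)"
 by (simp add: power2_eq_square algebra_simps)
 thus ?thesis using pos by simp
qed

text \<open>The graph \<open>en\<close> arises from \<open>en'\<close> by identifying vertices along
  \<open>q\<close>; \<open>j\<close> embeds its edges, and the edges of \<open>en'\<close> that are
  missed have become loops.\<close>

definition graph_quot ::
 "('w => 'v) => ('e => 'd) => ('e => 'v set) => 'e set => ('d => 'w set) => 'd set => bool" where
 "graph_quot q j en Ed en' Ed' \<longleftrightarrow> inj_on j Ed & j ` Ed <= Ed' & (ALL epp:Ed. en epp = q ` en' (j epp)) &
 (ALL epp:Ed' - j ` Ed. \<exists>v. q ` en' epp <= {v})"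

lemma energy_quot:
 assumes G': "fgraph V' en' Ed'" and Q: "graph_quot q j en Ed en' Ed'"
 shows "energy en' Ed' (u \<circ> q) = energy en Ed u"
proof -
 have "energy en' Ed' (u \<circ> q) = (SUM epp:Ed'. spread u (q ` en' epp))"
 by (simp add: energy_def spread_comp)
 also have "... = (SUM epp:j ` Ed. spread u (q ` en' epp))"
 proof (rule sum.mono_neutral_right)
 show "finite Ed'" "j ` Ed <= Ed'" using fgraph_finite[OF G'] Q by (auto simp: graph_quot_def)
 show "ALL epp:Ed' - j ` Ed. spread u (q ` en' epp) = 0"
 proof
 fix epp assume e: "epp : Ed' - j ` Ed"
 then obtain v where v: "q ` en' epp <= {v}" using Q unfolding graph_quot_def by blast
 have "en' epp ~= {}" using e G' unfolding fgraph_def by fastforce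
 hence "q ` en' epp = {v, v}" using v by auto
 thus "spread u (q ` en' epp) = 0" by (simp only: spread_pair) simp
 qed
 qed
 also have "... = (SUM epp:Ed. spread u (q ` en' (j epp)))"
 using Q by (subst sum.reindex) (auto simp: graph_quot_def)
 finally show ?thesis using Q by (simp add: energy_def graph_quot_def)
qed

lemma trees_loop:
 assumes "en e = {c}"
 shows "ntrees V en Ed (insert e B) = 0"
proof -
 have "{T. spanning_tree V en Ed T & insert e B <= T} = {}"
 proof (rule ccontr)
 assume "{T. spanning_tree V en Ed T & insert e B <= T} ~= {}"
 then obtain T where a: "spanning_tree V en Ed T & insert e B <= T" by blast
 hence "e : T" "en e = {c, c}" using assms by auto
 hence "c ~= c" using a unfolding spanning_tree_def by blast
 thus False by simp
 qed
 thus ?thesis unfolding ntrees_def by (simp only: card.empty of_nat_0)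
qed

text \<open>Rayleigh monotonicity: the voltage of the quotient, pulled back along \<open>q\<close>,
  keeps its energy and is a test function for Dirichlet's principle in the larger graph.\<close>

lemma trees_quot_edge:
 assumes G: "fgraph V en Ed" and G': "fgraph V' en' Ed'" and Q: "graph_quot q j en Ed en' Ed'" and e: "e : Ed"
 shows "ntrees V en Ed {e} * ntrees V' en' Ed' {} <= ntrees V' en' Ed' {j e} * ntrees V en Ed {}"
proof -
 have je: "j e : Ed'" "en e = q ` en' (j e)" using Q e by (auto simp: graph_quot_def)
 then obtain c d where cd: "en' (j e) = {c, d}" using G' unfolding fgraph_def by blast
 hence e2: "en e = {q c, q d}" using je by simp
 show ?thesis
 proof (cases "q c = q d | ntrees V en Ed {e} = 0")
 case True
 hence "ntrees V en Ed {e} = 0" using trees_loop[of en e "q c" V Ed "{}"] e2 by auto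
 thus ?thesis by (simp add: mult_nonneg_nonneg)
 next
 case False
 let ?F = "lead_count V en Ed (q c) (q d)"
 have qne: "q c ~= q d" and ne: "c ~= d" using False by auto
 have "((?F \<circ> q) c - (?F \<circ> q) d)^2 * ntrees V' en' Ed' {} <= ntrees V' en' Ed' {j e} * energy en' Ed' (?F \<circ> q)"
 by (rule dirichlet_principle[OF G' je(1) cd ne])
 hence "(ntrees V en Ed {e})^2 * ntrees V' en' Ed' {} <= ntrees V' en' Ed' {j e} * (ntrees V en Ed {} * ntrees V en Ed {e})"
 unfolding energy_quot[OF G' Q] energy_lead_count[OF G e e2 qne] using laplace_lead_count(2,3)[OF G e e2 qne] by simp
 hence "ntrees V en Ed {e} * (ntrees V en Ed {e} * ntrees V' en' Ed' {}) <=
 ntrees V en Ed {e} * (ntrees V' en' Ed' {j e} * ntrees V en Ed {})"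
 by (simp add: power2_eq_square algebra_simps)
 moreover have "ntrees V en Ed {e} > 0" using False trees_nonneg[of V en Ed "{e}"] by simp
 ultimately show ?thesis by simp
 qed
qed

text \<open>Acyclicity is traded for an edge count, so that contraction of an edge only has to be
  checked against connectedness.\<close>

lemma spanning_tree_card:
 assumes G: "fgraph V en Ed" and ne: "V ~= {}"
 shows "spanning_tree V en Ed T \<longleftrightarrow> T <= Ed & gconn V en T & card T = card V - 1"
proof
 assume T: "spanning_tree V en Ed T"
 thus "T <= Ed & gconn V en T & card T = card V - 1"
 using card_spanning_tree[OF G T ne] spanning_tree_alt[OF G] by simp
next
 assume T: "T <= Ed & gconn V en T & card T = card V - 1"
 hence GT: "fgraph V en T" using fgraph_mono[OF G] by simp
 have "num_spanning_trees V en T > 0" by (rule num_spanning_trees_pos[OF GT]) (use T in simp)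
 then obtain T0 where T0: "spanning_tree V en T T0" unfolding num_spanning_trees_def by (auto simp: card_gt_0_iff)
 hence "T0 <= T" "card T0 = card T" using card_spanning_tree[OF GT T0 ne] T by auto
 hence "T0 = T" using fgraph_finite(2)[OF GT] by (simp add: card_subset_eq)
 thus "spanning_tree V en Ed T" using T0 T unfolding spanning_tree_def by blast
qed

definition vmerge :: "'v => 'v => 'v => 'v" where
 "vmerge a b v = (if v = b then a else v)"

lemma fgraph_contract:
 assumes G: "fgraph V en Ed" and ab: "a : V" "a ~= b"
 shows "fgraph (V - {b}) (%epp. vmerge a b ` en epp) (Ed - {e})"
 unfolding fgraph_def
proof (intro conjI ballI)
 show "finite (V - {b})" "finite (Ed - {e})" using fgraph_finite[OF G] by auto
 fix epp assume "epp : Ed - {e}"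
 then obtain x y where xy: "x : V" "y : V" "en epp = {x, y}" using G unfolding fgraph_def by blast
 have "vmerge a b x : V - {b}" "vmerge a b y : V - {b}" using xy ab by (auto simp: vmerge_def)
 thus "EX x:V - {b}. EX y:V - {b}. vmerge a b ` en epp = {x, y}"
 using xy(3) by (intro bexI[of _ "vmerge a b x"] bexI[of _ "vmerge a b y"]) auto
qed

lemma gconn_contract:
 assumes G: "fgraph V en T" and e: "e : T" "en e = {a, b}" "a ~= b"
 shows "gconn (V - {b}) (%epp. vmerge a b ` en epp) (T - {e}) \<longleftrightarrow> gconn V en T"
proof -
 let ?m = "vmerge a b" and ?en = "%epp. vmerge a b ` en epp"
 have abV: "a : V" "b : V" using fgraph_ends_subset[OF G e(1)] e(2) by auto
 have ab: "(a, b) : (adj_rel en T)^*" by (rule adj_edge[where en = en, OF e(1,2)])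
 have near: "(?m x, x) : (adj_rel en T)^*" for x using ab by (auto simp: vmerge_def)
 have 1: "(?m x, ?m y) : (adj_rel ?en (T - {e}))^*" if "(x, y) : (adj_rel en T)^*" for x y
 using that
 proof (induction rule: rtrancl_induct)
 case (step y z)
 obtain epp where ep: "epp : T" "en epp = {y, z}" using step.hyps(2) unfolding adj_rel_def by blast
 have "(?m y, ?m z) : (adj_rel ?en (T - {e}))^*"
 proof (cases "epp = e")
 case True
 hence "?m y = ?m z" using ep e by (auto simp: vmerge_def doubleton_eq_iff)
 thus ?thesis by simp
 next
 case False
 show ?thesis by (rule adj_edge[where en = ?en and epp = epp]) (use False ep in auto)
 qed
 thus ?case using step.IH by (rule rtrancl_trans[rotated])
 qed simp
 have 2: "(x, y) : (adj_rel en T)^*" if "(x, y) : (adj_rel ?en (T - {e}))^*" for x y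
 using that
 proof (induction rule: rtrancl_induct)
 case (step y z)
 obtain epp where ep: "epp : T - {e}" "?en epp = {y, z}" using step.hyps(2) unfolding adj_rel_def by blast
 obtain p r where pr: "en epp = {p, r}" using ep G unfolding fgraph_def by blast
 have et: "epp : T" using ep by simp
 have "(p, r) : (adj_rel en T)^*" by (rule adj_edge[where en = en, OF et pr])
 hence mpr: "(?m p, ?m r) : (adj_rel en T)^*"
 using rtrancl_trans[OF near[of p] rtrancl_trans[OF _ adj_rtrancl_sym[OF near[of r]]]] by blast
 have "{?m p, ?m r} = {y, z}" using ep(2) pr by simp
 hence "(y, z) : (adj_rel en T)^*" using mpr adj_rtrancl_sym[OF mpr] by (auto simp: doubleton_eq_iff)
 thus ?case using step.IH by (rule rtrancl_trans[rotated])
 qed simp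
 show ?thesis
 proof
 assume c: "gconn V en T"
 show "gconn (V - {b}) ?en (T - {e})" unfolding gconn_def
 proof (intro ballI)
 fix u w assume "u : V - {b}" "w : V - {b}"
 thus "(u, w) : (adj_rel ?en (T - {e}))^*" using c 1[of u w] unfolding gconn_def by (auto simp: vmerge_def)
 qed
 next
 assume c: "gconn (V - {b}) ?en (T - {e})"
 show "gconn V en T" unfolding gconn_def
 proof (intro ballI)
 fix u w assume "u : V" "w : V"
 hence "?m u : V - {b}" "?m w : V - {b}" using abV e(3) by (auto simp: vmerge_def)
 hence "(?m u, ?m w) : (adj_rel en T)^*" using 2 c unfolding gconn_def by blast
 thus "(u, w) : (adj_rel en T)^*"
 using rtrancl_trans[OF adj_rtrancl_sym[OF near[of u]] rtrancl_trans[OF _ near[of w]]] by blast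
 qed
 qed
qed

lemma trees_contract:
 assumes G: "fgraph V en Ed" and e: "e : Ed" "en e = {a, b}" "a ~= b" "e ~: B"
 shows "ntrees (V - {b}) (%epp. vmerge a b ` en epp) (Ed - {e}) B = ntrees V en Ed (insert e B)"
proof -
 let ?en = "%epp. vmerge a b ` en epp"
 have abV: "a : V" "b : V" using fgraph_ends_subset[OF G e(1)] e(2) by auto
 have G2: "fgraph (V - {b}) ?en (Ed - {e})" by (rule fgraph_contract[OF G abV(1) e(3)])
 have ne: "V - {b} ~= {}" "V ~= {}" using abV e(3) by auto
 have c2: "card V >= 2"
 using card_mono[OF fgraph_finite(1)[OF G], of "{a, b}"] abV e(3) by simp
 have eq: "spanning_tree (V - {b}) ?en (Ed - {e}) (T - {e}) \<longleftrightarrow> spanning_tree V en Ed T" if eT: "e : T" for T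
 proof (cases "T <= Ed")
 case True
 have GT: "fgraph V en T" by (rule fgraph_mono[OF G True])
 have fT: "finite T" using fgraph_finite(2)[OF GT] .
 have "card (T - {e}) = card T - 1" "card (V - {b}) = card V - 1" "card T >= 1"
 using eT abV fT card_gt_0_iff[of T] by (auto simp: Suc_le_eq)
 hence "card (T - {e}) = card (V - {b}) - 1 \<longleftrightarrow> card T = card V - 1" using c2 by auto
 thus ?thesis
 unfolding spanning_tree_card[OF G ne(2)] spanning_tree_card[OF G2 ne(1)] gconn_contract[OF GT eT e(2,3)]
 using True by auto
 next
 case False
 thus ?thesis using eT e(1) unfolding spanning_tree_def by blast
 qed
 have "bij_betw (insert e) {T. spanning_tree (V - {b}) ?en (Ed - {e}) T & B <= T}
 {T. spanning_tree V en Ed T & insert e B <= T}"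
 proof (rule bij_betw_byWitness[where f' = "%T. T - {e}"])
 have no: "e ~: T" if "spanning_tree (V - {b}) ?en (Ed - {e}) T" for T
 using that unfolding spanning_tree_def by blast
 show "ALL T:{T. spanning_tree (V - {b}) ?en (Ed - {e}) T & B <= T}. insert e T - {e} = T" using no by auto
 show "ALL T:{T. spanning_tree V en Ed T & insert e B <= T}. insert e (T - {e}) = T" by auto
 show "insert e ` {T. spanning_tree (V - {b}) ?en (Ed - {e}) T & B <= T} <= {T. spanning_tree V en Ed T & insert e B <= T}"
 proof (rule image_subsetI)
 fix T assume T: "T : {T. spanning_tree (V - {b}) ?en (Ed - {e}) T & B <= T}"
 have "insert e T - {e} = T" using no[of T] T by auto
 thus "insert e T : {T. spanning_tree V en Ed T & insert e B <= T}" using eq[of "insert e T"] T by auto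
 qed
 show "(%T. T - {e}) ` {T. spanning_tree V en Ed T & insert e B <= T} <= {T. spanning_tree (V - {b}) ?en (Ed - {e}) T & B <= T}"
 using eq e(4) by auto
 qed
 thus ?thesis unfolding ntrees_def by (simp add: bij_betw_same_card)
qed

lemma graph_quot_contract:
 assumes Q: "graph_quot q j en Ed en' Ed'" and e: "e : Ed" and cd: "q c = a" "q d = b"
 shows "graph_quot (vmerge a b \<circ> q) j (%epp. vmerge a b ` en epp) (Ed - {e}) (%epp. vmerge c d ` en' epp) (Ed' - {j e})"
proof -
 have m: "vmerge a b (q (vmerge c d v)) = vmerge a b (q v)" for v using cd by (auto simp: vmerge_def)
 have im: "(vmerge a b \<circ> q) ` vmerge c d ` X = vmerge a b ` q ` X" for X by (auto simp: image_image m)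
 have inj: "inj_on j Ed" using Q by (simp add: graph_quot_def)
 have jd: "j ` (Ed - {e}) = j ` Ed - {j e}" using inj_on_image_set_diff[OF inj, of Ed "{e}"] e by auto
 show ?thesis unfolding graph_quot_def im jd
 proof (intro conjI ballI)
 show "inj_on j (Ed - {e})" using inj by (rule inj_on_subset) blast
 show "j ` Ed - {j e} <= Ed' - {j e}" using Q by (auto simp: graph_quot_def)
 fix epp assume "epp : Ed - {e}"
 thus "vmerge a b ` en epp = vmerge a b ` q ` en' (j epp)" using Q by (simp add: graph_quot_def)
 next
 fix epp assume "epp : Ed' - {j e} - (j ` Ed - {j e})"
 hence "epp : Ed' - j ` Ed" by blast
 then obtain v where "q ` en' epp <= {v}" using Q unfolding graph_quot_def by blast
 hence "vmerge a b ` q ` en' epp <= {vmerge a b v}" by auto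
 thus "\<exists>v. vmerge a b ` q ` en' epp <= {v}" by blast
 qed
qed

text \<open>Conditioning on an edge means contracting it, and contraction on both sides preserves
  the quotient relation. Thus \<open>P(e and B) = P(e) P(B | e)\<close> is compared factor by
  factor.\<close>

theorem trees_quot:
 assumes "finite B" "fgraph V en Ed" "fgraph V' en' Ed'" "graph_quot q j en Ed en' Ed'" "B <= Ed"
 shows "ntrees V en Ed B * ntrees V' en' Ed' {} <= ntrees V' en' Ed' (j ` B) * ntrees V en Ed {}"
 using assms
proof (induction B arbitrary: V en Ed V' en' Ed' q rule: finite_induct)
 case (insert e B)
 note G = insert.prems(1) and G' = insert.prems(2) and Q = insert.prems(3)
 have e: "e : Ed" "B <= Ed - {e}" using insert.prems insert.hyps by auto
 have je: "j e : Ed'" "en e = q ` en' (j e)" using Q e by (auto simp: graph_quot_def)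
 then obtain c d where cd: "en' (j e) = {c, d}" using G' unfolding fgraph_def by blast
 have e2: "en e = {q c, q d}" using je cd by simp
 have jeB: "j e ~: j ` B"
 proof
 assume "j e : j ` B"
 then obtain x where x: "x : B" "j e = j x" by blast
 have "inj_on j Ed" using Q by (simp add: graph_quot_def)
 hence "e = x" using inj_onD[of j Ed e x] x e by blast
 thus False using x insert.hyps by simp
 qed
 let ?t = "ntrees V en Ed" and ?t' = "ntrees V' en' Ed'"
 have fE: "finite Ed" "finite Ed'" using fgraph_finite[OF G] fgraph_finite[OF G'] by auto
 show ?case
 proof (cases "?t (insert e B) = 0 | ?t' {} = 0")
 case True
 thus ?thesis using trees_nonneg[of V' en' Ed' "j ` insert e B"] trees_nonneg[of V en Ed "{}"] by auto
 next
 case False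
 have ne: "q c ~= q d" using trees_loop[of en e "q c" V Ed B] e2 False by auto
 have ne': "c ~= d" using ne by auto
 have cV: "c : V'" "q c : V"
 using fgraph_ends_subset[OF G' je(1)] fgraph_ends_subset[OF G e(1)] cd e2 by auto
 let ?en = "%epp. vmerge (q c) (q d) ` en epp" and ?en' = "%epp. vmerge c d ` en' epp"
 have "ntrees (V - {q d}) ?en (Ed - {e}) B * ntrees (V' - {d}) ?en' (Ed' - {j e}) {} <=
 ntrees (V' - {d}) ?en' (Ed' - {j e}) (j ` B) * ntrees (V - {q d}) ?en (Ed - {e}) {}"
 by (rule insert.IH[OF fgraph_contract[OF G cV(2) ne] fgraph_contract[OF G' cV(1) ne']
 graph_quot_contract[OF Q e(1) refl refl] e(2)])
 hence I: "?t (insert e B) * ?t' {j e} <= ?t' (insert (j e) (j ` B)) * ?t {e}"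
 unfolding trees_contract[OF G e(1) e2 ne insert.hyps(2)] trees_contract[OF G' je(1) cd ne' jeB]
 using trees_contract[OF G e(1) e2 ne, of "{}"] trees_contract[OF G' je(1) cd ne', of "{}"] by simp
 have S: "?t {e} * ?t' {} <= ?t' {j e} * ?t {}" by (rule trees_quot_edge[OF G G' Q e(1)])
 have p: "?t (insert e B) > 0" "?t' {} > 0"
 using False trees_nonneg[of V en Ed "insert e B"] trees_nonneg[of V' en' Ed' "{}"] by auto
 have te: "?t {e} > 0" using less_le_trans[OF p(1) trees_mono[OF fE(1)]] by simp
 have "?t {e} * ?t' {} > 0" by (rule mult_pos_pos[OF te p(2)])
 hence "0 < ?t' {j e} * ?t {}" using S by linarith
 hence te': "?t' {j e} > 0" by auto
 have "(?t (insert e B) * ?t' {j e}) * (?t {e} * ?t' {}) <= (?t' (insert (j e) (j ` B)) * ?t {e}) * (?t' {j e} * ?t {})"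
 by (rule mult_mono[OF I S]) (use te in \<open>auto intro!: mult_nonneg_nonneg\<close>)
 hence "(?t' {j e} * ?t {e}) * (?t (insert e B) * ?t' {}) <=
 (?t' {j e} * ?t {e}) * (?t' (insert (j e) (j ` B)) * ?t {})"
 by (simp add: algebra_simps)
 thus ?thesis using te te' by simp
 qed
qed simp

text \<open>Contracting \<open>e\<close> is itself an identification of vertices, so
  \<open>C\<close> becomes no more likely given \<open>e\<close>; the induction applies to the
  contracted graph.\<close>

lemma trees_neg:
 assumes "finite B" "fgraph V en Ed" "B <= Ed" "C <= Ed" "B Int C = {}"
 shows "ntrees V en Ed (B Un C) * ntrees V en Ed {} <= ntrees V en Ed B * ntrees V en Ed C"
 using assms
proof (induction B arbitrary: V en Ed rule: finite_induct)
 case (insert e B)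
 note G = insert.prems(1)
 let ?t = "ntrees V en Ed"
 have e: "e : Ed" "B <= Ed - {e}" "C <= Ed - {e}" "e ~: C" "e ~: B Un C" "B Int C = {}"
 using insert.prems insert.hyps by auto
 obtain a b where ab: "en e = {a, b}" using G e(1) unfolding fgraph_def by blast
 have fE: "finite Ed" using fgraph_finite[OF G] by simp
 have fC: "finite C" using e(3) fE by (meson finite_Diff finite_subset)
 show ?case
 proof (cases "?t (insert e (B Un C)) = 0")
 case True
 thus ?thesis by (simp add: mult_nonneg_nonneg)
 next
 case False
 have ne: "a ~= b" using trees_loop[of en e a V Ed "B Un C"] ab False by auto
 have aV: "a : V" using fgraph_ends_subset[OF G e(1)] ab by auto
 let ?en = "%epp. vmerge a b ` en epp"
 note K = trees_contract[OF G e(1) ab ne]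
 note G2 = fgraph_contract[OF G aV ne, of e]
 have I: "?t (insert e (B Un C)) * ?t {e} <= ?t (insert e B) * ?t (insert e C)"
 using insert.IH[OF G2 e(2,3,6)] K[OF e(5)] K[OF insert.hyps(2)] K[OF e(4)] K[of "{}"] by simp
 have Q: "graph_quot (vmerge a b) id ?en (Ed - {e}) en Ed" unfolding graph_quot_def
 proof (intro conjI ballI)
 fix epp assume "epp : Ed - id ` (Ed - {e})"
 hence "epp = e" by auto
 hence "vmerge a b ` en epp <= {a}" using ab by (auto simp: vmerge_def)
 thus "\<exists>v. vmerge a b ` en epp <= {v}" by blast
 qed auto
 have S: "?t (insert e C) * ?t {} <= ?t C * ?t {e}"
 using trees_quot[OF fC G2 G Q e(3)] K[OF e(4)] K[of "{}"] by simp
 have "?t {e} * (?t (insert e (B Un C)) * ?t {}) = (?t (insert e (B Un C)) * ?t {e}) * ?t {}" by simp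
 also have "... <= (?t (insert e B) * ?t (insert e C)) * ?t {}" using I by (intro mult_right_mono) auto
 also have "... = ?t (insert e B) * (?t (insert e C) * ?t {})" by simp
 also have "... <= ?t (insert e B) * (?t C * ?t {e})" using S by (intro mult_left_mono) auto
 finally have "?t {e} * (?t (insert e (B Un C)) * ?t {}) <= ?t {e} * (?t (insert e B) * ?t C)" by (simp add: algebra_simps)
 moreover have "?t {e} > 0"
 using less_le_trans[OF _ trees_mono[OF fE, of "{e}" "insert e (B Un C)" V en], of 0] False by simp
 ultimately show ?thesis by simp
 qed
qed simp

lemma trees_delete:
 assumes "finite Ed" "e ~: B"
 shows "ntrees V en (Ed - {e}) B = ntrees V en Ed B - ntrees V en Ed (insert e B)"
proof -
 have fin: "finite {T. spanning_tree V en Ed T}" by (rule finite_spanning_trees[OF assms(1)])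
 have "{T. spanning_tree V en (Ed - {e}) T & B <= T} =
 {T. spanning_tree V en Ed T & B <= T} - {T. spanning_tree V en Ed T & insert e B <= T}"
 unfolding spanning_tree_def by blast
 moreover have "card ({T. spanning_tree V en Ed T & B <= T} - {T. spanning_tree V en Ed T & insert e B <= T})
 = card {T. spanning_tree V en Ed T & B <= T} - card {T. spanning_tree V en Ed T & insert e B <= T}"
 by (rule card_Diff_subset) (use fin in \<open>auto elim: finite_subset[rotated]\<close>)
 moreover have "card {T. spanning_tree V en Ed T & insert e B <= T} <= card {T. spanning_tree V en Ed T & B <= T}"
 by (rule card_mono) (use fin in \<open>auto elim: finite_subset[rotated]\<close>)
 ultimately show ?thesis unfolding ntrees_def by simp
qed

text \<open>The event that a tree contains \<^term>\<open>e\<close> or all of \<^term>\<open>B\<close> also becomes less likely in a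
 quotient; together with the previous theorem this yields two-sided control of cylinder events.\<close>

lemma trees_quot_or:
 assumes fin: "finite B" and G: "fgraph V en Ed" and G': "fgraph V' en' Ed'"
 and Q: "graph_quot q j en Ed en' Ed'" and e: "e : Ed" "B <= Ed" "e ~: B"
 defines "t == ntrees V en Ed" and "t' == ntrees V' en' Ed'"
 shows "(t B + t {e} - t (insert e B)) * t' {} <= (t' (j ` B) + t' {j e} - t' (insert (j e) (j ` B))) * t {}"
proof -
 have inj: "inj_on j Ed" using Q by (simp add: graph_quot_def)
 have jd: "j ` (Ed - {e}) = j ` Ed - {j e}" using inj_on_image_set_diff[OF inj, of Ed "{e}"] e by auto
 have jeB: "j e ~: j ` B"
 proof
 assume "j e : j ` B"
 then obtain x where x: "x : B" "j e = j x" by blast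
 hence "e = x" using inj_onD[OF inj, of e x] e by blast
 thus False using x e by simp
 qed
 have fE: "finite Ed" "finite Ed'" using fgraph_finite[OF G] fgraph_finite[OF G'] by auto
 \<comment> \<open>Conditioning on the absence of \<open>e\<close> deletes it, and deletion on both
   sides preserves the quotient relation as well.\<close>
 have Q2: "graph_quot q j en (Ed - {e}) en' (Ed' - {j e})" unfolding graph_quot_def jd
 proof (intro conjI ballI)
 show "inj_on j (Ed - {e})" using inj by (rule inj_on_subset) blast
 show "j ` Ed - {j e} <= Ed' - {j e}" using Q by (auto simp: graph_quot_def)
 show "en epp = q ` en' (j epp)" if "epp : Ed - {e}" for epp using that Q by (simp add: graph_quot_def)
 fix epp assume "epp : Ed' - {j e} - (j ` Ed - {j e})"
 hence "epp : Ed' - j ` Ed" by blast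
 thus "\<exists>v. q ` en' epp <= {v}" using Q unfolding graph_quot_def by blast
 qed
 have G2: "fgraph V en (Ed - {e})" and G2': "fgraph V' en' (Ed' - {j e})"
 using fgraph_mono[OF G] fgraph_mono[OF G'] by auto
 have Be: "B <= Ed - {e}" using e by auto
 define s b s' b' where "s = t {} - t {e}" and "b = t B - t (insert e B)"
 and "s' = t' {} - t' {j e}" and "b' = t' (j ` B) - t' (insert (j e) (j ` B))"
 note D = trees_delete[OF fE(1), of e _ V en] trees_delete[OF fE(2), of "j e" _ V' en']
 have M: "b * s' <= b' * s"
 using trees_quot[OF fin G2 G2' Q2 Be] D e jeB unfolding t_def t'_def s_def b_def s'_def b'_def by simp
 have S: "t {e} * t' {} <= t' {j e} * t {}" unfolding t_def t'_def by (rule trees_quot_edge[OF G G' Q e(1)])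
 have nn: "0 <= t X" "0 <= t' Y" for X Y by (simp_all add: t_def t'_def trees_nonneg)
 have b0: "0 <= b'" "b' <= s'" "0 <= b" "b <= s" "0 <= s" "0 <= s'"
 proof -
 have "ntrees V en (Ed - {e}) B >= 0" "ntrees V en (Ed - {e}) B <= ntrees V en (Ed - {e}) {}"
 "ntrees V' en' (Ed' - {j e}) (j ` B) >= 0" "ntrees V' en' (Ed' - {j e}) (j ` B) <= ntrees V' en' (Ed' - {j e}) {}"
 using fE by (auto intro!: trees_nonneg trees_mono)
 thus "0 <= b'" "b' <= s'" "0 <= b" "b <= s" "0 <= s" "0 <= s'"
 using D(1)[OF e(3)] D(2)[OF jeB] D(1)[of "{}"] D(2)[of "{}"]
 unfolding t_def t'_def s_def b_def s'_def b'_def by auto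
 qed
 have X: "(s' - b') * s <= (s - b) * s'" using M by (simp add: algebra_simps)
 have ss: "s' * t {} <= s * t' {}" using S by (simp add: s_def s'_def algebra_simps)
 \<comment> \<open>The complementary event, \<open>e\<close> absent and some edge of
   \<open>B\<close> absent, has probability \<open>P(not e) (1 - P(B | not e))\<close>, and both
   factors grow when passing to the quotient.\<close>
 have "(s' - b') * t {} <= (s - b) * t' {}"
 proof (cases "s = 0")
 case True
 hence "s' * t {} <= 0" using ss by simp
 hence "(s' - b') * t {} <= 0" using b0 nn(1)[of "{}"] by (smt (verit) mult_right_mono)
 moreover have "0 <= (s - b) * t' {}" using b0 nn by simp
 ultimately show ?thesis by linarith
 next
 case False
 hence sp: "s > 0" using b0 by simp
 have "s * ((s' - b') * t {}) = ((s' - b') * s) * t {}" by simp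
 also have "... <= ((s - b) * s') * t {}" by (rule mult_right_mono[OF X nn(1)])
 also have "... = (s - b) * (s' * t {})" by simp
 also have "... <= (s - b) * (s * t' {})" using ss b0 by (intro mult_left_mono) auto
 finally have "s * ((s' - b') * t {}) <= s * ((s - b) * t' {})" by (simp add: algebra_simps)
 thus ?thesis using sp by simp
 qed
 thus ?thesis unfolding s_def b_def s'_def b'_def by (simp add: algebra_simps)
qed

section \<open>The wired spanning forest as a local limit\<close>

definition tree_prob :: "'v set => ('e => 'v set) => 'e set => 'e set => real" where
 "tree_prob V en Ed B = ntrees V en Ed B / ntrees V en Ed {}"

lemma ntrees_conn: "fgraph V en Ed ==> gconn V en Ed ==> ntrees V en Ed {} > 0"
 using num_spanning_trees_pos by (simp add: ntrees_def num_spanning_trees_def)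

lemma tree_prob_bounds:
 assumes "finite Ed"
 shows "0 <= tree_prob V en Ed B" "tree_prob V en Ed B <= 1"
 using trees_mono[OF assms, of "{}" B V en] unfolding tree_prob_def by (auto simp: divide_le_eq_1)

lemma tree_prob_outside:
 assumes "~ B <= Ed" shows "tree_prob V en Ed B = 0"
proof -
 have "{T. spanning_tree V en Ed T & B <= T} = {}" using assms unfolding spanning_tree_def by blast
 thus ?thesis unfolding tree_prob_def ntrees_def by (simp only: card.empty of_nat_0 div_0)
qed

lemma tree_prob_quot:
 assumes "finite B" "fgraph V en Ed" "fgraph V' en' Ed'" "graph_quot q j en Ed en' Ed'" "B <= Ed"
 and pos: "ntrees V en Ed {} > 0" "ntrees V' en' Ed' {} > 0"
 shows "tree_prob V en Ed B <= tree_prob V' en' Ed' (j ` B)"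
 using trees_quot[OF assms(1-5)] pos unfolding tree_prob_def
 by (simp add: divide_le_eq le_divide_eq mult.commute less_le del: trees_pos_iff)

lemma tree_prob_quot_or:
 assumes "finite B" "fgraph V en Ed" "fgraph V' en' Ed'" "graph_quot q j en Ed en' Ed'" "e : Ed" "B <= Ed" "e ~: B"
 and pos: "ntrees V en Ed {} > 0" "ntrees V' en' Ed' {} > 0"
 shows "tree_prob V en Ed B + tree_prob V en Ed {e} - tree_prob V en Ed (insert e B) <=
 tree_prob V' en' Ed' (j ` B) + tree_prob V' en' Ed' {j e} - tree_prob V' en' Ed' (insert (j e) (j ` B))"
 unfolding tree_prob_def add_divide_distrib[symmetric] diff_divide_distrib[symmetric]
 using trees_quot_or[OF assms(1-7)] pos by (simp add: divide_le_eq le_divide_eq mult.commute less_le del: trees_pos_iff)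

lemma tree_prob_neg:
 assumes "finite B" "fgraph V en Ed" "B <= Ed" "C <= Ed" "B Int C = {}"
 and pos: "ntrees V en Ed {} > 0"
 shows "tree_prob V en Ed (B Un C) <= tree_prob V en Ed B * tree_prob V en Ed C"
 using trees_neg[OF assms(1-5)] pos unfolding tree_prob_def
 by (simp add: divide_le_eq le_divide_eq mult.commute less_le del: trees_pos_iff)

section \<open>Wired boxes and their monotone limit\<close>

context wb_group
begin

definition wv :: "'g set => 'g => 'g option" where "wv K v = (if v : K then Some v else None)"

abbreviation "wV K == Some ` K Un {None}"
abbreviation "wE K == wired_edges G f K"
abbreviation "PK K == tree_prob (wV K) (wired_ends K) (wE K)"

lemma wired_ends_wv: "wired_ends K epp = wv K ` ends epp"
 unfolding wired_ends_def wv_def by simp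

lemma wired_ends_ge: "wired_ends K (ge g l) = {wv K g, wv K (g @@ fst l)}"
 unfolding wired_ends_wv ends_ge by simp

lemma ge_wE: "K <= cG ==> g : K ==> l : Lab ==> ge g l : wE K"
 unfolding wired_edges_def using E_cay_iff ends_ge[of g l] by auto

lemma wE_ge:
 assumes K: "K <= cG" and e: "epp : wE K"
 obtains g l where "g : K" "l : Lab" "epp = ge g l"
proof -
 obtain g l where gl: "g : cG" "l : Lab" "epp = ge g l" using e E_cay_iff unfolding wired_edges_def by auto
 have "g : K | g @@ fst l : K" using e gl(3) ends_ge[of g l] unfolding wired_edges_def by auto
 thus ?thesis
 proof
 assume "g @@ fst l : K"
 thus ?thesis using that[OF _ linv_Lab[OF gl(2)]] ge_flip[OF gl(1,2)] gl(3) by metis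
 qed (use that gl in auto)
qed

lemma finite_wE: assumes "finite K" "K <= cG" shows "finite (wE K)"
proof (rule finite_subset)
 show "wE K <= (%(g, l). ge g l) ` (K \<times> Lab)"
 proof
 fix epp assume "epp : wE K"
 then obtain g l where "g : K" "l : Lab" "epp = ge g l" using wE_ge[OF assms(2)] by metis
 thus "epp : (%(g, l). ge g l) ` (K \<times> Lab)" by (intro image_eqI[of _ _ "(g, l)"]) auto
 qed
qed (use assms finite_Lab in auto)

lemma wired_graph:
 assumes K: "finite K" "K <= cG"
 shows "fgraph (wV K) (wired_ends K) (wE K)"
 unfolding fgraph_def
proof (intro conjI ballI)
 show "finite (wV K)" using K by simp
 show "finite (wE K)" by (rule finite_wE[OF K])
 fix epp assume "epp : wE K"
 then obtain g l where "g : K" "l : Lab" "epp = ge g l" using wE_ge[OF K(2)] by metis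
 thus "EX a:wV K. EX b:wV K. wired_ends K epp = {a, b}"
 by (intro bexI[of _ "wv K g"] bexI[of _ "wv K (g @@ fst l)"]) (auto simp: wired_ends_ge wv_def)
qed

text \<open>A component that never meets the boundary vertex would contain a translate of the whole
  infinite group inside the finite set \<open>K\<close>.\<close>

lemma wired_conn:
 assumes K: "finite K" "K <= cG"
 shows "gconn (wV K) (wired_ends K) (wE K)"
proof -
 let ?R = "(adj_rel (wired_ends K) (wE K))^*"
 have root: "(Some g, None) : ?R" if g: "g : K" for g
 proof (rule ccontr)
 assume n: "(Some g, None) ~: ?R"
 have gc: "g : cG" using g K by auto
 have r: "g @@ h : K & (Some g, Some (g @@ h)) : ?R" if "h : cG" for h
 proof (rule word_induct[OF that])
 show "g @@ \<one> : K & (Some g, Some (g @@ \<one>)) : ?R" using g gc by simp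
 fix h l assume h: "h : cG" "l : Lab" and IH: "g @@ h : K & (Some g, Some (g @@ h)) : ?R"
 have e: "g @@ (h @@ fst l) = g @@ h @@ fst l" using gc h(1) Lab_carrier(1)[OF h(2)] by (simp add: m_assoc)
 have E: "ge (g @@ h) l : wE K" using ge_wE[OF K(2) _ h(2)] IH by simp
 have "(Some (g @@ h), wv K (g @@ h @@ fst l)) : ?R"
 by (rule adj_edge[where en = "wired_ends K", OF E]) (use IH in \<open>simp add: wired_ends_ge wv_def\<close>)
 hence s: "(Some g, wv K (g @@ h @@ fst l)) : ?R" using IH rtrancl_trans by metis
 hence "g @@ h @@ fst l : K" using n by (auto simp: wv_def split: if_splits)
 thus "g @@ (h @@ fst l) : K & (Some g, Some (g @@ (h @@ fst l))) : ?R" using s e by (simp add: wv_def)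
 qed
 have "inj_on (%h. g @@ h) (cG)" using bij_left_mult[OF gc] by (simp add: bij_betw_def)
 moreover have "finite ((%h. g @@ h) ` cG)" by (rule finite_subset[OF _ K(1)]) (use r in auto)
 ultimately show False using inf finite_imageD by blast
 qed
 have "(x, None) : ?R" if "x : wV K" for x using that root by auto
 thus ?thesis unfolding gconn_def using adj_rtrancl_sym rtrancl_trans by metis
qed

lemma wired_pos: "finite K ==> K <= cG ==> ntrees (wV K) (wired_ends K) (wE K) {} > 0"
 by (intro ntrees_conn wired_graph wired_conn)

lemma PK_bounds: "finite K ==> K <= cG ==> 0 <= PK K B" "finite K ==> K <= cG ==> PK K B <= 1"
 by (rule tree_prob_bounds, rule finite_wE, assumption+)+

text \<open>Shrinking the box identifies more vertices with the boundary vertex, so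
  \<open>trees_quot\<close> makes cylinder probabilities increase with \<open>K\<close>.\<close>

lemma PK_mono:
 assumes K: "K <= K'" "finite K'" "K' <= cG" and B: "finite B"
 shows "PK K B <= PK K' B"
proof (cases "B <= wE K")
 case False
 show ?thesis unfolding tree_prob_outside[OF False] by (rule PK_bounds[OF K(2,3)])
next
 case True
 have K0: "finite K" "K <= cG" using K finite_subset by auto
 let ?q = "%x. case x of None => None | Some v => wv K v"
 have qv: "?q (wv K' v) = wv K v" for v using K by (auto simp: wv_def)
 have q: "?q ` wired_ends K' epp = wired_ends K epp" for epp
 unfolding wired_ends_wv image_image qv ..
 have "graph_quot ?q id (wired_ends K) (wE K) (wired_ends K') (wE K')" unfolding graph_quot_def q
 proof (intro conjI ballI)
 show "id ` wE K <= wE K'" using K by (auto simp: wired_edges_def)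
 fix epp assume "epp : wE K' - id ` wE K"
 hence "ends epp Int K = {}" by (auto simp: wired_edges_def)
 thus "\<exists>v. wired_ends K epp <= {v}" by (intro exI[of _ None]) (auto simp: wired_ends_wv wv_def)
 qed auto
 from tree_prob_quot[OF B wired_graph[OF K0] wired_graph[OF K(2,3)] this True wired_pos[OF K0] wired_pos[OF K(2,3)]]
 show ?thesis by simp
qed

text \<open>By monotonicity the limit along any exhaustion is this supremum, which depends on no
  exhaustion.\<close>

definition wsf_prob :: "'g ed set => real" where
 "wsf_prob B = Sup {PK K B | K. finite K & K <= cG}"

lemma PK_le_wsf: assumes "finite K" "K <= cG" shows "PK K B <= wsf_prob B"
 unfolding wsf_prob_def by (rule cSup_upper) (use assms PK_bounds in \<open>auto intro!: bdd_aboveI[of _ 1]\<close>)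

lemma wsf_approx:
 assumes "ett > 0"
 obtains K where "finite K" "K <= cG" "PK K B > wsf_prob B - ett"
proof -
 have "EX x:{PK K B | K. finite K & K <= cG}. wsf_prob B - ett < x"
 unfolding wsf_prob_def by (rule less_cSupD) (use assms in auto)
 thus ?thesis using that by blast
qed

lemma wsf_le_1: "wsf_prob B <= 1"
 unfolding wsf_prob_def by (rule cSup_least) (use PK_bounds in auto)

lemma wsf_empty: "wsf_prob {} = 1"
proof -
 have "PK {} {} = 1" unfolding tree_prob_def using wired_pos[of "{}"] by simp
 thus ?thesis using PK_le_wsf[of "{}" "{}"] wsf_le_1[of "{}"] by simp
qed

lemma wsf_limit:
 assumes K: "!!n. finite (K n)" "!!n. K n <= K (Suc n)" "(\<Union>n. K n) = cG" and B: "finite B"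
 shows "(%n. PK (K n) B) \<longlonglongrightarrow> wsf_prob B"
proof (rule LIMSEQ_I)
 fix r :: real assume "r > 0"
 then obtain K0 where K0: "finite K0" "K0 <= cG" "PK K0 B > wsf_prob B - r" by (rule wsf_approx)
 have mono: "K m <= K n" if "m <= n" for m n by (rule lift_Suc_mono_le[of K, OF K(2) that])
 have ex: "\<exists>n. K0 <= K n"
 using K0(1,2)
 proof (induction K0 rule: finite_induct)
 case (insert x F)
 then obtain n where n: "F <= K n" by auto
 obtain m where "x : K m" using insert K(3) by blast
 hence "insert x F <= K (max m n)" using n mono[of m "max m n"] mono[of n "max m n"] by auto
 thus ?case by blast
 qed simp
 then obtain n0 where n0: "K0 <= K n0" by blast
 show "\<exists>no. \<forall>n\<ge>no. norm (PK (K n) B - wsf_prob B) < r"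
 proof (intro exI allI impI)
 fix n assume "n0 <= n"
 hence s: "K0 <= K n" using n0 mono by blast
 have c: "K n <= cG" using K(3) by blast
 have "PK K0 B <= PK (K n) B" by (rule PK_mono[OF s K(1) c B])
 moreover have "PK (K n) B <= wsf_prob B" by (rule PK_le_wsf[OF K(1) c])
 ultimately show "norm (PK (K n) B - wsf_prob B) < r" using K0(3) by simp
 qed
qed

lemma PK_act:
 assumes K: "finite K" "K <= cG" and h: "h : cG" and B: "finite B" "B <= wE K"
 shows "PK K B <= PK ((%v. h @@ v) ` K) (edge_act G h ` B)"
proof -
 let ?K = "(%v. h @@ v) ` K"
 have K': "finite ?K" "?K <= cG" using K h by auto
 have inv: "edge_act G (inv h) (edge_act G h epp) = epp" if ep: "epp : wE K" for epp
 proof -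
 obtain g l where gl: "g : K" "l : Lab" "epp = ge g l" using wE_ge[OF K(2) ep] by metis
 have gc: "g : cG" using gl K by auto
 show ?thesis unfolding gl(3) using edge_act_ge[OF h gc gl(2)] edge_act_ge[of "inv h" "h @@ g" l] gl(2) h gc
 by (simp add: cancel_left)
 qed
 let ?q = "map_option (%v. inv h @@ v)"
 have qv: "?q (wv ?K (h @@ v)) = wv K v" if "v : cG" for v
 proof -
 have "h @@ v : ?K \<longleftrightarrow> v : K"
 proof
 assume "h @@ v : ?K"
 then obtain w where w: "w : K" "h @@ v = h @@ w" by auto
 thus "v : K" using h that K by auto
 qed simp
 thus ?thesis using h that by (simp add: wv_def cancel_left)
 qed
 have "graph_quot ?q (edge_act G h) (wired_ends K) (wE K) (wired_ends ?K) (wE ?K)" unfolding graph_quot_def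
 proof (intro conjI ballI)
 show "inj_on (edge_act G h) (wE K)" by (rule inj_on_inverseI) (rule inv)
 have onto: "wE ?K <= edge_act G h ` wE K"
 proof
 fix epp assume "epp : wE ?K"
 then obtain g l where gl: "g : ?K" "l : Lab" "epp = ge g l" using wE_ge[OF K'(2)] by metis
 then obtain v where v: "v : K" "g = h @@ v" by auto
 have "epp = edge_act G h (ge v l)" using edge_act_ge[OF h _ gl(2), of v] v gl(3) K by auto
 thus "epp : edge_act G h ` wE K" using ge_wE[OF K(2) v(1) gl(2)] by blast
 qed
 thus "\<exists>v. ?q ` wired_ends ?K epp <= {v}" if "epp : wE ?K - edge_act G h ` wE K" for epp using that by blast
 have *: "edge_act G h epp : wE ?K & wired_ends K epp = ?q ` wired_ends ?K (edge_act G h epp)" if ep: "epp : wE K" for epp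
 proof -
 obtain g l where gl: "g : K" "l : Lab" "epp = ge g l" using wE_ge[OF K(2) ep] by metis
 have gc: "g : cG" "g @@ fst l : cG" using gl K Lab_carrier(1)[OF gl(2)] by auto
 have e: "edge_act G h (ge g l) = ge (h @@ g) l" by (rule edge_act_ge[OF h gc(1) gl(2)])
 have a: "h @@ g @@ fst l = h @@ (g @@ fst l)" using h gc Lab_carrier(1)[OF gl(2)] by (simp add: m_assoc)
 show ?thesis using ge_wE[OF K'(2) _ gl(2)] gl(1) qv[OF gc(1)] qv[OF gc(2)] unfolding gl(3) e wired_ends_ge a
 by simp
 qed
 show "edge_act G h ` wE K <= wE ?K" using * by blast
 show "wired_ends K epp = ?q ` wired_ends ?K (edge_act G h epp)" if "epp : wE K" for epp using * that by blast
 qed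
 from tree_prob_quot[OF B(1) wired_graph[OF K] wired_graph[OF K'] this B(2) wired_pos[OF K] wired_pos[OF K']]
 show ?thesis .
qed

lemma wsf_act_le:
 assumes h: "h : cG" and B: "finite B"
 shows "wsf_prob B <= wsf_prob (edge_act G h ` B)"
 unfolding wsf_prob_def[of B]
proof (rule cSup_least)
 fix x assume "x : {PK K B | K. finite K & K <= cG}"
 then obtain K where K: "x = PK K B" "finite K" "K <= cG" by blast
 have K': "finite ((%v. h @@ v) ` K)" "(%v. h @@ v) ` K <= cG" using K h by auto
 show "x <= wsf_prob (edge_act G h ` B)"
 proof (cases "B <= wE K")
 case True
 show ?thesis using PK_act[OF K(2,3) h B True] PK_le_wsf[OF K', of "edge_act G h ` B"] K(1) by simp
 next
 case False
 have "x = 0" unfolding K(1) by (rule tree_prob_outside[OF False])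
 thus ?thesis using order_trans[OF PK_bounds(1)[OF K'] PK_le_wsf[OF K']] by simp
 qed
qed auto

lemma wsf_ge: assumes "g : cG" "l : Lab" shows "wsf_prob {ge g l} = wsf_prob {se l}"
proof (rule antisym)
 show "wsf_prob {ge g l} <= wsf_prob {se l}"
 using wsf_act_le[of "inv g" "{ge g l}"] edge_act_ge[of "inv g" g l] assms by simp
 show "wsf_prob {se l} <= wsf_prob {ge g l}"
 using wsf_act_le[of g "{se l}"] edge_act_ge[of g \<one> l] assms by simp
qed

lemma inc_wired:
 assumes K: "K <= cG" and g: "g : K"
 shows "bij_betw (ge g) Lab (inc (wired_ends K) (wE K) (Some g))"
proof (rule bij_betw_imageI)
 have gc: "g : cG" using g K by auto
 show "inj_on (ge g) Lab" by (rule inj_onI) (rule ge_inj[OF gc])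
 show "ge g ` Lab = inc (wired_ends K) (wE K) (Some g)"
 proof (intro equalityI subsetI)
 fix epp assume "epp : ge g ` Lab"
 thus "epp : inc (wired_ends K) (wE K) (Some g)"
 using ge_wE[OF K g] g by (auto simp: inc_def wired_ends_ge wv_def)
 next
 fix epp assume e: "epp : inc (wired_ends K) (wE K) (Some g)"
 hence "epp : wE K" by (simp add: inc_def)
 then obtain h l where hl: "h : K" "l : Lab" "epp = ge h l" using wE_ge[OF K] by metis
 have hc: "h : cG" using hl K by auto
 have "Some g : {wv K h, wv K (h @@ fst l)}" using e hl(3) by (simp add: inc_def wired_ends_ge)
 hence "g = h | g = h @@ fst l" by (auto simp: wv_def split: if_splits)
 thus "epp : ge g ` Lab"
 proof
 assume "g = h @@ fst l"
 hence "epp = ge g (linv l)" using ge_flip[OF hc hl(2)] hl(3) by simp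
 thus ?thesis using linv_Lab[OF hl(2)] by blast
 qed (use hl in blast)
 qed
qed

text \<open>Summation by parts; since \<open>u\<close> vanishes off \<open>K\<close>, the boundary
  vertex has value 0 and contributes nothing.\<close>

lemma wired_energy:
 fixes u :: "'g => real"
 assumes K: "finite K" "K <= cG" and u: "!!w. w : cG - K ==> u w = 0"
 defines "v == (%x. case x of None => 0 | Some w => u w)"
 shows "energy (wired_ends K) (wE K) v = (SUM g:K. u g * lap u g)"
 "!!w. w : cG ==> v (wv K w) = u w"
proof -
 note Gr = wired_graph[OF K]
 show vv: "!!w. w : cG ==> v (wv K w) = u w" using u by (auto simp: v_def wv_def)
 have "2 * energy (wired_ends K) (wE K) v =
 2 * (SUM x:wV K. v x * (SUM epp:inc (wired_ends K) (wE K) x. v x - v (other (wired_ends K epp) x)))"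
 unfolding dirichlet_form[OF Gr] energy_vertex_sum[OF Gr, symmetric] by (simp add: power2_eq_square)
 also have "(SUM x:wV K. v x * (SUM epp:inc (wired_ends K) (wE K) x. v x - v (other (wired_ends K epp) x)))
 = (SUM x:Some ` K. v x * (SUM epp:inc (wired_ends K) (wE K) x. v x - v (other (wired_ends K epp) x)))"
 using K by (subst sum.union_disjoint) (auto simp: v_def)
 also have "... = (SUM g:K. u g * (SUM epp:inc (wired_ends K) (wE K) (Some g). u g - v (other (wired_ends K epp) (Some g))))"
 by (subst sum.reindex) (auto simp: v_def)
 also have "... = (SUM g:K. u g * lap u g)"
 proof (rule sum.cong[OF refl])
 fix g assume g: "g : K"
 have gc: "g : cG" using g K by auto
 have "(SUM epp:inc (wired_ends K) (wE K) (Some g). u g - v (other (wired_ends K epp) (Some g)))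
 = (SUM l:Lab. u g - v (other (wired_ends K (ge g l)) (Some g)))"
 by (rule sum.reindex_bij_betw[OF inc_wired[OF K(2) g], symmetric])
 also have "... = (SUM l:Lab. u g - u (g @@ fst l))"
 proof (rule sum.cong[OF refl])
 fix l assume l: "l : Lab"
 have "other (wired_ends K (ge g l)) (Some g) = wv K (g @@ fst l)"
 by (rule other_eq) (use g in \<open>simp add: wired_ends_ge wv_def\<close>)
 thus "u g - v (other (wired_ends K (ge g l)) (Some g)) = u g - u (g @@ fst l)"
 using vv[of "g @@ fst l"] gc Lab_carrier(1)[OF l] by simp
 qed
 finally show "u g * (SUM epp:inc (wired_ends K) (wE K) (Some g). u g - v (other (wired_ends K epp) (Some g))) = u g * lap u g"
 by (simp add: lap_def opr_def nbr_def sum_subtractf deg_def)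
 qed
 finally show "energy (wired_ends K) (wE K) v = (SUM g:K. u g * lap u g)" by simp
qed

section \<open>The expected degree of the wired forest\<close>

definition walk :: "nat => 'g => real" where "walk k = (nbr ^^ k) dl1"

lemma walk_Suc: "walk (Suc k) w = (SUM l:Lab. walk k (w @@ fst l))"
 unfolding walk_def by (rule nbr_Suc)

lemma walk_nonneg: "walk k w >= 0"
proof (induction k arbitrary: w)
 case 0
 thus ?case by (simp add: walk_def dl1_def unit_elem_def)
qed (simp add: walk_Suc sum_nonneg)

lemma walk_mass:
 assumes "finite A" "A <= cG"
 shows "(SUM w:A. walk k w) <= real deg ^ k"
 using assms
proof (induction k arbitrary: A)
 case 0
 have "(SUM w:A. walk 0 w) = (SUM w:A. if w = \<one> then 1 else 0)"
 by (simp add: walk_def dl1_def unit_elem_def)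
 also have "... <= 1" using 0 by simp
 finally show ?case by simp
next
 case (Suc k)
 have "(SUM w:A. walk (Suc k) w) = (SUM l:Lab. SUM w:A. walk k (w @@ fst l))"
 unfolding walk_Suc by (rule sum.swap)
 also have "... <= (SUM l:Lab. real deg ^ k)"
 proof (rule sum_mono)
 fix l assume l: "l : Lab"
 have i: "inj_on (%w. w @@ fst l) A"
 using bij_right_mult[OF Lab_carrier(1)[OF l]] Suc.prems(2) by (auto simp: bij_betw_def intro: inj_on_subset)
 have "(SUM w:A. walk k (w @@ fst l)) = (SUM w:(%w. w @@ fst l) ` A. walk k w)"
 by (simp add: sum.reindex[OF i])
 also have "... <= real deg ^ k" using Suc.prems Lab_carrier(1)[OF l] by (intro Suc.IH) auto
 finally show "(SUM w:A. walk k (w @@ fst l)) <= real deg ^ k" .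
 qed
 finally show ?case by (simp add: deg_def)
qed

lemma finite_walk: "finite {w : cG. walk k w ~= 0}"
proof -
 have "walk k : FS" unfolding walk_def by (induction k) (auto intro: dl1_FS FS_nbr)
 thus ?thesis by (simp add: FS_def)
qed

text \<open>The voltage function of the unit current from \<open>\<one>\<close> to a neighbour is approximated by a
 difference of two translates of the truncated Green function of \<open>lap + thh\<close>.\<close>

lemma wired_degree:
 assumes lam: "thh > 0"
 obtains K where "finite K" "K <= cG"
 "(SUM l:Lab. PK K {se l}) >= 2 - 2 * thh * (\<Sum>k<m. walk k \<one> / (real deg + thh) ^ Suc k)
 - (2 + 4 * real deg / thh) * (real deg / (real deg + thh)) ^ m"
proof -
 define c where "c = 1 / (real deg + thh)"
 define g where "g w = (\<Sum>k<m. walk k w * c ^ Suc k)" for w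
 have c: "c > 0" "c * (real deg + thh) = 1" using lam by (auto simp: c_def)
 have cd: "c * real deg < 1" "1 - c * real deg = c * thh" using c mult_pos_pos[OF c(1) lam] by (auto simp: algebra_simps)
 have g0: "g w >= 0" for w unfolding g_def using walk_nonneg c by (intro sum_nonneg mult_nonneg_nonneg) auto
 have g1: "g w <= 1 / thh" if "w : cG" for w
 proof -
 have "g w <= (\<Sum>k<m. c * (c * real deg) ^ k)" unfolding g_def
 proof (rule sum_mono)
 fix k
 have "walk k w * c ^ Suc k <= real deg ^ k * c ^ Suc k"
 using walk_mass[of "{w}" k] that c by (intro mult_right_mono) auto
 thus "walk k w * c ^ Suc k <= c * (c * real deg) ^ k" by (simp add: power_mult_distrib algebra_simps)
 qed
 also have "... = c * ((1 - (c * real deg) ^ m) / (1 - c * real deg))"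
 using cd by (simp add: sum_distrib_left[symmetric] sum_gp_strict)
 also have "... <= c * (1 / (1 - c * real deg))"
 using c cd by (intro mult_left_mono divide_right_mono) auto
 also have "... = 1 / thh" using c lam unfolding cd(2) by simp
 finally show ?thesis .
 qed
 \<comment> \<open>The sum telescopes; the truncation shows only in the last term, of total mass at
   most \<open>(c * deg) ^ m\<close>.\<close>
 have eq: "lap g w + thh * g w = dl1 w - c ^ m * walk m w" for w
 proof -
 have "nbr g w = (\<Sum>k<m. walk (Suc k) w * c ^ Suc k)"
 unfolding nbr_def g_def walk_Suc by (subst sum.swap) (simp add: sum_distrib_right)
 moreover have "lap g w + thh * g w = (real deg + thh) * g w - nbr g w"
 by (simp add: lap_def opr_def algebra_simps)
 ultimately have "lap g w + thh * g w = (\<Sum>k<m. (real deg + thh) * (walk k w * c ^ Suc k) - walk (Suc k) w * c ^ Suc k)"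
 by (simp only: g_def sum_subtractf sum_distrib_left)
 also have "... = (\<Sum>k<m. walk k w * c ^ k - walk (Suc k) w * c ^ Suc k)"
 proof (rule sum.cong[OF refl])
 fix k
 have "(real deg + thh) * (walk k w * c ^ Suc k) = (c * (real deg + thh)) * (walk k w * c ^ k)" by simp
 thus "(real deg + thh) * (walk k w * c ^ Suc k) - walk (Suc k) w * c ^ Suc k = walk k w * c ^ k - walk (Suc k) w * c ^ Suc k"
 unfolding c(2) by simp
 qed
 also have "... = walk 0 w * c ^ 0 - walk m w * c ^ m" by (rule sum_lessThan_telescope')
 finally show ?thesis by (simp add: walk_def algebra_simps)
 qed
 define S where "S = {w : cG. g w ~= 0}"
 have finS: "finite S"
 proof (rule finite_subset)
 show "S <= (\<Union>k<m. {w : cG. walk k w ~= 0})"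
 proof
 fix w assume w: "w : S"
 show "w : (\<Union>k<m. {w : cG. walk k w ~= 0})"
 proof (rule ccontr)
 assume "w ~: (\<Union>k<m. {w : cG. walk k w ~= 0})"
 hence "walk k w = 0" if "k < m" for k using w that by (auto simp: S_def)
 thus False using w by (simp add: S_def g_def)
 qed
 qed
 qed (use finite_walk in auto)
 \<comment> \<open>The box contains the support of \<open>g\<close> and its translates by
   generators, hence the support of every test function \<open>u\<close> below.\<close>
 define K where "K = insert \<one> (fst ` Lab) Un S Un (%(l, w). fst l @@ w) ` (Lab \<times> S)"
 have K: "finite K" "K <= cG" "\<one> : K" "!!l. l : Lab ==> fst l : K"
 unfolding K_def using finS finite_Lab Lab_carrier(1) by (auto simp: S_def)
 \<comment> \<open>The voltage drop of the test function \<open>u\<close> across the edge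
   \<open>se l\<close>.\<close>
 define a where "a l = 2 * g \<one> - g (fst l) - g (inv (fst l))" for l :: "'g \<times> nat"
 \<comment> \<open>\<open>u\<close> is bounded by \<open>2 / thh\<close>, and the two truncation
   remainders have total mass at most \<open>2 * (c * deg) ^ m\<close>.\<close>
 define ett where "ett = 4 / thh * (c * real deg) ^ m"
 have ett0: "ett >= 0" using lam c by (simp add: ett_def)
 have low: "PK K {se l} >= a l - ett" if l: "l : Lab" for l
 proof -
 let ?s = "fst l"
 have s: "?s : cG" by (rule Lab_carrier(1)[OF l])
 define u where "u w = g w - g (inv ?s @@ w)" for w
 have u0: "u w = 0" if w: "w : cG - K" for w
 proof -
 have "w ~: S" using w by (auto simp: K_def)
 hence 1: "g w = 0" using w by (simp add: S_def)
 have "inv ?s @@ w ~: S"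
 proof
 assume "inv ?s @@ w : S"
 hence "(%(l, w). fst l @@ w) (l, inv ?s @@ w) : K" using l unfolding K_def by blast
 thus False using w s by (simp add: cancel_left)
 qed
 hence "g (inv ?s @@ w) = 0" using w s by (simp add: S_def)
 thus ?thesis using 1 by (simp add: u_def)
 qed
 have lapu: "lap u w = lap g w - lap g (inv ?s @@ w)" if w: "w : cG" for w
 proof -
 have "nbr u w = nbr g w - nbr g (inv ?s @@ w)" unfolding nbr_def u_def sum_subtractf
 using w s Lab_carrier(1) by (intro arg_cong2[of _ _ _ _ "(-)"] sum.cong refl) (auto simp: m_assoc dest: Lab_pair)
 thus ?thesis by (simp add: lap_def opr_def u_def algebra_simps)
 qed
 have ub: "\<bar>u w\<bar> <= 2 / thh" if w: "w : cG" for w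
 using g1[OF w] g1[of "inv ?s @@ w"] g0[of w] g0[of "inv ?s @@ w"] w s unfolding u_def by (simp add: abs_le_iff)
 let ?r = "%w. walk m w - walk m (inv ?s @@ w)"
 have al: "u \<one> - u ?s = a l" using s by (simp add: u_def a_def)
 \<comment> \<open>The equation for \<open>lap u\<close> is paired with \<open>u\<close>; the mass
   term \<open>- thh * u^2\<close> is nonpositive and dropped.\<close>
 have "(SUM w:K. u w * lap u w) <= (SUM w:K. u w * (dl1 w - dl1 (inv ?s @@ w)) - c ^ m * (u w * ?r w))"
 proof (rule sum_mono)
 fix w assume "w : K"
 hence w: "w : cG" using K by auto
 have L: "lap u w = (dl1 w - dl1 (inv ?s @@ w)) - c ^ m * ?r w - thh * u w"
 using eq[of w] eq[of "inv ?s @@ w"] lapu[OF w] by (simp add: u_def algebra_simps)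
 have "u w * lap u w = u w * (dl1 w - dl1 (inv ?s @@ w)) - c ^ m * (u w * ?r w) - thh * (u w * u w)"
 by (simp only: L) (simp add: algebra_simps)
 moreover have "thh * (u w * u w) >= 0" using lam by simp
 ultimately show "u w * lap u w <= u w * (dl1 w - dl1 (inv ?s @@ w)) - c ^ m * (u w * ?r w)" by linarith
 qed
 also have "... = (SUM w:K. u w * (dl1 w - dl1 (inv ?s @@ w))) - c ^ m * (SUM w:K. u w * ?r w)"
 by (simp add: sum_subtractf sum_distrib_left)
 also have "(SUM w:K. u w * (dl1 w - dl1 (inv ?s @@ w))) = a l"
 proof -
 have d: "dl1 (inv ?s @@ w) = (if w = ?s then 1 else 0)" if "w : K" for w
 proof -
 have wc: "w : cG" using that K by auto
 have "inv ?s @@ w = \<one> \<longleftrightarrow> w = ?s" using wc s inv_solve_left'[of "inv ?s" w \<one>]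
 by (metis cancel_left(1) l_inv r_one)
 thus ?thesis by (simp add: dl1_def unit_elem_def)
 qed
 have "(SUM w:K. u w * (dl1 w - dl1 (inv ?s @@ w))) =
 (SUM w:K. (if w = \<one> then u w else 0) - (if w = ?s then u w else 0))"
 using d by (intro sum.cong refl) (simp add: dl1_def unit_elem_def)
 also have "... = u \<one> - u ?s" unfolding sum_subtractf using K l by (simp add: sum.delta)
 finally show ?thesis using al by simp
 qed
 finally have D0: "(SUM w:K. u w * lap u w) <= a l - c ^ m * (SUM w:K. u w * ?r w)" .
 have "- (c ^ m * (SUM w:K. u w * ?r w)) <= ett"
 proof -
 have "\<bar>SUM w:K. u w * ?r w\<bar> <= (SUM w:K. 2 / thh * (walk m w + walk m (inv ?s @@ w)))"
 proof (rule order_trans[OF sum_abs sum_mono])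
 fix w assume "w : K"
 hence w: "w : cG" using K by auto
 have "\<bar>?r w\<bar> <= walk m w + walk m (inv ?s @@ w)"
 using walk_nonneg[of m w] walk_nonneg[of m "inv ?s @@ w"] by (simp add: abs_le_iff)
 thus "\<bar>u w * ?r w\<bar> <= 2 / thh * (walk m w + walk m (inv ?s @@ w))"
 unfolding abs_mult using ub[OF w] lam by (intro mult_mono) auto
 qed
 also have "... = 2 / thh * ((SUM w:K. walk m w) + (SUM w:K. walk m (inv ?s @@ w)))"
 by (simp only: sum_distrib_left[symmetric] sum.distrib)
 also have "... <= 2 / thh * (real deg ^ m + real deg ^ m)"
 proof (intro mult_left_mono add_mono walk_mass K)
 have i: "inj_on (%w. inv ?s @@ w) K"
 using bij_left_mult[of "inv ?s"] s K by (auto simp: bij_betw_def intro: inj_on_subset)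
 have "(SUM w:K. walk m (inv ?s @@ w)) = (SUM w:(%w. inv ?s @@ w) ` K. walk m w)"
 by (simp add: sum.reindex[OF i])
 also have "... <= real deg ^ m" using K s by (intro walk_mass) auto
 finally show "(SUM w:K. walk m (inv ?s @@ w)) <= real deg ^ m" .
 qed (use lam in auto)
 finally have "c ^ m * \<bar>SUM w:K. u w * ?r w\<bar> <= c ^ m * (4 / thh * real deg ^ m)"
 using c by (intro mult_left_mono) auto
 also have "... = ett" by (simp add: ett_def power_mult_distrib)
 finally have "c ^ m * \<bar>SUM w:K. u w * ?r w\<bar> <= ett" .
 moreover have "c ^ m * (- (SUM w:K. u w * ?r w)) <= c ^ m * \<bar>SUM w:K. u w * ?r w\<bar>"
 using c by (intro mult_left_mono) auto
 ultimately show ?thesis by linarith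
 qed
 hence D: "(SUM w:K. u w * lap u w) <= a l + ett" using D0 by linarith
 define v where "v = (%x. case x of None => 0 | Some w => u w)"
 have en: "energy (wired_ends K) (wE K) v = (SUM g:K. u g * lap u g)"
 unfolding v_def by (rule wired_energy(1)[OF K(1,2) u0])
 have vw: "v (wv K w) = u w" if "w : cG" for w
 unfolding v_def by (rule wired_energy(2)[OF K(1,2) u0 that])
 have sK: "wired_ends K (se l) = {wv K \<one>, wv K ?s}" using wired_ends_ge[of K \<one> l] s by simp
 have "\<one> ~= ?s" using Lab_carrier(2)[OF l] by simp
 hence ne: "wv K \<one> ~= wv K ?s" using K l by (simp add: wv_def)
 have pos: "ntrees (wV K) (wired_ends K) (wE K) {} > 0" by (rule wired_pos[OF K(1,2)])
 have "(v (wv K \<one>) - v (wv K ?s))^2 * ntrees (wV K) (wired_ends K) (wE K) {} <=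
 ntrees (wV K) (wired_ends K) (wE K) {se l} * energy (wired_ends K) (wE K) v"
 by (rule dirichlet_principle[OF wired_graph[OF K(1,2)] ge_wE[OF K(2,3) l] sK ne])
 hence "(a l)^2 <= PK K {se l} * (SUM w:K. u w * lap u w)"
 using pos vw[OF s] vw[OF one_closed] al unfolding en tree_prob_def
 by (simp add: le_divide_eq less_le del: trees_pos_iff)
 also have "... <= PK K {se l} * (a l + ett)" using D PK_bounds[OF K(1,2)] by (intro mult_left_mono)
 finally have sq: "(a l)^2 <= PK K {se l} * (a l + ett)" .
 have "a l + ett >= 0" using D energy_nonneg[of "wired_ends K" "wE K" v] unfolding en by linarith
 show ?thesis
 proof (cases "a l + ett = 0")
 case True
 thus ?thesis using PK_bounds(1)[OF K(1,2), of "{se l}"] ett0 by linarith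
 next
 case False
 \<comment> \<open>Comparing with \<open>(a - ett) * (a + ett)\<close> yields
   \<open>PK >= a - ett\<close> without dividing by \<open>a\<close>, whose sign is unknown.\<close>
 have "(a l - ett) * (a l + ett) = (a l)^2 - ett * ett" by (simp add: power2_eq_square algebra_simps)
 also have "... <= PK K {se l} * (a l + ett)" using sq ett0 mult_nonneg_nonneg[OF ett0 ett0] by linarith
 finally show ?thesis using False \<open>a l + ett >= 0\<close> by (simp add: mult_le_cancel_right)
 qed
 qed
 \<comment> \<open>Labels and inverse labels contribute equally, so the drops add up to
   \<open>2 * lap g \<one>\<close>, which is near 2 for small \<open>thh * g \<one>\<close>.\<close>
 have "2 - 2 * thh * g \<one> - 2 * (c * real deg) ^ m <= (SUM l:Lab. a l)"
 proof -
 have "(SUM l:Lab. g (inv (fst l))) = (SUM l:Lab. g (fst l))"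
 using sum_Lab_linv[of "%l. g (fst l)"] by (simp add: fst_linv)
 moreover have "nbr g \<one> = (SUM l:Lab. g (fst l))"
 unfolding nbr_def using Lab_carrier(1) by (intro sum.cong refl) (auto dest: Lab_pair)
 ultimately have "(SUM l:Lab. a l) = 2 * lap g \<one>"
 by (simp add: a_def sum_subtractf lap_def opr_def deg_def)
 moreover have "lap g \<one> = 1 - c ^ m * walk m \<one> - thh * g \<one>" using eq[of \<one>] by (simp add: dl1_def unit_elem_def)
 moreover have "c ^ m * walk m \<one> <= (c * real deg) ^ m"
 unfolding power_mult_distrib using walk_mass[of "{\<one>}" m] c by (intro mult_left_mono) auto
 ultimately show ?thesis by simp
 qed
 moreover have "(SUM l:Lab. a l - ett) <= (SUM l:Lab. PK K {se l})" by (intro sum_mono low)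
 ultimately have "2 - 2 * thh * g \<one> - 2 * (c * real deg) ^ m - real deg * ett <= (SUM l:Lab. PK K {se l})"
 by (simp add: sum_subtractf deg_def)
 moreover have "g \<one> = (\<Sum>k<m. walk k \<one> / (real deg + thh) ^ Suc k)" by (simp add: g_def c_def power_divide)
 moreover have "2 * (c * real deg) ^ m + real deg * ett = (2 + 4 * real deg / thh) * (real deg / (real deg + thh)) ^ m"
 by (simp add: ett_def c_def algebra_simps)
 ultimately show ?thesis using that[OF K(1,2)] by simp
qed

end

section \<open>Translation invariance of trees in the quotients\<close>

context wb_quot
begin

abbreviation "TP == tree_prob V ends E"

lemma quot_pos: "ntrees V ends E {} > 0"
 by (intro ntrees_conn graph conn)

definition lact :: "'g => 'g qd => 'g qd" where
 "lact h epp = (%(A, s, i). (h <# A, s, i)) ` epp"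

lemma lact_qe:
 assumes "h : cG" "g : cG" "l : Lab"
 shows "lact h (qe g l) = qe (h @@ g) l"
proof -
 have "h @@ g @@ fst l = h @@ (g @@ fst l)" using assms Lab_carrier(1)[OF assms(3)] by (simp add: m_assoc)
 thus ?thesis unfolding lact_def qe_def using assms Lab_carrier(1)[OF assms(3)] by (simp add: coset_lmult)
qed

lemma TP_lact_le:
 assumes h: "h : cG" and B: "B <= E"
 shows "TP B <= TP (lact h ` B)"
proof -
 have inv: "lact (inv h) (lact h epp) = epp" "lact h (lact (inv h) epp) = epp" "lact h epp : E" "lact (inv h) epp : E"
 "ends epp = (%A. inv h <# A) ` ends (lact h epp)" if ep: "epp : E" for epp
 proof -
 obtain g l where gl: "g : cG" "l : Lab" "epp = qe g l" using ep E_iff by blast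
 have s: "fst l : cG" by (rule Lab_carrier(1)[OF gl(2)])
 show "lact (inv h) (lact h epp) = epp" "lact h (lact (inv h) epp) = epp" "lact h epp : E" "lact (inv h) epp : E"
 using gl h by (auto simp: lact_qe cancel_left E_iff)
 have "lact h epp = qe (h @@ g) l" using lact_qe[OF h gl(1,2)] gl(3) by simp
 thus "ends epp = (%A. inv h <# A) ` ends (lact h epp)"
 using gl h s by (simp add: ends_qe coset_lmult m_assoc cancel_left)
 qed
 have "graph_quot (%A. inv h <# A) (lact h) ends E ends E" unfolding graph_quot_def
 proof (intro conjI ballI)
 show "inj_on (lact h) E" by (rule inj_on_inverseI) (rule inv(1))
 show "lact h ` E <= E" using inv(3) by blast
 show "ends epp = (%A. inv h <# A) ` ends (lact h epp)" if "epp : E" for epp by (rule inv(5)[OF that])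
 fix epp assume e: "epp : E - lact h ` E"
 hence "epp = lact h (lact (inv h) epp)" "lact (inv h) epp : E" using inv(2,4)[of epp] by auto
 thus "\<exists>v. (%A. inv h <# A) ` ends epp <= {v}" using e by blast
 qed
 thus ?thesis using finite_subset[OF B finE] by (intro tree_prob_quot[OF _ graph graph _ B quot_pos quot_pos])
qed

lemma TP_lact:
 assumes h: "h : cG" and B: "B <= E"
 shows "TP (lact h ` B) = TP B"
proof (rule antisym[OF _ TP_lact_le[OF h B]])
 have "lact (inv h) ` lact h ` B = B & lact h ` B <= E"
 proof -
 have "lact (inv h) (lact h epp) = epp & lact h epp : E" if eB: "epp : B" for epp
 proof -
 obtain g l where gl: "g : cG" "l : Lab" "epp = qe g l" using eB B E_iff by blast
 thus ?thesis using h by (auto simp: lact_qe cancel_left E_iff)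
 qed
 thus ?thesis by (force simp: image_image)
 qed
 thus "TP (lact h ` B) <= TP B" using TP_lact_le[of "inv h" "lact h ` B"] h by simp
qed

end

text \<open>Every tree has \<open>card V - 1\<close> edges, each with two ends, and by translation
  invariance all vertices have the same expected degree.\<close>

lemma (in wb_quot_loopfree) degree_sum:
 "rc V * (SUM l:Lab. TP {qe \<one> l}) = 2 * (rc V - 1)"
proof -
 let ?T = "{T. spanning_tree V ends E T}"
 have finT: "finite ?T" by (rule finite_spanning_trees[OF finE])
 have cV: "card V >= 1" using finV V_ne by (simp add: Suc_le_eq card_gt_0_iff)
 have deg1: "(SUM epp:inc ends E A. TP {epp}) = (SUM l:Lab. TP {qe \<one> l})" if AV: "A : V" for A
 proof -
 obtain g where g: "g : cG" "A = g <# H" using AV V_iff by auto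
 have "(SUM epp:inc ends E A. TP {epp}) = (SUM l:Lab. TP {qe g l})"
 unfolding g(2) by (rule sum.reindex_bij_betw[OF inc_qe[OF g(1)], symmetric])
 also have "... = (SUM l:Lab. TP {qe \<one> l})"
 proof (rule sum.cong[OF refl])
 fix l assume l: "l : Lab"
 have "qe \<one> l : E" using l E_iff by blast
 thus "TP {qe g l} = TP {qe \<one> l}" using TP_lact[OF g(1), of "{qe \<one> l}"] lact_qe[OF g(1) one_closed l] g by simp
 qed
 finally show ?thesis .
 qed
 have "rc V * (SUM l:Lab. TP {qe \<one> l}) = (SUM A:V. SUM epp:{epp:E. A : ends epp}. TP {epp})"
 using deg1 by (simp add: inc_def)
 also have "... = (SUM epp:E. SUM A:{A:V. A : ends epp}. TP {epp})" by (rule sum.swap_restrict[OF finV finE])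
 also have "... = (SUM epp:E. 2 * TP {epp})"
 proof (rule sum.cong[OF refl])
 fix epp assume "epp : E"
 then obtain g l where gl: "g : cG" "l : Lab" "epp = qe g l" using E_iff by blast
 have s: "fst l : cG" by (rule Lab_carrier(1)[OF gl(2)])
 have "{A:V. A : ends epp} = {g <# H, (g @@ fst l) <# H}" using gl s coset_V by (auto simp: ends_qe)
 hence "card {A:V. A : ends epp} = 2" using step_neq[OF gl(1,2)] by simp
 thus "(SUM A:{A:V. A : ends epp}. TP {epp}) = 2 * TP {epp}" by simp
 qed
 also have "... = 2 * (SUM epp:E. ntrees V ends E {epp}) / ntrees V ends E {}"
 by (simp add: tree_prob_def sum_distrib_left sum_divide_distrib)
 also have "(SUM epp:E. ntrees V ends E {epp}) = (SUM epp:E. SUM T:{T:?T. epp : T}. 1)"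
 by (simp add: ntrees_def)
 also have "... = (SUM T:?T. SUM epp:{epp:E. epp : T}. 1)" by (rule sum.swap_restrict[OF finE finT])
 also have "... = (SUM T:?T. rc V - 1)"
 proof (rule sum.cong[OF refl])
 fix T assume "T : ?T"
 hence T: "card T = card V - 1" "T <= E" using card_spanning_tree[OF graph _ V_ne] by auto
 hence "{epp:E. epp : T} = T" by blast
 thus "(SUM epp:{epp:E. epp : T}. 1) = rc V - 1" using T(1) cV by (simp add: of_nat_diff)
 qed
 also have "... = (rc V - 1) * ntrees V ends E {}" by (simp add: ntrees_def)
 finally show ?thesis using quot_pos by simp
qed

section \<open>Local convergence of the quotient trees\<close>

context sofic
begin

abbreviation "Pn n == tree_prob (q.V n) ends (q.E n)"

definition pe :: "nat => 'g ed => 'g qd" where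
 "pe n epp = (%(v, s, i). (v <# Sg n, s, i)) ` epp"

lemma pe_ge: "pe n (ge g l) = q.qe n g l"
 unfolding pe_def ge_def q.qe_def by simp

lemma pe_E: "epp : Ec ==> pe n epp : q.E n"
 using E_cay_iff q.E_iff pe_ge by metis

text \<open>For large \<open>n\<close> the box \<open>K\<close> and its outer neighbours embed into
  the quotient. Sending all other vertices to the boundary vertex exhibits the wired box as a
  quotient of the finite graph, so its probabilities are lower bounds there.\<close>

lemma eventually_quot:
 assumes K: "finite K" "K <= cG"
 shows "evs (%n. \<exists>qq. graph_quot qq (pe n) (wired_ends K) (wE K) ends (q.E n))"
proof -
 \<comment> \<open>The outer neighbours are included so that none of them wraps around into
   \<open>K\<close>.\<close>
 define F where "F = K Un (%(g, l). g @@ fst l) ` (K \<times> Lab)"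
 have F: "finite F" "F <= cG" "K <= F" using K finite_Lab Lab_pair by (auto simp: F_def subset_iff)
 show ?thesis using eventually_inj[OF F(1,2)]
 proof eventually_elim
 case (elim n)
 let ?H = "Sg n"
 let ?c = "%v. v <# ?H"
 define qq where "qq A = (if A : ?c ` K then Some (inv_into K ?c A) else None)" for A
 have inj: "inj_on ?c K" by (rule inj_onI) (use elim F in blast)
 have qv: "qq (v <# ?H) = wv K v" if "v : F" for v
 proof (cases "v : K")
 case True
 thus ?thesis using inv_into_f_f[OF inj True] by (simp add: qq_def wv_def)
 next
 case False
 have "v <# ?H ~: ?c ` K"
 proof
 assume "v <# ?H : ?c ` K"
 then obtain w where "w : K" "v <# ?H = w <# ?H" by blast
 hence "v = w" using elim that F by blast
 thus False using False \<open>w : K\<close> by simp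
 qed
 thus ?thesis using False by (simp add: qq_def wv_def)
 qed
 have sF: "g : F" "g @@ fst l : F" if "g : K" "l : Lab" for g l
 using that F(3) unfolding F_def by (auto intro!: image_eqI[of _ _ "(g, l)"])
 show ?case
 proof (intro exI[of _ qq], unfold graph_quot_def, intro conjI ballI)
 show "inj_on (pe n) (wE K)"
 proof (rule inj_onI)
 fix x y assume x: "x : wE K" "y : wE K" "pe n x = pe n y"
 obtain g l where g: "g : K" "l : Lab" "x = ge g l" using wE_ge[OF K(2) x(1)] by metis
 obtain h k where h: "h : K" "k : Lab" "y = ge h k" using wE_ge[OF K(2) x(2)] by metis
 have gc: "g : cG" "h : cG" using g h K by auto
 have e: "q.qe n g l = q.qe n h k" using x(3) g h by (simp add: pe_ge)
 have "(g <# ?H, fst l, snd l) : q.qe n h k" unfolding e[symmetric] by (simp add: q.qe_def)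
 hence "g <# ?H = h <# ?H & l = k | g <# ?H = (h @@ fst k) <# ?H & l = linv k"
 by (cases l; cases k) (simp add: q.qe_def linv_def)
 hence "g = h & l = k | g = h @@ fst k & l = linv k"
 using elim sF[OF g(1,2)] sF[OF h(1,2)] by blast
 thus "x = y" using g(3) h(3) ge_flip[OF gc(2) h(2)] by auto
 qed
 have *: "pe n epp : quot_edges G f ?H & wired_ends K epp = qq ` ends (pe n epp)" if ep: "epp : wE K" for epp
 proof -
 obtain g l where g: "g : K" "l : Lab" "epp = ge g l" using wE_ge[OF K(2) ep] by metis
 have "epp : Ec" using ep by (simp add: wired_edges_def)
 thus ?thesis using pe_E[of epp n] qv sF[OF g(1,2)] unfolding g(3) pe_ge q.ends_qe wired_ends_ge by simp
 qed
 show "pe n ` wE K <= quot_edges G f ?H" using * by blast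
 show "wired_ends K epp = qq ` ends (pe n epp)" if "epp : wE K" for epp using * that by blast
 fix epp assume e: "epp : quot_edges G f ?H - pe n ` wE K"
 then obtain g l where g: "g : cG" "l : Lab" "epp = q.qe n g l" using q.E_iff by blast
 have no: "A ~: ?c ` K" if A: "A : ends epp" for A
 proof
 assume "A : ?c ` K"
 then obtain v where v: "v : K" "A = v <# ?H" by blast
 have vc: "v : cG" using v K by auto
 obtain k where k: "k : Lab" "epp = q.qe n v k"
 proof (cases "A = g <# ?H")
 case True
 hence "epp = q.qe n v l" using q.qe_cong[of v n g l] g v vc by simp
 thus ?thesis using that g(2) by blast
 next
 case False
 hence Ae: "v <# ?H = (g @@ fst l) <# ?H" using A v g by (auto simp: q.ends_qe)
 have "q.qe n v (linv l) = q.qe n (g @@ fst l) (linv l)"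
 by (rule q.qe_cong[OF Ae vc _ linv_Lab[OF g(2)]]) (use g Lab_carrier(1)[OF g(2)] in simp)
 hence "epp = q.qe n v (linv l)" using q.qe_flip[OF g(1,2)] g(3) by simp
 thus ?thesis using that linv_Lab[OF g(2)] by blast
 qed
 hence "epp : pe n ` wE K" using ge_wE[OF K(2) v(1) k(1)] pe_ge[of n v k] by (metis image_eqI)
 thus False using e by blast
 qed
 have "qq ` ends epp <= {None}" using no by (auto simp: qq_def)
 thus "\<exists>v. qq ` ends epp <= {v}" by blast
 qed
 qed
qed

lemma Pn_lower:
 assumes B: "finite B" "B <= Ec" and ett: "ett > 0"
 shows "evs (%n. Pn n (pe n ` B) > wsf_prob B - ett)"
proof -
 obtain K where K: "finite K" "K <= cG" "PK K B > wsf_prob B - ett" by (rule wsf_approx[OF ett])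
 show ?thesis
 using eventually_quot[OF K(1,2)]
 proof eventually_elim
 case (elim n)
 then obtain qq where Q: "graph_quot qq (pe n) (wired_ends K) (wE K) ends (q.E n)" by blast
 show ?case
 proof (cases "B <= wE K")
 case True
 show ?thesis
 using K(3) tree_prob_quot[OF B(1) wired_graph[OF K(1,2)] q.graph Q True wired_pos[OF K(1,2)] q.quot_pos] by linarith
 next
 case False
 have "0 <= Pn n (pe n ` B)" by (rule tree_prob_bounds[OF q.finE])
 thus ?thesis using K(3) unfolding tree_prob_outside[OF False] by linarith
 qed
 qed
qed

text \<open>The first two terms are approximated from below in a large box; the third enters with a
  minus sign and is bounded by its supremum. \<open>trees_quot_or\<close> transfers the whole
  expression to the quotient.\<close>

lemma Pn_union_lower:
 assumes B: "finite B" "insert e B <= Ec" "e ~: B" and ett: "ett > 0"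
 shows "evs (%n. Pn n (pe n ` B) + Pn n {pe n e} - Pn n (pe n ` insert e B) >
 wsf_prob B + wsf_prob {e} - wsf_prob (insert e B) - ett)"
proof -
 have h: "ett / 2 > 0" using ett by simp
 obtain K1 where K1: "finite K1" "K1 <= cG" "PK K1 B > wsf_prob B - ett / 2" by (rule wsf_approx[OF h])
 obtain K2 where K2: "finite K2" "K2 <= cG" "PK K2 {e} > wsf_prob {e} - ett / 2" by (rule wsf_approx[OF h])
 define K where "K = K1 Un K2 Un (UN epp:insert e B. ends epp)"
 have fe: "finite (ends epp) & ends epp <= cG & ends epp ~= {}" if ep: "epp : Ec" for epp
 proof -
 obtain g l where "g : cG" "l : Lab" "epp = ge g l" using ep E_cay_iff by blast
 thus ?thesis using Lab_carrier(1)[of l] by (simp add: ends_ge)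
 qed
 have ee: "finite (ends epp)" "ends epp <= cG" "ends epp ~= {}" "epp : Ec" if "epp : insert e B" for epp
 using fe[of epp] subsetD[OF B(2) that] by auto
 have K: "finite K" "K <= cG"
 proof -
 show "finite K" unfolding K_def using K1(1) K2(1) B(1) ee(1) by (intro finite_UnI finite_UN_I) auto
 show "K <= cG" unfolding K_def by (intro Un_least UN_least K1(2) K2(2) ee(2))
 qed
 have sub: "insert e B <= wE K"
 proof
 fix epp assume ep: "epp : insert e B"
 have "ends epp <= K" unfolding K_def using ep by (intro UN_upper le_supI2)
 hence "ends epp Int K ~= {}" using ee(3)[OF ep] by (simp add: Int_absorb2)
 thus "epp : wE K" using ee(4)[OF ep] by (simp add: wired_edges_def)
 qed
 have s1: "K1 <= K" "K2 <= K" by (auto simp: K_def)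
 have 1: "PK K B > wsf_prob B - ett / 2" by (rule less_le_trans[OF K1(3) PK_mono[OF s1(1) K B(1)]])
 have 2: "PK K {e} > wsf_prob {e} - ett / 2" by (rule less_le_trans[OF K2(3) PK_mono[OF s1(2) K]]) simp
 have 3: "PK K (insert e B) <= wsf_prob (insert e B)" by (rule PK_le_wsf[OF K])
 show ?thesis using eventually_quot[OF K]
 proof eventually_elim
 case (elim n)
 then obtain qq where Q: "graph_quot qq (pe n) (wired_ends K) (wE K) ends (q.E n)" by blast
 have "PK K B + PK K {e} - PK K (insert e B) <= Pn n (pe n ` B) + Pn n {pe n e} - Pn n (insert (pe n e) (pe n ` B))"
 by (rule tree_prob_quot_or[OF B(1) wired_graph[OF K] q.graph Q _ _ B(3) wired_pos[OF K] q.quot_pos]) (use sub in auto)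
 thus ?case using 1 2 3 by simp
 qed
qed

text \<open>The mass times the truncated Green function at \<open>\<one>\<close> is at most the
  integral of \<open>x / (t + x)\<close>, which is small because the spectral measure has no atom at
  0.\<close>

lemma wsf_degree_ge: "(SUM l:Lab. wsf_prob {se l}) >= 2"
proof (rule field_le_epsilon)
 fix e :: real assume e: "e > 0"
 obtain M where M: "is_spectral M"
 "(%j. integral\<^sup>L M (%t. (1 / real (Suc j)) / (t + 1 / real (Suc j)))) \<longlonglongrightarrow> 0" by (rule resolvent_limit)
 have "evs (%j. integral\<^sup>L M (%t. (1 / real (Suc j)) / (t + 1 / real (Suc j))) < e / 4)"
 using order_tendstoD(2)[OF M(2), of "e / 4"] e by simp
 then obtain j where j: "integral\<^sup>L M (%t. (1 / real (Suc j)) / (t + 1 / real (Suc j))) < e / 4"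
 by (auto simp: eventually_sequentially)
 define x where "x = 1 / real (Suc j)"
 have x: "x > 0" by (simp add: x_def)
 interpret bounded_distribution M "real deg" using M(1) by (simp add: is_spectral_def)
 have sums: "(%k. x * walk k \<one> / (real deg + x) ^ Suc k) sums integral\<^sup>L M (%t. x / (t + x))"
 using resolvent_sums[OF x] unfolding spectral_nbr[OF M(1)] walk_def .
 have part: "x * (\<Sum>k<m. walk k \<one> / (real deg + x) ^ Suc k) <= e / 4" for m
 proof -
 have "(\<Sum>k<m. x * walk k \<one> / (real deg + x) ^ Suc k) <= integral\<^sup>L M (%t. x / (t + x))"
 unfolding sums_unique[OF sums] using sums walk_nonneg x
 by (intro sum_le_suminf) (auto simp: sums_iff intro!: divide_nonneg_nonneg mult_nonneg_nonneg)
 thus ?thesis using j unfolding x_def[symmetric] by (simp add: sum_distrib_left)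
 qed
 \<comment> \<open>The mass is now fixed, and the truncation error is made small by the choice of
   \<open>m\<close>.\<close>
 have "(%m. (2 + 4 * real deg / x) * (real deg / (real deg + x)) ^ m) \<longlonglongrightarrow> (2 + 4 * real deg / x) * 0"
 using x by (intro tendsto_mult tendsto_const LIMSEQ_power_zero) auto
 hence "evs (%m. (2 + 4 * real deg / x) * (real deg / (real deg + x)) ^ m < e / 2)"
 by (rule order_tendstoD(2)) (use e in simp)
 then obtain m where m: "(2 + 4 * real deg / x) * (real deg / (real deg + x)) ^ m < e / 2"
 by (auto simp: eventually_sequentially)
 obtain K where K: "finite K" "K <= cG" "(SUM l:Lab. PK K {se l}) >= 2 - 2 * x * (\<Sum>k<m. walk k \<one> / (real deg + x) ^ Suc k)
 - (2 + 4 * real deg / x) * (real deg / (real deg + x)) ^ m"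
 by (rule wired_degree[OF x])
 have "(SUM l:Lab. PK K {se l}) <= (SUM l:Lab. wsf_prob {se l})" by (intro sum_mono PK_le_wsf K)
 thus "2 <= (SUM l:Lab. wsf_prob {se l}) + e" using K(3) part[of m] m by linarith
qed

lemma Pn_edge_sum: "evs (%n. (SUM l:Lab. Pn n {q.qe n \<one> l}) <= 2)"
 using eventually_loopfree
proof eventually_elim
 case (elim n)
 interpret L: wb_quot_loopfree G f "Sg n" by (rule elim)
 have "real (N n) * (SUM l:Lab. Pn n {q.qe n \<one> l}) <= real (N n) * 2" using L.degree_sum by simp
 thus ?case using N_pos[of n] by simp
qed

lemma se_E: "l : Lab ==> se l : Ec"
 using E_cay_iff by blast

lemma wsf_degree_le: "(SUM l:Lab. wsf_prob {se l}) <= 2"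
proof (rule field_le_epsilon)
 fix e :: real assume e: "e > 0"
 have dp: "real deg > 0" using deg_pos by simp
 have "evs (%n. ALL l:Lab. Pn n {q.qe n \<one> l} > wsf_prob {se l} - e / real deg)"
 proof (rule eventually_ball_finite[OF finite_Lab], rule ballI)
 fix l assume "l : Lab"
 thus "evs (%n. Pn n {q.qe n \<one> l} > wsf_prob {se l} - e / real deg)"
 using Pn_lower[of "{se l}" "e / real deg"] se_E e dp by (simp add: pe_ge)
 qed
 hence "evs (%n. (SUM l:Lab. wsf_prob {se l}) <= 2 + e)"
 using Pn_edge_sum
 proof eventually_elim
 case (elim n)
 have "(SUM l:Lab. wsf_prob {se l} - e / real deg) <= (SUM l:Lab. Pn n {q.qe n \<one> l})"
 using elim(1) by (intro sum_mono) (simp add: less_imp_le)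
 thus ?case using elim(2) dp by (simp add: sum_subtractf deg_def[symmetric])
 qed
 thus "(SUM l:Lab. wsf_prob {se l}) <= 2 + e" by (simp add: eventually_sequentially) blast
qed

text \<open>Each edge probability is eventually at least its value in the wired forest, up to
  \<open>h\<close>. The sums over labels are at most 2 in the quotient and at least 2 in the forest,
  so no single edge can exceed its value by much.\<close>

lemma Pn_edge:
 assumes e: "e : Ec"
 shows "(%n. Pn n {pe n e}) \<longlonglongrightarrow> wsf_prob {e}"
proof (rule LIMSEQ_I)
 fix r :: real assume r: "r > 0"
 obtain g l where gl: "g : cG" "l : Lab" "e = ge g l" using e E_cay_iff by blast
 have dp: "real deg > 0" using deg_pos by simp
 define h where "h = r / (real deg + 1)"
 have h: "h > 0" "real deg * h < r" "h <= r" using r dp by (auto simp: h_def divide_simps)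
 have "evs (%n. ALL l:Lab. Pn n {q.qe n \<one> l} > wsf_prob {se l} - h)"
 proof (rule eventually_ball_finite[OF finite_Lab], rule ballI)
 fix l assume "l : Lab"
 thus "evs (%n. Pn n {q.qe n \<one> l} > wsf_prob {se l} - h)"
 using Pn_lower[of "{se l}" h] se_E h by (simp add: pe_ge)
 qed
 hence "evs (%n. norm (Pn n {pe n e} - wsf_prob {e}) < r)"
 using Pn_edge_sum
 proof eventually_elim
 case (elim n)
 have "q.qe n \<one> l : q.E n" using q.E_iff gl(2) by blast
 hence eq: "Pn n {pe n e} = Pn n {q.qe n \<one> l}"
 using q.TP_lact[OF gl(1), of "{q.qe n \<one> l}" n] q.lact_qe[OF gl(1) one_closed gl(2), of n] gl by (simp add: pe_ge)
 have we: "wsf_prob {e} = wsf_prob {se l}" unfolding gl(3) by (rule wsf_ge[OF gl(1,2)])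
 have "(SUM k:Lab - {l}. wsf_prob {se k} - h) <= (SUM k:Lab - {l}. Pn n {q.qe n \<one> k})"
 proof (rule sum_mono)
 fix k assume "k : Lab - {l}"
 thus "wsf_prob {se k} - h <= Pn n {q.qe n \<one> k}" using bspec[OF elim(1), of k] by simp
 qed
 moreover have "(SUM k:Lab. Pn n {q.qe n \<one> k}) = Pn n {q.qe n \<one> l} + (SUM k:Lab - {l}. Pn n {q.qe n \<one> k})"
 "(SUM k:Lab. wsf_prob {se k} - h) = (wsf_prob {se l} - h) + (SUM k:Lab - {l}. wsf_prob {se k} - h)"
 by (rule sum.remove[OF finite_Lab gl(2)])+
 moreover have "(SUM k:Lab. wsf_prob {se k} - h) >= 2 - real deg * h"
 using wsf_degree_ge by (simp add: sum_subtractf deg_def)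
 ultimately have "Pn n {q.qe n \<one> l} < wsf_prob {se l} + r" using elim(2) h by linarith
 moreover have "Pn n {q.qe n \<one> l} > wsf_prob {se l} - r" using bspec[OF elim(1) gl(2)] h by linarith
 ultimately show ?case unfolding eq we by (simp add: abs_less_iff)
 qed
 thus "\<exists>no. \<forall>n\<ge>no. norm (Pn n {pe n e} - wsf_prob {e}) < r" by (simp add: eventually_sequentially)
qed

text \<open>\<open>Pn_lower\<close> bounds the probability from below. From above,
  inclusion-exclusion is used: \<open>B\<close> and \<open>e\<close> converge by induction and by
  \<open>Pn_edge\<close>, and "\<open>e\<close> or all of \<open>B\<close>" has a lower
  bound.\<close>

theorem Pn_tendsto:
 assumes "finite B" "B <= Ec"
 shows "(%n. Pn n (pe n ` B)) \<longlonglongrightarrow> wsf_prob B"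
 using assms
proof (induction B rule: finite_induct)
 case empty
 have "Pn n {} = 1" for n unfolding tree_prob_def using q.quot_pos[of n] by simp
 thus ?case by (simp add: wsf_empty)
next
 case (insert e B)
 have IH: "(%n. Pn n (pe n ` B)) \<longlonglongrightarrow> wsf_prob B" and eE: "e : Ec" using insert by auto
 show ?case
 proof (rule LIMSEQ_I)
 fix r :: real assume r: "r > 0"
 have r3: "r / 3 > 0" and fB: "finite (insert e B)" and up: "wsf_prob B < wsf_prob B + r / 3" "wsf_prob {e} < wsf_prob {e} + r / 3"
 using r insert.hyps by auto
 have "evs (%n. norm (Pn n (pe n ` insert e B) - wsf_prob (insert e B)) < r)"
 using Pn_lower[OF fB insert.prems r] Pn_union_lower[OF insert.hyps(1) insert.prems insert.hyps(2) r3]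
 order_tendstoD(2)[OF IH up(1)] order_tendstoD(2)[OF Pn_edge[OF eE] up(2)]
 proof eventually_elim
 case (elim n)
 thus ?case by (simp add: abs_less_iff)
 qed
 thus "\<exists>no. \<forall>n\<ge>no. norm (Pn n (pe n ` insert e B) - wsf_prob (insert e B)) < r" by (simp add: eventually_sequentially)
 qed
qed

end

section \<open>Measure entropy: lower bound\<close>

text \<open>Moebius inversion: functions of finitely many edges are combinations of the events "all
  edges of \<open>B\<close> are present", the only ones whose probabilities are under
  control.\<close>

lemma moebius_coeffs:
 fixes h :: "'a set => real"
 assumes "finite F"
 shows "\<exists>c. \<forall>A\<subseteq>F. h A = (SUM B:Pow F. c B * of_bool (B <= A))"
 using assms
proof (induction F arbitrary: h rule: finite_induct)
 case empty
 thus ?case by (intro exI[of _ h]) auto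
next
 case (insert e F)
 obtain c1 where c1: "\<forall>A\<subseteq>F. h A = (SUM B:Pow F. c1 B * of_bool (B <= A))" using insert.IH by blast
 obtain c2 where c2: "\<forall>A\<subseteq>F. h (insert e A) - h A = (SUM B:Pow F. c2 B * of_bool (B <= A))"
 using insert.IH[of "%A. h (insert e A) - h A"] by blast
 define c where "c B = (if e : B then c2 (B - {e}) else c1 B)" for B
 have "h A = (SUM B:Pow (insert e F). c B * of_bool (B <= A))" if A: "A <= insert e F" for A
 proof -
 let ?A = "A - {e}"
 have AF: "?A <= F" using A by blast
 have "(SUM B:Pow (insert e F). c B * of_bool (B <= A)) =
 (SUM B:Pow F. c B * of_bool (B <= A)) + (SUM B:insert e ` Pow F. c B * of_bool (B <= A))"
 unfolding Pow_insert using insert.hyps by (intro sum.union_disjoint) auto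
 also have "(SUM B:Pow F. c B * of_bool (B <= A)) = (SUM B:Pow F. c1 B * of_bool (B <= ?A))"
 using insert.hyps by (intro sum.cong refl) (auto simp: c_def)
 also have "(SUM B:insert e ` Pow F. c B * of_bool (B <= A)) =
 (SUM B:Pow F. c (insert e B) * of_bool (insert e B <= A))"
 proof (rule sum.reindex_cong[OF _ refl refl])
 show "inj_on (insert e) (Pow F)" using insert.hyps(2) by (auto simp: inj_on_def)
 qed
 also have "... = of_bool (e : A) * (SUM B:Pow F. c2 B * of_bool (B <= ?A))"
 unfolding sum_distrib_left
 proof (rule sum.cong[OF refl])
 fix B assume "B : Pow F"
 hence "insert e B - {e} = B" "e ~: B" using insert.hyps(2) by auto
 thus "c (insert e B) * of_bool (insert e B <= A) = of_bool (e : A) * (c2 B * of_bool (B <= ?A))"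
 by (auto simp: c_def)
 qed
 also have "(SUM B:Pow F. c1 B * of_bool (B <= ?A)) + of_bool (e : A) * (SUM B:Pow F. c2 B * of_bool (B <= ?A))
 = h ?A + of_bool (e : A) * (h (insert e ?A) - h ?A)"
 using c1[rule_format, OF AF] c2[rule_format, OF AF] by presburger
 also have "... = h A" by (cases "e : A") (simp_all add: insert_absorb)
 finally show ?thesis by simp
 qed
 thus ?case by blast
qed

lemma finite_mean_dist:
 fixes p p' :: "'a => real"
 assumes "finite T" "T ~= {}" "!!t. t : T ==> \<bar>p t - p' t\<bar> <= ett"
 shows "\<bar>(SUM t:T. p t) / rc T - (SUM t:T. p' t) / rc T\<bar> <= ett"
proof -
 have c: "rc T > 0" using assms by (simp add: card_gt_0_iff)
 have "\<bar>(SUM t:T. p t - p' t)\<bar> <= (SUM t:T. ett)" using assms(3) by (intro order_trans[OF sum_abs] sum_mono)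
 hence "\<bar>(SUM t:T. p t - p' t) / rc T\<bar> <= ett" using c by (simp add: abs_divide divide_le_eq mult.commute)
 thus ?thesis by (simp add: sum_subtractf diff_divide_distrib)
qed

section \<open>Continuous functions and the integral against the wired forest\<close>

context wb_group
begin

definition cyl :: "'g ed set => ('g ed => bool) => real" where
 "cyl B x = of_bool (ALL epp:B. x epp)"

text \<open>By compactness \<open>p\<close> is nearly a function of finitely many edges, and such a
  function is a combination of cylinders.\<close>

lemma config_approx:
 assumes p: "p : CX" and ett: "ett > 0"
 obtains F c where "finite F" "F <= Ec"
 "!!x. x : cX ==> \<bar>p x - (SUM B:Pow F. c B * cyl B x)\<bar> <= ett"
proof -
 let ?I = "Ec" and ?X = "config_top G f" and ?D = "discrete_topology (UNIV :: bool set)"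
 have top: "topspace ?X = cX" unfolding config_top_def config_space_def by simp
 have cp: "compact_space ?X" unfolding config_top_def
 by (rule compact_space_product_topology[THEN iffD2]) (simp add: compact_space_discrete_topology)
 have ex: "\<exists>U. finite {i : ?I. U i ~= UNIV} & x : PiE ?I U & openin ?X (PiE ?I U) &
 (ALL y:PiE ?I U. \<bar>p y - p x\<bar> < ett / 2)" if x: "x : cX" for x
 proof -
 let ?S = "{y : topspace ?X. p y : ball (p x) (ett / 2)}"
 have "openin ?X ?S" by (rule openin_continuous_map_preimage[of _ euclideanreal]) (use p in \<open>auto simp: config_C_def\<close>)
 moreover have "x : ?S" using x ett top by simp
 ultimately obtain U where U: "finite {i : ?I. U i ~= topspace ?D}" "ALL i:?I. openin ?D (U i)" "x : PiE ?I U" "PiE ?I U <= ?S"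
 unfolding config_top_def openin_product_topology_alt by blast
 have "openin ?X (PiE ?I U)" unfolding config_top_def openin_PiE_gen using U by auto
 thus ?thesis using U by (intro exI[of _ U]) (auto simp: dist_real_def abs_minus_commute)
 qed
 have "\<exists>U. ALL x:cX. finite {i : ?I. U x i ~= UNIV} & x : PiE ?I (U x) & openin ?X (PiE ?I (U x)) &
 (ALL y:PiE ?I (U x). \<bar>p y - p x\<bar> < ett / 2)" by (rule bchoice) (rule ballI, rule ex)
 then obtain U where U0: "ALL x:cX. finite {i : ?I. U x i ~= UNIV} & x : PiE ?I (U x) & openin ?X (PiE ?I (U x)) &
 (ALL y:PiE ?I (U x). \<bar>p y - p x\<bar> < ett / 2)" by (rule exE)
 have U: "finite {i : ?I. U x i ~= UNIV}" "x : PiE ?I (U x)" "openin ?X (PiE ?I (U x))" if "x : cX" for x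
 using bspec[OF U0 that] by simp_all
 have U4: "\<bar>p y - p x\<bar> < ett / 2" if x: "x : cX" and y: "y : PiE ?I (U x)" for x y
 using bspec[OF U0 x] y by simp
 have "compactin ?X (cX)" using cp top by (simp add: compact_space_def)
 hence "\<exists>\<F>. finite \<F> & \<F> <= (%x. PiE ?I (U x)) ` cX & cX <= \<Union>\<F>"
 by (rule compactinD) (use U(2,3) in auto)
 then obtain \<F> where \<F>: "finite \<F>" "\<F> <= (%x. PiE ?I (U x)) ` cX" "cX <= \<Union>\<F>" by (elim exE conjE)
 obtain Z where Z: "Z <= cX" "finite Z" "\<F> = (%x. PiE ?I (U x)) ` Z"
 using finite_subset_image[OF \<F>(1,2)] by (elim exE conjE)
 define F where "F = (UN x:Z. {i : ?I. U x i ~= UNIV})"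
 have F: "finite F" "F <= ?I" unfolding F_def using Z U(1) by (auto simp: subset_iff)
 \<comment> \<open>The value of \<open>p\<close> at the configuration that keeps \<open>A\<close>
   and closes every other edge.\<close>
 define h where "h A = p (\<lambda>epp\<in>?I. epp : A)" for A
 obtain c where c: "\<forall>A\<subseteq>F. h A = (SUM B:Pow F. c B * of_bool (B <= A))" using moebius_coeffs[OF F(1)] by blast
 show ?thesis
 proof (rule that[OF F])
 fix x assume x: "x : cX"
 obtain z where z: "z : Z" "x : PiE ?I (U z)" using \<F>(3) Z(3) x by auto
 define A where "A = {epp : F. x epp}"
 define y where "y = (\<lambda>epp\<in>?I. epp : A)"
 have "y : PiE ?I (U z)"
 proof (rule PiE_I)
 fix i assume i: "i : ?I"
 show "y i : U z i"
 proof (cases "i : F")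
 case True
 hence "y i = x i" using i by (simp add: y_def A_def)
 thus ?thesis using PiE_mem[OF z(2) i] by simp
 next
 case False
 hence "U z i = UNIV" using z(1) i by (auto simp: F_def)
 thus ?thesis by simp
 qed
 qed (simp add: y_def)
 moreover have zc: "z : cX" using z Z by auto
 ultimately have "\<bar>p y - p z\<bar> < ett / 2" "\<bar>p x - p z\<bar> < ett / 2" using U4[OF zc] z(2) by auto
 hence "\<bar>p x - p y\<bar> <= ett" by linarith
 moreover have "p y = (SUM B:Pow F. c B * of_bool (B <= A))"
 proof -
 have "A <= F" by (auto simp: A_def)
 thus ?thesis using c[rule_format, of A] by (simp only: h_def y_def)
 qed
 moreover have "(SUM B:Pow F. c B * of_bool (B <= A)) = (SUM B:Pow F. c B * cyl B x)"
 proof (rule sum.cong[OF refl])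
 fix B assume "B : Pow F"
 hence "B <= A \<longleftrightarrow> (ALL epp:B. x epp)" by (auto simp: A_def)
 thus "c B * of_bool (B <= A) = c B * cyl B x" by (simp add: cyl_def)
 qed
 ultimately show "\<bar>p x - (SUM B:Pow F. c B * cyl B x)\<bar> <= ett" by simp
 qed
qed

definition wired_mean :: "'g set => (('g ed => bool) => real) => real" where
 "wired_mean K p = (SUM T:wired_trees G f K. p (wired_config G f K T)) / rc (wired_trees G f K)"

definition exhausts :: "(nat => 'g set) => bool" where
 "exhausts K \<longleftrightarrow> (\<forall>n. finite (K n) & K n <= K (Suc n)) & (\<Union>n. K n) = cG"

lemma exhausts_wball: "exhausts wball"
 unfolding exhausts_def using finite_wball wball_mono[of _ "Suc _"] wball_carrier carrier_wball by fastforce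

lemma exhausts_eventually:
 assumes K: "exhausts K" and F: "finite F" "F <= cG"
 shows "evs (%n. F <= K n)"
proof -
 have mono: "K m <= K n" if "m <= n" for m n
 by (rule lift_Suc_mono_le[of K, OF _ that]) (use K in \<open>simp add: exhausts_def\<close>)
 have "evs (%n. ALL x:F. x : K n)"
 proof (rule eventually_ball_finite[OF F(1)], rule ballI)
 fix x assume "x : F"
 then obtain m where "x : K m" using F(2) K unfolding exhausts_def by blast
 thus "evs (%n. x : K n)" using mono eventually_sequentially by blast
 qed
 thus ?thesis by (rule eventually_mono) blast
qed

lemma wired_trees_fin:
 assumes "finite K" "K <= cG"
 shows "finite (wired_trees G f K)" "wired_trees G f K ~= {}" "rc (wired_trees G f K) = ntrees (wV K) (wired_ends K) (wE K) {}"
proof -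
 show c: "rc (wired_trees G f K) = ntrees (wV K) (wired_ends K) (wE K) {}"
 unfolding wired_trees_def ntrees_def by simp
 show "finite (wired_trees G f K)" unfolding wired_trees_def by (rule finite_spanning_trees[OF finite_wE[OF assms]])
 show "wired_trees G f K ~= {}" using c wired_pos[OF assms] by auto
qed

lemma exhausts_K: assumes "exhausts K" shows "finite (K n)" "K n <= cG"
 using assms unfolding exhausts_def by auto

lemma wired_mean_cyl:
 assumes K: "exhausts K" and B: "finite B" "B <= Ec"
 shows "(%n. wired_mean (K n) (cyl B)) \<longlonglongrightarrow> wsf_prob B"
proof (rule Lim_transform_eventually)
 show "(%n. PK (K n) B) \<longlonglongrightarrow> wsf_prob B" by (rule wsf_limit[OF _ _ _ B(1)]) (use K in \<open>auto simp: exhausts_def\<close>)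
 have e: "finite (ends epp) & ends epp <= cG" if ep: "epp : B" for epp
 proof -
 obtain g l where "g : cG" "l : Lab" "epp = ge g l" using ep B E_cay_iff by blast
 thus ?thesis using Lab_carrier(1)[of l] by (simp add: ends_ge)
 qed
 have "finite (UN epp:B. ends epp)" "(UN epp:B. ends epp) <= cG" using B(1) e by auto
 from exhausts_eventually[OF K this] show "evs (%n. PK (K n) B = wired_mean (K n) (cyl B))"
 proof eventually_elim
 case (elim n)
 note f = wired_trees_fin[OF exhausts_K[OF K]]
 have "(SUM T:wired_trees G f (K n). cyl B (wired_config G f (K n) T)) = (SUM T:wired_trees G f (K n). of_bool (B <= T))"
 using elim B(2) by (intro sum.cong refl) (auto simp: cyl_def wired_config_def)
 also have "... = ntrees (wV (K n)) (wired_ends (K n)) (wE (K n)) B"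
 using f(1)[of n] unfolding ntrees_def wired_trees_def by (simp add: Int_def)
 finally show ?case using f(3)[of n] unfolding wired_mean_def tree_prob_def by simp
 qed
qed

lemma wired_config_space: "wired_config G f K T : cX"
 by (simp add: wired_config_def config_space_def)

lemma wsf_integral_eq:
 assumes "!!K. exhausts K ==> (%n. wired_mean (K n) p) \<longlonglongrightarrow> v"
 shows "wI p = v"
 unfolding wsf_integral_def
proof (rule the_equality)
 show "\<forall>K. (\<forall>n. finite (K n) & K n <= K (Suc n)) & (\<Union>n. K n) = cG -->
 (%n. (SUM T:wired_trees G f (K n). p (wired_config G f (K n) T)) / rc (wired_trees G f (K n))) \<longlonglongrightarrow> v"
 using assms unfolding exhausts_def wired_mean_def by blast
 fix l assume "\<forall>K. (\<forall>n. finite (K n) & K n <= K (Suc n)) & (\<Union>n. K n) = cG -->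
 (%n. (SUM T:wired_trees G f (K n). p (wired_config G f (K n) T)) / rc (wired_trees G f (K n))) \<longlonglongrightarrow> l"
 hence "(%n. wired_mean (wball n) p) \<longlonglongrightarrow> l"
 using exhausts_wball unfolding exhausts_def wired_mean_def by blast
 thus "l = v" using assms[OF exhausts_wball] LIMSEQ_unique by blast
qed

lemma wired_mean_near:
 assumes K: "exhausts K" and F: "finite F" "F <= Ec"
 and ap: "!!x. x : cX ==> \<bar>p x - (SUM B:Pow F. c B * cyl B x)\<bar> <= ett" and ett: "ett > 0"
 shows "evs (%n. \<bar>wired_mean (K n) p - (SUM B:Pow F. c B * wsf_prob B)\<bar> < 2 * ett)"
proof -
 have "(%n. SUM B:Pow F. c B * wired_mean (K n) (cyl B)) \<longlonglongrightarrow> (SUM B:Pow F. c B * wsf_prob B)"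
 using F by (intro tendsto_sum tendsto_mult tendsto_const wired_mean_cyl[OF K]) (auto intro: finite_subset)
 hence "evs (%n. \<bar>(SUM B:Pow F. c B * wired_mean (K n) (cyl B)) - (SUM B:Pow F. c B * wsf_prob B)\<bar> < ett)"
 using ett by (simp add: tendsto_iff dist_real_def)
 thus ?thesis
 proof eventually_elim
 case (elim n)
 let ?T = "wired_trees G f (K n)"
 have "\<bar>wired_mean (K n) p - (SUM T:?T. SUM B:Pow F. c B * cyl B (wired_config G f (K n) T)) / rc ?T\<bar> <= ett"
 unfolding wired_mean_def using wired_trees_fin[OF exhausts_K[OF K]] wired_config_space ap by (intro finite_mean_dist) auto
 moreover have "(SUM T:?T. SUM B:Pow F. c B * cyl B (wired_config G f (K n) T)) / rc ?T
 = (SUM B:Pow F. c B * wired_mean (K n) (cyl B))"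
 unfolding wired_mean_def by (subst sum.swap) (simp add: sum_divide_distrib sum_distrib_left)
 ultimately show ?case using elim by linarith
 qed
qed

text \<open>\<open>wsf_integral\<close> is a definite description, so the limit must be shown to
  exist along every exhaustion: balls give a Cauchy sequence, and approximation by cylinders carries
  its limit to all other exhaustions.\<close>

lemma wsf_integral_near:
 assumes p: "p : CX" and F: "finite F" "F <= Ec"
 and ap: "!!x. x : cX ==> \<bar>p x - (SUM B:Pow F. c B * cyl B x)\<bar> <= ett" and ett: "ett > 0"
 shows "\<bar>wI p - (SUM B:Pow F. c B * wsf_prob B)\<bar> <= 2 * ett"
proof -
 have near: "\<exists>v. \<forall>K. exhausts K --> evs (%n. \<bar>wired_mean (K n) p - v\<bar> < r)" if r: "r > 0" for r
 proof -
 have r2: "r / 2 > 0" using r by simp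
 obtain F c where F: "finite F" "F <= Ec"
 "!!x. x : cX ==> \<bar>p x - (SUM B:Pow F. c B * cyl B x)\<bar> <= r / 2"
 by (rule config_approx[OF p r2], rule that)
 show ?thesis using wired_mean_near[OF _ F r2] by (intro exI[of _ "SUM B:Pow F. c B * wsf_prob B"]) auto
 qed
 have "Cauchy (%n. wired_mean (wball n) p)"
 proof (rule metric_CauchyI)
 fix r :: real assume "r > 0"
 then obtain v where v: "\<forall>K. exhausts K --> evs (%n. \<bar>wired_mean (K n) p - v\<bar> < r / 2)"
 using near[of "r / 2"] by auto
 have "evs (%n. \<bar>wired_mean (wball n) p - v\<bar> < r / 2)" using v exhausts_wball by blast
 then obtain M where M: "!!n. n >= M ==> \<bar>wired_mean (wball n) p - v\<bar> < r / 2" by (auto simp: eventually_sequentially)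
 show "\<exists>M. \<forall>m\<ge>M. \<forall>n\<ge>M. dist (wired_mean (wball m) p) (wired_mean (wball n) p) < r"
 proof (intro exI allI impI)
 fix m n assume "M <= m" "M <= n"
 thus "dist (wired_mean (wball m) p) (wired_mean (wball n) p) < r" using M[of m] M[of n] unfolding dist_real_def by linarith
 qed
 qed
 then obtain l where l: "(%n. wired_mean (wball n) p) \<longlonglongrightarrow> l" by (auto simp: Cauchy_convergent_iff convergent_def)
 have lv: "\<bar>l - v\<bar> <= r" if "evs (%n. \<bar>wired_mean (wball n) p - v\<bar> < r)" for v r
 proof (rule tendsto_upperbound[OF tendsto_rabs[OF tendsto_diff[OF l tendsto_const]]])
 show "evs (%n. \<bar>wired_mean (wball n) p - v\<bar> <= r)" using that by (rule eventually_mono) simp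
 qed simp
 have "wI p = l"
 proof (rule wsf_integral_eq)
 fix K assume K: "exhausts K"
 show "(%n. wired_mean (K n) p) \<longlonglongrightarrow> l"
 proof (rule tendstoI)
 fix r :: real assume "r > 0"
 then obtain v where v: "\<forall>K. exhausts K --> evs (%n. \<bar>wired_mean (K n) p - v\<bar> < r / 2)"
 using near[of "r / 2"] by auto
 have lv0: "\<bar>l - v\<bar> <= r / 2" using lv v exhausts_wball by blast
 have "evs (%n. \<bar>wired_mean (K n) p - v\<bar> < r / 2)" using v K by blast
 thus "evs (%n. dist (wired_mean (K n) p) l < r)"
 proof eventually_elim
 case (elim n)
 thus ?case using lv0 unfolding dist_real_def by linarith
 qed
 qed
 qed
 thus ?thesis using lv[OF wired_mean_near[OF exhausts_wball F ap ett]] by simp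
qed

end

text \<open>Chebyshev's inequality: pairs that are not bad have nonpositive covariance, a bad pair
  contributes at most 1, and each vertex has at most \<open>C\<close> bad partners.\<close>

lemma second_moment:
 fixes muu dl C :: real and S :: "'v => 'e set"
 assumes fin: "finite Tr" "finite V"
 and mean: "!!A. A : V ==> rc {T : Tr. S A <= T} = muu * rc Tr"
 and joint: "!!A A'. A : V ==> A' : V ==> A' ~: bad A ==> rc {T : Tr. S A Un S A' <= T} <= muu^2 * rc Tr"
 and bad: "!!A. A : V ==> rc (V Int bad A) <= C" and dl: "dl > 0" and V: "V ~= {}"
 shows "rc {T : Tr. \<bar>(SUM A:V. of_bool (S A <= T)) / real (card V) - muu\<bar> > dl} * (dl^2 * rc V) <= C * rc Tr"
proof -
 let ?t = "rc Tr" and ?N = "rc V"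
 let ?B = "{T : Tr. \<bar>(SUM A:V. of_bool (S A <= T)) / ?N - muu\<bar> > dl}"
 define i :: "'v => 'e set => real" where "i A T = of_bool (S A <= T)" for A T
 define Y where "Y T = (SUM A:V. i A T - muu)" for T
 have N: "?N > 0" using V fin by (simp add: card_gt_0_iff)
 have s1: "(SUM T:Tr. i A T) = muu * ?t" if "A : V" for A using mean[OF that] fin by (simp add: i_def Int_def)
 have s2: "(SUM T:Tr. i A T * i A' T) = rc {T : Tr. S A Un S A' <= T}" for A A'
 using fin by (simp add: i_def of_bool_conj[symmetric] Int_def del: of_bool_conj)
 have cov: "(SUM T:Tr. (i A T - muu) * (i A' T - muu)) <= of_bool (A' : bad A) * ?t" if A: "A : V" "A' : V" for A A'
 proof -
 have "(SUM T:Tr. (i A T - muu) * (i A' T - muu)) = (SUM T:Tr. i A T * i A' T - muu * i A T - muu * i A' T + muu^2)"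
 by (intro sum.cong refl) (simp add: power2_eq_square algebra_simps)
 also have "... = rc {T : Tr. S A Un S A' <= T} - muu^2 * ?t"
 using s1[OF A(1)] s1[OF A(2)]
 by (simp only: sum.distrib sum_subtractf sum_distrib_left[symmetric] s2 sum_constant) (simp add: power2_eq_square)
 also have "... <= of_bool (A' : bad A) * ?t"
 proof (cases "A' : bad A")
 case True
 have "rc {T : Tr. S A Un S A' <= T} <= ?t" using fin by (intro of_nat_mono card_mono) auto
 moreover have "0 <= muu^2 * ?t" by simp
 moreover have "of_bool (A' : bad A) * ?t = ?t" using True by simp
 ultimately show ?thesis by linarith
 qed (use joint[OF A] in simp)
 finally show ?thesis .
 qed
 have "rc ?B * (dl * ?N)^2 = (SUM T:?B. (dl * ?N)^2)" by simp
 also have "... <= (SUM T:?B. (Y T)^2)"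
 proof (rule sum_mono)
 fix T assume "T : ?B"
 moreover have "(SUM A:V. of_bool (S A <= T)) / ?N - muu = Y T / ?N" using N by (simp add: Y_def i_def sum_subtractf field_simps)
 ultimately have "dl < \<bar>Y T / ?N\<bar>" by simp
 hence "dl * ?N <= \<bar>Y T\<bar>" using N by (simp add: less_divide_eq)
 thus "(dl * ?N)^2 <= (Y T)^2" using dl N power_mono[of "dl * ?N" "\<bar>Y T\<bar>" 2] by simp
 qed
 also have "... <= (SUM T:Tr. (Y T)^2)" using fin by (intro sum_mono2) auto
 also have "... = (SUM T:Tr. SUM A:V. SUM A':V. (i A T - muu) * (i A' T - muu))"
 by (simp add: Y_def power2_eq_square sum_product)
 also have "... = (SUM A:V. SUM A':V. SUM T:Tr. (i A T - muu) * (i A' T - muu))"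
 by (subst sum.swap, intro sum.cong refl, subst sum.swap, rule refl)
 also have "... <= (SUM A:V. SUM A':V. of_bool (A' : bad A) * ?t)" by (intro sum_mono cov)
 also have "... = (SUM A:V. rc (V Int bad A) * ?t)"
 using fin by (simp add: sum_distrib_right[symmetric] Int_def)
 also have "... <= (SUM A:V. C * ?t)" using bad by (intro sum_mono mult_right_mono) auto
 finally have "?N * (rc ?B * (dl^2 * ?N)) <= ?N * (C * ?t)" by (simp add: power2_eq_square algebra_simps)
 thus ?thesis using N by simp
qed

section \<open>Microstates from spanning trees\<close>

context wb_quot
begin

definition pq :: "'g set => 'g ed => 'g qd" where
 "pq B epp = (%(v, s, i). (B #> v, s, i)) ` epp"

lemma pq_ge: "b : cG ==> g : cG ==> l : Lab ==> pq (b <# H) (ge g l) = qe (b @@ g) l"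
 using Lab_carrier(1)[of l] unfolding pq_def ge_def qe_def by (simp add: coset_rmult m_assoc)

text \<open>The coordinate at \<open>A\<close> is the tree seen from the vertex
  \<open>invc A\<close>, unrolled to the Cayley graph. This assignment is exactly equivariant, so
  only the empirical averages remain to be controlled.\<close>

definition ph :: "'g qd set => 'g set => 'g ed => bool" where
 "ph T A = (\<lambda>epp\<in>Ec. pq (invc A) epp : T)"

lemma ph_act:
 assumes "A : V" "s : cG"
 shows "ph T (s <# A) = config_act G f s (ph T A)"
proof
 fix epp
 obtain a where a: "a : cG" "A = a <# H" using assms V_iff by auto
 show "ph T (s <# A) epp = config_act G f s (ph T A) epp"
 proof (cases "epp : Ec")
 case True
 then obtain g l where gl: "g : cG" "l : Lab" "epp = ge g l" using E_cay_iff by blast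
 have e: "edge_act G (inv s) epp = ge (inv s @@ g) l" "ge (inv s @@ g) l : Ec"
 using edge_act_ge[of "inv s" g l] gl assms E_cay_iff by auto
 have "invc (s <# A) = (inv a @@ inv s) <# H" "invc A = inv a <# H"
 using a assms invc_coset[of "s @@ a"] invc_coset[of a] by (auto simp: coset_lmult inv_mult_group)
 thus ?thesis using True e gl a assms by (simp add: ph_def config_act_def pq_ge m_assoc)
 qed (simp add: ph_def config_act_def)
qed

lemma ph_separates:
 assumes T: "T <= E" "T' <= E" "T ~= T'"
 obtains A epp where "A : V" "epp : SE" "ph T A epp ~= ph T' A epp"
proof -
 obtain x where x: "x : E" "(x : T) ~= (x : T')" using T by blast
 then obtain b l where b: "b : cG" "l : Lab" "x = qe b l" using E_iff by blast
 have "pq (invc (inv b <# H)) (se l) = x" using b invc_coset[of "inv b"] pq_ge[of b \<one> l] by simp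
 moreover have "se l : Ec" using b E_cay_iff by blast
 ultimately have "ph T (inv b <# H) (se l) ~= ph T' (inv b <# H) (se l)" using x by (simp add: ph_def)
 moreover have "inv b <# H : V" "se l : SE" using b coset_V star_edges_eq by auto
 ultimately show ?thesis using that by blast
qed

end

context sofic
begin

abbreviation "Tr n == {T. spanning_tree (q.V n) ends (q.E n) T}"
abbreviation "mean n p T == (SUM A:q.V n. p (q.ph T A)) / real (N n)"

lemma finite_Tr: "finite (Tr n)" "rc (Tr n) > 0"
 using finite_spanning_trees[OF q.finE] q.quot_pos[of n] by (auto simp: ntrees_def)

text \<open>Translates of a cylinder event are equally likely, and by negative association disjoint
  translates are not positively correlated; so the variance of the empirical mean is of order
  \<open>1 / N n\<close>.\<close>

lemma cyl_concentration:
 assumes B: "finite B" "B <= Ec" and dl: "dl > 0" and thh: "thh > 0"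
 shows "evs (%n. rc {T : Tr n. \<bar>mean n (cyl B) T - wsf_prob B\<bar> > dl} <= thh * rc (Tr n))"
proof -
 define F where "F = (UN epp:B. ends epp)"
 have rep: "EX g:cG. EX l:Lab. epp = ge g l" if "epp : B" for epp using that B(2) E_cay_iff by blast
 have F: "finite F" "F <= cG"
 proof -
 have "finite (ends epp) & ends epp <= cG" if "epp : B" for epp
 using rep[OF that] Lab_carrier(1) by (auto simp: ends_ge)
 thus "finite F" "F <= cG" unfolding F_def using B(1) by auto
 qed
 \<comment> \<open>Overlapping translates share a vertex \<open>b g H = b' g' H\<close> with
   \<open>g\<close> and \<open>g'\<close> in \<open>F\<close>; the pair \<open>(g, g')\<close>
   determines the second translate from the first.\<close>
 define C where "C = rc (F \<times> F)"
 have "evs (%n. dist (Pn n (pe n ` B)) (wsf_prob B) < dl / 2)"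
 by (rule tendstoD[OF Pn_tendsto[OF B]]) (use dl in simp)
 moreover have "evs (%n. real (N n) >= C / (thh * (dl / 2)^2))"
 using N_at_top by (auto simp: filterlim_at_top)
 ultimately show ?thesis
 proof eventually_elim
 case (elim n)
 let ?V = "q.V n" and ?E = "q.E n" and ?H = "Sg n"
 define S where "S A = q.pq (q.invc A) ` B" for A
 define bad where "bad A = {A' : ?V. S A Int S A' ~= {}}" for A
 define muu where "muu = Pn n (pe n ` B)"
 have inv: "EX b:cG. q.invc A = b <# ?H" if "A : ?V" for A using q.invc_V[OF that] q.V_iff by blast
 have pqB: "q.pq (b <# ?H) epp = q.lact b (pe n epp)" "q.pq (b <# ?H) epp : ?E"
 "ends (q.pq (b <# ?H) epp) <= (%g. (b @@ g) <# ?H) ` F" "ends (q.pq (b <# ?H) epp) ~= {}"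
 if b: "b : cG" and ep: "epp : B" for b epp
 proof -
 obtain g l where gl: "g : cG" "l : Lab" "epp = ge g l" using rep[OF ep] by blast
 have s: "fst l : cG" by (rule Lab_carrier(1)[OF gl(2)])
 have e: "q.pq (b <# ?H) epp = q.qe n (b @@ g) l" using q.pq_ge[OF b gl(1,2)] gl(3) by simp
 show "q.pq (b <# ?H) epp = q.lact b (pe n epp)" unfolding e unfolding gl(3) pe_ge by (rule q.lact_qe[OF b gl(1,2), symmetric])
 show "q.pq (b <# ?H) epp : ?E" unfolding e using q.E_iff b gl by blast
 have "ends epp <= F" using ep unfolding F_def by blast
 hence "g : F" "g @@ fst l : F" unfolding gl(3) ends_ge by auto
 thus "ends (q.pq (b <# ?H) epp) <= (%g. (b @@ g) <# ?H) ` F"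
 unfolding e q.ends_qe using b gl s by (auto simp: m_assoc)
 show "ends (q.pq (b <# ?H) epp) ~= {}" unfolding e q.ends_qe by simp
 qed
 have SE: "S A <= ?E" if "A : ?V" for A using inv[OF that] pqB(2) by (auto simp: S_def)
 have peE: "pe n ` B <= ?E" using B(2) pe_E by auto
 have PS: "Pn n (S A) = muu" if A: "A : ?V" for A
 proof -
 obtain b where b: "b : cG" "q.invc A = b <# ?H" using inv[OF A] by blast
 have "S A = q.lact b ` pe n ` B" unfolding S_def b(2) image_image by (intro image_cong refl pqB(1)[OF b(1)])
 thus ?thesis unfolding muu_def using q.TP_lact[OF b(1) peE] by simp
 qed
 have cnt: "rc {T : Tr n. X <= T} = Pn n X * rc (Tr n)" for X
 using finite_Tr(2)[of n] unfolding tree_prob_def ntrees_def by simp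
 have "rc {T : Tr n. \<bar>(SUM A:?V. of_bool (S A <= T)) / real (card ?V) - muu\<bar> > dl / 2} * ((dl / 2)^2 * rc ?V) <= C * rc (Tr n)"
 proof (rule second_moment[where bad = bad])
 show "rc {T : Tr n. S A <= T} = muu * rc (Tr n)" if "A : ?V" for A using cnt PS[OF that] by simp
 show "rc {T : Tr n. S A Un S A' <= T} <= muu^2 * rc (Tr n)" if A: "A : ?V" "A' : ?V" "A' ~: bad A" for A A'
 proof -
 have "S A Int S A' = {}" using A by (auto simp: bad_def)
 moreover have "finite (S A)" using B(1) by (simp add: S_def)
 ultimately have "Pn n (S A Un S A') <= Pn n (S A) * Pn n (S A')"
 using tree_prob_neg[OF _ q.graph SE[OF A(1)] SE[OF A(2)] _ q.quot_pos] by blast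
 thus ?thesis unfolding cnt PS[OF A(1)] PS[OF A(2)] using finite_Tr(2)[of n] by (simp add: power2_eq_square)
 qed
 show "rc (?V Int bad A) <= C" if A: "A : ?V" for A
 proof -
 obtain b where b: "b : cG" "q.invc A = b <# ?H" using inv[OF A] by blast
 have "?V Int bad A <= (%(g, g'). q.invc ((b @@ g @@ inv g') <# ?H)) ` (F \<times> F)"
 proof
 fix A' assume A': "A' : ?V Int bad A"
 then obtain b' where b': "b' : cG" "q.invc A' = b' <# ?H" using inv by blast
 obtain x where x: "x : S A" "x : S A'" using A' by (auto simp: bad_def)
 obtain epp where ep: "epp : B" "x = q.pq (b <# ?H) epp" using x(1) b by (auto simp: S_def)
 obtain epp' where ep': "epp' : B" "x = q.pq (b' <# ?H) epp'" using x(2) b' by (auto simp: S_def)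
 have "ends x ~= {}" "ends x <= (%g. (b @@ g) <# ?H) ` F" "ends x <= (%g. (b' @@ g) <# ?H) ` F"
 using pqB(3,4)[OF b(1) ep(1)] pqB(3)[OF b'(1) ep'(1)] ep(2) ep'(2) by auto
 then obtain g g' where g: "g : F" "g' : F" "(b @@ g) <# ?H = (b' @@ g') <# ?H" by blast
 have gc: "g : cG" "g' : cG" using g F by auto
 have "((b @@ g) <# ?H) #> inv g' = ((b' @@ g') <# ?H) #> inv g'" using g(3) by simp
 hence "(b @@ g @@ inv g') <# ?H = b' <# ?H" using gc b b' by (simp add: q.coset_rmult m_assoc)
 hence "q.invc ((b @@ g @@ inv g') <# ?H) = A'" using b'(2) q.invc_invc[of A' n] A' by simp
 thus "A' : (%(g, g'). q.invc ((b @@ g @@ inv g') <# ?H)) ` (F \<times> F)"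
 using g by (intro image_eqI[of _ _ "(g, g')"]) auto
 qed
 hence "card (?V Int bad A) <= card ((%(g, g'). q.invc ((b @@ g @@ inv g') <# ?H)) ` (F \<times> F))"
 using F by (intro card_mono) auto
 also have "... <= card (F \<times> F)" using F by (intro card_image_le) auto
 finally show ?thesis by (simp add: C_def)
 qed
 qed (use finite_Tr fin q.V_ne dl in auto)
 moreover have "(SUM A:?V. of_bool (S A <= T)) = (SUM A:?V. cyl B (q.ph T A))" for T
 using B(2) by (intro sum.cong refl) (auto simp: cyl_def S_def q.ph_def)
 ultimately have key: "rc {T : Tr n. \<bar>mean n (cyl B) T - muu\<bar> > dl / 2} * ((dl / 2)^2 * real (N n)) <= C * rc (Tr n)" by simp
 have "{T : Tr n. \<bar>mean n (cyl B) T - wsf_prob B\<bar> > dl} <= {T : Tr n. \<bar>mean n (cyl B) T - muu\<bar> > dl / 2}"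
 proof
 fix T assume T: "T : {T : Tr n. \<bar>mean n (cyl B) T - wsf_prob B\<bar> > dl}"
 moreover have "\<bar>muu - wsf_prob B\<bar> < dl / 2" using elim(1) unfolding muu_def dist_real_def .
 ultimately have "\<bar>mean n (cyl B) T - muu\<bar> > dl / 2" by (simp only: mem_Collect_eq) linarith
 thus "T : {T : Tr n. \<bar>mean n (cyl B) T - muu\<bar> > dl / 2}" using T by blast
 qed
 hence le: "rc {T : Tr n. \<bar>mean n (cyl B) T - wsf_prob B\<bar> > dl} <= rc {T : Tr n. \<bar>mean n (cyl B) T - muu\<bar> > dl / 2}"
 using finite_Tr(1)[of n] by (intro of_nat_mono card_mono) auto
 define D where "D = (dl / 2)^2 * real (N n)"
 have D: "D > 0" using dl N_pos[of n] by (simp add: D_def)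
 have "C <= thh * D" using elim(2) dl thh by (simp add: D_def divide_le_eq mult.commute mult.left_commute)
 hence "rc {T : Tr n. \<bar>mean n (cyl B) T - muu\<bar> > dl / 2} * D <= (thh * D) * rc (Tr n)"
 using key mult_right_mono[of C "thh * D" "rc (Tr n)"] unfolding D_def[symmetric] by linarith
 hence "rc {T : Tr n. \<bar>mean n (cyl B) T - muu\<bar> > dl / 2} * D <= (thh * rc (Tr n)) * D" by (simp add: algebra_simps)
 thus ?case using le D by simp
 qed
qed

lemma fun_concentration:
 assumes p: "p : CX" and dl: "dl > 0" and thh: "thh > 0"
 shows "evs (%n. rc {T : Tr n. \<bar>mean n p T - wI p\<bar> > dl} <= thh * rc (Tr n))"
proof -
 \<comment> \<open>Budget: \<open>dl / 6\<close> for approximating the empirical mean,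
   \<open>dl / 3\<close> for the integral, \<open>dl / 2\<close> for the cylinder averages.\<close>
 have d6: "dl / 6 > 0" using dl by simp
 obtain F c where F: "finite F" "F <= Ec"
 "!!x. x : cX ==> \<bar>p x - (SUM B:Pow F. c B * cyl B x)\<bar> <= dl / 6"
 by (rule config_approx[OF p d6], rule that)
 have near: "\<bar>wI p - (SUM B:Pow F. c B * wsf_prob B)\<bar> <= 2 * (dl / 6)"
 by (rule wsf_integral_near[OF p F d6])
 \<comment> \<open>Adding 1 keeps the denominator of \<open>gam\<close> positive when all
   coefficients vanish.\<close>
 define s where "s = (SUM B:Pow F. \<bar>c B\<bar>) + 1"
 have s: "s >= 1" unfolding s_def by (simp add: sum_nonneg)
 define gam where "gam = dl / (2 * s)"
 define ka where "ka = thh / rc (Pow F)"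
 have cp: "rc (Pow F) > 0" using F(1) by (simp add: card_Pow)
 have pos: "gam > 0" "ka > 0" using dl thh s cp by (auto simp: gam_def ka_def)
 have "evs (%n. ALL B:Pow F. rc {T : Tr n. \<bar>mean n (cyl B) T - wsf_prob B\<bar> > gam} <= ka * rc (Tr n))"
 using F pos by (intro eventually_ball_finite ballI cyl_concentration) (auto intro: finite_subset)
 thus ?thesis
 proof eventually_elim
 case (elim n)
 let ?V = "q.V n"
 let ?bad = "%B. {T : Tr n. \<bar>mean n (cyl B) T - wsf_prob B\<bar> > gam}"
 have "{T : Tr n. \<bar>mean n p T - wI p\<bar> > dl} <= (UN B:Pow F. ?bad B)"
 proof (rule subsetI, rule ccontr)
 fix T assume T: "T : {T : Tr n. \<bar>mean n p T - wI p\<bar> > dl}" and no: "T ~: (UN B:Pow F. ?bad B)"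
 have "\<bar>mean n p T - (SUM A:?V. SUM B:Pow F. c B * cyl B (q.ph T A)) / real (N n)\<bar> <= dl / 6"
 using fin q.V_ne F(3) by (intro finite_mean_dist) (auto simp: q.ph_def config_space_def)
 moreover have "(SUM A:?V. SUM B:Pow F. c B * cyl B (q.ph T A)) / real (N n) = (SUM B:Pow F. c B * mean n (cyl B) T)"
 by (subst sum.swap) (simp add: sum_divide_distrib sum_distrib_left)
 moreover have "\<bar>(SUM B:Pow F. c B * mean n (cyl B) T) - (SUM B:Pow F. c B * wsf_prob B)\<bar> <= (SUM B:Pow F. \<bar>c B\<bar> * gam)"
 unfolding sum_subtractf[symmetric]
 proof (rule order_trans[OF sum_abs sum_mono])
 fix B assume "B : Pow F"
 hence "T ~: ?bad B" using no by blast
 hence "~ gam < \<bar>mean n (cyl B) T - wsf_prob B\<bar>" using T by simp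
 hence "\<bar>mean n (cyl B) T - wsf_prob B\<bar> <= gam" by linarith
 thus "\<bar>c B * mean n (cyl B) T - c B * wsf_prob B\<bar> <= \<bar>c B\<bar> * gam"
 unfolding right_diff_distrib[symmetric] abs_mult by (intro mult_left_mono) auto
 qed
 moreover have "(SUM B:Pow F. \<bar>c B\<bar> * gam) <= dl / 2"
 proof -
 have "(SUM B:Pow F. \<bar>c B\<bar> * gam) = (s - 1) * gam" by (simp add: s_def sum_distrib_right)
 also have "... <= s * gam" using pos by (intro mult_right_mono) auto
 finally show ?thesis using s by (simp add: gam_def)
 qed
 moreover have "\<bar>mean n p T - wI p\<bar> > dl" using T by simp
 ultimately show False using near by linarith
 qed
 hence "card {T : Tr n. \<bar>mean n p T - wI p\<bar> > dl} <= card (UN B:Pow F. ?bad B)"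
 using finite_Tr(1)[of n] F(1) by (intro card_mono) auto
 also have "... <= (SUM B:Pow F. card (?bad B))" using F(1) by (intro card_UN_le) auto
 finally have "rc {T : Tr n. \<bar>mean n p T - wI p\<bar> > dl} <= real (SUM B:Pow F. card (?bad B))"
 by (rule of_nat_mono)
 also have "... = (SUM B:Pow F. rc (?bad B))" by (rule of_nat_sum)
 also have "... <= (SUM B:Pow F. ka * rc (Tr n))" using elim by (intro sum_mono) auto
 also have "... = thh * rc (Tr n)" using cp by (simp add: ka_def)
 finally show ?case .
 qed
qed

text \<open>Most trees give microstates that pass all tests in \<open>L\<close>, and distinct trees
  differ on the edges at \<open>\<one>\<close> for some coset, hence are separated at scale
  1.\<close>

lemma measure_lower:
 assumes W: "W <= cG" and L: "finite L" "L <= CX" and dl: "dl > 0"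
 shows "ereal (hT) <=
 limsup (%n. eln (sep_number (sofic_Map_nu G (Sg n) (cX) (config_act G f) (rho_config G f) (wI) W L dl)
 (rho_inf (q.V n) (rho_config G f)) 1) / ereal (real (N n)))"
proof (rule limsup_ge_entropy)
 \<comment> \<open>With this value the trees failing one of the tests make up at most half of all
   trees.\<close>
 define thh where "thh = 1 / (2 * (rc L + 1))"
 have thh: "thh > 0" "rc L * thh <= 1 / 2" by (auto simp: thh_def field_simps)
 have "evs (%n. ALL p:L. rc {T : Tr n. \<bar>mean n p T - wI p\<bar> > dl} <= thh * rc (Tr n))"
 using L dl thh by (intro eventually_ball_finite ballI fun_concentration) auto
 thus "evs (%n. ereal (1 / 2 * real (tau_quot G f (Sg n))) <=
 sep_number (sofic_Map_nu G (Sg n) (cX) (config_act G f) (rho_config G f) (wI) W L dl)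
 (rho_inf (q.V n) (rho_config G f)) 1)"
 proof eventually_elim
 case (elim n)
 let ?V = "q.V n"
 let ?bad = "%p. {T : Tr n. \<bar>mean n p T - wI p\<bar> > dl}"
 define Go where "Go = Tr n - (UN p:L. ?bad p)"
 define Ph where "Ph T = (\<lambda>A\<in>?V. q.ph T A)" for T
 have finG: "finite Go" using finite_Tr(1)[of n] by (simp add: Go_def)
 have sA: "s <# A : ?V" if "A : ?V" "s : cG" for s A
 proof -
 obtain a where a: "a : cG" "A = a <# Sg n" using \<open>A : ?V\<close> q.V_iff by blast
 show ?thesis unfolding a(2) q.coset_lmult[OF a(1) \<open>s : cG\<close>] by (rule q.coset_V) (use a that in simp)
 qed
 have dist: "rho_inf ?V (rho_config G f) (Ph T) (Ph T') >= 1" if T: "T : Go" "T' : Go" "T ~= T'" for T T'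
 proof -
 have TE: "T <= q.E n" "T' <= q.E n" using T unfolding Go_def spanning_tree_def by auto
 obtain A epp where A: "A : ?V" "epp : SE" "q.ph T A epp ~= q.ph T' A epp" by (rule q.ph_separates[OF TE T(3)])
 thus ?thesis by (intro rho_inf_pos[OF fin A(1)]) (auto simp: rho_config_def Ph_def)
 qed
 have inj: "inj_on Ph Go"
 proof (rule inj_onI, rule ccontr)
 fix T T' assume T: "T : Go" "T' : Go" "Ph T = Ph T'" "T ~= T'"
 have "rho_inf ?V (rho_config G f) (Ph T) (Ph T') < 1"
 by (rule rho_inf_zero[OF fin q.V_ne]) (use T(3) in \<open>auto simp: rho_config_def\<close>)
 thus False using dist[OF T(1,2,4)] by simp
 qed
 have "card (Tr n) <= card Go + card (UN p:L. ?bad p)"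
 proof -
 have "Tr n <= Go Un (UN p:L. ?bad p)" by (auto simp: Go_def)
 hence "card (Tr n) <= card (Go Un (UN p:L. ?bad p))" using finG L(1) finite_Tr(1)[of n] by (intro card_mono) auto
 thus ?thesis using card_Un_le[of Go "UN p:L. ?bad p"] by linarith
 qed
 also have "card (UN p:L. ?bad p) <= (SUM p:L. card (?bad p))" using L(1) by (rule card_UN_le)
 finally have "rc (Tr n) <= real (card Go + (SUM p:L. card (?bad p)))" by (simp only: of_nat_le_iff)
 also have "... = rc Go + (SUM p:L. rc (?bad p))" by simp
 also have "(SUM p:L. rc (?bad p)) <= (SUM p:L. thh * rc (Tr n))" using elim by (intro sum_mono) auto
 also have "... = (rc L * thh) * rc (Tr n)" by simp
 also have "... <= 1 / 2 * rc (Tr n)" using thh by (intro mult_right_mono) auto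
 finally have "1 / 2 * real (tau_quot G f (Sg n)) <= rc (Ph ` Go)"
 by (simp add: card_image[OF inj] tau_quot_def num_spanning_trees_def)
 moreover have "ereal (rc (Ph ` Go)) <= sep_number (sofic_Map_nu G (Sg n) (cX) (config_act G f) (rho_config G f) (wI) W L dl)
 (rho_inf ?V (rho_config G f)) 1"
 proof (rule sep_number_lower)
 show "finite (Ph ` Go)" using finG by simp
 show "rho_inf ?V (rho_config G f) x y >= 1" if xy: "x : Ph ` Go" "y : Ph ` Go" "x ~= y" for x y
 proof -
 obtain T T' where T: "T : Go" "T' : Go" "x = Ph T" "y = Ph T'" using xy by blast
 hence "T ~= T'" using xy(3) by auto
 thus ?thesis using dist[OF T(1,2)] T(3,4) by simp
 qed
 show "Ph ` Go <= sofic_Map_nu G (Sg n) (cX) (config_act G f) (rho_config G f) (wI) W L dl"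
 proof (rule image_subsetI)
 fix T assume T: "T : Go"
 have "rho_2 ?V (rho_config G f) (%A. Ph T (s <# A)) (%A. config_act G f s (Ph T A)) <= dl" if "s : W" for s
 proof -
 have s: "s : cG" using that W by auto
 have "(SUM A:?V. (rho_config G f (Ph T (s <# A)) (config_act G f s (Ph T A)))^2) = 0"
 proof (intro sum.neutral ballI)
 fix A assume A: "A : ?V"
 have "Ph T (s <# A) = config_act G f s (Ph T A)" using q.ph_act[OF A s] sA[OF A s] A by (simp add: Ph_def)
 thus "(rho_config G f (Ph T (s <# A)) (config_act G f s (Ph T A)))^2 = 0" by (simp add: rho_config_def)
 qed
 thus ?thesis unfolding rho_2_def using dl by simp
 qed
 moreover have "\<bar>(SUM A:?V. p (Ph T A)) / real (N n) - wI p\<bar> <= dl" if "p : L" for p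
 proof -
 have "T ~: ?bad p" using T that unfolding Go_def by blast
 hence "~ dl < \<bar>mean n p T - wI p\<bar>" using T by (simp add: Go_def)
 thus ?thesis by (simp add: Ph_def)
 qed
 moreover have "Ph T : ?V \<rightarrow>\<^sub>E cX" by (auto simp: Ph_def q.ph_def config_space_def)
 ultimately show "Ph T : sofic_Map_nu G (Sg n) (cX) (config_act G f) (rho_config G f) (wI) W L dl"
 unfolding sofic_Map_nu_def sofic_Map_def by simp
 qed
 qed
 ultimately show ?case by (meson ereal_less_eq(3) order_trans)
 qed
qed simp

end

section \<open>Measure entropy: upper bound\<close>

context wb_group
begin

primrec reach :: "nat => ('g ed => bool) => 'g set" where
 "reach 0 x = {\<one>}"
| "reach (Suc k) x = reach k x Un {g @@ fst l | g l. g : reach k x & l : Lab & x (ge g l)}"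

text \<open>The same \<open>M\<close> serves as radius and as size: a cluster that keeps growing
  gains a vertex in each step, so after \<open>M\<close> steps it has more than \<open>M\<close>
  vertices.\<close>

definition small_comp :: "nat => ('g ed => bool) => real" where
 "small_comp M x = of_bool (card (reach M x) <= M)"

definition root_deg :: "('g ed => bool) => real" where
 "root_deg x = (SUM l:Lab. cyl {se l} x)"

lemma reach_wball: "reach k x <= wball k"
proof (induction k)
 case (Suc k)
 have "wball k <= wball (Suc k)" by (rule wball_mono) simp
 moreover have "g @@ fst l : wball (Suc k)" if "g : reach k x" "l : Lab" for g l using that Suc by (intro wball_step) auto
 ultimately show ?case using Suc unfolding reach.simps by blast
qed simp

lemma reach_cong:
 assumes "!!g l. g : wball M ==> l : Lab ==> x (ge g l) = x' (ge g l)"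
 shows "k <= M ==> reach k x = reach k x'"
proof (induction k)
 case (Suc k)
 hence e: "reach k x = reach k x'" by simp
 have "g : wball M" if "g : reach k x'" for g using that reach_wball[of k x'] wball_mono[of k M] Suc.prems by auto
 hence "x (ge g l) = x' (ge g l)" if "g : reach k x'" "l : Lab" for g l using assms that by blast
 hence "{g @@ fst l | g l. g : reach k x' & l : Lab & x (ge g l)} = {g @@ fst l | g l. g : reach k x' & l : Lab & x' (ge g l)}"
 by (intro Collect_cong ex_cong1) auto
 thus ?case unfolding reach.simps e by simp
qed simp

lemma config_C_finite:
 assumes F: "finite F" "F <= Ec" and dep: "!!x x'. (!!epp. epp : F ==> x epp = x' epp) ==> p x = p x'"
 shows "p : CX"
 unfolding config_C_def mem_Collect_eq continuous_map_closedin
proof (intro conjI allI impI ballI)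
 fix C :: "real set"
 show "closedin (config_top G f) {x : topspace (config_top G f). p x : C}"
 unfolding config_top_def
 proof (rule closedin_finite_coords[OF F])
 fix z z' assume z: "z : {x : topspace (product_topology (%_. discrete_topology UNIV) (Ec)). p x : C}"
 "z' : Ec \<rightarrow>\<^sub>E UNIV" and eq: "!!i. i : F ==> z i = z' i"
 have "p z = p z'" by (rule dep) (rule eq)
 thus "z' : {x : topspace (product_topology (%_. discrete_topology UNIV) (Ec)). p x : C}" using z by simp
 qed auto
qed simp

lemma tests_C: "small_comp M : CX" "root_deg : CX"
proof -
 let ?F = "(%(g, l). ge g l) ` (wball M \<times> Lab)"
 have F: "finite ?F" using finite_wball finite_Lab by simp
 have FE: "?F <= Ec"
 proof
 fix epp assume "epp : ?F"
 then obtain g l where "g : wball M" "l : Lab" "epp = ge g l" by auto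
 thus "epp : Ec" using wball_carrier E_cay_iff by blast
 qed
 show "small_comp M : CX"
 proof (rule config_C_finite[OF F FE])
 fix x x' :: "'g ed => bool" assume e: "!!epp. epp : ?F ==> x epp = x' epp"
 have "reach M x = reach M x'"
 proof (rule reach_cong[OF _ order_refl])
 fix g l assume "g : wball M" "l : Lab"
 thus "x (ge g l) = x' (ge g l)" by (intro e image_eqI[of _ _ "(g, l)"]) auto
 qed
 thus "small_comp M x = small_comp M x'" by (simp add: small_comp_def)
 qed
 show "root_deg : CX"
 proof (rule config_C_finite[of "SE"])
 show "finite (SE)" "SE <= Ec" using finite_star by (auto simp: star_edges_def)
 show "root_deg x = root_deg x'" if e: "!!epp. epp : SE ==> x epp = x' epp" for x x'
 unfolding root_deg_def cyl_def using e star_edges_eq by (intro sum.cong refl) auto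
 qed
qed

lemma wsf_root_deg: "wI root_deg = (SUM l:Lab. wsf_prob {se l})"
proof (rule wsf_integral_eq)
 fix K assume K: "exhausts K"
 have "(%n. SUM l:Lab. wired_mean (K n) (cyl {se l})) \<longlonglongrightarrow> (SUM l:Lab. wsf_prob {se l})"
 using E_cay_iff by (intro tendsto_sum wired_mean_cyl[OF K]) auto
 moreover have "wired_mean A root_deg = (SUM l:Lab. wired_mean A (cyl {se l}))" for A
 unfolding wired_mean_def root_deg_def by (subst sum.swap) (simp add: sum_divide_distrib)
 ultimately show "(%n. wired_mean (K n) root_deg) \<longlonglongrightarrow> (SUM l:Lab. wsf_prob {se l})" by simp
qed

text \<open>Every vertex of a wired spanning tree is connected to the boundary vertex, so small
 components cannot be seen near the origin.\<close>

lemma wsf_small_comp: "wI (small_comp M) = 0"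
proof (rule wsf_integral_eq)
 fix K assume K: "exhausts K"
 have "evs (%n. 0 = wired_mean (K n) (small_comp M))"
 using exhausts_eventually[OF K finite_wball wball_carrier, of "Suc M"]
 proof eventually_elim
 case (elim n)
 let ?K = "K n"
 note Kn = exhausts_K[OF K, of n]
 have "small_comp M (wired_config G f ?K T) = 0" if T: "T : wired_trees G f ?K" for T
 proof -
 define x where "x = wired_config G f ?K T"
 have st: "spanning_tree (wV ?K) (wired_ends ?K) (wE ?K) T" using T by (simp add: wired_trees_def)
 have grow: "reach (Suc k) x ~= reach k x" if k: "k < M" for k
 proof
 assume stab: "reach (Suc k) x = reach k x"
 have sub: "reach k x <= wball M" using reach_wball[of k x] wball_mono[of k M] k by auto
 have "v : Some ` reach k x" if "(Some \<one>, v) : (adj_rel (wired_ends ?K) T)^*" for v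
 using that
 proof (induction rule: rtrancl_induct)
 case base
 have "\<one> : reach k x" by (induction k) auto
 thus ?case by simp
 next
 case (step y z)
 obtain g where g: "g : reach k x" "y = Some g" using step.IH by blast
 have gM: "g : wball M" using g sub by auto
 have gK: "g : ?K" using gM elim wball_mono[of M "Suc M"] by auto
 obtain epp where ep: "epp : T" "wired_ends ?K epp = {y, z}" using step.hyps(2) unfolding adj_rel_def by blast
 have "epp : inc (wired_ends ?K) (wE ?K) (Some g)" using ep st g unfolding spanning_tree_def inc_def by auto
 hence "epp : ge g ` Lab" using inc_wired[OF Kn(2) gK] by (simp add: bij_betw_def)
 then obtain l where l: "l : Lab" "epp = ge g l" by blast
 have sK: "g @@ fst l : ?K" using wball_step[OF gM l(1)] elim by auto
 have gc: "g : cG" using gK Kn by auto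
 have "ge g l : Ec" using gc l E_cay_iff by blast
 hence "x (ge g l)" using ep(1) l(2) gK sK by (simp add: x_def wired_config_def ends_ge)
 hence "g @@ fst l : reach (Suc k) x" using g(1) l(1) unfolding reach.simps by blast
 hence r: "g @@ fst l : reach k x" by (subst stab[symmetric])
 have "{Some g, Some (g @@ fst l)} = {Some g, z}" using ep(2) l(2) gK sK g(2) by (simp add: wired_ends_ge wv_def)
 hence "z = Some (g @@ fst l)" by (auto simp: doubleton_eq_iff)
 thus ?case using r by simp
 qed
 moreover have "\<one> : ?K" using elim one_wball[of "Suc M"] by auto
 hence "(Some \<one>, None) : (adj_rel (wired_ends ?K) T)^*" using st unfolding spanning_tree_def by blast
 ultimately show False by blast
 qed
 have "card (reach k x) >= k + 1" if "k <= M" for k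
 using that
 proof (induction k)
 case (Suc k)
 have "reach k x \<subset> reach (Suc k) x" using grow[of k] Suc.prems by auto
 hence "card (reach k x) < card (reach (Suc k) x)"
 by (rule psubset_card_mono[OF finite_subset[OF reach_wball finite_wball]])
 thus ?case using Suc by simp
 qed simp
 from this[of M] show ?thesis by (simp add: small_comp_def x_def[symmetric])
 qed
 thus ?case by (simp add: wired_mean_def)
 qed
 thus "(%n. wired_mean (K n) (small_comp M)) \<longlonglongrightarrow> 0" by (rule Lim_transform_eventually[OF tendsto_const])
qed

end

context wb_quot_loopfree
begin

text \<open>Mean degree about 2 leaves about \<open>N\<close> edges, and rare small clusters mean
  few components; so the open edges are a spanning forest with few roots plus few surplus edges
  \<open>X\<close>. \<open>D\<close> corrects the labels whose edge is read differently from its two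
  ends.\<close>

lemma few_components_code:
 fixes ka dl :: real
 assumes fii: "fii : sofic_Map_nu G H (cX) (config_act G f) (rho_config G f) (wI)
 ((%g. inv g) ` wball M) {small_comp M, root_deg} dl"
 and M: "M >= 1" "4 / ka <= real M" and inj: "!!a b. a : wball M ==> b : wball M ==> a <# H = b <# H ==> a = b"
 and ka: "ka > 0" and dl: "0 < dl" "dl <= 1" "(4 * (real deg + 1) * (rc (wball M) + 1)) * dl <= ka"
 and dg: "(SUM l:Lab. wsf_prob {se l}) <= 2"
 defines "P == {(B, l) : V \<times> Lab. fii (invc B) (se l)}"
 obtains Z y X D where "Z <= V" "rc Z <= ka * rc V" "y : rf V ends E Z" "X <= E" "rc X <= ka * rc V"
 "D <= V \<times> Lab" "rc D <= ka * rc V" "P = {(B, l) : V \<times> Lab. qa B l : y ` (V - Z) Un X} - D"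
proof -
 let ?N = "rc V" and ?c = "rc (wball M)"
 have N: "?N > 0" using finV V_ne by (simp add: card_gt_0_iff)
 have fiiP: "fii : V \<rightarrow>\<^sub>E cX" and mean: "!!p. p : {small_comp M, root_deg} ==> \<bar>(SUM A:V. p (fii A)) / ?N - wI p\<bar> <= dl"
 and eqv: "!!g. g : wball M ==> rho_2 V (rho_config G f) (%A. fii (inv g <# A)) (%A. config_act G f (inv g) (fii A)) <= dl"
 using fii unfolding sofic_Map_nu_def sofic_Map_def by auto
 define bg where "bg g = {A : V. EX l:Lab. fii (inv g <# A) (se l) ~= fii A (ge g l)}" for g
 have cbg: "rc (bg g) <= dl * ?N" if g: "g : wball M" for g
 proof -
 have gc: "g : cG" using g wball_carrier by blast
 have act: "config_act G f (inv g) z (se l) = z (ge g l)" if "l : Lab" for z l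
 using edge_act_ge[OF gc one_closed that] gc that E_cay_iff by (auto simp: config_act_def)
 have "rho_config G f (fii (inv g <# A)) (config_act G f (inv g) (fii A)) = of_bool (A : bg g)" if "A : V" for A
 using that act by (auto simp: rho_config_def bg_def star_edges_eq)
 hence "rho_2 V (rho_config G f) (%A. fii (inv g <# A)) (%A. config_act G f (inv g) (fii A)) <= dl \<longleftrightarrow>
 0 <= dl & rc {A : V. A : bg g} <= dl^2 * ?N" by (intro rho_2_count[OF finV V_ne])
 moreover have "{A : V. A : bg g} = bg g" by (auto simp: bg_def)
 ultimately have "rc (bg g) <= dl^2 * ?N" using eqv[OF g] by simp
 also have "... <= dl * ?N" using dl N by (intro mult_right_mono) (auto simp: power2_eq_square mult_left_le)
 finally show ?thesis .
 qed
 define BB where "BB = invc ` (UN g:wball M. bg g)"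
 have BBV: "BB <= V" unfolding BB_def bg_def using invc_V by auto
 have cBB: "rc BB <= ?c * dl * ?N"
 proof -
 have fb: "finite (UN g:wball M. bg g)" using finV finite_wball by (auto simp: bg_def)
 have "card BB <= card (UN g:wball M. bg g)" unfolding BB_def by (rule card_image_le[OF fb])
 also have "... <= (SUM g:wball M. card (bg g))" by (rule card_UN_le[OF finite_wball])
 finally have "rc BB <= real (SUM g:wball M. card (bg g))" by (rule of_nat_mono)
 also have "... = (SUM g:wball M. rc (bg g))" by (rule of_nat_sum)
 also have "... <= (SUM g:wball M. dl * ?N)" by (intro sum_mono cbg)
 finally show ?thesis by simp
 qed
 have Pmem: "(B, l) : P \<longleftrightarrow> B : V & l : Lab & fii (invc B) (se l)" for B l unfolding P_def by auto
 have loc: "((b @@ g) <# H, l) : P \<longleftrightarrow> fii (inv b <# H) (ge g l)"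
 if b: "b : cG" "b <# H ~: BB" and g: "g : wball M" and l: "l : Lab" for b g l
 proof -
 have gc: "g : cG" using g wball_carrier by blast
 have iv: "inv b <# H : V" "invc (inv b <# H) = b <# H" using b coset_V invc_coset[of "inv b"] by auto
 have "inv b <# H ~: bg g"
 proof
 assume "inv b <# H : bg g"
 hence "invc (inv b <# H) : BB" unfolding BB_def using g by blast
 thus False using iv b by simp
 qed
 hence "fii (inv g <# (inv b <# H)) (se l) = fii (inv b <# H) (ge g l)" using iv l unfolding bg_def by blast
 moreover have "invc ((b @@ g) <# H) = inv g <# (inv b <# H)" using b gc invc_coset[of "b @@ g"] by (simp add: coset_lmult inv_mult_group)
 ultimately show ?thesis using Pmem coset_V b gc l by simp
 qed
 \<comment> \<open>An edge counts as open when at least one of its ends reads it as open.\<close>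
 define omm where "omm = (%(B, l). qa B l) ` P"
 have qaE: "qa B l : E" if Bl: "B : V" "l : Lab" for B l
 proof -
 obtain g where g: "g : cG" "B = g <# H" using Bl(1) V_iff by blast
 show ?thesis unfolding g(2) qa_qe[OF g(1) Bl(2)] using E_iff g(1) Bl(2) by blast
 qed
 have ommE: "omm <= E" unfolding omm_def using qaE Pmem by auto
 have finomm: "finite omm" using ommE finE finite_subset by blast
 \<comment> \<open>\<open>Q\<close> reads the open edges from both ends. It exceeds \<open>P\<close>
   only over vertices of \<open>BB\<close>, where equivariance fails.\<close>
 define Q where "Q = {(B, l) : V \<times> Lab. qa B l : omm}"
 have Qmem: "(B, l) : Q \<longleftrightarrow> B : V & l : Lab & qa B l : omm" for B l unfolding Q_def by auto
 have finVL: "finite (V \<times> Lab)" using finV finite_Lab by simp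
 have PQ: "P <= Q" unfolding omm_def Q_def P_def by (auto intro!: image_eqI)
 have QV: "Q <= V \<times> Lab" by (auto simp: Q_def)
 have DB: "Q - P <= BB \<times> Lab"
 proof
 fix z assume z: "z : Q - P"
 obtain B l where Bl: "z = (B, l)" by (cases z)
 have B: "B : V" "l : Lab" "qa B l : omm" "(B, l) ~: P" using z Bl Qmem by auto
 then obtain B' l' where B': "(B', l') : P" "qa B l = qa B' l'" unfolding omm_def by auto
 obtain b' where b': "b' : cG" "B' = b' <# H" using B'(1) Pmem V_iff by blast
 have l': "l' : Lab" using B' Pmem by blast
 have s': "fst l' : cG" by (rule Lab_carrier(1)[OF l'])
 have "(B, fst l, snd l) : qe b' l'" using B'(2) qa_qe[OF b'(1) l'] b'(2) by (auto simp: qa_def)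
 hence "B = B' & l = l' | B = (b' @@ fst l') <# H & l = linv l'"
 unfolding b'(2) by (cases l; cases l') (simp add: qe_def linv_def)
 hence Bb: "B = (b' @@ fst l') <# H" "l = linv l'" using B B' by auto
 have "B : BB"
 proof (rule ccontr)
 assume nb: "B ~: BB"
 have bc: "b' @@ fst l' : cG" using b' s' by simp
 have g: "fst l : wball M" using wball_step[OF one_wball[of 0] B(2)] Lab_carrier(1)[OF B(2)] wball_mono[of "Suc 0" M] M by auto
 have e1: "b' @@ fst l' @@ fst l = b'" using Bb(2) b' s' by (simp add: fst_linv m_assoc)
 have "ge (fst l) l' = se l" using ge_flip[OF one_closed B(2)] linv_linv[OF l'] Bb(2) Lab_carrier(1)[OF B(2)] by simp
 hence "fii (inv (b' @@ fst l') <# H) (se l)" using loc[OF bc _ g l'] nb Bb(1) B'(1) e1 b'(2) by simp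
 moreover have "invc B = inv (b' @@ fst l') <# H" unfolding Bb(1) by (rule invc_coset[OF bc])
 ultimately show False using B Pmem by simp
 qed
 thus "z : BB \<times> Lab" using Bl B by simp
 qed
 have cD: "rc (Q - P) <= ?c * dl * ?N * real deg"
 proof -
 have "card (Q - P) <= card (BB \<times> Lab)" using finite_subset[OF BBV finV] finite_Lab by (intro card_mono DB) auto
 hence "rc (Q - P) <= rc BB * real deg" by (simp add: card_cartesian_product deg_def flip: of_nat_mult)
 also have "... <= ?c * dl * ?N * real deg" by (rule mult_right_mono[OF cBB]) simp
 finally show ?thesis .
 qed
 have cP: "rc P <= (2 + dl) * ?N"
 proof -
 have "rc P = (SUM B:V. rc {l : Lab. fii (invc B) (se l)})"
 proof -
 have "P = Sigma V (%B. {l : Lab. fii (invc B) (se l)})" unfolding P_def by auto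
 thus ?thesis using finV finite_Lab by (simp add: card_SigmaI)
 qed
 also have "... = (SUM B:V. root_deg (fii (invc B)))"
 using finite_Lab by (intro sum.cong refl) (simp add: root_deg_def cyl_def Int_def)
 also have "... = (SUM A:V. root_deg (fii A))" by (rule sum.reindex_bij_betw[OF bij_invc])
 finally have "rc P / ?N <= 2 + dl" using mean[of root_deg] dg unfolding wsf_root_deg by simp
 thus ?thesis using N by (simp add: divide_le_eq)
 qed
 have comm: "2 * rc omm <= rc Q"
 proof -
 have "(SUM epp:omm. rc {A : V. A : ends epp}) = (SUM epp:omm. 2)"
 proof (rule sum.cong[OF refl])
 fix epp assume "epp : omm"
 hence "epp : E" using ommE by blast
 then obtain g l where gl: "g : cG" "l : Lab" "epp = qe g l" using E_iff by blast
 have s: "fst l : cG" by (rule Lab_carrier(1)[OF gl(2)])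
 have "{A:V. A : ends epp} = {g <# H, (g @@ fst l) <# H}" using gl s coset_V by (auto simp: ends_qe)
 thus "rc {A:V. A : ends epp} = 2" using step_neq[OF gl(1,2)] by simp
 qed
 moreover have "(SUM epp:omm. SUM A:{A : V. A : ends epp}. 1 :: real) = (SUM A:V. SUM epp:{epp : omm. A : ends epp}. 1)"
 using sum.swap_restrict[OF finomm finV, of "%_ _. 1 :: real" "%epp A. A : ends epp"] .
 moreover have "(SUM A:V. rc {epp : omm. A : ends epp}) <= (SUM A:V. rc {l : Lab. qa A l : omm})"
 proof (intro sum_mono of_nat_mono)
 fix A assume "A : V"
 then obtain g where g: "g : cG" "A = g <# H" using V_iff by auto
 have "{epp : omm. A : ends epp} <= qa A ` {l : Lab. qa A l : omm}"
 proof
 fix epp assume e: "epp : {epp : omm. A : ends epp}"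
 hence "epp : inc ends E A" using ommE by (auto simp: inc_def)
 hence "epp : qe g ` Lab" using inc_qe[OF g(1)] g(2) by (simp add: bij_betw_def)
 then obtain l where "l : Lab" "epp = qa A l" using qa_qe[OF g(1)] g(2) by auto
 thus "epp : qa A ` {l : Lab. qa A l : omm}" using e by blast
 qed
 thus "card {epp : omm. A : ends epp} <= card {l : Lab. qa A l : omm}"
 using finite_Lab by (intro surj_card_le) auto
 qed
 moreover have "rc Q = (SUM A:V. rc {l : Lab. qa A l : omm})"
 proof -
 have "Q = Sigma V (%A. {l : Lab. qa A l : omm})" unfolding Q_def by auto
 thus ?thesis using finV finite_Lab by (simp add: card_SigmaI)
 qed
 ultimately show ?thesis by simp
 qed
 define comp where "comp v = {w : V. (v, w) : (adj_rel ends omm)^*}" for v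
 have comp_self: "v : comp v" if "v : V" for v using that by (simp add: comp_def)
 have comp_eq: "comp w = comp v" if "(v, w) : (adj_rel ends omm)^*" for v w
 unfolding comp_def using that adj_rtrancl_sym[OF that] by (auto intro: rtrancl_trans)
 define Sm where "Sm = {v : V. small_comp M (fii (invc v)) = 1}"
 have cSm: "rc Sm <= dl * ?N"
 proof -
 have "rc Sm = (SUM v:V. small_comp M (fii (invc v)))"
 unfolding Sm_def small_comp_def using finV by (simp add: Int_def)
 also have "... = (SUM A:V. small_comp M (fii A))" by (rule sum.reindex_bij_betw[OF bij_invc])
 finally have "rc Sm / ?N <= dl" using mean[of "small_comp M"] unfolding wsf_small_comp by simp
 thus ?thesis using N by (simp add: divide_le_eq)
 qed
 have big: "real M <= rc (comp v)" if v: "v : V" "v ~: BB" "v ~: Sm" for v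
 proof -
 obtain b where b: "b : cG" "v = b <# H" using v V_iff by auto
 define x where "x = fii (inv b <# H)"
 have iv: "invc v = inv b <# H" unfolding b(2) by (rule invc_coset[OF b(1)])
 have xe: "fii (invc v) = x" by (simp only: iv x_def)
 have rM: "M < card (reach M x)" using v(1,3) by (auto simp: Sm_def small_comp_def xe)
 have rc: "(v, (b @@ g) <# H) : (adj_rel ends omm)^*" if "k <= M" "g : reach k x" for k g
 using that
 proof (induction k arbitrary: g)
 case 0
 thus ?case using b by simp
 next
 case (Suc k)
 show ?case
 proof (cases "g : reach k x")
 case False
 then obtain h l where h: "g = h @@ fst l" "h : reach k x" "l : Lab" "x (ge h l)" using Suc.prems(2) by auto
 have hM: "h : wball M" using h(2) reach_wball[of k x] wball_mono[of k M] Suc.prems by auto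
 have hc: "h : cG" "b @@ h : cG" using hM wball_carrier b by auto
 have "((b @@ h) <# H, l) : P" using loc[OF b(1) _ hM h(3)] v(2) b(2) h(4) by (simp add: x_def)
 hence "(%(B, l). qa B l) ((b @@ h) <# H, l) : omm" unfolding omm_def by (rule imageI)
 hence e: "qe (b @@ h) l : omm" using qa_qe[OF hc(2) h(3)] by simp
 have gb: "b @@ g = b @@ h @@ fst l" using h(1) b hc Lab_carrier(1)[OF h(3)] by (simp add: m_assoc)
 have "((b @@ h) <# H, (b @@ g) <# H) : (adj_rel ends omm)^*" unfolding gb by (rule adj_edge[where en = ends, OF e ends_qe])
 moreover have "(v, (b @@ h) <# H) : (adj_rel ends omm)^*" by (rule Suc.IH[OF _ h(2)]) (use Suc.prems in simp)
 ultimately show ?thesis by (rule rtrancl_trans[rotated])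
 qed (use Suc in simp)
 qed
 have inj2: "inj_on (%g. (b @@ g) <# H) (reach M x)"
 proof (rule inj_onI)
 fix g h assume gh: "g : reach M x" "h : reach M x" "(b @@ g) <# H = (b @@ h) <# H"
 have w: "g : wball M" "h : wball M" using gh reach_wball by auto
 have c: "g : cG" "h : cG" using w wball_carrier by auto
 have "inv b <# ((b @@ g) <# H) = inv b <# ((b @@ h) <# H)" using gh(3) by simp
 hence "g <# H = h <# H" using b c by (simp add: coset_lmult cancel_left)
 thus "g = h" using inj w by blast
 qed
 have "(%g. (b @@ g) <# H) ` reach M x <= comp v"
 proof (rule image_subsetI)
 fix g assume g: "g : reach M x"
 have "g : cG" using g reach_wball wball_carrier by blast
 thus "(b @@ g) <# H : comp v" using rc[OF order_refl g] coset_V[of "b @@ g"] b by (simp add: comp_def)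
 qed
 hence "card (reach M x) <= card (comp v)" using finV by (intro card_inj_on_le[OF inj2]) (auto simp: comp_def)
 thus ?thesis using rM by simp
 qed
 \<comment> \<open>\<open>SOME\<close> is applied to the component as a set, so all its members
   obtain the same representative.\<close>
 define r where "r v = (SOME w. w : comp v)" for v
 have r: "r v : comp v" if "v : V" for v unfolding r_def by (rule someI[of "%w. w : comp v", OF comp_self[OF that]])
 define Z where "Z = r ` V"
 have ZV: "Z <= V" unfolding Z_def using r by (auto simp: comp_def)
 have finZ: "finite Z" using ZV finV finite_subset by blast
 have cZ: "rc Z <= ?c * dl * ?N + dl * ?N + ka / 4 * ?N"
 proof -
 define Z1 where "Z1 = Z - (BB Un Sm)"
 have dis: "comp z Int comp z' = {}" if z: "z : Z1" "z' : Z1" "z ~= z'" for z z'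
 proof (rule ccontr)
 assume "comp z Int comp z' ~= {}"
 then obtain w where w: "(z, w) : (adj_rel ends omm)^*" "(z', w) : (adj_rel ends omm)^*" by (auto simp: comp_def)
 have zz: "comp z = comp z'" using comp_eq[OF w(1)] comp_eq[OF w(2)] by simp
 obtain v v' where v: "v : V" "z = r v" "v' : V" "z' = r v'" using z unfolding Z1_def Z_def by blast
 have "comp z = comp v" "comp z' = comp v'" using r[OF v(1)] r[OF v(3)] v comp_eq by (auto simp: comp_def)
 hence "r v = r v'" using zz unfolding r_def by simp
 thus False using z v by simp
 qed
 have "(SUM z:Z1. real M) <= (SUM z:Z1. rc (comp z))"
 proof (rule sum_mono)
 fix z assume "z : Z1"
 thus "real M <= rc (comp z)" using big[of z] ZV by (auto simp: Z1_def)
 qed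
 also have "... = rc (UN z:Z1. comp z)"
 using finZ finV dis by (subst card_UN_disjoint) (auto simp: Z1_def comp_def)
 also have "... <= ?N" using finV by (intro of_nat_mono card_mono) (auto simp: comp_def)
 finally have "rc Z1 * real M <= ?N" by simp
 moreover have "rc Z1 * (4 / ka) <= rc Z1 * real M" using M by (intro mult_left_mono) auto
 ultimately have "rc Z1 * (4 / ka) <= ?N" by linarith
 hence Z1: "rc Z1 <= ka / 4 * ?N" using ka by (simp add: field_simps)
 have "card Z <= card (BB Un Sm Un Z1)" using finZ finV BBV finite_subset[OF BBV finV]
 by (intro card_mono) (auto simp: Z1_def Sm_def)
 also have "... <= card BB + card Sm + card Z1" using card_Un_le[of "BB Un Sm" Z1] card_Un_le[of BB Sm] by linarith
 finally have "rc Z <= rc BB + rc Sm + rc Z1" by linarith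
 thus ?thesis using cBB cSm Z1 by linarith
 qed
 obtain y where y: "y : rf V ends E Z" "y ` (V - Z) <= omm"
 proof (rule bfs_forest[OF graph ommE ZV])
 fix v assume v: "v : V"
 thus "EX z:Z. (v, z) : (adj_rel ends omm)^*" using r[OF v] unfolding Z_def comp_def by blast
 qed (rule that)
 \<comment> \<open>The forest consumes \<open>card V - card Z\<close> open edges; the surplus is
   small because twice the number of open edges is little more than
   \<open>2 * card V\<close>.\<close>
 define X where "X = omm - y ` (V - Z)"
 have cX: "rc X <= rc omm - ?N + rc Z"
 proof -
 have "card (y ` (V - Z)) = card V - card Z" using card_image[OF rf_inj[OF graph y(1)]] card_Diff_subset[OF finZ ZV] by simp
 moreover have "card Z <= card V" using finV ZV by (intro card_mono)
 moreover have "card X + card (y ` (V - Z)) = card omm" unfolding X_def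
 using card_Diff_subset[OF finite_subset[OF y(2) finomm] y(2)] card_mono[OF finomm y(2)] by linarith
 ultimately show ?thesis by linarith
 qed
 have "card Q <= card P + card (Q - P)"
 using card_Un_le[of P "Q - P"] PQ by (simp add: Un_absorb1)
 hence "rc Q <= (2 + dl) * ?N + ?c * dl * ?N * real deg" using cP cD by linarith
 hence ommle: "2 * rc omm <= (2 + dl) * ?N + ?c * dl * ?N * real deg" using comm by (rule order_trans[rotated])
 \<comment> \<open>All errors are multiples of \<open>u\<close>; expanding
   \<open>(deg + 1) * (card (wball M) + 1)\<close> in the bound on \<open>dl\<close> gives exactly
   the four terms of \<open>du\<close>.\<close>
 define u where "u = dl * ?N"
 have u: "u >= 0" using dl N by (simp add: u_def)
 have du: "4 * u + 4 * (?c * u) + 4 * (?c * u * real deg) + 4 * (u * real deg) <= ka * ?N"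
 using mult_right_mono[OF dl(3), of ?N] N by (simp add: u_def algebra_simps)
 have nn: "0 <= ?c * u" "0 <= ?c * u * real deg" "0 <= u * real deg" "0 <= ka * ?N" using u ka N by auto
 have cZ': "4 * rc Z <= 4 * (?c * u) + 4 * u + ka * ?N" using cZ by (simp add: u_def mult.assoc)
 have omm': "2 * rc omm <= 2 * ?N + u + ?c * u * real deg" using ommle unfolding u_def distrib_right by (simp only: mult.assoc)
 have cD': "rc (Q - P) <= ?c * u * real deg" using cD by (simp add: u_def mult.assoc)
 show ?thesis
 proof (rule that[OF ZV _ y(1), of X "Q - P"])
 show "rc Z <= ka * ?N" using cZ' du nn u by linarith
 show "X <= E" using ommE by (auto simp: X_def)
 show "rc X <= ka * ?N" using cX omm' cZ' du nn u by linarith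
 show "Q - P <= V \<times> Lab" using QV by blast
 show "rc (Q - P) <= ka * ?N" using cD' du nn u by linarith
 have om: "y ` (V - Z) Un X = omm" using y(2) by (auto simp: X_def)
 have "P = Q - (Q - P)" using PQ by blast
 thus "P = {(B, l) : V \<times> Lab. qa B l : y ` (V - Z) Un X} - (Q - P)" unfolding om Q_def[symmetric] .
 qed
qed

end

context sofic
begin

abbreviation "MapN n W L dl == sofic_Map_nu G (Sg n) (cX) (config_act G f) (rho_config G f) (wI) W L dl"
abbreviation "msep n W L dl epp == eln (sep_number (MapN n W L dl) (rho_inf (q.V n) (rho_config G f)) epp) / ereal (real (N n))"

lemma measure_upper:
 assumes epp: "epp > 0" and e: "e > 0"
 obtains W L dl where "finite W" "W <= cG" "finite L" "L <= CX" "dl > 0"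
 "limsup (%n. msep n W L dl epp) <= ereal (hT + e)"
proof -
 \<comment> \<open>One third each for the rooted forest, the surplus edges and the
   corrections.\<close>
 have e3: "e / 3 > 0" and dp: "real deg > 0" using e deg_pos by auto
 obtain ka0 where ka0: "ka0 > 0" "evs (%n. \<forall>k. real k <= ka0 * real (N n) -->
 rc (fr n k) <= exp ((hT + e / 3) * real (N n)))" by (rule few_rooted_growth[OF e3])
 obtain ka1 where ka1: "ka1 > 0" "!!N (A :: 'g qd set) k. finite A ==> rc A <= real deg * real N ==> real k <= ka1 * real N ==>
 rc (small_subsets A k) <= exp (e / 3 * real N)" by (rule small_subsets_subexponential[OF dp e3], rule that)
 obtain ka2 where ka2: "ka2 > 0" "!!N (A :: 'g qd) k. finite A ==> rc A <= real deg * real N ==> real k <= ka2 * real N ==>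
 rc (small_subsets A k) <= exp (e / 3 * real N)" by (rule small_subsets_subexponential[OF dp e3], rule that)
 define ka where "ka = min ka0 (min ka1 ka2)"
 have ka: "ka > 0" "ka <= ka0" "ka <= ka1" "ka <= ka2" using ka0(1) ka1(1) ka2(1) by (auto simp: ka_def)
 \<comment> \<open>Away from the exceptional vertices each component has at least \<open>M\<close>
   vertices, so there are at most \<open>ka / 4 * N n\<close> of them.\<close>
 define M where "M = max 1 (nat \<lceil>4 / ka\<rceil>)"
 have "4 / ka <= real (nat \<lceil>4 / ka\<rceil>)" by (rule real_nat_ceiling_ge)
 also have "... <= real M" unfolding M_def by (intro of_nat_mono) simp
 finally have M: "M >= 1" "4 / ka <= real M" by (simp_all add: M_def)
 let ?q = "4 * (real deg + 1) * (rc (wball M) + 1)"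
 define dl where "dl = min 1 (ka / ?q)"
 have q0: "?q > 0" by (simp add: add_pos_nonneg)
 have dl: "0 < dl" "dl <= 1" using q0 ka(1) by (auto simp: dl_def)
 have "dl <= ka / ?q" by (simp add: dl_def)
 hence dl3: "?q * dl <= ka" using q0 by (simp only: le_divide_eq mult.commute if_True)
 let ?W = "(%g. inv g) ` wball M" and ?L = "{small_comp M, root_deg}"
 have "evs (%n. sep_number (MapN n ?W ?L dl) (rho_inf (q.V n) (rho_config G f)) epp
 <= ereal (exp ((hT + e) * real (N n))))"
 using ka0(2) eventually_loopfree eventually_inj[OF finite_wball wball_carrier, of M]
 proof eventually_elim
 case (elim n)
 interpret L: wb_quot_loopfree G f "Sg n" by (rule elim(2))
 let ?V = "q.V n" and ?E = "q.E n"
 let ?N = "real (N n)"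
 define k where "k = nat \<lfloor>ka * ?N\<rfloor>"
 have kN: "real k <= ka * ?N" unfolding k_def by (rule of_nat_floor) (use ka in simp)
 have lek: "j <= k" if "real j <= ka * ?N" for j unfolding k_def by (rule le_nat_floor[OF that])
 have mon: "real k <= ka' * ?N" if "ka <= ka'" for ka' using kN mult_right_mono[OF that, of ?N] by linarith
 define key where "key fii = {(B, l) : ?V \<times> Lab. fii (q.invc B) (se l)}" for fii :: "'g set => 'g ed => bool"
 define dec where "dec = (%((Z, y), X, D). {(B, l) : ?V \<times> Lab. q.qa B l : y ` (?V - Z) Un X} - D)"
 let ?A = "fr n k \<times> small_subsets ?E k \<times> small_subsets (?V \<times> Lab) k"
 have finVL: "finite (?V \<times> Lab)" using fin finite_Lab by simp
 have fA: "finite ?A" using finite_fr finite_small_subsets[OF q.finE] finite_small_subsets[OF finVL] by blast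
 have cE: "rc ?E <= real deg * real (N n)" using q.cardE[of n] by (metis of_nat_le_iff of_nat_mult)
 have cVL: "rc (?V \<times> Lab) <= real deg * real (N n)" by (simp add: card_cartesian_product deg_def)
 have "sep_number (MapN n ?W ?L dl) (rho_inf ?V (rho_config G f)) epp <= ereal (rc (dec ` ?A))"
 proof (rule sep_number_upper[where key = key])
 show "finite (dec ` ?A)" using fA by simp
 show "key ` MapN n ?W ?L dl <= dec ` ?A"
 proof (rule image_subsetI)
 fix fii assume fii: "fii : MapN n ?W ?L dl"
 have inj: "a = b" if "a : wball M" "b : wball M" "a <# Sg n = b <# Sg n" for a b using elim(3) that by blast
 obtain Z y X D where z: "Z <= ?V" "rc Z <= ka * ?N" "y : rf ?V ends ?E Z" "X <= ?E" "rc X <= ka * ?N"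
 "D <= ?V \<times> Lab" "rc D <= ka * ?N" "{(B, l) : ?V \<times> Lab. fii (q.invc B) (se l)} = {(B, l) : ?V \<times> Lab. q.qa B l : y ` (?V - Z) Un X} - D"
 by (rule L.few_components_code[OF fii M inj ka(1) dl dl3 wsf_degree_le])
 have "((Z, y), X, D) : ?A" using z lek by (simp add: few_rooted_def small_subsets_def)
 moreover have "key fii = dec ((Z, y), X, D)" using z(8) by (simp add: key_def dec_def)
 ultimately show "key fii : dec ` ?A" by (rule image_eqI[rotated])
 qed
 fix fii ps assume k: "key fii = key ps"
 show "rho_inf ?V (rho_config G f) fii ps < epp"
 proof (rule rho_inf_zero[OF fin q.V_ne _ epp])
 fix A assume A: "A : ?V"
 have "fii A (se l) = ps A (se l)" if l: "l : Lab" for l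
 proof -
 have "(q.invc A, l) : key fii \<longleftrightarrow> (q.invc A, l) : key ps" using k by simp
 thus ?thesis using q.invc_V[OF A] q.invc_invc[OF A] l by (simp add: key_def)
 qed
 thus "rho_config G f (fii A) (ps A) = 0" by (auto simp: rho_config_def star_edges_eq)
 qed
 qed
 also have "ereal (rc (dec ` ?A)) <= ereal (exp ((hT + e) * ?N))"
 proof -
 have "rc (dec ` ?A) <= rc ?A" by (intro of_nat_mono card_image_le fA)
 also have "... = rc (fr n k) * (rc (small_subsets ?E k) * rc (small_subsets (?V \<times> Lab) k))"
 by (simp add: card_cartesian_product)
 also have "... <= exp ((hT + e / 3) * ?N) * (exp (e / 3 * ?N) * exp (e / 3 * ?N))"
 using elim(1) mon[OF ka(2)] ka1(2)[OF q.finE cE mon[OF ka(3)]] ka2(2)[OF finVL cVL mon[OF ka(4)]]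
 by (intro mult_mono) auto
 also have "... = exp ((hT + e) * ?N)" by (simp add: exp_add[symmetric] algebra_simps)
 finally show ?thesis by simp
 qed
 finally show ?case .
 qed
 hence "limsup (%n. msep n ?W ?L dl epp) <= ereal (hT + e)" by (rule limsup_le_entropy)
 moreover have "?W <= cG" using wball_carrier by auto
 ultimately show ?thesis using that[of ?W ?L dl] finite_wball tests_C dl by simp
qed

theorem measure_entropy_eq:
 "sofic_measure_entropy G Sg (cX) (config_act G f) (rho_config G f) (CX) (wI)
 = ereal (hT)"
 unfolding sofic_measure_entropy_def
proof (rule antisym)
 let ?I = "%epp. INF W\<in>{W. finite W & W <= cG}. INF L\<in>{L. finite L & L <= CX}.
 INF dl\<in>{0<..}. limsup (%n. msep n W L dl epp)"
 show "(SUP epp\<in>{0<..}. ?I epp) <= ereal (hT)"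
 proof (rule SUP_least)
 fix epp :: real assume "epp : {0<..}"
 hence epp: "epp > 0" by simp
 show "?I epp <= ereal (hT)"
 proof (rule ereal_le_epsilon2)
 fix e :: real assume e: "0 < e"
 obtain W L dl where w: "finite W" "W <= cG" "finite L" "L <= CX" "dl > 0"
 "limsup (%n. msep n W L dl epp) <= ereal (hT + e)" by (rule measure_upper[OF epp e])
 have "?I epp <= limsup (%n. msep n W L dl epp)"
 by (rule INF_lower2[of W], simp add: w, rule INF_lower2[of L], simp add: w, rule INF_lower, simp add: w)
 thus "?I epp <= ereal (hT) + ereal e" using w(6) by simp
 qed
 qed
 have "ereal (hT) <= ?I 1" by (intro INF_greatest measure_lower) auto
 thus "ereal (hT) <= (SUP epp\<in>{0<..}. ?I epp)" by (rule SUP_upper2[rotated]) simp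
qed

end

theorem theorem1p2:
  fixes G :: "'g monoid" and \<Sigma> :: "nat \<Rightarrow> 'g set" and f :: "'g \<Rightarrow> int"
  assumes "group G"
    and "countable (carrier G)" and "infinite (carrier G)"
    and "\<And>n. \<Sigma> n \<lhd> G" and "\<And>n. finite (left_cosets G (\<Sigma> n))"
    and "(\<Inter>n. \<Union>i\<in>{n..}. \<Sigma> i) = {\<one>\<^bsub>G\<^esub>}"
    and "well_balanced G f"
  shows "sofic_measure_entropy G \<Sigma> (config_space G f) (config_act G f) (rho_config G f)
           (config_C G f) (wsf_integral G f)
         = sofic_entropy G \<Sigma> (F_model G f) (shift_act G) (rho_F G)
      \<and> sofic_entropy G \<Sigma> (F_model G f) (shift_act G) (rho_F G) = ereal (tree_entropy G f)
      \<and> log_det_NG G f = ereal (tree_entropy G f)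
      \<and> (\<lambda>n. ln (real (tau_quot G f (\<Sigma> n))) / real (card (left_cosets G (\<Sigma> n))))
           \<longlonglongrightarrow> tree_entropy G f"
proof -
  interpret sofic G f \<Sigma>
    by (intro sofic.intro wb_group.intro wb_group_axioms.intro sofic_axioms.intro assms)
  show ?thesis
    using measure_entropy_eq sofic_entropy_eq log_det_tree_entropy tau_limit by simp
qed

end
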